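(* Let $\hat f:M^n\to\mathbb{R}^{n+q}$ be a strongly genuine deformation of an isometric immersion $f:M^n\to\mathbb{R}^{n+p}$, and let $\tau:L^\ell\subset T_f^\perp M\to\hat L^\ell\subset T_{\hat f}^\perp M$ be a parallel vector bundle isometry that preserves second fundamental forms ($\ell\ge0$). Then, along each connected component of an open dense subset of $M^n$, $i(\phi_\tau)$ is constant and $f$ and $\hat f$ are mutually $\bar D_Y^d$-ruled for any smooth vector field $Y\in RE(\phi_\tau)$, where $D_Y^d:=\ker(\phi_\tau^Y)\subset TM$. In particular, $f$ and $\hat f$ are mutually $d$-ruled with $d=n+\ell-i(\phi_\tau)\ge n-p-q+3\ell$.
   Context: Superscripts denote dimension or rank; manifolds, bundles and maps are smooth. Singular isometric extension: a pair of isometric immersions $f:M^n\to\mathbb{R}^{n+p}$ and $\hat f:M^n\to\mathbb{R}^{n+q}$ singularly extends isometrically if there are a manifold $N^{n+s}$ with $s>0$, an embedding $j:M^n\hookrightarrow N^{n+s}$, and isometric maps $F:N^{n+s}\to\mathbb{R}^{n+p}$ and $\hat F:N^{n+s}\to\mathbb{R}^{n+q}$ (i.e. smooth maps inducing the same, possibly degenerate, metric on $N^{n+s}$) such that $f=F\circ j$ and $\hat f=\hat F\circ j$, and the set of points where $F$ and $\hat F$ fail to be immersions (possibly empty) is contained in $j(M)$. The isometric immersion $\hat f$ is a strongly genuine deformation of $f$ if there is no (nonempty) open subset $U\subset M^n$ along which $f|_U$ and $\hat f|_U$ singularly extend isometrically. The isometry $\tau$: $T_f^\perp M$, $T_{\hat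 f}^\perp M$ are the normal bundles, with second fundamental forms $\alpha,\hat\alpha$ and normal connections $\nabla^\perp,\hat\nabla^\perp$; $L^\ell$, $\hat L^\ell$ are rank $\ell$ normal subbundles, and subscripts such as $(\cdot)_L$ denote orthogonal projection. That $\tau$ is parallel and preserves second fundamental forms means $\tau\circ\alpha_L=\hat\alpha_{\hat L}$ and $\tau((\nabla^\perp_X\xi)_L)=(\hat\nabla^\perp_X\tau\xi)_{\hat L}$ for all $X\in TM$, $\xi\in L$. Set $\bar\tau=\mathrm{Id}\oplus\tau:TM\oplus L\to TM\oplus\hat L$. The form $\phi_\tau$: $\phi_\tau:TM\times(TM\oplus L)\to L^\perp\times\hat L^\perp$ is $$\phi_\tau(X,v)=\big((\tilde\nabla_Xv)_{L^\perp},(\tilde\nabla_X\bar\tau v)_{\hat L^\perp}\big),$$ where $\tilde\nabla$ is the connection of the Euclidean ambient spaces, and $L^\perp\subset T^\perp_fM$, $\hat L^\perp\subset T^\perp_{\hat f}M$ are orthogonal complements in the normal bundles. Write $\phi_\tau^X=\phi_\tau(X,\cdot\,)$ and $i(\phi_\tau)(x)=\max\{\mathrm{rank}(\phi_\tau^X):X\in T_xM\}$. $RE(\phi_\tau)\subset TM$ is the set of regular elements, i.e. of $Y\in T_xM$, $x\in M$, with $\mathrm{rank}(\phi_\tau^Y)=i(\phi_\tau)(x)$. Ruled: $f$ is $D^d$-ruled, or $d$-ruled, if $D^d\subset TM$ is a rank $d$ totally geodesic distribution whose leaves are mapped by $f$ to open subsets of $d$-dimensional affine subspaces. For an arbitrary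 distribution $D^d\subset TM$, $f$ is $\bar D^d$-ruled if for each $x\in M^n$ there is a totally geodesic submanifold of $M^n$ tangent to $D(x)$ at $x$ which is mapped by $f$ to an open subset of a $d$-dimensional affine subspace; such an $f$ is also regarded as $d$-ruled, usually with bigger rulings when $D^d$ is not totally geodesic. "Mutually" means that both $f$ and $\hat f$ are ruled with the same rulings. *)

theory Defs
  imports "HOL-Analysis.Analysis"
begin

section \<open>Smooth functions on open subsets of \<open>Euclidean_space n\<close>\<close>

definition partial :: "nat \<Rightarrow> ((nat \<Rightarrow> real) \<Rightarrow> 'b::real_normed_vector) \<Rightarrow> (nat \<Rightarrow> real) \<Rightarrow> 'b"
  where "partial i F u = vector_derivative (\<lambda>t. F (u(i := t))) (at (u i))"

primrec Ck_on :: "nat \<Rightarrow> nat \<Rightarrow> (nat \<Rightarrow> real) set \<Rightarrow> ((nat \<Rightarrow> real) \<Rightarrow> 'b::real_normed_vector) \<Rightarrow> bool"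
  where
    "Ck_on n 0 S F = continuous_on S F"
  | "Ck_on n (Suc k) S F =
      (continuous_on S F \<and>
       (\<forall>i<n. (\<forall>u\<in>S. (\<lambda>t. F (u(i := t))) differentiable (at (u i))) \<and>
              Ck_on n k S (partial i F)))"

definition Cinf_on :: "nat \<Rightarrow> (nat \<Rightarrow> real) set \<Rightarrow> ((nat \<Rightarrow> real) \<Rightarrow> 'b::real_normed_vector) \<Rightarrow> bool"
  where "Cinf_on n S F \<longleftrightarrow> openin (Euclidean_space n) S \<and> (\<forall>k. Ck_on n k S F)"

section \<open>Smooth manifolds\<close>

text \<open>A smooth manifold is given by a topology, a dimension and a (not necessarily maximal)
  smooth atlas, whose charts take values in \<open>Euclidean_space n\<close>. The dimension is a number and
  not a type, so that one may quantify over manifolds of unspecified dimension.\<close>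

record 'a mfd =
  mtop :: "'a topology"
  mdim :: nat
  atlas :: "('a set \<times> ('a \<Rightarrow> nat \<Rightarrow> real)) set"

abbreviation pts :: "'a mfd \<Rightarrow> 'a set" where "pts M \<equiv> topspace (mtop M)"

definition smooth_manifold :: "'a mfd \<Rightarrow> bool"
  where "smooth_manifold M \<longleftrightarrow>
    Hausdorff_space (mtop M) \<and> second_countable (mtop M) \<and>
    (\<Union>(C, c)\<in>atlas M. C) = pts M \<and>
    (\<forall>(C, c)\<in>atlas M.
       openin (mtop M) C \<and> openin (Euclidean_space (mdim M)) (c ` C) \<and>
       embedding_map (subtopology (mtop M) C) (Euclidean_space (mdim M)) c) \<and>
    (\<forall>(C, c)\<in>atlas M. \<forall>(C', c')\<in>atlas M. \<forall>i<mdim M.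
       Cinf_on (mdim M) (c ` (C \<inter> C')) (\<lambda>u. c' (inv_into C c u) i))"

definition open_sub :: "'a mfd \<Rightarrow> 'a set \<Rightarrow> 'a mfd"
  where "open_sub M U =
    \<lparr>mtop = subtopology (mtop M) U, mdim = mdim M, atlas = (\<lambda>(C, c). (C \<inter> U, c)) ` atlas M\<rparr>"

definition smooth_on :: "'a mfd \<Rightarrow> 'a set \<Rightarrow> ('a \<Rightarrow> 'b::real_normed_vector) \<Rightarrow> bool"
  where "smooth_on M U h \<longleftrightarrow> openin (mtop M) U \<and>
    (\<forall>(C, c)\<in>atlas M. Cinf_on (mdim M) (c ` (C \<inter> U)) (h \<circ> inv_into C c))"

definition smooth_near :: "'a mfd \<Rightarrow> 'a \<Rightarrow> ('a \<Rightarrow> 'b::real_normed_vector) \<Rightarrow> bool"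
  where "smooth_near M x h \<longleftrightarrow> (\<exists>U. x \<in> U \<and> smooth_on M U h)"

definition smooth_map :: "'a mfd \<Rightarrow> 'c mfd \<Rightarrow> ('a \<Rightarrow> 'c) \<Rightarrow> bool"
  where "smooth_map M N j \<longleftrightarrow> continuous_map (mtop M) (mtop N) j \<and>
    (\<forall>(C, c)\<in>atlas N. \<forall>i<mdim N. smooth_on M {x \<in> pts M. j x \<in> C} (\<lambda>x. c (j x) i))"

section \<open>Tangent vectors\<close>

text \<open>A tangent vector at \<open>x\<close> acts as a directional derivative on the real functions that are smooth
  near \<open>x\<close>; it is set to 0 on all other functions, so that distinct tangent vectors differ
  already on smooth functions. The zero vector is \<open>\<lambda>_. 0\<close>.\<close>

type_synonym 'a tvec = "('a \<Rightarrow> real) \<Rightarrow> real"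

definition tangent_space :: "'a mfd \<Rightarrow> 'a \<Rightarrow> 'a tvec set"
  where "tangent_space M x =
    {X. \<exists>(C, c)\<in>atlas M. x \<in> C \<and>
       (\<exists>a. X = (\<lambda>h. if smooth_near M x h
                    then \<Sum>i<mdim M. a i * partial i (h \<circ> inv_into C c) (c x) else 0))}"

definition vector_field :: "'a mfd \<Rightarrow> 'a set \<Rightarrow> ('a \<Rightarrow> 'a tvec) \<Rightarrow> bool"
  where "vector_field M U X \<longleftrightarrow> openin (mtop M) U \<and> (\<forall>x\<in>U. X x \<in> tangent_space M x) \<and>
    (\<forall>V h. V \<subseteq> U \<and> smooth_on M V h \<longrightarrow> smooth_on M V (\<lambda>y. X y h))"

definition bracket :: "'a mfd \<Rightarrow> ('a \<Rightarrow> 'a tvec) \<Rightarrow> ('a \<Rightarrow> 'a tvec) \<Rightarrow> 'a \<Rightarrow> 'a tvec"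
  where "bracket M X Y x =
    (\<lambda>h. if smooth_near M x h then X x (\<lambda>y. Y y h) - Y x (\<lambda>y. X y h) else 0)"

definition push :: "'c mfd \<Rightarrow> ('a \<Rightarrow> 'c) \<Rightarrow> 'a \<Rightarrow> 'a tvec \<Rightarrow> 'c tvec"
  where "push N j x X = (\<lambda>h. if smooth_near N (j x) h then X (h \<circ> j) else 0)"

text \<open>For a Euclidean-valued map \<open>F\<close> defined near the base point of \<open>X\<close>, \<open>deriv_along X F\<close> is the
  differential of \<open>F\<close> at \<open>X\<close>; for a vector field \<open>F\<close> along a map into Euclidean space it is
  the flat ambient derivative of \<open>F\<close> in the direction \<open>X\<close>.\<close>

definition deriv_along :: "'a tvec \<Rightarrow> ('a \<Rightarrow> 'b::euclidean_space) \<Rightarrow> 'b"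
  where "deriv_along X F = (\<Sum>b\<in>Basis. X (\<lambda>y. F y \<bullet> b) *\<^sub>R b)"

definition embedding :: "'a mfd \<Rightarrow> 'c mfd \<Rightarrow> ('a \<Rightarrow> 'c) \<Rightarrow> bool"
  where "embedding M N j \<longleftrightarrow> smooth_map M N j \<and> embedding_map (mtop M) (mtop N) j \<and>
    (\<forall>x\<in>pts M. \<forall>X\<in>tangent_space M x. push N j x X = (\<lambda>_. 0) \<longrightarrow> X = (\<lambda>_. 0))"

definition immersion_at :: "'a mfd \<Rightarrow> ('a \<Rightarrow> 'b::euclidean_space) \<Rightarrow> 'a \<Rightarrow> bool"
  where "immersion_at M F x \<longleftrightarrow>
    (\<forall>X\<in>tangent_space M x. deriv_along X F = 0 \<longrightarrow> X = (\<lambda>_. 0))"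

definition distribution :: "'a mfd \<Rightarrow> nat \<Rightarrow> ('a \<Rightarrow> 'a tvec set) \<Rightarrow> bool"
  where "distribution M d D \<longleftrightarrow>
    (\<forall>x\<in>pts M. \<exists>U X. x \<in> U \<and> openin (mtop M) U \<and> (\<forall>k<d. vector_field M U (X k)) \<and>
       (\<forall>y\<in>U. D y = {\<lambda>h. \<Sum>k<d. a k * X k y h | a. True} \<and>
          (\<forall>a. (\<lambda>h. \<Sum>k<d. a k * X k y h) = (\<lambda>_. 0) \<longrightarrow> (\<forall>k<d. a k = 0))))"

section \<open>Riemannian metrics and totally geodesic submanifolds\<close>

type_synonym 'a metric = "'a \<Rightarrow> 'a tvec \<Rightarrow> 'a tvec \<Rightarrow> real"

definition riemannian_metric :: "'a mfd \<Rightarrow> 'a metric \<Rightarrow> bool"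
  where "riemannian_metric M g \<longleftrightarrow>
    (\<forall>x\<in>pts M. \<forall>X\<in>tangent_space M x. \<forall>Y\<in>tangent_space M x.
       g x X Y = g x Y X \<and>
       (\<forall>Z\<in>tangent_space M x. \<forall>a b. g x (\<lambda>h. a * X h + b * Y h) Z = a * g x X Z + b * g x Y Z) \<and>
       (X \<noteq> (\<lambda>_. 0) \<longrightarrow> g x X X > 0)) \<and>
    (\<forall>U X Y. vector_field M U X \<and> vector_field M U Y \<longrightarrow> smooth_on M U (\<lambda>x. g x (X x) (Y x)))"

definition koszul :: "'a mfd \<Rightarrow> 'a metric \<Rightarrow> ('a \<Rightarrow> 'a tvec) \<Rightarrow> ('a \<Rightarrow> 'a tvec) \<Rightarrow> ('a \<Rightarrow> 'a tvec) \<Rightarrow> 'a \<Rightarrow> real"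
  where "koszul M g X Y Z x =
    (X x (\<lambda>y. g y (Y y) (Z y)) + Y x (\<lambda>y. g y (X y) (Z y)) - Z x (\<lambda>y. g y (X y) (Y y))
     + g x (bracket M X Y x) (Z x) - g x (bracket M X Z x) (Y x) - g x (bracket M Y Z x) (X x)) / 2"

definition levi_civita :: "'a mfd \<Rightarrow> 'a metric \<Rightarrow> ('a \<Rightarrow> 'a tvec) \<Rightarrow> ('a \<Rightarrow> 'a tvec) \<Rightarrow> 'a \<Rightarrow> 'a tvec"
  where "levi_civita M g X Y x =
    (THE W. W \<in> tangent_space M x \<and>
       (\<forall>U Z. x \<in> U \<and> vector_field M U Z \<longrightarrow> g x W (Z x) = koszul M g X Y Z x))"

definition submanifold :: "'a mfd \<Rightarrow> 'a mfd \<Rightarrow> bool"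
  where "submanifold M P \<longleftrightarrow> smooth_manifold P \<and> embedding P M (\<lambda>x. x)"

definition sub_tangent :: "'a mfd \<Rightarrow> 'a mfd \<Rightarrow> 'a \<Rightarrow> 'a tvec set"
  where "sub_tangent M P x = push M (\<lambda>y. y) x ` tangent_space P x"

definition totally_geodesic :: "'a mfd \<Rightarrow> 'a metric \<Rightarrow> 'a mfd \<Rightarrow> bool"
  where "totally_geodesic M g P \<longleftrightarrow> submanifold M P \<and>
    (\<forall>U X Y. vector_field M U X \<and> vector_field M U Y \<and>
       (\<forall>y\<in>U \<inter> pts P. X y \<in> sub_tangent M P y \<and> Y y \<in> sub_tangent M P y) \<longrightarrow>
       (\<forall>x\<in>U \<inter> pts P. levi_civita M g X Y x \<in> sub_tangent M P x))"

section \<open>Isometric immersions and singular isometric extensions\<close>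

definition isometric_immersion :: "'a mfd \<Rightarrow> 'a metric \<Rightarrow> ('a \<Rightarrow> 'b::euclidean_space) \<Rightarrow> bool"
  where "isometric_immersion M g f \<longleftrightarrow> smooth_on M (pts M) f \<and>
    (\<forall>x\<in>pts M. immersion_at M f x \<and>
       (\<forall>X\<in>tangent_space M x. \<forall>Y\<in>tangent_space M x.
          g x X Y = deriv_along X f \<bullet> deriv_along Y f))"

text \<open>The points of \<open>N\<close> are taken in the type \<open>nat \<Rightarrow> real\<close>. This is no restriction: a second
  countable Hausdorff manifold has at most continuum many points, hence is diffeomorphic to one
  whose points belong to this type.\<close>

definition singularly_extends ::
    "'a mfd \<Rightarrow> ('a \<Rightarrow> 'b::euclidean_space) \<Rightarrow> ('a \<Rightarrow> 'c::euclidean_space) \<Rightarrow> bool"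
  where "singularly_extends M f fh \<longleftrightarrow>
    (\<exists>(N :: (nat \<Rightarrow> real) mfd) s j F Fh.
       smooth_manifold N \<and> s > 0 \<and> mdim N = mdim M + s \<and> embedding M N j \<and>
       smooth_on N (pts N) F \<and> smooth_on N (pts N) Fh \<and>
       (\<forall>y\<in>pts N. \<forall>X\<in>tangent_space N y. \<forall>Y\<in>tangent_space N y.
          deriv_along X F \<bullet> deriv_along Y F = deriv_along X Fh \<bullet> deriv_along Y Fh) \<and>
       (\<forall>x\<in>pts M. f x = F (j x) \<and> fh x = Fh (j x)) \<and>
       {y \<in> pts N. \<not> immersion_at N F y \<or> \<not> immersion_at N Fh y} \<subseteq> j ` pts M)"

definition strongly_genuine_deformation ::
    "'a mfd \<Rightarrow> 'a metric \<Rightarrow> ('a \<Rightarrow> 'b::euclidean_space) \<Rightarrow> ('a \<Rightarrow> 'c::euclidean_space) \<Rightarrow> bool"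
  where "strongly_genuine_deformation M g f fh \<longleftrightarrow>
    isometric_immersion M g f \<and> isometric_immersion M g fh \<and>
    \<not> (\<exists>U. openin (mtop M) U \<and> U \<noteq> {} \<and> singularly_extends (open_sub M U) f fh)"

section \<open>Normal subbundles and the isometry \<open>\<tau>\<close>\<close>

definition proj :: "'b::euclidean_space set \<Rightarrow> 'b \<Rightarrow> 'b"
  where "proj S v = (THE w. w \<in> S \<and> v - w \<in> S\<^sup>\<bottom>)"

definition normal_space :: "'a mfd \<Rightarrow> ('a \<Rightarrow> 'b::euclidean_space) \<Rightarrow> 'a \<Rightarrow> 'b set"
  where "normal_space M f x = ((\<lambda>X. deriv_along X f) ` tangent_space M x)\<^sup>\<bottom>"

definition normal_subbundle ::
    "'a mfd \<Rightarrow> ('a \<Rightarrow> 'b::euclidean_space) \<Rightarrow> nat \<Rightarrow> ('a \<Rightarrow> 'b set) \<Rightarrow> bool"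
  where "normal_subbundle M f l L \<longleftrightarrow>
    (\<forall>x\<in>pts M. subspace (L x) \<and> dim (L x) = l \<and> L x \<subseteq> normal_space M f x \<and>
       (\<exists>U e. x \<in> U \<and> (\<forall>i<l. smooth_on M U (e i)) \<and> openin (mtop M) U \<and>
          (\<forall>y\<in>U. L y = span ((\<lambda>i. e i y) ` {..<l}))))"

definition bundle_section ::
    "'a mfd \<Rightarrow> ('a \<Rightarrow> 'b::euclidean_space set) \<Rightarrow> 'a set \<Rightarrow> ('a \<Rightarrow> 'b) \<Rightarrow> bool"
  where "bundle_section M L U \<xi> \<longleftrightarrow> smooth_on M U \<xi> \<and> (\<forall>y\<in>U. \<xi> y \<in> L y)"

definition bundle_isometry ::
    "'a mfd \<Rightarrow> ('a \<Rightarrow> 'b::euclidean_space set) \<Rightarrow> ('a \<Rightarrow> 'c::euclidean_space set) \<Rightarrow> ('a \<Rightarrow> 'b \<Rightarrow> 'c) \<Rightarrow> bool"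
  where "bundle_isometry M L Lh \<tau> \<longleftrightarrow>
    (\<forall>x\<in>pts M. \<tau> x ` L x = Lh x \<and>
       (\<forall>\<xi>\<in>L x. \<forall>\<eta>\<in>L x. \<tau> x \<xi> \<bullet> \<tau> x \<eta> = \<xi> \<bullet> \<eta> \<and>
          (\<forall>a b. \<tau> x (a *\<^sub>R \<xi> + b *\<^sub>R \<eta>) = a *\<^sub>R \<tau> x \<xi> + b *\<^sub>R \<tau> x \<eta>))) \<and>
    (\<forall>U \<xi>. bundle_section M L U \<xi> \<longrightarrow> smooth_on M U (\<lambda>y. \<tau> y (\<xi> y)))"

definition normal_connection ::
    "'a mfd \<Rightarrow> ('a \<Rightarrow> 'b::euclidean_space) \<Rightarrow> 'a \<Rightarrow> 'a tvec \<Rightarrow> ('a \<Rightarrow> 'b) \<Rightarrow> 'b"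
  where "normal_connection M f x X \<xi> = proj (normal_space M f x) (deriv_along X \<xi>)"

text \<open>\<open>\<alpha>(X, Y)\<close> at \<open>x\<close>, for a tangent vector \<open>X\<close> at \<open>x\<close> and a vector field \<open>Y\<close> defined near \<open>x\<close>.\<close>

definition second_fundamental_form ::
    "'a mfd \<Rightarrow> ('a \<Rightarrow> 'b::euclidean_space) \<Rightarrow> 'a \<Rightarrow> 'a tvec \<Rightarrow> ('a \<Rightarrow> 'a tvec) \<Rightarrow> 'b"
  where "second_fundamental_form M f x X Y =
    proj (normal_space M f x) (deriv_along X (\<lambda>y. deriv_along (Y y) f))"

definition preserves_second_fundamental_forms ::
    "'a mfd \<Rightarrow> ('a \<Rightarrow> 'b::euclidean_space) \<Rightarrow> ('a \<Rightarrow> 'c::euclidean_space) \<Rightarrow>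
     ('a \<Rightarrow> 'b set) \<Rightarrow> ('a \<Rightarrow> 'c set) \<Rightarrow> ('a \<Rightarrow> 'b \<Rightarrow> 'c) \<Rightarrow> bool"
  where "preserves_second_fundamental_forms M f fh L Lh \<tau> \<longleftrightarrow>
    (\<forall>U Y. vector_field M U Y \<longrightarrow> (\<forall>x\<in>U. \<forall>X\<in>tangent_space M x.
       \<tau> x (proj (L x) (second_fundamental_form M f x X Y)) =
       proj (Lh x) (second_fundamental_form M fh x X Y)))"

definition parallel_isometry ::
    "'a mfd \<Rightarrow> ('a \<Rightarrow> 'b::euclidean_space) \<Rightarrow> ('a \<Rightarrow> 'c::euclidean_space) \<Rightarrow>
     ('a \<Rightarrow> 'b set) \<Rightarrow> ('a \<Rightarrow> 'c set) \<Rightarrow> ('a \<Rightarrow> 'b \<Rightarrow> 'c) \<Rightarrow> bool"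
  where "parallel_isometry M f fh L Lh \<tau> \<longleftrightarrow>
    (\<forall>U \<xi>. bundle_section M L U \<xi> \<longrightarrow> (\<forall>x\<in>U. \<forall>X\<in>tangent_space M x.
       \<tau> x (proj (L x) (normal_connection M f x X \<xi>)) =
       proj (Lh x) (normal_connection M fh x X (\<lambda>y. \<tau> y (\<xi> y)))))"

section \<open>The form \<open>\<phi>\<^sub>\<tau>\<close>\<close>

text \<open>An element of \<open>TM \<oplus> L\<close> at \<open>x\<close> is a pair \<open>(Z, \<xi>)\<close> of a tangent vector and an element of \<open>L x\<close>.
  The value of \<open>\<phi>\<^sub>\<tau>(X, \<cdot>)\<close> on it is computed from any local smooth section \<open>(Z, \<xi>)\<close> of \<open>TM \<oplus> L\<close>
  extending it, and does not depend on the extension.\<close>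

definition compl_proj ::
    "'a mfd \<Rightarrow> ('a \<Rightarrow> 'b::euclidean_space) \<Rightarrow> ('a \<Rightarrow> 'b set) \<Rightarrow> 'a \<Rightarrow> 'b \<Rightarrow> 'b"
  where "compl_proj M f L x = proj (normal_space M f x \<inter> (L x)\<^sup>\<bottom>)"

definition phi ::
    "'a mfd \<Rightarrow> ('a \<Rightarrow> 'b::euclidean_space) \<Rightarrow> ('a \<Rightarrow> 'c::euclidean_space) \<Rightarrow>
     ('a \<Rightarrow> 'b set) \<Rightarrow> ('a \<Rightarrow> 'c set) \<Rightarrow> ('a \<Rightarrow> 'b \<Rightarrow> 'c) \<Rightarrow> 'a \<Rightarrow> 'a tvec \<Rightarrow> 'a tvec \<times> 'b \<Rightarrow> 'b \<times> 'c"
  where "phi M f fh L Lh \<tau> x X v =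
    (THE w. \<forall>U Z \<xi>. x \<in> U \<and> vector_field M U Z \<and> bundle_section M L U \<xi> \<and> (Z x, \<xi> x) = v \<longrightarrow>
       w = (compl_proj M f L x (deriv_along X (\<lambda>y. deriv_along (Z y) f + \<xi> y)),
            compl_proj M fh Lh x (deriv_along X (\<lambda>y. deriv_along (Z y) fh + \<tau> y (\<xi> y)))))"

definition phi_rank ::
    "'a mfd \<Rightarrow> ('a \<Rightarrow> 'b::euclidean_space) \<Rightarrow> ('a \<Rightarrow> 'c::euclidean_space) \<Rightarrow>
     ('a \<Rightarrow> 'b set) \<Rightarrow> ('a \<Rightarrow> 'c set) \<Rightarrow> ('a \<Rightarrow> 'b \<Rightarrow> 'c) \<Rightarrow> 'a \<Rightarrow> 'a tvec \<Rightarrow> nat"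
  where "phi_rank M f fh L Lh \<tau> x X = dim (phi M f fh L Lh \<tau> x X ` (tangent_space M x \<times> L x))"

definition phi_ker ::
    "'a mfd \<Rightarrow> ('a \<Rightarrow> 'b::euclidean_space) \<Rightarrow> ('a \<Rightarrow> 'c::euclidean_space) \<Rightarrow>
     ('a \<Rightarrow> 'b set) \<Rightarrow> ('a \<Rightarrow> 'c set) \<Rightarrow> ('a \<Rightarrow> 'b \<Rightarrow> 'c) \<Rightarrow> 'a \<Rightarrow> 'a tvec \<Rightarrow> ('a tvec \<times> 'b) set"
  where "phi_ker M f fh L Lh \<tau> x X =
    {v \<in> tangent_space M x \<times> L x. phi M f fh L Lh \<tau> x X v = 0}"

definition phi_index ::
    "'a mfd \<Rightarrow> ('a \<Rightarrow> 'b::euclidean_space) \<Rightarrow> ('a \<Rightarrow> 'c::euclidean_space) \<Rightarrow>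
     ('a \<Rightarrow> 'b set) \<Rightarrow> ('a \<Rightarrow> 'c set) \<Rightarrow> ('a \<Rightarrow> 'b \<Rightarrow> 'c) \<Rightarrow> 'a \<Rightarrow> nat"
  where "phi_index M f fh L Lh \<tau> x = Max (phi_rank M f fh L Lh \<tau> x ` tangent_space M x)"

definition regular_elements ::
    "'a mfd \<Rightarrow> ('a \<Rightarrow> 'b::euclidean_space) \<Rightarrow> ('a \<Rightarrow> 'c::euclidean_space) \<Rightarrow>
     ('a \<Rightarrow> 'b set) \<Rightarrow> ('a \<Rightarrow> 'c set) \<Rightarrow> ('a \<Rightarrow> 'b \<Rightarrow> 'c) \<Rightarrow> 'a \<Rightarrow> 'a tvec set"
  where "regular_elements M f fh L Lh \<tau> x =
    {Y \<in> tangent_space M x. phi_rank M f fh L Lh \<tau> x Y = phi_index M f fh L Lh \<tau> x}"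

section \<open>Rulings\<close>

definition maps_onto_affine_piece :: "('a \<Rightarrow> 'b::euclidean_space) \<Rightarrow> 'a set \<Rightarrow> nat \<Rightarrow> bool"
  where "maps_onto_affine_piece f S d \<longleftrightarrow>
    (\<exists>A. affine A \<and> aff_dim A = int d \<and> openin (top_of_set A) (f ` S))"

text \<open>\<open>f\<close> and \<open>fh\<close> are mutually \<open>D\<close>-bar-ruled: the same totally geodesic submanifolds are rulings
  of both. The distribution \<open>D\<close> need not be integrable.\<close>

definition mutually_bar_ruled ::
    "'a mfd \<Rightarrow> 'a metric \<Rightarrow> ('a \<Rightarrow> 'b::euclidean_space) \<Rightarrow> ('a \<Rightarrow> 'c::euclidean_space) \<Rightarrow>
     nat \<Rightarrow> ('a \<Rightarrow> 'a tvec set) \<Rightarrow> bool"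
  where "mutually_bar_ruled M g f fh d D \<longleftrightarrow>
    distribution M d D \<and>
    (\<forall>x\<in>pts M. \<exists>P. totally_geodesic M g P \<and> mdim P = d \<and> x \<in> pts P \<and> sub_tangent M P x = D x \<and>
       maps_onto_affine_piece f (pts P) d \<and> maps_onto_affine_piece fh (pts P) d)"

text \<open>Being \<open>d\<close>-ruled is understood in the wide sense, where the rulings need not be the leaves
  of the rank \<open>d\<close> distribution.\<close>

definition mutually_ruled ::
    "'a mfd \<Rightarrow> 'a metric \<Rightarrow> ('a \<Rightarrow> 'b::euclidean_space) \<Rightarrow> ('a \<Rightarrow> 'c::euclidean_space) \<Rightarrow> nat \<Rightarrow> bool"
  where "mutually_ruled M g f fh d \<longleftrightarrow> (\<exists>D. mutually_bar_ruled M g f fh d D)"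

end

theory Submission
  imports Defs
begin

text \<open>In a chart, \<open>TM \<oplus> L\<close> is framed by vector fields \<open>e a\<close> along \<open>f\<close> and their images \<open>eh a\<close> along \<open>fh\<close>, with
  the same Gram matrix and the same connection coefficients. The compatibility equations then say
  that \<open>\<phi>\<^sub>\<tau>\<close> is flat for the difference of the two inner products. By Moore's lemma \<open>\<phi>\<^sub>\<tau>(X, v)\<close> is
  null for every \<open>X\<close> when \<open>v\<close> lies in the kernel of a regular \<open>\<phi>\<^sub>\<tau>\<^sup>Y\<close>, and so \<open>f + t v\<close> and \<open>fh + t \<tau>v\<close>
  induce the same metric for every section \<open>v\<close> of this kernel. As no open piece extends singularly,
  these maps have singular points with \<open>t \<noteq> 0\<close> near every point of \<open>t = 0\<close>. Hence \<open>v\<close> is tangent to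
  \<open>M\<close>, say \<open>v = Z\<close>, and with \<open>G = (f, fh)\<close> the singular points force all vectors obtained by
  repeatedly differentiating \<open>Z\<close> along the previous vector to be tangent as well. A Neumann series in
  \<open>t\<close> now yields bounded \<open>W\<close> such that \<open>G u + t Z u\<close> is, up to an arbitrarily small error, constant
  to first order along \<open>(W, -1)\<close>; following these directions down to \<open>t = 0\<close> shows that \<open>G u + t Z u\<close>
  lies in the image of \<open>G\<close> for small \<open>t\<close>. Applied to all constant coefficient combinations of a frame
  of the kernel, this gives a common affine piece of dimension \<open>d\<close> in both images. The dense set is
  the union of a maximal disjoint family of connected charts on which \<open>i(\<phi>\<^sub>\<tau>)\<close> is constant.\<close>


section \<open>Calculus on open subsets of \<open>Euclidean_space n\<close>\<close>

text \<open>Strong genuineness yields, near each \<open>u\<close>, only some singular points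
  \<open>(u', t)\<close> of the extension, with no control over how they vary. Tangency survives
  because it is a closed condition: at such a point a normal component equals \<open>t\<close> times
  a bounded vector, and \<open>t\<close> may be taken arbitrarily small. Nor is there a smooth field
  \<open>W\<close> along which \<open>G u + t Z u\<close> would be constant: the truncation order of
  the series depends on the desired error. So no differential equation is solved; a maximum argument
  on a compact cone asks for only one approximate direction at each point. The kernel distribution
  need not be integrable, hence leaves cannot serve as rulings. But every constant combination
  \<open>Z a\<close> of a kernel frame is again a kernel section, and for a fixed base point the
  points \<open>G u0 + Z a u0\<close> fill a disc of dimension \<open>d\<close>. Working with the
  pair \<open>G\<close> gives one preimage of this disc for both immersions. This is possible
  because the extensions of \<open>f\<close> and \<open>fh\<close> have equal Gram matrices, so a
  linear dependence among the derivatives of one holds with the same coefficients for the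
  other.\<close>

definition Rn :: "nat \<Rightarrow> (nat \<Rightarrow> real) set"
  where "Rn n = {x. \<forall>i\<ge>n. x i = 0}"

text \<open>Cubes replace metric balls: moving one coordinate at a time stays inside a cube, and all
  smoothness is expressed by partial derivatives. The dimension is a number and not a type, so
  points are functions on \<open>nat\<close> that vanish from index \<open>n\<close> on.\<close>

definition obox :: "nat \<Rightarrow> (nat \<Rightarrow> real) \<Rightarrow> real \<Rightarrow> (nat \<Rightarrow> real) set"
  where "obox n u r = {v \<in> Rn n. \<forall>i<n. \<bar>v i - u i\<bar> < r}"

abbreviation openE :: "nat \<Rightarrow> (nat \<Rightarrow> real) set \<Rightarrow> bool"
  where "openE n S \<equiv> openin (Euclidean_space n) S"

abbreviation has_partial :: "nat \<Rightarrow> ((nat \<Rightarrow> real) \<Rightarrow> 'b::real_normed_vector) \<Rightarrow> (nat \<Rightarrow> real) \<Rightarrow> 'b \<Rightarrow> bool"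
  where "has_partial i F u D \<equiv> ((\<lambda>t. F (u(i := t))) has_vector_derivative D) (at (u i))"

section \<open>Topology of coordinate space\<close>

lemma topspace_Rn [simp]: "topspace (Euclidean_space n) = Rn n"
  by (simp add: topspace_Euclidean_space Rn_def)

lemma Euclidean_space_top_of_set: "Euclidean_space n = top_of_set (Rn n)"
  by (simp add: Euclidean_space_def Rn_def euclidean_product_topology)

lemma Rn_mono: "n \<le> m \<Longrightarrow> Rn n \<subseteq> Rn m"
  by (auto simp: Rn_def)

lemma open_coord_box: "open {v::nat\<Rightarrow>real. \<forall>i<n. \<bar>v i - u i\<bar> < r}"
proof -
  have "{v::nat\<Rightarrow>real. \<forall>i<n. \<bar>v i - u i\<bar> < r} = (\<Inter>i\<in>{..<n}. {v. \<bar>v i - u i\<bar> < r})"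
    by auto
  moreover have 1: "open {v::nat\<Rightarrow>real. \<bar>v i - u i\<bar> < r}" for i
  proof -
    have "{v::nat\<Rightarrow>real. \<bar>v i - u i\<bar> < r} = (\<lambda>v. v i) -` ball (u i) r"
      by (auto simp: dist_real_def abs_minus_commute)
    then show ?thesis by (simp add: open_vimage)
  qed
  moreover have "open (\<Inter>i\<in>{..<n}. {v::nat\<Rightarrow>real. \<bar>v i - u i\<bar> < r})"
    by (rule open_INT) (auto simp: 1)
  ultimately show ?thesis by simp
qed

lemma openE_obox: "openE n (obox n u r)"
proof -
  have "obox n u r = Rn n \<inter> {v. \<forall>i<n. \<bar>v i - u i\<bar> < r}" by (auto simp: obox_def)
  then show ?thesis
    unfolding Euclidean_space_top_of_set using openin_open_Int[OF open_coord_box] by simp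
qed

text \<open>A basic open set of the product topology restricts every coordinate by some radius.
  Members of \<open>Rn n\<close> agree from index \<open>n\<close> on, so only the first
  \<open>n\<close> radii count, and finitely many have a positive minimum.\<close>

lemma openE_iff: "openE n S \<longleftrightarrow> S \<subseteq> Rn n \<and> (\<forall>u\<in>S. \<exists>r>0. obox n u r \<subseteq> S)"
proof
  assume S: "openE n S"
  then obtain T where T: "open T" "S = Rn n \<inter> T"
    unfolding Euclidean_space_top_of_set openin_open by auto
  have "\<exists>r>0. obox n u r \<subseteq> S" if u: "u \<in> S" for u
  proof -
    have "openin (product_topology (\<lambda>i. euclidean) UNIV) T"
      using T by (simp add: open_fun_def)
    then obtain X where X: "u \<in> Pi\<^sub>E UNIV X" "\<And>i. open (X i)" "Pi\<^sub>E UNIV X \<subseteq> T"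
      using product_topology_open_contains_basis[of "\<lambda>i. euclidean" UNIV T u] u T
      unfolding open_openin[symmetric] by blast
    have "\<exists>r>0. \<forall>t. \<bar>t - u i\<bar> < r \<longrightarrow> t \<in> X i" for i
    proof -
      have "u i \<in> X i" using X(1) by auto
      then obtain r where "r > 0" "ball (u i) r \<subseteq> X i" using X(2) open_contains_ball by blast
      then show ?thesis by (intro exI[of _ r]) (auto simp: dist_real_def abs_minus_commute subset_iff)
    qed
    then obtain r where r: "\<And>i. r i > 0" "\<And>i t. \<bar>t - u i\<bar> < r i \<Longrightarrow> t \<in> X i" by metis
    \<comment> \<open>The inserted 1 keeps the minimum meaningful for \<open>n = 0\<close>.\<close>
    define R where "R = Min (insert 1 (r ` {..<n}))"
    have R: "R > 0" "\<And>i. i < n \<Longrightarrow> R \<le> r i"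
      unfolding R_def using r(1) by auto
    have "obox n u R \<subseteq> S"
    proof
      fix v assume v: "v \<in> obox n u R"
      have "v i \<in> X i" for i
      proof (cases "i < n")
        case True then show ?thesis using v R(2)[of i] r(2)[of "v i" i] by (auto simp: obox_def)
      next
        case False
        then have "v i = u i" using v u T by (auto simp: obox_def Rn_def)
        then show ?thesis using X(1) by auto
      qed
      then have "v \<in> T" using X(3) by auto
      then show "v \<in> S" using T(2) v by (auto simp: obox_def)
    qed
    then show ?thesis using R by blast
  qed
  moreover have "S \<subseteq> Rn n" using T by simp
  ultimately show "S \<subseteq> Rn n \<and> (\<forall>u\<in>S. \<exists>r>0. obox n u r \<subseteq> S)" by simp
next
  assume S: "S \<subseteq> Rn n \<and> (\<forall>u\<in>S. \<exists>r>0. obox n u r \<subseteq> S)"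
  show "openE n S"
  proof (subst openin_subopen, intro ballI)
    fix u assume u: "u \<in> S"
    then obtain r where "r > 0" "obox n u r \<subseteq> S" using S by blast
    moreover have "u \<in> obox n u r" using u S \<open>r > 0\<close> by (auto simp: obox_def)
    ultimately show "\<exists>T. openE n T \<and> u \<in> T \<and> T \<subseteq> S" using openE_obox by blast
  qed
qed

lemma openE_subset: "openE n S \<Longrightarrow> S \<subseteq> Rn n"
  by (simp add: openE_iff)

lemma obox_self [simp]: "u \<in> obox n u r \<longleftrightarrow> u \<in> Rn n \<and> (n = 0 \<or> r > 0)"
  by (auto simp: obox_def)

lemma obox_mono: "r \<le> s \<Longrightarrow> obox n u r \<subseteq> obox n u s"
  by (force simp: obox_def)

lemma obox_upd: "u \<in> obox n c r \<Longrightarrow> i < n \<Longrightarrow> \<bar>t - c i\<bar> < r \<Longrightarrow> u(i := t) \<in> obox n c r"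
  by (auto simp: obox_def Rn_def)

lemma openE_upd:
  assumes "openE n S" "u \<in> S" "i < n"
  obtains r where "r > 0" "\<And>t. \<bar>t - u i\<bar> < r \<Longrightarrow> u(i := t) \<in> S"
proof -
  obtain r where "r > 0" "obox n u r \<subseteq> S" using assms by (auto simp: openE_iff)
  moreover have "u \<in> Rn n" using assms openE_subset by blast
  ultimately show thesis using that[of r] obox_upd[of u n u r i] assms(3) by auto
qed

lemma openE_vimage:
  assumes "openE n S" "continuous_on S F" "open T"
  shows "openE n {u\<in>S. F u \<in> T}"
proof -
  have "openin (top_of_set S) (S \<inter> F -` T)"
    by (rule continuous_openin_preimage_gen[OF assms(2,3)])
  then have "openin (top_of_set (Rn n)) (S \<inter> F -` T)"
    using openin_trans assms(1) unfolding Euclidean_space_top_of_set by blast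
  moreover have "S \<inter> F -` T = {u\<in>S. F u \<in> T}" by auto
  ultimately show ?thesis unfolding Euclidean_space_top_of_set by simp
qed

lemma continuous_obox:
  fixes F :: "(nat \<Rightarrow> real) \<Rightarrow> 'b::metric_space"
  assumes "openE n S" "continuous_on S F" "u \<in> S" "e > 0"
  obtains r where "r > 0" "obox n u r \<subseteq> S" "\<And>v. v \<in> obox n u r \<Longrightarrow> dist (F v) (F u) < e"
proof -
  have "openE n {v\<in>S. F v \<in> ball (F u) e}" by (rule openE_vimage[OF assms(1,2) open_ball])
  moreover have "u \<in> {v\<in>S. F v \<in> ball (F u) e}" using assms by auto
  ultimately obtain r where "r > 0" "obox n u r \<subseteq> {v\<in>S. F v \<in> ball (F u) e}"
    unfolding openE_iff by meson
  then show thesis using that[of r] by (fastforce simp: dist_commute)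
qed

lemma continuous_onI_obox:
  fixes F :: "(nat \<Rightarrow> real) \<Rightarrow> 'b::metric_space"
  assumes S: "S \<subseteq> Rn n"
    and "\<And>u e. u \<in> S \<Longrightarrow> e > 0 \<Longrightarrow> \<exists>r>0. \<forall>v\<in>obox n u r \<inter> S. dist (F v) (F u) < e"
  shows "continuous_on S F"
  unfolding continuous_on_topological
proof (intro ballI allI impI)
  fix u B assume u: "u \<in> S" and B: "open B" "F u \<in> B"
  then obtain e where e: "e > 0" "ball (F u) e \<subseteq> B" by (meson open_contains_ball)
  obtain r where r: "r > 0" "\<And>v. v\<in>obox n u r \<inter> S \<Longrightarrow> dist (F v) (F u) < e" using assms(2)[OF u e(1)] by auto
  show "\<exists>A. open A \<and> u \<in> A \<and> (\<forall>v\<in>S. v \<in> A \<longrightarrow> F v \<in> B)"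
  proof (intro exI conjI ballI impI)
    show "open {v. \<forall>i<n. \<bar>v i - u i\<bar> < r}" by (rule open_coord_box)
    show "u \<in> {v. \<forall>i<n. \<bar>v i - u i\<bar> < r}" using r by auto
    fix v assume "v \<in> S" "v \<in> {v. \<forall>i<n. \<bar>v i - u i\<bar> < r}"
    then have "v \<in> obox n u r \<inter> S" using S by (auto simp: obox_def)
    then show "F v \<in> B" using r(2)[of v] e(2) by (auto simp: dist_commute subset_iff)
  qed
qed

lemma openE_Un_local:
  "(\<And>u. u \<in> S \<Longrightarrow> \<exists>T. openE n T \<and> u \<in> T \<and> T \<subseteq> S) \<Longrightarrow> openE n S"
  by (subst openin_subopen) blast

subsection \<open>Functions of class \<open>C\<^sup>k\<close>\<close>

lemma Ck_imp_continuous: "Ck_on n k S F \<Longrightarrow> continuous_on S F"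
  by (cases k) auto

lemma Ck_has_partial:
  assumes "Ck_on n (Suc k) S F" "i < n" "u \<in> S"
  shows "has_partial i F u (partial i F u)"
  using assms vector_derivative_works unfolding partial_def Ck_on.simps by blast

lemma partial_eqI: "has_partial i F u D \<Longrightarrow> partial i F u = D"
  by (simp add: partial_def vector_derivative_at)

lemma has_partial_cong:
  assumes S: "openE n S" and "u \<in> S" "i < n" and eq: "\<And>v. v \<in> S \<Longrightarrow> F v = G v"
    and "has_partial i F u D"
  shows "has_partial i G u D"
proof -
  obtain r where r: "r > 0" "\<And>t. \<bar>t - u i\<bar> < r \<Longrightarrow> u(i := t) \<in> S"
    using openE_upd[OF S assms(2,3)] by metis
  show ?thesis
    by (rule has_vector_derivative_transform_within[OF assms(5) r(1)])
       (use r eq in \<open>auto simp: dist_real_def\<close>)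
qed

lemma partial_cong:
  assumes "openE n S" "u \<in> S" "i < n" "\<And>v. v \<in> S \<Longrightarrow> F v = G v"
  shows "partial i F u = partial i G u"
proof -
  obtain r where r: "r > 0" "\<And>t. \<bar>t - u i\<bar> < r \<Longrightarrow> u(i := t) \<in> S"
    using openE_upd[OF assms(1-3)] by metis
  have "\<forall>\<^sub>F t in nhds (u i). F (u(i := t)) = G (u(i := t))"
    unfolding eventually_nhds_metric using r assms(4) by (auto simp: dist_real_def)
  then show ?thesis unfolding partial_def
    by (intro vector_derivative_cong_eq) auto
qed

lemma Ck_SucI:
  assumes S: "openE n S" and "continuous_on S F"
    and hp: "\<And>i u. i < n \<Longrightarrow> u \<in> S \<Longrightarrow> has_partial i F u (F' i u)"
    and "\<And>i. i < n \<Longrightarrow> Ck_on n k S (partial i F)"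
  shows "Ck_on n (Suc k) S F"
  unfolding Ck_on.simps using assms(2,4) differentiableI_vector[OF hp] by simp

lemma Ck_cong:
  assumes S: "openE n S" and "\<And>u. u \<in> S \<Longrightarrow> F u = G u" "Ck_on n k S F"
  shows "Ck_on n k S G"
  using assms(2,3)
proof (induction k arbitrary: F G)
  case 0 then show ?case by (auto cong: continuous_on_cong)
next
  case (Suc k)
  show ?case
  proof (rule Ck_SucI[OF S])
    show "continuous_on S G" using Ck_imp_continuous[OF Suc.prems(2)] Suc.prems(1) by (auto cong: continuous_on_cong)
    fix i assume i: "i < n"
    show "has_partial i G u (partial i F u)" if "u \<in> S" for u
      by (rule has_partial_cong[OF S that i _ Ck_has_partial[OF Suc.prems(2) i that]]) (rule Suc.prems(1))
    have "Ck_on n k S (partial i F)" using Suc.prems(2) i by auto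
    then show "Ck_on n k S (partial i G)"
      using Suc.IH[of "partial i F" "partial i G"] partial_cong[OF S _ i Suc.prems(1)] by simp
  qed
qed

text \<open>Most closure properties of \<open>Ck_on\<close> are inductions on \<open>k\<close> with
  this rule: give a formula \<open>F'\<close> for the partial derivatives and apply the induction
  hypothesis to that formula.\<close>

lemma Ck_SucI':
  assumes S: "openE n S" and "continuous_on S F"
    and hp: "\<And>i u. i < n \<Longrightarrow> u \<in> S \<Longrightarrow> has_partial i F u (F' i u)"
    and Ck: "\<And>i. i < n \<Longrightarrow> Ck_on n k S (F' i)"
  shows "Ck_on n (Suc k) S F"
  by (rule Ck_SucI[OF S assms(2) hp])
     (auto intro!: Ck_cong[OF S _ Ck] simp: partial_eqI[OF hp])

lemma Ck_SucD: "Ck_on n (Suc k) S F \<Longrightarrow> Ck_on n k S F"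
  by (induction k arbitrary: F) auto

lemma Ck_mono: "Ck_on n k S F \<Longrightarrow> j \<le> k \<Longrightarrow> Ck_on n j S F"
  by (induction k) (auto simp: le_Suc_eq dest: Ck_SucD simp del: Ck_on.simps)

lemma Ck_subset:
  assumes "openE n T" "T \<subseteq> S" "Ck_on n k S F" shows "Ck_on n k T F"
  using assms(3)
proof (induction k arbitrary: F)
  case 0 then show ?case using continuous_on_subset[OF _ assms(2)] by simp
next
  case (Suc k)
  then show ?case using assms(2) continuous_on_subset[OF _ assms(2), of F] by auto
qed

lemma Ck_local:
  assumes S: "openE n S" and loc: "\<And>u. u \<in> S \<Longrightarrow> \<exists>T. openE n T \<and> u \<in> T \<and> Ck_on n k T F"
  shows "Ck_on n k S F"
proof -
  have "\<exists>T. openE n T \<and> u \<in> T \<and> T \<subseteq> S \<and> Ck_on n k T F" if u: "u \<in> S" for u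
  proof -
    obtain T where "openE n T" "u \<in> T" "Ck_on n k T F" using loc u by blast
    then show ?thesis using S u by (intro exI[of _ "T \<inter> S"]) (auto intro: Ck_subset[of _ "T \<inter> S" T])
  qed
  then show ?thesis
  proof (induction k arbitrary: F)
    case 0
    show ?case unfolding Ck_on.simps
    proof (rule continuous_onI_obox[OF openE_subset[OF S]])
      fix u e assume u: "u \<in> S" and e: "e > (0::real)"
      obtain T where T: "openE n T" "u \<in> T" "T \<subseteq> S" "continuous_on T F" using 0[OF u] by auto
      obtain r where "r > 0" "\<And>v. v \<in> obox n u r \<Longrightarrow> dist (F v) (F u) < e"
        using continuous_obox[OF T(1,4,2) e] by metis
      then show "\<exists>r>0. \<forall>v\<in>obox n u r \<inter> S. dist (F v) (F u) < e" by blast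
    qed
  next
    case (Suc k)
    have "continuous_on S F"
    proof (rule continuous_onI_obox[OF openE_subset[OF S]])
      fix u e assume u: "u \<in> S" and e: "e > (0::real)"
      obtain T where T: "openE n T" "u \<in> T" "T \<subseteq> S" "continuous_on T F" using Suc.prems[OF u] by auto
      obtain r where "r > 0" "\<And>v. v \<in> obox n u r \<Longrightarrow> dist (F v) (F u) < e"
        using continuous_obox[OF T(1,4,2) e] by metis
      then show "\<exists>r>0. \<forall>v\<in>obox n u r \<inter> S. dist (F v) (F u) < e" by blast
    qed
    moreover have "Ck_on n k S (partial i F)" if "i < n" for i
      by (rule Suc.IH) (use Suc.prems that in fastforce)
    moreover have "(\<lambda>t. F (u(i := t))) differentiable at (u i)" if "i < n" "u \<in> S" for i u
      using Suc.prems[OF that(2)] that by auto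
    ultimately show ?case by auto
  qed
qed

lemma has_partial_const [simp]: "has_partial i (\<lambda>u. c) u 0"
  by (simp add: has_vector_derivative_const)

lemma has_partial_coord: "has_partial i (\<lambda>u. u j) u (if i = j then 1 else 0)"
  by (auto simp: has_vector_derivative_def intro!: derivative_eq_intros)

lemma has_partial_add:
  "has_partial i F u D \<Longrightarrow> has_partial i G u D' \<Longrightarrow> has_partial i (\<lambda>u. F u + G u) u (D + D')"
  by (rule has_vector_derivative_add)

lemma has_partial_bilinear:
  assumes "bounded_bilinear B" "has_partial i F u D" "has_partial i G u D'"
  shows "has_partial i (\<lambda>u. B (F u) (G u)) u (B (F u) D' + B D (G u))"
  using bounded_bilinear.has_vector_derivative[OF assms] by simp

lemma Ck_const: "openE n S \<Longrightarrow> Ck_on n k S (\<lambda>u. c)"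
proof (induction k arbitrary: c)
  case (Suc k)
  show ?case by (rule Ck_SucI'[OF Suc.prems, where F' = "\<lambda>_ _. 0"]) (auto intro: Suc)
qed auto

lemma Ck_coord: "openE n S \<Longrightarrow> Ck_on n k S (\<lambda>u. u j)"
proof (cases k)
  case 0 then show ?thesis by (simp add: continuous_on_subset[OF continuous_on_product_coordinates])
next
  case (Suc m)
  assume S: "openE n S"
  show ?thesis unfolding Suc
    by (rule Ck_SucI'[OF S _ has_partial_coord])
      (auto simp: continuous_on_subset[OF continuous_on_product_coordinates] Ck_const S)
qed

lemma Ck_add: "openE n S \<Longrightarrow> Ck_on n k S F \<Longrightarrow> Ck_on n k S G \<Longrightarrow> Ck_on n k S (\<lambda>u. F u + G u)"
proof (induction k arbitrary: F G)
  case 0 then show ?case by (auto intro: continuous_intros)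
next
  case (Suc k)
  show ?case
    by (rule Ck_SucI'[OF Suc.prems(1) _ has_partial_add[OF Ck_has_partial[OF Suc.prems(2)] Ck_has_partial[OF Suc.prems(3)]]])
      (use Suc in \<open>auto intro: continuous_intros\<close>)
qed

lemma Ck_bilinear:
  assumes B: "bounded_bilinear B" and S: "openE n S"
  shows "Ck_on n k S F \<Longrightarrow> Ck_on n k S G \<Longrightarrow> Ck_on n k S (\<lambda>u. B (F u) (G u))"
proof (induction k arbitrary: F G)
  case 0 then show ?case by (auto intro: bounded_bilinear.continuous_on[OF B])
next
  case (Suc k)
  show ?case
  proof (rule Ck_SucI'[OF S _ has_partial_bilinear[OF B Ck_has_partial[OF Suc.prems(1)] Ck_has_partial[OF Suc.prems(2)]]])
    show "continuous_on S (\<lambda>u. B (F u) (G u))"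
      using Suc.prems by (auto intro: bounded_bilinear.continuous_on[OF B])
    show "Ck_on n k S (\<lambda>u. B (F u) (partial i G u) + B (partial i F u) (G u))" if "i < n" for i
      using Suc.prems that Ck_SucD[OF Suc.prems(1)] Ck_SucD[OF Suc.prems(2)]
      by (intro Ck_add[OF S] Suc.IH) auto
  qed
qed

lemma Ck_sum:
  assumes "openE n S" "\<And>a. a \<in> A \<Longrightarrow> Ck_on n k S (F a)"
  shows "Ck_on n k S (\<lambda>u. \<Sum>a\<in>A. F a u)"
  using assms(2) by (induction A rule: infinite_finite_induct) (auto intro: Ck_const Ck_add assms(1))

text \<open>The derivative of \<open>inverse h\<close> is a polynomial in \<open>inverse h\<close>
  and \<open>partial i h\<close>, so the induction on \<open>k\<close> closes on itself.\<close>

lemma Ck_inverse: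
  fixes h :: "(nat \<Rightarrow> real) \<Rightarrow> real"
  assumes S: "openE n S" and nz: "\<And>u. u \<in> S \<Longrightarrow> h u \<noteq> 0"
  shows "Ck_on n k S h \<Longrightarrow> Ck_on n k S (\<lambda>u. inverse (h u))"
proof (induction k)
  case 0 then show ?case using nz by (auto intro: continuous_intros)
next
  case (Suc k)
  have I: "Ck_on n k S (\<lambda>u. inverse (h u))" using Suc Ck_SucD by blast
  show ?case
  proof (rule Ck_SucI'[OF S])
    show "continuous_on S (\<lambda>u. inverse (h u))" using I Ck_imp_continuous by blast
    fix i assume i: "i < n"
    show "has_partial i (\<lambda>u. inverse (h u)) u ((- 1) * ((inverse (h u) * partial i h u) * inverse (h u)))" if "u \<in> S" for u
      using Ck_has_partial[OF Suc.prems i that] nz[OF that]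
      unfolding has_real_derivative_iff_has_vector_derivative[symmetric]
      by (auto intro!: derivative_eq_intros)
    show "Ck_on n k S (\<lambda>u. (- 1) * ((inverse (h u) * partial i h u) * inverse (h u)))"
      using Suc.prems i I by (intro Ck_bilinear[OF bounded_bilinear_mult S] Ck_const[OF S]) auto
  qed
qed

subsection \<open>Total differentiability and the chain rule\<close>

lemma onorm_scaleR_le:
  fixes y :: "'b::real_normed_vector"
  shows "norm y \<le> e \<Longrightarrow> onorm (\<lambda>h. h *\<^sub>R y) \<le> e"
  by (rule onorm_le) (auto simp: mult.commute[of e] intro!: mult_left_mono)

lemma has_vector_derivative_linear_term:
  fixes c :: "'b::real_normed_vector"
  shows "((\<lambda>t. t *\<^sub>R c) has_vector_derivative c) F"
  unfolding has_vector_derivative_def by (intro bounded_linear_imp_has_derivative bounded_linear_scaleR_left)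

text \<open>The path from \<open>u\<close> to \<open>v\<close> changes one coordinate at a time and
  never leaves the cube. On each leg the mean value inequality is applied to the difference of
  \<open>F\<close> and its linear model; the derivative of this difference is bounded by
  \<open>e\<close>.\<close>

lemma obox_increment:
  fixes F :: "(nat \<Rightarrow> real) \<Rightarrow> 'b::real_normed_vector"
  assumes hp: "\<And>w i. w \<in> obox n c r \<Longrightarrow> i < n \<Longrightarrow> has_partial i F w (F' i w)"
    and bd: "\<And>w i. w \<in> obox n c r \<Longrightarrow> i < n \<Longrightarrow> norm (F' i w - A i) \<le> e"
    and u: "u \<in> obox n c r" and v: "v \<in> obox n c r"
  shows "norm (F v - F u - (\<Sum>i<n. (v i - u i) *\<^sub>R A i)) \<le> e * (\<Sum>i<n. \<bar>v i - u i\<bar>)"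
proof -
  define w where "w k = (\<lambda>j. if j < k then v j else u j)" for k
  have wn: "w n = v" "w 0 = u"
    using u v by (auto simp: w_def obox_def Rn_def fun_eq_iff)
  have "F v - F u = (\<Sum>k<n. F (w (Suc k)) - F (w k))"
    by (subst sum_lessThan_telescope) (simp add: wn)
  then have "norm (F v - F u - (\<Sum>i<n. (v i - u i) *\<^sub>R A i)) =
      norm (\<Sum>k<n. F (w (Suc k)) - F (w k) - (v k - u k) *\<^sub>R A k)"
    by (simp add: sum_subtractf)
  also have "\<dots> \<le> (\<Sum>k<n. e * \<bar>v k - u k\<bar>)"
  proof (rule sum_norm_le)
    fix k assume "k \<in> {..<n}" then have k: "k < n" by simp
    have wk: "w k \<in> obox n c r" using u v by (auto simp: w_def obox_def Rn_def)
    define g where "g t = F ((w k)(k := t)) - t *\<^sub>R A k" for t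
    have "norm (g (v k) - g (u k)) \<le> e * norm (v k - u k)"
    proof (rule differentiable_bound[where S = "closed_segment (u k) (v k)"])
      fix t assume t: "t \<in> closed_segment (u k) (v k)"
      have "closed_segment (u k) (v k) \<subseteq> ball (c k) r"
        using u v k by (intro closed_segment_subset) (auto simp: obox_def dist_real_def abs_minus_commute)
      then have tt: "(w k)(k := t) \<in> obox n c r"
        using t by (intro obox_upd wk k) (auto simp: dist_real_def abs_minus_commute subset_iff)
      have "((\<lambda>t. F ((w k)(k := t))) has_vector_derivative F' k ((w k)(k := t))) (at t)"
        using hp[OF tt k] by simp
      then have "((\<lambda>t. F ((w k)(k := t)) - t *\<^sub>R A k) has_vector_derivative (F' k ((w k)(k := t)) - 1 *\<^sub>R A k)) (at t)"
        by (intro has_vector_derivative_diff) (auto simp: has_vector_derivative_def intro!: derivative_eq_intros)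
      then show "(g has_derivative (\<lambda>h. h *\<^sub>R (F' k ((w k)(k := t)) - A k))) (at t within closed_segment (u k) (v k))"
        unfolding g_def has_vector_derivative_def by (auto intro: has_derivative_at_withinI)
      show "onorm (\<lambda>h. h *\<^sub>R (F' k ((w k)(k := t)) - A k)) \<le> e"
        by (rule onorm_scaleR_le[OF bd[OF tt k]])
    qed auto
    moreover have "(w k)(k := v k) = w (Suc k)" "(w k)(k := u k) = w k"
      by (auto simp: w_def fun_eq_iff)
    ultimately show "norm (F (w (Suc k)) - F (w k) - (v k - u k) *\<^sub>R A k) \<le> e * \<bar>v k - u k\<bar>"
      by (simp add: g_def algebra_simps)
  qed
  finally show ?thesis by (simp add: sum_distrib_left)
qed

text \<open>Strict differentiability: both points vary around \<open>u\<close>. This stronger form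
  is what yields the lower Lipschitz bound in \<open>local_bilipschitz\<close>.\<close>

lemma C1_strict_diff:
  fixes F :: "(nat \<Rightarrow> real) \<Rightarrow> 'b::real_normed_vector"
  assumes S: "openE n S" and F: "Ck_on n (Suc k) S F" and u: "u \<in> S" and e: "e > 0"
  obtains r where "r > 0" "obox n u r \<subseteq> S"
    "\<And>v w. v \<in> obox n u r \<Longrightarrow> w \<in> obox n u r \<Longrightarrow>
      norm (F v - F w - (\<Sum>i<n. (v i - w i) *\<^sub>R partial i F u)) \<le> e * (\<Sum>i<n. \<bar>v i - w i\<bar>)"
proof -
  have "\<exists>r>0. obox n u r \<subseteq> S \<and> (i < n \<longrightarrow> (\<forall>v\<in>obox n u r. norm (partial i F v - partial i F u) < e))" for i
  proof (cases "i < n")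
    case True
    then have "continuous_on S (partial i F)" using F Ck_imp_continuous[of n k S "partial i F"] by simp
    from continuous_obox[OF S this u e] show ?thesis by (metis dist_norm)
  next
    case False then show ?thesis using S u by (auto simp: openE_iff)
  qed
  then obtain r where r: "\<And>i. r i > 0" "\<And>i. obox n u (r i) \<subseteq> S"
     "\<And>i v. i < n \<Longrightarrow> v\<in>obox n u (r i) \<Longrightarrow> norm (partial i F v - partial i F u) < e" by metis
  \<comment> \<open>Index \<open>n\<close> is included so that the set is nonempty for
    \<open>n = 0\<close>; its radius has merely to give a cube inside \<open>S\<close>.\<close>
  define R where "R = Min (r ` {..n})"
  have R: "R > 0" "\<And>i. i \<le> n \<Longrightarrow> R \<le> r i" unfolding R_def using r(1) by auto
  have sub: "obox n u R \<subseteq> obox n u (r i)" if "i \<le> n" for i using R(2)[OF that] obox_mono by blast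
  show thesis
  proof (rule that[of R])
    show S': "obox n u R \<subseteq> S" using sub[of 0] r(2)[of 0] by auto
    have hp: "has_partial i F w (partial i F w)" if "w \<in> obox n u R" "i < n" for w i
      using Ck_has_partial[OF F that(2)] S' that(1) by blast
    have bd: "norm (partial i F w - partial i F u) \<le> e" if "w \<in> obox n u R" "i < n" for w i
      using r(3)[OF that(2)] sub[of i] that by (meson less_imp_le less_imp_le_nat subsetD)
    fix v w assume "v \<in> obox n u R" "w \<in> obox n u R"
    then show "norm (F v - F w - (\<Sum>i<n. (v i - w i) *\<^sub>R partial i F u)) \<le> e * (\<Sum>i<n. \<bar>v i - w i\<bar>)"
      by (intro obox_increment[OF hp bd])
  qed (use R in auto)
qed

lemma has_vector_derivative_zeroI:
  fixes R :: "real \<Rightarrow> 'b::real_normed_vector"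
  assumes "R t0 = 0" "\<And>e. e > 0 \<Longrightarrow> eventually (\<lambda>t. norm (R t) \<le> e * \<bar>t - t0\<bar>) (at t0)"
  shows "(R has_vector_derivative 0) (at t0)"
  unfolding has_vector_derivative_def has_derivative_within_alt
proof (intro conjI allI impI)
  show "bounded_linear (\<lambda>x. x *\<^sub>R (0::'b))" by (simp add: bounded_linear_zero)
  fix e :: real assume "e > 0"
  from assms(2)[OF this] obtain d where "d > 0" "\<And>t. t \<noteq> t0 \<Longrightarrow> dist t t0 < d \<Longrightarrow> norm (R t) \<le> e * \<bar>t - t0\<bar>"
    by (auto simp: eventually_at)
  then show "\<exists>d>0. \<forall>y\<in>UNIV. norm (y - t0) < d \<longrightarrow> norm (R y - R t0 - (y - t0) *\<^sub>R 0) \<le> e * norm (y - t0)"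
    using assms(1) by (intro exI[of _ d]) (auto simp: dist_real_def, metis abs_0 cancel_comm_monoid_add_class.diff_cancel mult_zero_right norm_zero order_refl)
qed

text \<open>A curve with differentiable coordinates is Lipschitz at \<open>t0\<close>. So the error
  of the first order expansion of \<open>F\<close>, small relative to the increment of the curve, is
  also small relative to \<open>\<bar>t - t0\<bar>\<close>.\<close>

lemma chain_rule_curve:
  fixes F :: "(nat \<Rightarrow> real) \<Rightarrow> 'b::real_normed_vector"
  assumes S: "openE m S" and F: "Ck_on m (Suc k) S F"
    and dom: "\<gamma> t0 \<in> S" "eventually (\<lambda>t. \<gamma> t \<in> Rn m) (at t0)"
    and \<gamma>: "\<And>j. j < m \<Longrightarrow> ((\<lambda>t. \<gamma> t j) has_real_derivative \<gamma>' j) (at t0)"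
  shows "((\<lambda>t. F (\<gamma> t)) has_vector_derivative (\<Sum>j<m. \<gamma>' j *\<^sub>R partial j F (\<gamma> t0))) (at t0)"
proof -
  define L where "L t = (\<Sum>j<m. (\<gamma> t j - \<gamma> t0 j) *\<^sub>R partial j F (\<gamma> t0))" for t
  define R where "R t = F (\<gamma> t) - F (\<gamma> t0) - L t" for t
  \<comment> \<open>Each difference quotient is eventually within 1 of its limit, which explains the
    summand 1.\<close>
  define C where "C = (\<Sum>j<m. \<bar>\<gamma>' j\<bar> + 1)"
  have C0: "C \<ge> 0" unfolding C_def by (intro sum_nonneg) auto
  have lip: "\<forall>\<^sub>F t in at t0. (\<Sum>j<m. \<bar>\<gamma> t j - \<gamma> t0 j\<bar>) \<le> C * \<bar>t - t0\<bar>"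
  proof -
    have "\<forall>\<^sub>F t in at t0. \<bar>\<gamma> t j - \<gamma> t0 j\<bar> \<le> (\<bar>\<gamma>' j\<bar> + 1) * \<bar>t - t0\<bar>" if j: "j < m" for j
    proof -
      have "((\<lambda>t. (\<gamma> t j - \<gamma> t0 j) / (t - t0)) \<longlongrightarrow> \<gamma>' j) (at t0)"
        using \<gamma>[OF j] by (simp add: has_field_derivative_iff)
      then have "\<forall>\<^sub>F t in at t0. dist ((\<gamma> t j - \<gamma> t0 j) / (t - t0)) (\<gamma>' j) < 1"
        by (rule tendstoD) simp
      moreover have "\<forall>\<^sub>F t in at t0. t \<noteq> t0" by (rule eventually_neq_at_within)
      ultimately show ?thesis
      proof eventually_elim
        case (elim t)
        have "\<bar>(\<gamma> t j - \<gamma> t0 j) / (t - t0)\<bar> \<le> \<bar>\<gamma>' j\<bar> + 1"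
          using elim(1) unfolding dist_real_def by linarith
        then show ?case using elim(2) by (simp add: abs_divide pos_divide_le_eq)
      qed
    qed
    then have "\<forall>\<^sub>F t in at t0. \<forall>j\<in>{..<m}. \<bar>\<gamma> t j - \<gamma> t0 j\<bar> \<le> (\<bar>\<gamma>' j\<bar> + 1) * \<bar>t - t0\<bar>"
      by (intro eventually_ball_finite) auto
    then show ?thesis
    proof eventually_elim
      case (elim t)
      have "(\<Sum>j<m. \<bar>\<gamma> t j - \<gamma> t0 j\<bar>) \<le> (\<Sum>j<m. (\<bar>\<gamma>' j\<bar> + 1) * \<bar>t - t0\<bar>)" using elim by (intro sum_mono) auto
      then show ?case by (simp add: C_def sum_distrib_right)
    qed
  qed
  have near: "\<forall>\<^sub>F t in at t0. \<gamma> t \<in> obox m (\<gamma> t0) r" if "r > 0" for r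
  proof -
    have "\<forall>\<^sub>F t in at t0. \<forall>j\<in>{..<m}. \<bar>\<gamma> t j - \<gamma> t0 j\<bar> < r"
    proof (intro eventually_ball_finite ballI)
      fix j assume "j \<in> {..<m}"
      then have "isCont (\<lambda>t. \<gamma> t j) t0" using \<gamma> DERIV_isCont by blast
      then have "((\<lambda>t. \<gamma> t j) \<longlongrightarrow> \<gamma> t0 j) (at t0)" by (simp add: isCont_def)
      from tendstoD[OF this that] show "\<forall>\<^sub>F t in at t0. \<bar>\<gamma> t j - \<gamma> t0 j\<bar> < r" by (simp add: dist_real_def)
    qed auto
    with dom(2) show ?thesis by eventually_elim (auto simp: obox_def)
  qed
  have "(R has_vector_derivative 0) (at t0)"
  proof (rule has_vector_derivative_zeroI)
    show "R t0 = 0" by (simp add: R_def L_def)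
    fix e :: real assume e: "e > 0"
    \<comment> \<open>Dividing by \<open>C + 1\<close> instead of \<open>C\<close> covers the case
      \<open>C = 0\<close>.\<close>
    define e' where "e' = e / (C + 1)"
    have e': "e' > 0" "e' * C \<le> e"
      using e C0 by (simp_all add: e'_def pos_divide_le_eq algebra_simps)
    obtain r where r: "r > 0" "obox m (\<gamma> t0) r \<subseteq> S" "\<And>v w. v \<in> obox m (\<gamma> t0) r \<Longrightarrow> w \<in> obox m (\<gamma> t0) r \<Longrightarrow>
      norm (F v - F w - (\<Sum>i<m. (v i - w i) *\<^sub>R partial i F (\<gamma> t0))) \<le> e' * (\<Sum>i<m. \<bar>v i - w i\<bar>)"
      using C1_strict_diff[OF S F dom(1) e'(1)] by blast
    from near[OF r(1)] lip show "\<forall>\<^sub>F t in at t0. norm (R t) \<le> e * \<bar>t - t0\<bar>"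
    proof eventually_elim
      case (elim t)
      have "\<gamma> t0 \<in> obox m (\<gamma> t0) r" using r(1) dom(1) openE_subset[OF S] by auto
      from r(3)[OF elim(1) this] have "norm (R t) \<le> e' * (\<Sum>i<m. \<bar>\<gamma> t i - \<gamma> t0 i\<bar>)"
        by (simp add: R_def L_def)
      also have "\<dots> \<le> e' * (C * \<bar>t - t0\<bar>)" using elim(2) e' by (intro mult_left_mono) auto
      also have "\<dots> \<le> e * \<bar>t - t0\<bar>" using e'(2) by (simp add: mult.assoc[symmetric] mult_right_mono)
      finally show ?case .
    qed
  qed
  moreover have "(L has_vector_derivative (\<Sum>j<m. (\<gamma>' j) *\<^sub>R partial j F (\<gamma> t0))) (at t0)"
    unfolding L_def
  proof (intro has_vector_derivative_sum)
    fix j assume "j \<in> {..<m}"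
    then have "((\<lambda>t. \<gamma> t j - \<gamma> t0 j) has_vector_derivative (\<gamma>' j - 0)) (at t0)"
      using \<gamma> by (intro has_vector_derivative_diff has_vector_derivative_const)
        (simp add: has_real_derivative_iff_has_vector_derivative)
    from bounded_linear.has_vector_derivative[OF bounded_linear_scaleR_left this]
    show "((\<lambda>t. (\<gamma> t j - \<gamma> t0 j) *\<^sub>R partial j F (\<gamma> t0)) has_vector_derivative \<gamma>' j *\<^sub>R partial j F (\<gamma> t0)) (at t0)"
      by simp
  qed
  ultimately have "((\<lambda>t. R t + L t + F (\<gamma> t0)) has_vector_derivative (0 + (\<Sum>j<m. \<gamma>' j *\<^sub>R partial j F (\<gamma> t0)) + 0)) (at t0)"
    by (intro has_vector_derivative_add has_vector_derivative_const)
  then show ?thesis by (simp add: R_def)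
qed

lemma has_partial_compose:
  fixes F :: "(nat \<Rightarrow> real) \<Rightarrow> 'b::real_normed_vector"
  assumes S: "openE n S" and S': "openE m S'" and F: "Ck_on m (Suc k) S' F"
    and G: "\<And>u. u \<in> S \<Longrightarrow> G u \<in> S'" and u: "u \<in> S" and i: "i < n"
    and hp: "\<And>j. j < m \<Longrightarrow> has_partial i (\<lambda>u. G u j) u (G' j)"
  shows "has_partial i (\<lambda>u. F (G u)) u (\<Sum>j<m. G' j *\<^sub>R partial j F (G u))"
proof -
  obtain r where r: "r > 0" "\<And>t. \<bar>t - u i\<bar> < r \<Longrightarrow> u(i := t) \<in> S"
    using openE_upd[OF S u i] by metis
  have "((\<lambda>t. F (G (u(i := t)))) has_vector_derivative (\<Sum>j<m. G' j *\<^sub>R partial j F (G (u(i := u i))))) (at (u i))"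
    by (rule chain_rule_curve[OF S' F])
      (use r G u hp openE_subset[OF S'] in \<open>auto simp: eventually_at dist_real_def has_real_derivative_iff_has_vector_derivative subset_iff intro!: exI[of _ r]\<close>)
  then show ?thesis by simp
qed

lemma Ck_compose:
  fixes F :: "(nat \<Rightarrow> real) \<Rightarrow> 'b::real_normed_vector"
  assumes S: "openE n S" and S': "openE m S'" and G: "\<And>u. u \<in> S \<Longrightarrow> G u \<in> S'"
  shows "Ck_on m k S' F \<Longrightarrow> (\<And>j. j < m \<Longrightarrow> Ck_on n k S (\<lambda>u. G u j)) \<Longrightarrow> Ck_on n k S (\<lambda>u. F (G u))"
proof (induction k arbitrary: F)
  case 0
  have "continuous_on S (\<lambda>u. G u j)" for j
  proof (cases "j < m")
    \<comment> \<open>Coordinates from \<open>m\<close> on vanish on \<open>S'\<close>, so their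
      continuity, which the product topology asks for as well, is that of the constant 0.\<close>
    case False
    have "G u j = 0" if "u \<in> S" for u using G[OF that] openE_subset[OF S'] False by (auto simp: Rn_def)
    then have "continuous_on S (\<lambda>u. G u j) \<longleftrightarrow> continuous_on S (\<lambda>u. 0::real)"
      by (intro continuous_on_cong) auto
    then show ?thesis by simp
  qed (use 0 in auto)
  then have "continuous_on S G" by (rule continuous_on_coordinatewise_then_product)
  moreover have "continuous_on S' F" using 0(1) by simp
  ultimately have "continuous_on S (\<lambda>u. F (G u))"
    using G by (intro continuous_on_compose2[of S' F S G]) auto
  then show ?case by simp
next
  case (Suc k)
  have Gk: "Ck_on n k S (\<lambda>u. G u j)" if "j < m" for j using Suc.prems(2)[OF that] Ck_SucD by blast
  have k0: "Ck_on n k S (\<lambda>u. F (G u))" by (rule Suc.IH[OF Ck_SucD[OF Suc.prems(1)] Gk])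
  show ?case
  proof (rule Ck_SucI'[OF S])
    show "continuous_on S (\<lambda>u. F (G u))" using k0 Ck_imp_continuous by blast
    fix i assume i: "i < n"
    show "has_partial i (\<lambda>u. F (G u)) u (\<Sum>j<m. partial i (\<lambda>u. G u j) u *\<^sub>R partial j F (G u))" if "u \<in> S" for u
      by (rule has_partial_compose[OF S S' Suc.prems(1) G that i Ck_has_partial[OF Suc.prems(2) i that]])
    show "Ck_on n k S (\<lambda>u. \<Sum>j<m. partial i (\<lambda>u. G u j) u *\<^sub>R partial j F (G u))"
      using Suc.prems i by (intro Ck_sum S Ck_bilinear[OF bounded_bilinear_scaleR S] Suc.IH Gk) auto
  qed
qed

text \<open>The second difference of \<open>F\<close> over a small rectangle, divided by its area,
  is within \<open>e\<close> of \<open>partial i (partial j F) u\<close>, by the mean value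
  inequality in one variable and then in the other. The second difference is symmetric in the two
  variables, so both mixed derivatives are close to one and the same quantity.\<close>

lemma partial_commute:
  fixes F :: "(nat \<Rightarrow> real) \<Rightarrow> 'b::real_normed_vector"
  assumes S: "openE n S" and F: "Ck_on n (Suc (Suc k)) S F" and u: "u \<in> S" and ij: "i < n" "j < n"
  shows "partial i (partial j F) u = partial j (partial i F) u"
proof (cases "i = j")
  case False
  have uR: "u \<in> Rn n" using openE_subset[OF S] u by auto
  have est: "\<exists>r>0. \<forall>s t. 0 < s \<and> s < r \<and> 0 < t \<and> t < r \<longrightarrow>
      norm (F (u(i := u i + s, j := u j + t)) - F (u(i := u i + s)) - F (u(j := u j + t)) + F u
         - (s * t) *\<^sub>R partial i (partial j F) u) \<le> e * (s * t)"
    if ij: "i < n" "j < n" "i \<noteq> j" and e: "e > 0" for i j and e :: real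
  proof -
    have F1: "Ck_on n (Suc 0) S (partial i F)" "Ck_on n (Suc 0) S (partial j F)"
      using F ij Ck_mono[of n "Suc k" S _ "Suc 0"] unfolding Ck_on.simps(2)[of n "Suc k"] by blast+
    have cont: "continuous_on S (partial i (partial j F))" using F1(2) ij(1) Ck_imp_continuous[of n 0 S "partial i (partial j F)"] by simp
    obtain r where r: "r > 0" "obox n u r \<subseteq> S"
      and cl: "\<And>v. v \<in> obox n u r \<Longrightarrow> norm (partial i (partial j F) v - partial i (partial j F) u) < e"
      using continuous_obox[OF S cont u e] by (metis dist_norm)
    let ?A = "partial i (partial j F) u"
    have inb: "u(i := a, j := b) \<in> obox n u r" "u(j := b, i := a) \<in> obox n u r"
      if "\<bar>a - u i\<bar> < r" "\<bar>b - u j\<bar> < r" for a b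
      using that ij uR by (auto simp: obox_def Rn_def)
    have "norm (F (u(i := u i + s, j := u j + t)) - F (u(i := u i + s)) - F (u(j := u j + t)) + F u
         - (s * t) *\<^sub>R ?A) \<le> e * (s * t)" if st: "0 < s" "s < r" "0 < t" "t < r" for s t
    proof -
      define g where "g b = F (u(i := u i + s, j := b)) - F (u(i := u i, j := b)) - b *\<^sub>R (s *\<^sub>R ?A)" for b
      have dg: "(g has_vector_derivative (partial j F (u(i := u i + s, j := b)) - partial j F (u(i := u i, j := b)) - s *\<^sub>R ?A)) (at b)"
        if "b \<in> {u j..u j + t}" for b
      proof -
        have "has_partial j F (u(i := a, j := b)) (partial j F (u(i := a, j := b)))" if "\<bar>a - u i\<bar> < r" for a
          using \<open>b \<in> _\<close> st by (intro Ck_has_partial[OF F ij(2)] subsetD[OF r(2)] inb that) auto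
        from this[of "u i + s"] this[of "u i"] st r(1) show ?thesis
          unfolding g_def by (intro has_vector_derivative_diff has_vector_derivative_linear_term) auto
      qed
      have "norm (g (u j + t) - g (u j)) \<le> (e * s) * norm (u j + t - u j)"
      proof (rule differentiable_bound[where S = "{u j..u j + t}"])
        fix b assume b: "b \<in> {u j..u j + t}"
        show "(g has_derivative (\<lambda>h. h *\<^sub>R (partial j F (u(i := u i + s, j := b)) - partial j F (u(i := u i, j := b)) - s *\<^sub>R ?A))) (at b within {u j..u j + t})"
          using dg[OF b] by (auto simp: has_vector_derivative_def intro: has_derivative_at_withinI)
        \<comment> \<open>The increment of \<open>partial j F\<close> in direction \<open>i\<close>,
          minus its linear model; the bound for it is the bound for the derivative of
          \<open>g\<close>.\<close>
        define h where "h a = partial j F (u(j := b, i := a)) - a *\<^sub>R ?A" for a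
        have hh: "norm (h (u i + s) - h (u i)) \<le> e * norm (u i + s - u i)"
        proof (rule differentiable_bound[where S = "{u i..u i + s}"])
          fix a assume a: "a \<in> {u i..u i + s}"
          have m: "u(j := b, i := a) \<in> obox n u r" using a b st by (intro inb) auto
          have "has_partial i (partial j F) (u(j := b, i := a)) (partial i (partial j F) (u(j := b, i := a)))"
            by (intro Ck_has_partial[OF F1(2) ij(1)] subsetD[OF r(2)] m)
          then have "(h has_vector_derivative (partial i (partial j F) (u(j := b, i := a)) - ?A)) (at a)"
            unfolding h_def by (intro has_vector_derivative_diff has_vector_derivative_linear_term) auto
          then show "(h has_derivative (\<lambda>x. x *\<^sub>R (partial i (partial j F) (u(j := b, i := a)) - ?A))) (at a within {u i..u i + s})"
            by (auto simp: has_vector_derivative_def intro: has_derivative_at_withinI)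
          show "onorm (\<lambda>x. x *\<^sub>R (partial i (partial j F) (u(j := b, i := a)) - ?A)) \<le> e"
            by (rule onorm_scaleR_le[OF less_imp_le[OF cl[OF m]]])
        qed (use st in auto)
        have "norm (partial j F (u(i := u i + s, j := b)) - partial j F (u(i := u i, j := b)) - s *\<^sub>R ?A) \<le> e * s"
        proof -
          have "u(j := b, i := a) = u(i := a, j := b)" for a by (rule fun_upd_twist) (use ij in auto)
          with hh show ?thesis using st by (simp only: h_def) (simp add: algebra_simps del: fun_upd_triv)
        qed
        then show "onorm (\<lambda>h. h *\<^sub>R (partial j F (u(i := u i + s, j := b)) - partial j F (u(i := u i, j := b)) - s *\<^sub>R ?A)) \<le> e * s"
          by (rule onorm_scaleR_le)
      qed (use st in auto)
      moreover have "g (u j + t) - g (u j) = F (u(i := u i + s, j := u j + t)) - F (u(i := u i + s)) - F (u(j := u j + t)) + F u - (s * t) *\<^sub>R ?A"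
      proof -
        have *: "u(i := u i + s, j := u j) = u(i := u i + s)" using ij by auto
        show ?thesis unfolding g_def fun_upd_triv * by (simp add: algebra_simps del: fun_upd_apply)
      qed
      ultimately show ?thesis using st by (simp add: mult.assoc)
    qed
    then show ?thesis using r(1) by blast
  qed
  let ?A = "partial i (partial j F) u" and ?B = "partial j (partial i F) u"
  have "norm (?A - ?B) \<le> e" if e: "e > 0" for e
  proof -
    have "e/2 > 0" using e by simp
    obtain r1 where r1: "r1 > 0" "\<And>s t. 0 < s \<and> s < r1 \<and> 0 < t \<and> t < r1 \<Longrightarrow>
      norm (F (u(i := u i + s, j := u j + t)) - F (u(i := u i + s)) - F (u(j := u j + t)) + F u - (s * t) *\<^sub>R ?A) \<le> e/2 * (s * t)"
      using est[OF ij False \<open>e/2 > 0\<close>] by blast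
    obtain r2 where r2: "r2 > 0" "\<And>s t. 0 < s \<and> s < r2 \<and> 0 < t \<and> t < r2 \<Longrightarrow>
      norm (F (u(j := u j + s, i := u i + t)) - F (u(j := u j + s)) - F (u(i := u i + t)) + F u - (s * t) *\<^sub>R ?B) \<le> e/2 * (s * t)"
      using est[OF ij(2,1) False[symmetric] \<open>e/2 > 0\<close>] by blast
    note r = r1(1) r2(1) r1(2) r2(2)
    define s where "s = min r1 r2 / 2"
    have s: "0 < s" "s < r1" "s < r2" using r(1,2) by (auto simp: s_def min_def)
    let ?D = "F (u(i := u i + s, j := u j + s)) - F (u(i := u i + s)) - F (u(j := u j + s)) + F u"
    have 1: "norm (?D - (s * s) *\<^sub>R ?A) \<le> e/2 * (s * s)" using r(3)[of s s] s by auto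
    have 2: "norm (?D - (s * s) *\<^sub>R ?B) \<le> e/2 * (s * s)"
    proof -
      have "u(j := u j + s, i := u i + s) = u(i := u i + s, j := u j + s)"
        by (rule fun_upd_twist) (use False in auto)
      then show ?thesis using r(4)[of s s] s by (simp add: algebra_simps del: fun_upd_apply)
    qed
    have "norm ((?D - (s * s) *\<^sub>R ?B) - (?D - (s * s) *\<^sub>R ?A)) \<le> e/2 * (s * s) + e/2 * (s * s)"
      by (rule order_trans[OF norm_triangle_ineq4]) (use 1 2 in linarith)
    then have "norm ((s * s) *\<^sub>R (?A - ?B)) \<le> e * (s * s)" by (simp add: algebra_simps)
    then show ?thesis using s(1) by (simp add: mult.commute)
  qed
  then have "norm (?A - ?B) \<le> 0" by (rule dense_ge)
  then show ?thesis by simp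
qed simp

subsection \<open>Smooth functions\<close>

lemma CinfI: "openE n S \<Longrightarrow> (\<And>k. Ck_on n k S F) \<Longrightarrow> Cinf_on n S F"
  by (simp add: Cinf_on_def)

lemma Cinf_open: "Cinf_on n S F \<Longrightarrow> openE n S"
  and Cinf_Ck: "Cinf_on n S F \<Longrightarrow> Ck_on n k S F"
  by (simp_all add: Cinf_on_def)

lemma Cinf_continuous: "Cinf_on n S F \<Longrightarrow> continuous_on S F"
  using Cinf_Ck[of n S F 0] by simp

lemma Cinf_has_partial:
  "Cinf_on n S F \<Longrightarrow> i < n \<Longrightarrow> u \<in> S \<Longrightarrow> has_partial i F u (partial i F u)"
  using Ck_has_partial[OF Cinf_Ck] by blast

lemma Cinf_partial: "Cinf_on n S F \<Longrightarrow> i < n \<Longrightarrow> Cinf_on n S (partial i F)"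
  using Cinf_Ck[of n S F "Suc k" for k] by (simp add: Cinf_on_def)

lemma Cinf_const [simp]: "openE n S \<Longrightarrow> Cinf_on n S (\<lambda>u. c)"
  by (simp add: Cinf_on_def Ck_const)

lemma Cinf_coord: "openE n S \<Longrightarrow> Cinf_on n S (\<lambda>u. u j)"
  by (simp add: Cinf_on_def Ck_coord)

lemma Cinf_add: "Cinf_on n S F \<Longrightarrow> Cinf_on n S G \<Longrightarrow> Cinf_on n S (\<lambda>u. F u + G u)"
  by (simp add: Cinf_on_def Ck_add)

lemma Cinf_bilinear:
  "bounded_bilinear B \<Longrightarrow> Cinf_on n S F \<Longrightarrow> Cinf_on n S G \<Longrightarrow> Cinf_on n S (\<lambda>u. B (F u) (G u))"
  by (simp add: Cinf_on_def Ck_bilinear)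

lemmas Cinf_scaleR = Cinf_bilinear[OF bounded_bilinear_scaleR]
  and Cinf_mult = Cinf_bilinear[OF bounded_bilinear_mult]
  and Cinf_inner = Cinf_bilinear[OF bounded_bilinear_inner]

lemma Cinf_linear:
  assumes "bounded_linear h" "Cinf_on n S F" shows "Cinf_on n S (\<lambda>u. h (F u))"
proof (rule CinfI[OF Cinf_open[OF assms(2)]])
  note S = Cinf_open[OF assms(2)]
  show "Ck_on n k S (\<lambda>u. h (F u))" for k
    using Cinf_Ck[OF assms(2), of k]
  proof (induction k arbitrary: F)
    case 0 then show ?case using bounded_linear.continuous_on[OF assms(1), of S F] by simp
  next
    case (Suc k)
    show ?case
    proof (rule Ck_SucI'[OF S])
      show "continuous_on S (\<lambda>u. h (F u))" using bounded_linear.continuous_on[OF assms(1), of S F] Suc.prems by simp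
      show "has_partial i (\<lambda>u. h (F u)) u (h (partial i F u))" if "i < n" "u \<in> S" for i u
        by (rule bounded_linear.has_vector_derivative[OF assms(1) Ck_has_partial[OF Suc.prems that]])
      show "Ck_on n k S (\<lambda>u. h (partial i F u))" if "i < n" for i
        using Suc that by simp
    qed
  qed
qed

lemma Cinf_minus: "Cinf_on n S F \<Longrightarrow> Cinf_on n S (\<lambda>u. - F u)"
  by (rule Cinf_linear[OF bounded_linear_minus[OF bounded_linear_ident]])

lemma Cinf_diff: "Cinf_on n S F \<Longrightarrow> Cinf_on n S G \<Longrightarrow> Cinf_on n S (\<lambda>u. F u - G u)"
  using Cinf_add[of n S F "\<lambda>u. - G u"] Cinf_minus[of n S G] by simp

lemma Cinf_Pair:
  assumes "Cinf_on n S F" "Cinf_on n S G" shows "Cinf_on n S (\<lambda>u. (F u, G u))"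
proof -
  have "Cinf_on n S (\<lambda>u. (F u, 0) + (0, G u))"
    by (intro Cinf_add Cinf_linear[OF bounded_linear_Pair[OF bounded_linear_ident bounded_linear_zero] assms(1)]
      Cinf_linear[OF bounded_linear_Pair[OF bounded_linear_zero bounded_linear_ident] assms(2)])
  then show ?thesis by simp
qed

lemma Cinf_sum:
  "openE n S \<Longrightarrow> (\<And>a. a \<in> A \<Longrightarrow> Cinf_on n S (F a)) \<Longrightarrow> Cinf_on n S (\<lambda>u. \<Sum>a\<in>A. F a u)"
  by (simp add: Cinf_on_def Ck_sum)

lemma Cinf_inverse:
  "Cinf_on n S h \<Longrightarrow> (\<And>u. u \<in> S \<Longrightarrow> h u \<noteq> (0::real)) \<Longrightarrow> Cinf_on n S (\<lambda>u. inverse (h u))"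
  by (simp add: Cinf_on_def Ck_inverse)

lemma Cinf_cong:
  "Cinf_on n S F \<Longrightarrow> (\<And>u. u \<in> S \<Longrightarrow> F u = G u) \<Longrightarrow> Cinf_on n S G"
  using Ck_cong[of n S F G] by (simp add: Cinf_on_def)

lemma Cinf_subset: "Cinf_on n S F \<Longrightarrow> openE n T \<Longrightarrow> T \<subseteq> S \<Longrightarrow> Cinf_on n T F"
  using Ck_subset[of n T S _ F] by (simp add: Cinf_on_def)

lemma Cinf_compose:
  assumes "Cinf_on m S' F" "openE n S" "\<And>u. u \<in> S \<Longrightarrow> G u \<in> S'"
    and "\<And>j. j < m \<Longrightarrow> Cinf_on n S (\<lambda>u. G u j)"
  shows "Cinf_on n S (\<lambda>u. F (G u))"
proof (rule CinfI[OF assms(2)])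
  show "Ck_on n k S (\<lambda>u. F (G u))" for k
    by (rule Ck_compose[where G = G and m = m and S' = S', OF assms(2) Cinf_open[OF assms(1)]])
      (use assms Cinf_Ck in blast)+
qed

lemma Cinf_local:
  assumes "\<And>u. u \<in> S \<Longrightarrow> \<exists>T. u \<in> T \<and> T \<subseteq> S \<and> Cinf_on n T F"
  shows "Cinf_on n S F"
proof (rule CinfI)
  show S: "openE n S"
  proof (rule openE_Un_local)
    fix u assume "u \<in> S"
    then show "\<exists>T. openE n T \<and> u \<in> T \<and> T \<subseteq> S" using assms Cinf_open by meson
  qed
  show "Ck_on n k S F" for k
  proof (rule Ck_local[OF S])
    fix u assume "u \<in> S"
    then show "\<exists>T. openE n T \<and> u \<in> T \<and> Ck_on n k T F" using assms Cinf_open Cinf_Ck by meson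
  qed
qed

lemma partial_add:
  "Cinf_on n S F \<Longrightarrow> Cinf_on n S G \<Longrightarrow> i < n \<Longrightarrow> u \<in> S \<Longrightarrow>
   partial i (\<lambda>u. F u + G u) u = partial i F u + partial i G u"
  unfolding partial_def[of i "\<lambda>u. F u + G u"]
  by (intro vector_derivative_at has_partial_add Cinf_has_partial)

lemma partial_bilinear:
  "bounded_bilinear B \<Longrightarrow> Cinf_on n S F \<Longrightarrow> Cinf_on n S G \<Longrightarrow> i < n \<Longrightarrow> u \<in> S \<Longrightarrow>
   partial i (\<lambda>u. B (F u) (G u)) u = B (F u) (partial i G u) + B (partial i F u) (G u)"
  unfolding partial_def[of i "\<lambda>u. B (F u) (G u)"]
  by (intro vector_derivative_at has_partial_bilinear Cinf_has_partial)

lemmas partial_scaleR = partial_bilinear[OF bounded_bilinear_scaleR]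
  and partial_mult = partial_bilinear[OF bounded_bilinear_mult]
  and partial_inner = partial_bilinear[OF bounded_bilinear_inner]

lemma partial_linear:
  assumes "bounded_linear h" "Cinf_on n S F" "i < n" "u \<in> S"
  shows "partial i (\<lambda>u. h (F u)) u = h (partial i F u)"
  using bounded_linear.has_vector_derivative[OF assms(1) Cinf_has_partial[OF assms(2-4)]]
  unfolding partial_def[of i "\<lambda>u. h (F u)"] by (rule vector_derivative_at)

lemma partial_sum:
  assumes "openE n S" "\<And>a. a \<in> A \<Longrightarrow> Cinf_on n S (F a)" "i < n" "u \<in> S"
  shows "partial i (\<lambda>u. \<Sum>a\<in>A. F a u) u = (\<Sum>a\<in>A. partial i (F a) u)"
proof -
  have "has_partial i (F a) u (partial i (F a) u)" if "a \<in> A" for a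
    by (rule Cinf_has_partial[OF assms(2)[OF that] assms(3,4)])
  then have "((\<lambda>t. \<Sum>a\<in>A. F a (u(i := t))) has_vector_derivative (\<Sum>a\<in>A. partial i (F a) u)) (at (u i))"
    by (rule has_vector_derivative_sum)
  then show ?thesis unfolding partial_def[of i "\<lambda>u. \<Sum>a\<in>A. F a u"] by (rule vector_derivative_at)
qed

lemma partial_const [simp]: "partial i (\<lambda>u. c) u = 0"
  by (simp add: partial_def)

lemma partial_coord: "partial i (\<lambda>u. u j) u = (if i = j then 1 else 0)"
  unfolding partial_def using has_partial_coord[where i = i and u = u and j = j] by (rule vector_derivative_at)

lemma partial_Pair:
  assumes "Cinf_on n S F" "Cinf_on n S G" "i < n" "u \<in> S"
  shows "partial i (\<lambda>u. (F u, G u)) u = (partial i F u, partial i G u)"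
  using has_vector_derivative_Pair[OF Cinf_has_partial[OF assms(1,3,4)] Cinf_has_partial[OF assms(2-4)]]
  unfolding partial_def[of i "\<lambda>u. (F u, G u)"] by (rule vector_derivative_at)

lemma Cinf_partial_commute:
  "Cinf_on n S F \<Longrightarrow> u \<in> S \<Longrightarrow> i < n \<Longrightarrow> j < n \<Longrightarrow>
   partial i (partial j F) u = partial j (partial i F) u"
  by (rule partial_commute[OF Cinf_open Cinf_Ck])

subsection \<open>Linearly independent families and dual frames\<close>

text \<open>Families are indexed, so a repeated vector counts as dependent, and coefficients are
  functions of the index. This suits frames that vary with the point, where the set of values is no
  stable index.\<close>

definition lin_indep :: "'i set \<Rightarrow> ('i \<Rightarrow> 'v::real_vector) \<Rightarrow> bool"
  where "lin_indep I w \<longleftrightarrow> (\<forall>c. (\<Sum>i\<in>I. c i *\<^sub>R w i) = 0 \<longrightarrow> (\<forall>i\<in>I. c i = 0))"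

lemma lin_indep_subset:
  assumes "lin_indep I w" "J \<subseteq> I" "finite I" shows "lin_indep J w"
  unfolding lin_indep_def
proof (rule allI, rule impI)
  fix c assume c: "(\<Sum>i\<in>J. c i *\<^sub>R w i) = 0"
  define c' where "c' i = (if i \<in> J then c i else 0)" for i
  have "(\<Sum>i\<in>I. c' i *\<^sub>R w i) = (\<Sum>i\<in>J. c' i *\<^sub>R w i)"
    by (rule sum.mono_neutral_right) (use assms in \<open>auto simp: c'_def\<close>)
  also have "\<dots> = (\<Sum>i\<in>J. c i *\<^sub>R w i)" by (rule sum.cong) (auto simp: c'_def)
  finally have "\<forall>i\<in>I. c' i = 0" using c assms(1) unfolding lin_indep_def by simp
  then show "\<forall>i\<in>J. c i = 0" using assms(2) by (auto simp: c'_def subset_iff split: if_splits)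
qed

lemma span_image_sum:
  assumes "finite I" shows "v \<in> span (w ` I) \<longleftrightarrow> (\<exists>c. v = (\<Sum>i\<in>I. c i *\<^sub>R w i))"
  using assms
proof (induction I arbitrary: v)
  case (insert a I)
  show ?case
  proof
    assume "v \<in> span (w ` insert a I)"
    then obtain k where "v - k *\<^sub>R w a \<in> span (w ` I)"
      unfolding image_insert span_insert by blast
    then obtain c where c: "v - k *\<^sub>R w a = (\<Sum>i\<in>I. c i *\<^sub>R w i)" using insert.IH by blast
    have "(\<Sum>i\<in>I. (c(a := k)) i *\<^sub>R w i) = (\<Sum>i\<in>I. c i *\<^sub>R w i)" using insert.hyps by (intro sum.cong) auto
    then have "v = (\<Sum>i\<in>insert a I. (c(a := k)) i *\<^sub>R w i)" using c insert.hyps by (simp add: algebra_simps)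
    then show "\<exists>c. v = (\<Sum>i\<in>insert a I. c i *\<^sub>R w i)" by blast
  next
    assume "\<exists>c. v = (\<Sum>i\<in>insert a I. c i *\<^sub>R w i)"
    then obtain c where "v = (\<Sum>i\<in>insert a I. c i *\<^sub>R w i)" by blast
    moreover have "(\<Sum>i\<in>insert a I. c i *\<^sub>R w i) \<in> span (w ` insert a I)"
      by (intro span_sum span_scale span_base imageI)
    ultimately show "v \<in> span (w ` insert a I)" by simp
  qed
qed auto

lemma dual_imp_lin_indep:
  fixes w :: "'i \<Rightarrow> 'b::real_inner"
  assumes "finite I" "\<And>i j. i \<in> I \<Longrightarrow> j \<in> I \<Longrightarrow> ws i \<bullet> w j = (if i = j then 1 else 0)"
  shows "lin_indep I w"
  unfolding lin_indep_def
proof (intro allI impI ballI)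
  fix c i assume c: "(\<Sum>i\<in>I. c i *\<^sub>R w i) = 0" and i: "i \<in> I"
  have "ws i \<bullet> (\<Sum>j\<in>I. c j *\<^sub>R w j) = (\<Sum>j\<in>I. if i = j then c j else 0)"
    unfolding inner_sum_right using assms i by (intro sum.cong) auto
  then show "c i = 0" using c i assms(1) by simp
qed

lemma dual_coeff:
  fixes w :: "'i \<Rightarrow> 'b::real_inner"
  assumes "finite I" "\<And>i j. i \<in> I \<Longrightarrow> j \<in> I \<Longrightarrow> ws i \<bullet> w j = (if i = j then 1 else 0)" "i \<in> I"
  shows "ws i \<bullet> (\<Sum>j\<in>I. c j *\<^sub>R w j) = c i"
proof -
  have "ws i \<bullet> (\<Sum>j\<in>I. c j *\<^sub>R w j) = (\<Sum>j\<in>I. if i = j then c j else 0)"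
    unfolding inner_sum_right using assms by (intro sum.cong) auto
  then show ?thesis using assms by simp
qed

text \<open>One Gram--Schmidt step: the residue \<open>r\<close> of the new vector is nonzero at \<open>u0\<close>, hence near \<open>u0\<close>.\<close>

lemma dual_frame:
  fixes e :: "'i \<Rightarrow> (nat \<Rightarrow> real) \<Rightarrow> 'b::euclidean_space"
  assumes "finite I" "openE n S" "\<And>i. i \<in> I \<Longrightarrow> Cinf_on n S (e i)" "u0 \<in> S" "lin_indep I (\<lambda>i. e i u0)"
  shows "\<exists>S' es. openE n S' \<and> u0 \<in> S' \<and> S' \<subseteq> S \<and> (\<forall>i\<in>I. Cinf_on n S' (es i)) \<and>
    (\<forall>u\<in>S'. \<forall>i\<in>I. \<forall>j\<in>I. es i u \<bullet> e j u = (if i = j then 1 else 0)) \<and>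
    (\<forall>u\<in>S'. \<forall>i\<in>I. es i u \<in> span ((\<lambda>j. e j u) ` I))"
  using assms
proof (induction I)
  case empty then show ?case by auto
next
  case (insert a I)
  have li: "lin_indep I (\<lambda>i. e i u0)" using lin_indep_subset[OF insert.prems(4)] insert.hyps by auto
  obtain S1 es where *: "openE n S1 \<and> u0 \<in> S1 \<and> S1 \<subseteq> S \<and> (\<forall>i\<in>I. Cinf_on n S1 (es i)) \<and>
    (\<forall>u\<in>S1. \<forall>i\<in>I. \<forall>j\<in>I. es i u \<bullet> e j u = (if i = j then 1 else 0)) \<and>
    (\<forall>u\<in>S1. \<forall>i\<in>I. es i u \<in> span ((\<lambda>j. e j u) ` I))"
    using insert.IH[OF insert.prems(1) insert.prems(2) insert.prems(3) li] by blast
  then have S1: "openE n S1" "u0 \<in> S1" "S1 \<subseteq> S" "\<And>i. i \<in> I \<Longrightarrow> Cinf_on n S1 (es i)"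
    and es: "\<And>u i j. u \<in> S1 \<Longrightarrow> i \<in> I \<Longrightarrow> j \<in> I \<Longrightarrow> es i u \<bullet> e j u = (if i = j then 1 else 0)"
    and sp: "\<And>u i. u \<in> S1 \<Longrightarrow> i \<in> I \<Longrightarrow> es i u \<in> span ((\<lambda>j. e j u) ` I)"
    by blast+
  have e1: "Cinf_on n S1 (e i)" if "i \<in> insert a I" for i
    using insert.prems(2)[OF that] S1 by (auto intro: Cinf_subset)
  define r where "r u = e a u - (\<Sum>i\<in>I. (e a u \<bullet> es i u) *\<^sub>R e i u)" for u
  have rC: "Cinf_on n S1 r" unfolding r_def
    using e1 S1 by (intro Cinf_diff Cinf_sum Cinf_scaleR Cinf_inner) auto
  have r_es: "r u \<bullet> es i u = 0" if "u \<in> S1" "i \<in> I" for u i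
    using dual_coeff[of I "\<lambda>i. es i u" "\<lambda>i. e i u" i "\<lambda>i. e a u \<bullet> es i u"] es that insert.hyps
    unfolding r_def inner_diff_left by (simp add: inner_commute)
  \<comment> \<open>The two sides agree because their difference lies in the span of the
    \<open>e j u\<close> and is orthogonal to each of them. The formula turns orthogonality to the
    \<open>es j u\<close>, which is evident for \<open>r\<close>, into orthogonality to the
    \<open>e j u\<close>.\<close>
  have e_es: "e i u = (\<Sum>j\<in>I. (e i u \<bullet> e j u) *\<^sub>R es j u)" if u: "u \<in> S1" and i: "i \<in> I" for u i
  proof -
    have sub: "span ((\<lambda>j. es j u) ` I) \<subseteq> span ((\<lambda>j. e j u) ` I)"
      using sp[OF u] by (intro span_minimal) auto
    have li: "lin_indep I (\<lambda>j. es j u)"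
      by (rule dual_imp_lin_indep[of I "\<lambda>j. e j u"]) (use insert.hyps es[OF u] in \<open>auto simp: inner_commute\<close>)
    let ?d = "e i u - (\<Sum>j\<in>I. (e i u \<bullet> e j u) *\<^sub>R es j u)"
    have "?d \<in> span ((\<lambda>j. e j u) ` I)"
      using i by (intro span_diff subsetD[OF sub, of "\<Sum>j\<in>I. (e i u \<bullet> e j u) *\<^sub>R es j u"] span_sum span_scale)
        (auto intro: span_base)
    then obtain c where c: "?d = (\<Sum>j\<in>I. c j *\<^sub>R e j u)" 
      using span_image_sum[OF insert.hyps(1), of ?d "\<lambda>j. e j u"] by auto
    have z: "e j u \<bullet> ?d = 0" if "j \<in> I" for j
    proof -
      have "e j u \<bullet> (\<Sum>j\<in>I. (e i u \<bullet> e j u) *\<^sub>R es j u) = e i u \<bullet> e j u"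
        by (rule dual_coeff) (use insert.hyps es[OF u] that in \<open>auto simp: inner_commute\<close>)
      then show ?thesis by (simp add: inner_diff_right inner_commute)
    qed
    have "?d \<bullet> ?d = (\<Sum>j\<in>I. c j *\<^sub>R e j u) \<bullet> ?d" using c by simp
    also have "\<dots> = 0" using z by (simp add: inner_sum_left)
    finally show ?thesis by simp
  qed
  have r_e: "r u \<bullet> e i u = 0" if "u \<in> S1" "i \<in> I" for u i
    by (subst e_es[OF that]) (simp add: inner_sum_right r_es[OF that(1)])
  have r_a: "r u \<bullet> e a u = r u \<bullet> r u" if "u \<in> S1" for u
  proof -
    have "r u \<bullet> (\<Sum>i\<in>I. (e a u \<bullet> es i u) *\<^sub>R e i u) = 0" by (simp add: inner_sum_right r_e[OF that])
    then show ?thesis by (subst (3) r_def) (simp add: inner_diff_right)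
  qed
  have "r u0 \<noteq> 0"
  proof
    assume "r u0 = 0"
    define c where "c i = (if i = a then 1 else - (e a u0 \<bullet> es i u0))" for i
    have "(\<Sum>i\<in>I. c i *\<^sub>R e i u0) = - (\<Sum>i\<in>I. (e a u0 \<bullet> es i u0) *\<^sub>R e i u0)"
      unfolding sum_negf[symmetric] using insert.hyps by (intro sum.cong) (auto simp: c_def)
    then have "(\<Sum>i\<in>insert a I. c i *\<^sub>R e i u0) = r u0"
      using insert.hyps by (simp add: r_def c_def)
    then have "c a = 0" using insert.prems(4) \<open>r u0 = 0\<close> unfolding lin_indep_def by simp
    then show False by (simp add: c_def)
  qed
  define S2 where "S2 = {u\<in>S1. r u \<in> - {0}}"
  have S2: "openE n S2" unfolding S2_def by (rule openE_vimage[OF S1(1) Cinf_continuous[OF rC]]) auto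
  have S21: "S2 \<subseteq> S1" and u02: "u0 \<in> S2" using S1 \<open>r u0 \<noteq> 0\<close> by (auto simp: S2_def)
  have nz: "r u \<bullet> r u \<noteq> 0" if "u \<in> S2" for u using that by (auto simp: S2_def)
  \<comment> \<open>\<open>r\<close> is orthogonal to the old \<open>e j\<close> and satisfies
    \<open>r \<bullet> e a = r \<bullet> r\<close>, so this rescaling pairs to 1 with
    \<open>e a\<close>. The old dual vectors are corrected by a multiple of \<open>ea\<close> so as
    to annihilate \<open>e a\<close>.\<close>
  define ea where "ea u = inverse (r u \<bullet> r u) *\<^sub>R r u" for u
  define es' where "es' i = (if i = a then ea else (\<lambda>u. es i u - (es i u \<bullet> e a u) *\<^sub>R ea u))" for i
  have rC2: "Cinf_on n S2 r" by (rule Cinf_subset[OF rC S2 S21])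
  have eaC: "Cinf_on n S2 ea" unfolding ea_def
    by (intro Cinf_scaleR Cinf_inverse Cinf_inner rC2) (rule nz)
  have "Cinf_on n S2 (es' i)" if "i \<in> insert a I" for i
  proof (cases "i = a")
    case False
    then have "Cinf_on n S2 (es i)" "Cinf_on n S2 (e a)"
      using that Cinf_subset[OF S1(4) S2 S21] Cinf_subset[OF e1 S2 S21] by auto
    then show ?thesis using False unfolding es'_def by (auto intro!: Cinf_diff Cinf_scaleR Cinf_inner eaC)
  qed (simp add: es'_def eaC)
  moreover have "es' i u \<bullet> e j u = (if i = j then 1 else 0)" if u: "u \<in> S2" and ij: "i \<in> insert a I" "j \<in> insert a I" for u i j
  proof -
    have u1: "u \<in> S1" using u S21 by auto
    have ea_a: "ea u \<bullet> e a u = 1" using nz[OF u] by (simp add: ea_def r_a[OF u1])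
    have ea_j: "ea u \<bullet> e j u = 0" if "j \<in> I" for j using r_e[OF u1 that] by (simp add: ea_def)
    show ?thesis
      using ij insert.hyps(2) ea_a ea_j es[OF u1] by (auto simp: es'_def inner_diff_left)
  qed
  moreover have "es' i u \<in> span ((\<lambda>j. e j u) ` insert a I)" if u: "u \<in> S2" and i: "i \<in> insert a I" for u i
  proof -
    have u1: "u \<in> S1" using u S21 by auto
    have mono: "span ((\<lambda>j. e j u) ` I) \<subseteq> span ((\<lambda>j. e j u) ` insert a I)" by (intro span_mono) auto
    have "r u \<in> span ((\<lambda>j. e j u) ` insert a I)" unfolding r_def
      by (intro span_diff span_sum span_scale span_base imageI) auto
    then have "ea u \<in> span ((\<lambda>j. e j u) ` insert a I)" by (simp add: ea_def span_scale)
    then show ?thesis using i sp[OF u1] mono unfolding es'_def by (auto intro!: span_diff span_scale)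
  qed
  ultimately show ?case using S2 u02 S21 S1(3) by (intro exI[of _ S2] exI[of _ es']) auto
qed

subsection \<open>Closed cubes and the cone argument\<close>

definition kbox :: "nat \<Rightarrow> (nat \<Rightarrow> real) \<Rightarrow> real \<Rightarrow> (nat \<Rightarrow> real) set"
  where "kbox n u r = {v \<in> Rn n. \<forall>i<n. \<bar>v i - u i\<bar> \<le> r}"

lemma compact_kbox: "compact (kbox n u r)"
proof -
  have "kbox n u r = Pi\<^sub>E UNIV (\<lambda>i. if i < n then {u i - r..u i + r} else {0})" (is "_ = Pi\<^sub>E UNIV ?X")
  proof (intro set_eqI iffI)
    fix v assume "v \<in> kbox n u r"
    then have "v i \<in> ?X i" for i by (auto simp: kbox_def Rn_def abs_le_iff algebra_simps)
    then show "v \<in> Pi\<^sub>E UNIV ?X" by auto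
  next
    fix v assume "v \<in> Pi\<^sub>E UNIV ?X"
    then have v: "v i \<in> ?X i" for i by (auto simp: PiE_def Pi_def)
    have "v i = 0" if "n \<le> i" for i using v[of i] that by simp
    moreover have "\<bar>v i - u i\<bar> \<le> r" if "i < n" for i using v[of i] that by (auto simp: abs_le_iff)
    ultimately show "v \<in> kbox n u r" by (auto simp: kbox_def Rn_def)
  qed
  moreover have "compactin (product_topology (\<lambda>i. euclidean) UNIV) (Pi\<^sub>E UNIV ?X)"
    unfolding compactin_PiE by auto
  ultimately show ?thesis by (simp add: euclidean_product_topology)
qed

lemma kbox_subset_obox: "s < r \<Longrightarrow> kbox n u s \<subseteq> obox n u r"
  by (fastforce simp: kbox_def obox_def)

lemma continuous_obox_ex:
  fixes F :: "(nat \<Rightarrow> real) \<Rightarrow> 'b::metric_space"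
  assumes "openE n S" "continuous_on S F" "u \<in> S" "e > 0"
  shows "\<exists>r>0. obox n u r \<subseteq> S \<and> (\<forall>v\<in>obox n u r. dist (F v) (F u) < e)"
proof (rule continuous_obox[OF assms])
  fix r assume "r > 0" "obox n u r \<subseteq> S" "\<And>v. v \<in> obox n u r \<Longrightarrow> dist (F v) (F u) < e"
  then show ?thesis by (intro exI[of _ r]) simp
qed

lemma C1_strict_diff_ex:
  fixes F :: "(nat \<Rightarrow> real) \<Rightarrow> 'b::real_normed_vector"
  assumes "Cinf_on n S F" "u \<in> S" "e > 0"
  shows "\<exists>r>0. obox n u r \<subseteq> S \<and> (\<forall>v\<in>obox n u r. \<forall>w\<in>obox n u r.
      norm (F v - F w - (\<Sum>i<n. (v i - w i) *\<^sub>R partial i F u)) \<le> e * (\<Sum>i<n. \<bar>v i - w i\<bar>))"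
proof (rule C1_strict_diff[OF Cinf_open[OF assms(1)] Cinf_Ck[OF assms(1)] assms(2,3)])
  fix r assume "r > 0" "obox n u r \<subseteq> S" "\<And>v w. v \<in> obox n u r \<Longrightarrow> w \<in> obox n u r \<Longrightarrow>
      norm (F v - F w - (\<Sum>i<n. (v i - w i) *\<^sub>R partial i F u)) \<le> e * (\<Sum>i<n. \<bar>v i - w i\<bar>)"
  then show ?thesis by (intro exI[of _ r]) simp
qed

lemma continuous_fst_coord: "continuous_on UNIV (\<lambda>p::(nat \<Rightarrow> real) \<times> real. fst p i)"
  by (rule continuous_on_product_then_coordinatewise[OF continuous_on_fst[OF continuous_on_id]])

text \<open>The distance of \<open>G u + t *\<^sub>R Z u\<close> to the compact image of the cube is constant along the
  characteristics \<open>(u + s *\<^sub>R W, t - s)\<close> up to \<open>o(s)\<close>; so this distance minus \<open>\<epsilon> * t\<close>, on a cone that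
  the characteristics do not leave, attains its maximum at \<open>t = 0\<close>, where it is \<open>0\<close>.\<close>

lemma cone_reach:
  fixes G Z :: "(nat \<Rightarrow> real) \<Rightarrow> 'e::euclidean_space"
  assumes G: "Cinf_on n S G" and Z: "Cinf_on n S Z"
    and sub: "kbox n u0 R \<subseteq> S" and u0: "u0 \<in> Rn n" and K: "K \<ge> 0" "K * T \<le> R"
    and flow: "\<And>u t \<eta>. u \<in> kbox n u0 R \<Longrightarrow> 0 < t \<Longrightarrow> t \<le> T \<Longrightarrow> \<eta> > 0 \<Longrightarrow>
      \<exists>W. (\<forall>i<n. \<bar>W i\<bar> \<le> K) \<and>
        norm ((\<Sum>i<n. W i *\<^sub>R (partial i G u + t *\<^sub>R partial i Z u)) - Z u) \<le> \<eta>"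
    and t0: "0 \<le> t0" "t0 \<le> T"
  shows "G u0 + t0 *\<^sub>R Z u0 \<in> G ` kbox n u0 R"
proof (rule ccontr)
  assume neg: "G u0 + t0 *\<^sub>R Z u0 \<notin> G ` kbox n u0 R"
  have "0 \<le> K * T" using K t0 by auto
  then have R0: "R \<ge> 0" using K by linarith
  have u0k: "u0 \<in> kbox n u0 R" using u0 R0 by (simp add: kbox_def)
  then have t0': "t0 > 0" using neg t0 by (cases "t0 = 0") auto
  define Q where "Q = G ` kbox n u0 R"
  have cG: "continuous_on (kbox n u0 R) G" and cZ: "continuous_on (kbox n u0 R) Z"
    using continuous_on_subset[OF Cinf_continuous[OF G] sub] continuous_on_subset[OF Cinf_continuous[OF Z] sub] by auto
  have Q: "closed Q" "Q \<noteq> {}"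
    unfolding Q_def using compact_imp_closed[OF compact_continuous_image[OF cG compact_kbox]] u0k by auto
  define D where "D p = infdist (G (fst p) + snd p *\<^sub>R Z (fst p)) Q" for p :: "(nat \<Rightarrow> real) \<times> real"
  have d0: "D (u0, t0) > 0"
    unfolding D_def using infdist_pos_not_in_closed[OF Q] neg by (simp add: Q_def)
  \<comment> \<open>Half the slope for which \<open>\<epsilon> * t0\<close> would equal the distance
    at \<open>(u0, t0)\<close>; thus \<open>w\<close> is still positive there.\<close>
  define \<epsilon> where "\<epsilon> = D (u0, t0) / (2 * t0)"
  have e0: "\<epsilon> > 0" using d0 t0' by (simp add: \<epsilon>_def)
  \<comment> \<open>The backward cone of \<open>(u0, t0)\<close> for speed \<open>K\<close> per
    coordinate. Since \<open>K * T \<le> R\<close>, the steps below never leave the cube, and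
    compactness provides a maximum of \<open>w\<close>.\<close>
  define C where "C = (kbox n u0 R \<times> {0..t0}) \<inter> (\<Inter>i\<in>{..<n}. {p. \<bar>fst p i - u0 i\<bar> \<le> K * (t0 - snd p)})"
  have "closed {p::(nat \<Rightarrow> real) \<times> real. \<bar>fst p i - u0 i\<bar> \<le> K * (t0 - snd p)}" for i
    by (rule closed_Collect_le)
       (rule continuous_on_rabs continuous_on_diff continuous_fst_coord continuous_on_const continuous_on_mult
         continuous_on_snd continuous_on_id)+
  then have cC: "compact C"
    unfolding C_def by (intro compact_Int_closed compact_Times compact_kbox compact_Icc closed_INT) auto
  define w where "w p = D p - \<epsilon> * snd p" for p
  have CK: "fst ` C \<subseteq> kbox n u0 R" by (auto simp: C_def)
  have cf: "continuous_on C (\<lambda>p. H (fst p))" if "continuous_on (kbox n u0 R) H" for H :: "_ \<Rightarrow> 'e"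
    by (rule continuous_on_compose2[OF that continuous_on_fst[OF continuous_on_id] CK])
  have cw: "continuous_on C w"
    unfolding w_def D_def
    by (rule continuous_on_diff continuous_on_infdist continuous_on_add continuous_on_scaleR continuous_on_mult
        cf[OF cG] cf[OF cZ] continuous_on_const continuous_on_snd continuous_on_id)+
  have inC: "(u0, t0) \<in> C" using u0k t0 by (auto simp: C_def)
  obtain p where p: "p \<in> C" "\<And>y. y \<in> C \<Longrightarrow> w y \<le> w p"
    using continuous_attains_sup[OF cC _ cw] inC by blast
  obtain u t where ut: "p = (u, t)" by fastforce
  have "w (u0, t0) = D (u0, t0) / 2" using t0' by (simp add: w_def \<epsilon>_def)
  then have wp: "w p > 0" using p(2)[OF inC] d0 by linarith
  have uk: "u \<in> kbox n u0 R" and t: "0 \<le> t" "t \<le> t0"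
    and cone: "\<And>i. i < n \<Longrightarrow> \<bar>u i - u0 i\<bar> \<le> K * (t0 - t)" using p(1) by (auto simp: C_def ut)
  have "t \<noteq> 0"
  proof
    assume "t = 0"
    then have "D p = 0" using uk by (simp add: D_def ut Q_def)
    then show False using wp \<open>t = 0\<close> by (simp add: w_def ut)
  qed
  then have tp: "t > 0" using t by simp
  have uS: "u \<in> S" using uk sub by auto
  have uR: "u \<in> Rn n" using uk by (auto simp: kbox_def)
  \<comment> \<open>The error \<open>\<epsilon> / 4\<close> of \<open>W\<close> and another
    \<open>\<epsilon> / 4\<close> from differentiability change the distance by at most
    \<open>\<epsilon> / 2\<close> per unit of \<open>t\<close>. Moving down in \<open>t\<close>
    gains \<open>\<epsilon>\<close> per unit in \<open>w\<close>, so \<open>w\<close> would exceed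
    its maximum.\<close>
  obtain W where W: "\<And>i. i < n \<Longrightarrow> \<bar>W i\<bar> \<le> K"
    and Wn: "norm ((\<Sum>i<n. W i *\<^sub>R (partial i G u + t *\<^sub>R partial i Z u)) - Z u) \<le> \<epsilon> / 4"
    using flow[OF uk tp, of "\<epsilon> / 4"] t t0 e0 by auto
  define \<gamma> where "\<gamma> s = (\<lambda>i. if i < n then u i + s * W i else 0)" for s
  have g0: "\<gamma> 0 = u" using uR by (auto simp: \<gamma>_def Rn_def fun_eq_iff)
  have gR: "\<gamma> s \<in> Rn n" for s by (auto simp: \<gamma>_def Rn_def)
  have gd: "((\<lambda>s. \<gamma> s j) has_real_derivative W j) (at 0)" if "j < n" for j
    using that unfolding \<gamma>_def by (auto intro!: derivative_eq_intros)
  have dG: "((\<lambda>s. G (\<gamma> s)) has_vector_derivative (\<Sum>j<n. W j *\<^sub>R partial j G (\<gamma> 0))) (at 0)"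
    by (rule chain_rule_curve[OF Cinf_open[OF G] Cinf_Ck[OF G]]) (use g0 uS gR gd in auto)
  have dZ: "((\<lambda>s. Z (\<gamma> s)) has_vector_derivative (\<Sum>j<n. W j *\<^sub>R partial j Z (\<gamma> 0))) (at 0)"
    by (rule chain_rule_curve[OF Cinf_open[OF Z] Cinf_Ck[OF Z]]) (use g0 uS gR gd in auto)
  define \<phi> where "\<phi> s = G (\<gamma> s) + (t - s) *\<^sub>R Z (\<gamma> s)" for s
  define v where "v = (\<Sum>i<n. W i *\<^sub>R (partial i G u + t *\<^sub>R partial i Z u)) - Z u"
  have dl: "((\<lambda>s. t - s) has_field_derivative (-1)) (at 0)" by (auto intro!: derivative_eq_intros)
  have "((\<lambda>s. G (\<gamma> s) + (t - s) *\<^sub>R Z (\<gamma> s)) has_vector_derivative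
      ((\<Sum>j<n. W j *\<^sub>R partial j G (\<gamma> 0)) + ((t - 0) *\<^sub>R (\<Sum>j<n. W j *\<^sub>R partial j Z (\<gamma> 0)) + (-1) *\<^sub>R Z (\<gamma> 0)))) (at 0)"
    by (rule has_vector_derivative_add[OF dG has_vector_derivative_scaleR[OF dl dZ]])
  moreover have "(\<Sum>j<n. W j *\<^sub>R partial j G (\<gamma> 0)) + ((t - 0) *\<^sub>R (\<Sum>j<n. W j *\<^sub>R partial j Z (\<gamma> 0)) + (-1) *\<^sub>R Z (\<gamma> 0)) = v"
    unfolding v_def g0 by (simp add: scaleR_add_right sum.distrib scaleR_sum_right mult.commute)
  ultimately have "(\<phi> has_vector_derivative v) (at 0)" unfolding \<phi>_def by simp
  then have "\<forall>e>0. \<exists>d>0. \<forall>y. norm (y - 0) < d \<longrightarrow> norm (\<phi> y - \<phi> 0 - (y - 0) *\<^sub>R v) \<le> e * norm (y - 0)"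
    unfolding has_vector_derivative_def has_derivative_within_alt by simp
  then obtain d where d: "d > 0" "\<And>y. \<bar>y\<bar> < d \<Longrightarrow> norm (\<phi> y - \<phi> 0 - y *\<^sub>R v) \<le> \<epsilon> / 4 * \<bar>y\<bar>"
    using e0 by (metis diff_zero real_norm_def zero_less_divide_iff zero_less_numeral)
  \<comment> \<open>The cap \<open>t\<close> keeps the new time nonnegative, as membership in the
    cone requires.\<close>
  define s where "s = min (d / 2) t"
  have s: "s > 0" "s < d" "s \<le> t" using d tp by (auto simp: s_def min_def)
  have "norm (\<phi> s - \<phi> 0) \<le> norm (\<phi> s - \<phi> 0 - s *\<^sub>R v) + norm (s *\<^sub>R v)"
    using norm_triangle_ineq[of "\<phi> s - \<phi> 0 - s *\<^sub>R v" "s *\<^sub>R v"] by simp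
  also have "\<dots> \<le> \<epsilon> / 4 * s + s * (\<epsilon> / 4)"
    using d(2)[of s] s Wn unfolding v_def[symmetric] by (intro add_mono) (auto intro: mult_left_mono)
  finally have n1: "norm (\<phi> s - \<phi> 0) \<le> s * \<epsilon> / 2" by (simp add: algebra_simps)
  have sW: "\<bar>s * W i\<bar> \<le> K * s" if "i < n" for i
    using W[OF that] s by (simp add: abs_mult mult.commute mult_right_mono)
  have c2: "\<bar>\<gamma> s i - u0 i\<bar> \<le> K * (t0 - (t - s))" if "i < n" for i
    using cone[OF that] sW[OF that] that by (simp add: \<gamma>_def algebra_simps)
  have "K * (t0 - (t - s)) \<le> K * T" using K s t t0 by (intro mult_left_mono) auto
  then have "\<gamma> s \<in> kbox n u0 R" using c2 gR K(2) by (force simp: kbox_def)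
  then have "(\<gamma> s, t - s) \<in> C" using c2 s t by (auto simp: C_def)
  from p(2)[OF this] have "w (\<gamma> s, t - s) \<le> w p" .
  moreover have "D p \<le> D (\<gamma> s, t - s) + s * \<epsilon> / 2"
  proof -
    have "\<phi> 0 = G u + t *\<^sub>R Z u" by (simp add: \<phi>_def g0)
    then have "D p = infdist (\<phi> 0) Q" "D (\<gamma> s, t - s) = infdist (\<phi> s) Q"
      by (simp_all add: D_def ut \<phi>_def)
    then show ?thesis using infdist_triangle[of "\<phi> 0" Q "\<phi> s"] n1 by (simp add: dist_norm norm_minus_commute)
  qed
  moreover have "s * \<epsilon> > 0" using s e0 by simp
  ultimately show False by (simp add: w_def ut algebra_simps)
qed

subsection \<open>Iterated coefficients of a tangent field\<close>

text \<open>Coefficients, in the frame \<open>partial i G\<close>, of a sequence of tangent vectors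
  that starts with the field with coefficients \<open>b\<close>: each is the tangential part of the
  derivative of \<open>Z\<close> along the one before. Up to powers of \<open>-t\<close> these are
  the terms of the Neumann series.\<close>

primrec iter_coeff where
  "iter_coeff n \<Lambda> Z b 0 = b"
| "iter_coeff n \<Lambda> Z b (Suc k) = (\<lambda>i u. \<Lambda> i u \<bullet> (\<Sum>j<n. iter_coeff n \<Lambda> Z b k j u *\<^sub>R partial j Z u))"

text \<open>\<open>\<Lambda>\<close> is dual to the tangent frame without having to be tangent
  itself. For \<open>G = (f, fh)\<close> the dual frame of \<open>f\<close> paired with 0 is used.
  Thus \<open>perp\<close> is in general an oblique projection, whose kernel is the tangent space of
  \<open>G\<close>.\<close>

locale framed_immersion =
  fixes n :: nat and S :: "(nat \<Rightarrow> real) set" and G :: "(nat \<Rightarrow> real) \<Rightarrow> 'e::euclidean_space"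
    and \<Lambda> :: "nat \<Rightarrow> (nat \<Rightarrow> real) \<Rightarrow> 'e"
  assumes G: "Cinf_on n S G" and \<Lambda>: "\<And>i. i < n \<Longrightarrow> Cinf_on n S (\<Lambda> i)"
    and dual: "\<And>u i j. u \<in> S \<Longrightarrow> i < n \<Longrightarrow> j < n \<Longrightarrow> \<Lambda> i u \<bullet> partial j G u = (if i = j then 1 else 0)"
begin

lemma S: "openE n S" by (rule Cinf_open[OF G])

definition perp where "perp u w = w - (\<Sum>i<n. (\<Lambda> i u \<bullet> w) *\<^sub>R partial i G u)"

lemma perp_add: "perp u (v + w) = perp u v + perp u w"
  by (simp add: perp_def inner_add_right scaleR_add_left sum.distrib)

lemma perp_scaleR: "perp u (c *\<^sub>R v) = c *\<^sub>R perp u v"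
  by (simp add: perp_def scaleR_diff_right scaleR_sum_right)

lemma perp_zero [simp]: "perp u 0 = 0" by (simp add: perp_def)

lemma perp_sum: "perp u (\<Sum>a\<in>A. f a) = (\<Sum>a\<in>A. perp u (f a))"
  by (induction A rule: infinite_finite_induct) (auto simp: perp_add)

lemma dual_sum:
  assumes "u \<in> S" "i < n" shows "\<Lambda> i u \<bullet> (\<Sum>j<n. c j *\<^sub>R partial j G u) = c i"
  by (rule dual_coeff[where I = "{..<n}" and ws = "\<lambda>i. \<Lambda> i u" and w = "\<lambda>j. partial j G u"])
     (use assms dual in auto)

lemma perp_partial:
  assumes "u \<in> S" "j < n" shows "perp u (partial j G u) = 0"
proof -
  have "(\<Sum>i<n. (\<Lambda> i u \<bullet> partial j G u) *\<^sub>R partial i G u) = (\<Sum>i<n. if i = j then partial i G u else 0)"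
    using assms dual by (intro sum.cong) auto
  then show ?thesis using assms by (simp add: perp_def)
qed

lemma Cinf_dG: "i < n \<Longrightarrow> Cinf_on n S (partial i G)" by (rule Cinf_partial[OF G])

lemma Cinf_perp: "Cinf_on n S w \<Longrightarrow> Cinf_on n S (\<lambda>u. perp u (w u))"
  unfolding perp_def
  by (rule Cinf_diff, assumption, rule Cinf_sum[OF S], rule Cinf_scaleR, rule Cinf_inner)
     (auto intro: \<Lambda> Cinf_dG)

context
  fixes b :: "nat \<Rightarrow> (nat \<Rightarrow> real) \<Rightarrow> real" and Z :: "(nat \<Rightarrow> real) \<Rightarrow> 'e"
  assumes b: "\<And>i. i < n \<Longrightarrow> Cinf_on n S (b i)" and Z: "Cinf_on n S Z"
    and Zb: "\<And>u. u \<in> S \<Longrightarrow> Z u = (\<Sum>i<n. b i u *\<^sub>R partial i G u)"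
begin

text \<open>Geometrically \<open>yy k\<close> is the derivative of \<open>Z\<close> along the
  tangent vector \<open>zz k\<close>, and \<open>zz (Suc k)\<close> is the tangential part of
  \<open>yy k\<close>; the two agree exactly when \<open>yy k\<close> is tangent.\<close>

definition zz where "zz k u = (\<Sum>i<n. iter_coeff n \<Lambda> Z b k i u *\<^sub>R partial i G u)"
definition yy where "yy k u = (\<Sum>i<n. iter_coeff n \<Lambda> Z b k i u *\<^sub>R partial i Z u)"

lemma Cinf_iter: "i < n \<Longrightarrow> Cinf_on n S (iter_coeff n \<Lambda> Z b k i)"
proof (induction k arbitrary: i)
  case 0 then show ?case by (simp add: b)
next
  case (Suc k)
  have "Cinf_on n S (\<lambda>u. \<Lambda> i u \<bullet> (\<Sum>j<n. iter_coeff n \<Lambda> Z b k j u *\<^sub>R partial j Z u))"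
    by (rule Cinf_inner[OF \<Lambda>[OF Suc.prems]], rule Cinf_sum[OF S], rule Cinf_scaleR)
       (auto intro: Suc.IH Cinf_partial[OF Z])
  then show ?case by simp
qed

lemma Cinf_yy: "Cinf_on n S (yy k)"
  unfolding yy_def
  by (rule Cinf_sum[OF S], rule Cinf_scaleR) (auto intro: Cinf_iter Cinf_partial[OF Z])

lemma zz_Suc: "zz (Suc k) u = yy k u - perp u (yy k u)"
  by (simp add: zz_def yy_def perp_def)

lemma zz_0: "u \<in> S \<Longrightarrow> zz 0 u = Z u"
  by (simp add: zz_def Zb)

text \<open>Modulo the span of \<open>\<partial>\<^sub>i G + t \<partial>\<^sub>i Z\<close> one has \<open>zz k = - t * yy k\<close>, and \<open>yy k = zz (k + 1)\<close> where \<open>yy k\<close> is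
  tangent; so at a singular point of \<open>G + t Z\<close> all the \<open>yy k\<close> lie in this span.\<close>

lemma tangent_iterates:
  assumes sing: "\<And>u \<delta>. u \<in> S \<Longrightarrow> \<delta> > 0 \<Longrightarrow> \<exists>u'\<in>obox n u \<delta> \<inter> S. \<exists>t. 0 < \<bar>t\<bar> \<and> \<bar>t\<bar> < \<delta> \<and>
     (\<exists>c. Z u' = (\<Sum>i<n. c i *\<^sub>R (partial i G u' + t *\<^sub>R partial i Z u')))"
  shows "u \<in> S \<Longrightarrow> perp u (yy k u) = 0"
proof (induction k arbitrary: u rule: less_induct)
  case (less k)
  define sp where "sp u' t = {w. \<exists>c. w = (\<Sum>i<n. c i *\<^sub>R (partial i G u' + t *\<^sub>R partial i Z u'))}" for u' t
  have spI: "(\<Sum>i<n. c i *\<^sub>R (partial i G u' + t *\<^sub>R partial i Z u')) \<in> sp u' t" for c u' t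
    unfolding sp_def mem_Collect_eq by (rule exI, rule refl)
  have sp_diff: "v - w \<in> sp u' t" if vw: "v \<in> sp u' t" "w \<in> sp u' t" for v w u' t
  proof -
    obtain c d where "v = (\<Sum>i<n. c i *\<^sub>R (partial i G u' + t *\<^sub>R partial i Z u'))"
      "w = (\<Sum>i<n. d i *\<^sub>R (partial i G u' + t *\<^sub>R partial i Z u'))" using vw by (auto simp: sp_def)
    then have "v - w = (\<Sum>i<n. (c i - d i) *\<^sub>R (partial i G u' + t *\<^sub>R partial i Z u'))"
      by (simp add: scaleR_diff_left sum_subtractf)
    then show ?thesis using spI by simp
  qed
  have sp_sc: "a *\<^sub>R v \<in> sp u' t" if v: "v \<in> sp u' t" for a v u' t
  proof -
    obtain c where "v = (\<Sum>i<n. c i *\<^sub>R (partial i G u' + t *\<^sub>R partial i Z u'))" using v by (auto simp: sp_def)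
    then have "a *\<^sub>R v = (\<Sum>i<n. (a * c i) *\<^sub>R (partial i G u' + t *\<^sub>R partial i Z u'))"
      by (simp add: scaleR_sum_right)
    then show ?thesis using spI by simp
  qed
  have yy_sp: "yy k u' \<in> sp u' t" if u': "u' \<in> S" and t: "t \<noteq> 0" and Zs: "Z u' \<in> sp u' t" for u' t
  proof -
    \<comment> \<open>The combination with the coefficients of \<open>zz j\<close> equals
      \<open>zz j + t *\<^sub>R yy j\<close>. Hence membership in the span passes from
      \<open>zz j\<close> to \<open>yy j\<close> on division by \<open>t\<close>; here
      \<open>t \<noteq> 0\<close> matters.\<close>
    have step: "yy j u' \<in> sp u' t" if zj: "zz j u' \<in> sp u' t" for j
    proof -
      have "(\<Sum>i<n. iter_coeff n \<Lambda> Z b j i u' *\<^sub>R (partial i G u' + t *\<^sub>R partial i Z u')) = zz j u' + t *\<^sub>R yy j u'"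
        by (simp add: zz_def yy_def scaleR_add_right sum.distrib scaleR_sum_right mult.commute)
      then have "zz j u' + t *\<^sub>R yy j u' \<in> sp u' t"
        using spI[of "\<lambda>i. iter_coeff n \<Lambda> Z b j i u'" u' t] by (simp only:)
      from sp_sc[OF sp_diff[OF this zj], of "1 / t"] show ?thesis using t by simp
    qed
    \<comment> \<open>Tangency of the earlier \<open>yy j\<close>, known at \<open>u'\<close> from
      the outer induction, identifies \<open>yy j\<close> with \<open>zz (Suc j)\<close> and lets
      membership climb from \<open>Z\<close> up to index \<open>k\<close>.\<close>
    have "zz j u' \<in> sp u' t" if "j \<le> k" for j
      using that
    proof (induction j)
      case 0 then show ?case using Zs zz_0[OF u'] by simp
    next
      case (Suc j)
      then have "zz (Suc j) u' = yy j u'" using less.IH[of j u'] u' by (simp add: zz_Suc)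
      then show ?case using step Suc by simp
    qed
    then show ?thesis using step by simp
  qed
  \<comment> \<open>Continuous bounds for the tangential matrix of the derivative of
    \<open>Z\<close>, for the tangential coefficients of \<open>yy k\<close>, and for the normal
    parts of the derivatives of \<open>Z\<close>. The constant \<open>M\<close> bounds each of them
    near \<open>u\<close>.\<close>
  let ?m1 = "\<lambda>u. \<Sum>i<n. \<Sum>j<n. \<bar>\<Lambda> i u \<bullet> partial j Z u\<bar>"
  let ?m2 = "\<lambda>u. \<Sum>i<n. \<bar>\<Lambda> i u \<bullet> yy k u\<bar>"
  let ?m3 = "\<lambda>u. \<Sum>j<n. norm (perp u (partial j Z u))"
  let ?N = "\<lambda>u. perp u (yy k u)"
  have dZ: "Cinf_on n S (partial j Z)" if "j < n" for j by (rule Cinf_partial[OF Z that])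
  have c1: "continuous_on S ?m1"
    by (intro continuous_on_sum continuous_on_rabs Cinf_continuous[OF Cinf_inner[OF \<Lambda> dZ]]) auto
  have c2: "continuous_on S ?m2"
    by (intro continuous_on_sum continuous_on_rabs Cinf_continuous[OF Cinf_inner[OF \<Lambda> Cinf_yy]]) auto
  have c3: "continuous_on S ?m3"
    by (intro continuous_on_sum continuous_on_norm Cinf_continuous[OF Cinf_perp[OF dZ]]) auto
  have cN: "continuous_on S ?N" by (rule Cinf_continuous[OF Cinf_perp[OF Cinf_yy]])
  define M where "M = ?m1 u + ?m2 u + ?m3 u + 1"
  have nonneg: "?m1 u \<ge> 0" "?m2 u \<ge> 0" "?m3 u \<ge> 0" for u by (intro sum_nonneg; simp)+
  then have M1: "M \<ge> 1" using nonneg[of u] unfolding M_def by linarith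
  show "?N u = 0"
  proof (rule ccontr)
    assume "?N u \<noteq> 0"
    then have e: "norm (?N u) / 2 > 0" by simp
    from continuous_obox_ex[OF S continuous_on_add[OF continuous_on_add[OF c1 c2] c3] less.prems zero_less_one]
    obtain r1 where r1: "r1 > 0" "obox n u r1 \<subseteq> S"
      "\<forall>v\<in>obox n u r1. dist (?m1 v + ?m2 v + ?m3 v) (?m1 u + ?m2 u + ?m3 u) < 1" by (elim exE conjE)
    from continuous_obox_ex[OF S cN less.prems e]
    obtain r2 where r2: "r2 > 0" "obox n u r2 \<subseteq> S"
      "\<forall>v\<in>obox n u r2. dist (?N v) (?N u) < norm (?N u) / 2" by (elim exE conjE)
    \<comment> \<open>The bound \<open>1 / (2 * M)\<close> forces the coefficients \<open>c\<close>
      to satisfy \<open>(\<Sum>i<n. \<bar>c i\<bar>) \<le> 2 * M\<close>. The last bound then makes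
      the normal part at \<open>u'\<close>, which is at most
      \<open>\<bar>t\<bar> * (2 * M) * M\<close>, no larger than half its norm at \<open>u\<close>,
      although continuity keeps it above this half.\<close>
    define \<delta> where "\<delta> = min (min r1 r2) (min (1 / (2 * M)) (norm (?N u) / (4 * M * M)))"
    have "norm (?N u) / (4 * M * M) > 0" using e M1 by simp
    then have d: "\<delta> > 0" using r1 r2 M1 by (simp add: \<delta>_def)
    from sing[OF less.prems d] obtain u' where u'0: "u' \<in> obox n u \<delta> \<inter> S"
      and ex: "\<exists>t. 0 < \<bar>t\<bar> \<and> \<bar>t\<bar> < \<delta> \<and> (\<exists>c. Z u' = (\<Sum>i<n. c i *\<^sub>R (partial i G u' + t *\<^sub>R partial i Z u')))"
      by (rule bexE)
    from ex obtain t c0 where t: "0 < \<bar>t\<bar>" "\<bar>t\<bar> < \<delta>"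
      and Zc: "Z u' = (\<Sum>i<n. c0 i *\<^sub>R (partial i G u' + t *\<^sub>R partial i Z u'))" by (elim exE conjE)
    have Zs: "Z u' \<in> sp u' t" unfolding Zc by (rule spI)
    have u': "u' \<in> obox n u \<delta>" "u' \<in> S" using u'0 by auto
    have "\<delta> \<le> r1" "\<delta> \<le> r2" by (simp_all add: \<delta>_def)
    then have "u' \<in> obox n u r1" "u' \<in> obox n u r2" using u'(1) obox_mono by blast+
    from bspec[OF r1(3) this(1)] bspec[OF r2(3) this(2)]
    have "?m1 u' + ?m2 u' + ?m3 u' \<le> M" and N1: "norm (?N u' - ?N u) < norm (?N u) / 2"
      unfolding M_def dist_real_def dist_norm by linarith+
    moreover have "norm (?N u) \<le> norm (?N u') + norm (?N u' - ?N u)"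
      using norm_triangle_ineq4[of "?N u'" "?N u' - ?N u"] by simp
    ultimately have N2: "norm (?N u') > norm (?N u) / 2" and M: "?m1 u' + ?m2 u' + ?m3 u' \<le> M" by linarith+
    have M: "?m1 u' \<le> M" "?m2 u' \<le> M" "?m3 u' \<le> M" using M nonneg[of u'] by linarith+
    obtain c where c: "yy k u' = (\<Sum>i<n. c i *\<^sub>R (partial i G u' + t *\<^sub>R partial i Z u'))"
      using yy_sp[OF u'(2) _ Zs] t unfolding sp_def mem_Collect_eq by fastforce
    have c': "yy k u' = (\<Sum>i<n. c i *\<^sub>R partial i G u') + t *\<^sub>R (\<Sum>i<n. c i *\<^sub>R partial i Z u')"
      unfolding c by (simp add: scaleR_add_right sum.distrib scaleR_sum_right mult.commute)
    \<comment> \<open>Pairing with \<open>\<Lambda> i\<close> isolates \<open>c i\<close>, at the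
      price of a term of order \<open>t\<close> in all the coefficients, which is absorbed
      below.\<close>
    have ci: "c i = \<Lambda> i u' \<bullet> yy k u' - t * (\<Sum>j<n. c j * (\<Lambda> i u' \<bullet> partial j Z u'))" if "i < n" for i
      using dual_sum[OF u'(2) that, of c] unfolding c' by (simp add: inner_add_right inner_sum_right)
    have "(\<Sum>i<n. \<bar>c i\<bar>) \<le> (\<Sum>i<n. \<bar>\<Lambda> i u' \<bullet> yy k u'\<bar> + \<bar>t\<bar> * (\<Sum>j<n. \<bar>c j\<bar> * \<bar>\<Lambda> i u' \<bullet> partial j Z u'\<bar>))"
    proof (rule sum_mono)
      fix i assume "i \<in> {..<n}"
      then have "\<bar>c i\<bar> \<le> \<bar>\<Lambda> i u' \<bullet> yy k u'\<bar> + \<bar>t * (\<Sum>j<n. c j * (\<Lambda> i u' \<bullet> partial j Z u'))\<bar>"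
        using ci[of i] by (metis abs_triangle_ineq4 lessThan_iff)
      also have "\<bar>t * (\<Sum>j<n. c j * (\<Lambda> i u' \<bullet> partial j Z u'))\<bar> \<le> \<bar>t\<bar> * (\<Sum>j<n. \<bar>c j\<bar> * \<bar>\<Lambda> i u' \<bullet> partial j Z u'\<bar>)"
        unfolding abs_mult[of t] by (intro mult_left_mono order_trans[OF sum_abs]) (auto simp: abs_mult)
      finally show "\<bar>c i\<bar> \<le> \<bar>\<Lambda> i u' \<bullet> yy k u'\<bar> + \<bar>t\<bar> * (\<Sum>j<n. \<bar>c j\<bar> * \<bar>\<Lambda> i u' \<bullet> partial j Z u'\<bar>)" by simp
    qed
    also have "\<dots> = ?m2 u' + \<bar>t\<bar> * (\<Sum>j<n. \<bar>c j\<bar> * (\<Sum>i<n. \<bar>\<Lambda> i u' \<bullet> partial j Z u'\<bar>))"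
      unfolding sum.distrib sum_distrib_left[symmetric] by (subst sum.swap) (simp add: sum_distrib_left)
    also have "\<dots> \<le> M + \<bar>t\<bar> * (\<Sum>j<n. \<bar>c j\<bar> * M)"
    proof (intro add_mono mult_left_mono sum_mono)
      fix j assume j: "j \<in> {..<n}"
      have "(\<Sum>i<n. \<bar>\<Lambda> i u' \<bullet> partial j Z u'\<bar>) \<le> ?m1 u'"
        using j by (intro sum_mono member_le_sum) auto
      then show "(\<Sum>i<n. \<bar>\<Lambda> i u' \<bullet> partial j Z u'\<bar>) \<le> M" using M by linarith
    qed (use M in auto)
    also have "\<dots> = M + (\<bar>t\<bar> * M) * (\<Sum>j<n. \<bar>c j\<bar>)"
      unfolding sum_distrib_right[symmetric] by simp
    finally have cs: "(\<Sum>i<n. \<bar>c i\<bar>) \<le> M + (\<bar>t\<bar> * M) * (\<Sum>j<n. \<bar>c j\<bar>)" .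
    have "\<bar>t\<bar> < 1 / (2 * M)" using t by (simp add: \<delta>_def)
    then have "\<bar>t\<bar> * M \<le> 1 / 2" using M1 by (simp add: field_simps)
    then have "(\<bar>t\<bar> * M) * (\<Sum>j<n. \<bar>c j\<bar>) \<le> 1 / 2 * (\<Sum>j<n. \<bar>c j\<bar>)"
      by (rule mult_right_mono) (intro sum_nonneg; simp)
    then have cs2: "(\<Sum>i<n. \<bar>c i\<bar>) \<le> 2 * M" using cs by linarith
    have "?N u' = t *\<^sub>R (\<Sum>j<n. c j *\<^sub>R perp u' (partial j Z u'))"
      unfolding c' using perp_partial[OF u'(2)] by (simp add: perp_add perp_scaleR perp_sum)
    then have "norm (?N u') = \<bar>t\<bar> * norm (\<Sum>j<n. c j *\<^sub>R perp u' (partial j Z u'))" by simp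
    also have "\<dots> \<le> \<bar>t\<bar> * (\<Sum>j<n. \<bar>c j\<bar> * M)"
    proof (intro mult_left_mono sum_norm_le)
      fix j assume j: "j \<in> {..<n}"
      have "norm (perp u' (partial j Z u')) \<le> ?m3 u'" by (rule member_le_sum) (use j in auto)
      then show "norm (c j *\<^sub>R perp u' (partial j Z u')) \<le> \<bar>c j\<bar> * M" using M by (auto intro!: mult_left_mono)
    qed simp
    also have "\<dots> = \<bar>t\<bar> * ((\<Sum>j<n. \<bar>c j\<bar>) * M)" by (simp add: sum_distrib_right)
    also have "\<dots> \<le> \<bar>t\<bar> * ((2 * M) * M)" using cs2 M1 by (intro mult_left_mono mult_right_mono) auto
    also have "\<dots> \<le> norm (?N u) / (4 * M * M) * ((2 * M) * M)"
      using t(2) M1 by (intro mult_right_mono) (auto simp: \<delta>_def)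
    also have "\<dots> = norm (?N u) / 2" using M1 by (simp add: field_simps)
    finally show False using N2 by linarith
  qed
qed

text \<open>\<open>W\<close> is a partial sum of the Neumann series with terms
  \<open>(-t)^k x k\<close>. Since tangency gives \<open>yy k = zz (Suc k)\<close>, the resulting
  combination of the vectors \<open>partial i G + t partial i Z\<close> telescopes and misses
  \<open>Z\<close> only by \<open>- (-t)^m zz m\<close>. With \<open>t * M \<le> 1 / 2\<close> the
  terms decay like \<open>(1 / 2)^k * M\<close>, so \<open>W\<close> is bounded by
  \<open>2 * M\<close> for every \<open>m\<close> while the error tends to 0.\<close>

lemma approximate_flow:
  assumes u: "u \<in> S" and tang: "\<And>k. perp u (yy k u) = 0"
    and M: "(\<Sum>i<n. \<Sum>j<n. \<bar>\<Lambda> i u \<bullet> partial j Z u\<bar>) \<le> M" "(\<Sum>i<n. \<bar>b i u\<bar>) \<le> M" "(\<Sum>i<n. norm (partial i G u)) \<le> M"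
    and t: "0 < t" "t * M \<le> 1 / 2" and \<eta>: "\<eta> > 0"
  shows "\<exists>W. (\<forall>i<n. \<bar>W i\<bar> \<le> 2 * M) \<and>
      norm ((\<Sum>i<n. W i *\<^sub>R (partial i G u + t *\<^sub>R partial i Z u)) - Z u) \<le> \<eta>"
proof -
  define x where "x k i = iter_coeff n \<Lambda> Z b k i u" for k i
  have "0 \<le> (\<Sum>i<n. \<bar>b i u\<bar>)" by (intro sum_nonneg) auto
  then have M0: "M \<ge> 0" using M by linarith
  have bound: "t ^ k * (\<Sum>i<n. \<bar>x k i\<bar>) \<le> (1/2) ^ k * M" for k
  proof (induction k)
    case 0 then show ?case using M by (simp add: x_def)
  next
    case (Suc k)
    have "(\<Sum>i<n. \<bar>x (Suc k) i\<bar>) \<le> (\<Sum>i<n. \<Sum>j<n. \<bar>x k j\<bar> * \<bar>\<Lambda> i u \<bullet> partial j Z u\<bar>)"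
      unfolding x_def by (intro sum_mono) (auto simp: inner_sum_right abs_mult intro!: order_trans[OF sum_abs])
    also have "\<dots> = (\<Sum>j<n. \<bar>x k j\<bar> * (\<Sum>i<n. \<bar>\<Lambda> i u \<bullet> partial j Z u\<bar>))"
      by (subst sum.swap) (simp add: sum_distrib_left)
    also have "\<dots> \<le> (\<Sum>j<n. \<bar>x k j\<bar> * M)"
    proof (intro mult_left_mono sum_mono)
      fix j assume j: "j \<in> {..<n}"
      have "(\<Sum>i<n. \<bar>\<Lambda> i u \<bullet> partial j Z u\<bar>) \<le> (\<Sum>i<n. \<Sum>j<n. \<bar>\<Lambda> i u \<bullet> partial j Z u\<bar>)"
        using j by (intro sum_mono member_le_sum) auto
      then show "(\<Sum>i<n. \<bar>\<Lambda> i u \<bullet> partial j Z u\<bar>) \<le> M" using M by linarith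
    qed auto
    also have "\<dots> = (\<Sum>j<n. \<bar>x k j\<bar>) * M" by (simp add: sum_distrib_right)
    finally have "t ^ Suc k * (\<Sum>i<n. \<bar>x (Suc k) i\<bar>) \<le> t ^ Suc k * ((\<Sum>j<n. \<bar>x k j\<bar>) * M)"
      using t by (intro mult_left_mono) auto
    also have "\<dots> = (t * M) * (t ^ k * (\<Sum>j<n. \<bar>x k j\<bar>))" by (simp add: algebra_simps)
    also have "\<dots> \<le> (1/2) * ((1/2) ^ k * M)"
      by (rule mult_mono[OF t(2) Suc]) (use t M0 in \<open>auto intro!: mult_nonneg_nonneg sum_nonneg\<close>)
    finally show ?case by simp
  qed
  define W where "W m i = (\<Sum>k<m. (-t) ^ k * x k i)" for m i
  have zz_yy: "zz (Suc k) u = yy k u" for k using tang[of k] by (simp add: zz_Suc)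
  have E: "(\<Sum>i<n. W m i *\<^sub>R (partial i G u + t *\<^sub>R partial i Z u)) - Z u = - ((-t) ^ m *\<^sub>R zz m u)" for m
  proof (induction m)
    case 0 then show ?case using zz_0[OF u] by (simp add: W_def)
  next
    case (Suc m)
    have "(\<Sum>i<n. W (Suc m) i *\<^sub>R (partial i G u + t *\<^sub>R partial i Z u)) =
       (\<Sum>i<n. W m i *\<^sub>R (partial i G u + t *\<^sub>R partial i Z u)) +
       (-t) ^ m *\<^sub>R (\<Sum>i<n. x m i *\<^sub>R (partial i G u + t *\<^sub>R partial i Z u))"
      unfolding scaleR_sum_right sum.distrib[symmetric] by (intro sum.cong) (auto simp: W_def scaleR_add_left)
    also have "(\<Sum>i<n. x m i *\<^sub>R (partial i G u + t *\<^sub>R partial i Z u)) = zz m u + t *\<^sub>R yy m u"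
      by (simp add: x_def zz_def yy_def scaleR_add_right sum.distrib scaleR_sum_right mult.commute)
    finally show ?case using Suc by (simp add: zz_yy algebra_simps)
  qed
  have nz: "norm ((-t) ^ m *\<^sub>R zz m u) \<le> (1/2) ^ m * (M * M)" for m
  proof -
    have "norm (zz m u) \<le> (\<Sum>i<n. \<bar>x m i\<bar> * M)" unfolding zz_def x_def[symmetric]
    proof (rule sum_norm_le)
      fix i assume i: "i \<in> {..<n}"
      have "norm (partial i G u) \<le> (\<Sum>i<n. norm (partial i G u))" by (rule member_le_sum) (use i in auto)
      then show "norm (x m i *\<^sub>R partial i G u) \<le> \<bar>x m i\<bar> * M" using M by (auto intro!: mult_left_mono)
    qed
    then have "t ^ m * norm (zz m u) \<le> t ^ m * (\<Sum>i<n. \<bar>x m i\<bar>) * M"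
      using t by (simp add: sum_distrib_right[symmetric] mult.assoc mult_left_mono)
    also have "\<dots> \<le> (1/2) ^ m * M * M" using bound M0 by (intro mult_right_mono) auto
    finally show ?thesis using t by (simp add: power_abs mult.assoc)
  qed
  have "(\<lambda>m. (1/2) ^ m * (M * M)) \<longlonglongrightarrow> 0 * (M * M)"
    by (intro tendsto_mult tendsto_const LIMSEQ_power_zero) auto
  then have "\<forall>\<^sub>F m in sequentially. (1/2) ^ m * (M * M) < \<eta>" using \<eta> by (intro order_tendstoD) auto
  then obtain m where m: "(1/2) ^ m * (M * M) < \<eta>" by (auto simp: eventually_sequentially)
  have "\<bar>W m i\<bar> \<le> 2 * M" if "i < n" for i
  proof -
    have "\<bar>W m i\<bar> \<le> (\<Sum>k<m. \<bar>(-t) ^ k * x k i\<bar>)" unfolding W_def by (rule sum_abs)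
    also have "\<dots> \<le> (\<Sum>k<m. (1/2) ^ k * M)"
    proof (rule sum_mono)
      fix k
      have "\<bar>x k i\<bar> \<le> (\<Sum>i<n. \<bar>x k i\<bar>)" by (rule member_le_sum) (use that in auto)
      then have "t ^ k * \<bar>x k i\<bar> \<le> t ^ k * (\<Sum>i<n. \<bar>x k i\<bar>)" using t by (intro mult_left_mono) auto
      from order_trans[OF this bound[of k]] show "\<bar>(-t) ^ k * x k i\<bar> \<le> (1/2) ^ k * M"
        using t by (simp add: abs_mult power_abs del: power_divide)
    qed
    also have "\<dots> = (\<Sum>k<m. (1/2) ^ k) * M" by (simp add: sum_distrib_right)
    also have "(\<Sum>k<m. (1/2::real) ^ k) = 2 - 2 * (1/2) ^ m" by (simp add: sum_gp_strict)
    also have "(2 - 2 * (1/2) ^ m) * M \<le> 2 * M" using M0 by (intro mult_right_mono) auto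
    finally show ?thesis .
  qed
  moreover have "norm ((\<Sum>i<n. W m i *\<^sub>R (partial i G u + t *\<^sub>R partial i Z u)) - Z u) \<le> \<eta>"
    unfolding E using nz[of m] m by simp
  ultimately show ?thesis by blast
qed

end

end

section \<open>Local injectivity and lifts of affine discs\<close>

context framed_immersion
begin

text \<open>A lower Lipschitz bound takes the place of the inverse function theorem. Pairing with
  the dual vectors recovers \<open>v - w\<close> from \<open>G v - G w\<close> up to the error of
  strict differentiability, which is small enough to be absorbed.\<close>

lemma local_bilipschitz:
  assumes u0: "u0 \<in> S"
  shows "\<exists>r>0. \<exists>c>0. obox n u0 r \<subseteq> S \<and>
    (\<forall>v\<in>obox n u0 r. \<forall>w\<in>obox n u0 r. (\<Sum>i<n. \<bar>v i - w i\<bar>) \<le> c * norm (G v - G w))"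
proof -
  define A where "A = (\<Sum>i<n. norm (\<Lambda> i u0))"
  have A0: "A \<ge> 0" unfolding A_def by (intro sum_nonneg) auto
  \<comment> \<open>Chosen so that the error, summed over all coordinates, is at most half of the
    quantity to be estimated.\<close>
  define e where "e = 1 / (2 * (A + 1))"
  have e: "e > 0" "A * e \<le> 1/2" using A0 by (auto simp: e_def field_simps)
  from C1_strict_diff_ex[OF G u0 e(1)] obtain r where r: "r > 0" "obox n u0 r \<subseteq> S"
    and sd: "\<forall>v\<in>obox n u0 r. \<forall>w\<in>obox n u0 r.
      norm (G v - G w - (\<Sum>i<n. (v i - w i) *\<^sub>R partial i G u0)) \<le> e * (\<Sum>i<n. \<bar>v i - w i\<bar>)"
    by (elim exE conjE)
  have "(\<Sum>i<n. \<bar>v i - w i\<bar>) \<le> (2 * A + 1) * norm (G v - G w)" if v: "v \<in> obox n u0 r" and w: "w \<in> obox n u0 r" for v w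
  proof -
    let ?s = "\<Sum>i<n. \<bar>v i - w i\<bar>"
    let ?E = "G v - G w - (\<Sum>i<n. (v i - w i) *\<^sub>R partial i G u0)"
    have E: "norm ?E \<le> e * ?s" by (rule bspec[OF bspec[OF sd v] w])
    have "?s \<le> (\<Sum>i<n. norm (\<Lambda> i u0) * (norm (G v - G w) + e * ?s))"
    proof (rule sum_mono)
      fix i assume "i \<in> {..<n}"
      then have i: "i < n" by simp
      have "\<Lambda> i u0 \<bullet> (G v - G w) - \<Lambda> i u0 \<bullet> ?E = v i - w i"
        using dual_sum[OF u0 i, of "\<lambda>j. v j - w j"] by (simp add: inner_diff_right)
      then have "\<bar>v i - w i\<bar> \<le> \<bar>\<Lambda> i u0 \<bullet> (G v - G w)\<bar> + \<bar>\<Lambda> i u0 \<bullet> ?E\<bar>" by linarith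
      also have "\<dots> \<le> norm (\<Lambda> i u0) * norm (G v - G w) + norm (\<Lambda> i u0) * norm ?E"
        by (intro add_mono Cauchy_Schwarz_ineq2)
      also have "\<dots> \<le> norm (\<Lambda> i u0) * norm (G v - G w) + norm (\<Lambda> i u0) * (e * ?s)"
        using E by (intro add_left_mono mult_left_mono) auto
      finally show "\<bar>v i - w i\<bar> \<le> norm (\<Lambda> i u0) * (norm (G v - G w) + e * ?s)" by (simp add: distrib_left)
    qed
    also have "\<dots> = A * norm (G v - G w) + (A * e) * ?s"
      unfolding A_def sum_distrib_right[symmetric] by (simp add: algebra_simps)
    also have "\<dots> \<le> A * norm (G v - G w) + 1/2 * ?s"
      using e(2) by (intro add_left_mono mult_right_mono) (auto intro: sum_nonneg)
    finally have "?s \<le> 2 * A * norm (G v - G w)" by simp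
    also have "\<dots> \<le> (2 * A + 1) * norm (G v - G w)" by (simp add: mult_right_mono)
    finally show ?thesis .
  qed
  moreover have "2 * A + 1 > 0" using A0 by simp
  ultimately show ?thesis using r by (intro exI[of _ r] exI[of _ "2 * A + 1"] conjI ballI) auto
qed

text \<open>\<open>y\<close> is initially just a choice of preimages. The Lipschitz bound makes it
  continuous and, with strict differentiability of \<open>G\<close>, differentiable with partial
  derivatives \<open>\<Lambda> i (y a) \<bullet> z k\<close>. These are smooth functions of
  \<open>y a\<close>, so each order of smoothness of \<open>y\<close> gives the next.\<close>

lemma smooth_inverse_on_affine:
  assumes y: "\<And>a. a \<in> obox d (\<lambda>_. 0) \<epsilon> \<Longrightarrow> y a \<in> S"
    and Gy: "\<And>a. a \<in> obox d (\<lambda>_. 0) \<epsilon> \<Longrightarrow> G (y a) = p + (\<Sum>k<d. a k *\<^sub>R z k)"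
    and c: "c \<ge> 0"
    and lip: "\<And>a a'. a \<in> obox d (\<lambda>_. 0) \<epsilon> \<Longrightarrow> a' \<in> obox d (\<lambda>_. 0) \<epsilon> \<Longrightarrow>
      (\<Sum>i<n. \<bar>y a i - y a' i\<bar>) \<le> c * norm (G (y a) - G (y a'))"
    and i: "i < n"
  shows "Cinf_on d (obox d (\<lambda>_. 0) \<epsilon>) (\<lambda>a. y a i)"
proof -
  let ?D = "obox d (\<lambda>_. 0::real) \<epsilon>"
  have D: "openE d ?D" by (rule openE_obox)
  have hp: "has_partial k (\<lambda>a. y a i) a (\<Lambda> i (y a) \<bullet> z k)" if a: "a \<in> ?D" and k: "k < d" and i: "i < n" for a k i
  proof -
    obtain \<rho> where \<rho>: "\<rho> > 0" "\<And>t. \<bar>t - a k\<bar> < \<rho> \<Longrightarrow> a(k := t) \<in> ?D"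
      using openE_upd[OF D a k] by blast
    have yS: "y a \<in> S" by (rule y[OF a])
    have dG: "G (y (a(k := t))) - G (y a) = (t - a k) *\<^sub>R z k" if t: "\<bar>t - a k\<bar> < \<rho>" for t
    proof -
      have "(\<Sum>j<d. (a(k := t)) j *\<^sub>R z j) - (\<Sum>j<d. a j *\<^sub>R z j) = (\<Sum>j<d. if j = k then (t - a k) *\<^sub>R z k else 0)"
        unfolding sum_subtractf[symmetric] by (intro sum.cong) (auto simp: scaleR_diff_left)
      then show ?thesis using Gy[OF \<rho>(2)[OF t]] Gy[OF a] k by simp
    qed
    define C where "C = c * norm (z k)"
    have C0: "C \<ge> 0" using c by (simp add: C_def)
    have lip': "(\<Sum>j<n. \<bar>y (a(k := t)) j - y a j\<bar>) \<le> C * \<bar>t - a k\<bar>" if t: "\<bar>t - a k\<bar> < \<rho>" for t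
      using lip[OF \<rho>(2)[OF t] a] unfolding dG[OF t] by (simp add: C_def mult.commute mult.left_commute)
    define R where "R t = y (a(k := t)) i - y a i - (t - a k) *\<^sub>R (\<Lambda> i (y a) \<bullet> z k)" for t
    have "(R has_vector_derivative 0) (at (a k))"
    proof (rule has_vector_derivative_zeroI)
      show "R (a k) = 0" by (simp add: R_def)
      fix e :: real assume e: "e > 0"
      \<comment> \<open>Near \<open>a\<close> the increment of \<open>y\<close> is at most
        \<open>C\<close> times that of the parameter, and pairing with \<open>\<Lambda> i\<close>
        may stretch the error once more. \<open>B\<close> bounds the product and is
        positive.\<close>
      define B where "B = norm (\<Lambda> i (y a)) * C + 1"
      have B: "B > 0" using C0 by (simp add: B_def add_nonneg_pos)
      then have "e / B > 0" using e by simp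
      from C1_strict_diff_ex[OF G yS this] obtain r where r: "r > 0" "obox n (y a) r \<subseteq> S"
        and sd: "\<forall>v\<in>obox n (y a) r. \<forall>w\<in>obox n (y a) r.
          norm (G v - G w - (\<Sum>i<n. (v i - w i) *\<^sub>R partial i G (y a))) \<le> e / B * (\<Sum>i<n. \<bar>v i - w i\<bar>)"
        by (elim exE conjE)
      define \<delta> where "\<delta> = min \<rho> (r / (C + 1))"
      have d: "\<delta> > 0" using \<rho> r C0 by (simp add: \<delta>_def)
      have "norm (R t) \<le> e * \<bar>t - a k\<bar>" if t: "dist t (a k) < \<delta>" for t
      proof -
        have t1: "\<bar>t - a k\<bar> < \<rho>" and t2: "\<bar>t - a k\<bar> < r / (C + 1)" using t by (auto simp: dist_real_def \<delta>_def)
        let ?v = "y (a(k := t))"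
        have "C * \<bar>t - a k\<bar> \<le> (C + 1) * \<bar>t - a k\<bar>" by (simp add: mult_right_mono)
        also have "\<dots> < r" using t2 C0 by (simp add: pos_less_divide_eq mult.commute)
        finally have Cr: "C * \<bar>t - a k\<bar> < r" .
        have "\<bar>?v j - y a j\<bar> < r" if "j < n" for j
        proof -
          have "\<bar>?v j - y a j\<bar> \<le> (\<Sum>j<n. \<bar>?v j - y a j\<bar>)" by (rule member_le_sum) (use that in auto)
          then show ?thesis using lip'[OF t1] Cr by linarith
        qed
        moreover have "?v \<in> Rn n" using y[OF \<rho>(2)[OF t1]] openE_subset[OF S] by blast
        ultimately have vin: "?v \<in> obox n (y a) r" by (simp add: obox_def)
        have ain: "y a \<in> obox n (y a) r" using yS openE_subset[OF S] r by auto
        let ?E = "G ?v - G (y a) - (\<Sum>i<n. (?v i - y a i) *\<^sub>R partial i G (y a))"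
        have E: "norm ?E \<le> e / B * (\<Sum>i<n. \<bar>?v i - y a i\<bar>)" by (rule bspec[OF bspec[OF sd vin] ain])
        have "R t = - (\<Lambda> i (y a) \<bullet> ?E)"
          using dual_sum[OF yS i, of "\<lambda>j. ?v j - y a j"] unfolding dG[OF t1] R_def
          by (simp add: inner_diff_right)
        then have "norm (R t) \<le> norm (\<Lambda> i (y a)) * norm ?E" by (simp add: Cauchy_Schwarz_ineq2)
        also have "\<dots> \<le> norm (\<Lambda> i (y a)) * (e / B * (C * \<bar>t - a k\<bar>))"
        proof (rule mult_left_mono)
          have "e / B * (\<Sum>i<n. \<bar>?v i - y a i\<bar>) \<le> e / B * (C * \<bar>t - a k\<bar>)"
            by (rule mult_left_mono[OF lip'[OF t1]]) (use e B in simp)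
          with E show "norm ?E \<le> e / B * (C * \<bar>t - a k\<bar>)" by linarith
        qed simp
        also have "\<dots> = (norm (\<Lambda> i (y a)) * C) / B * (e * \<bar>t - a k\<bar>)" by simp
        also have "\<dots> \<le> 1 * (e * \<bar>t - a k\<bar>)"
        proof (rule mult_right_mono)
          show "norm (\<Lambda> i (y a)) * C / B \<le> 1" using B by (simp add: B_def)
        qed (use e in auto)
        finally show ?thesis by simp
      qed
      then show "\<forall>\<^sub>F t in at (a k). norm (R t) \<le> e * \<bar>t - a k\<bar>"
        unfolding eventually_at using d by blast
    qed
    moreover have "((\<lambda>t. (t - a k) *\<^sub>R (\<Lambda> i (y a) \<bullet> z k)) has_vector_derivative (\<Lambda> i (y a) \<bullet> z k)) (at (a k))"
    proof -
      have "((\<lambda>t. t *\<^sub>R (\<Lambda> i (y a) \<bullet> z k) - a k *\<^sub>R (\<Lambda> i (y a) \<bullet> z k)) has_vector_derivative (\<Lambda> i (y a) \<bullet> z k - 0)) (at (a k))"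
        by (rule has_vector_derivative_diff[OF has_vector_derivative_linear_term has_vector_derivative_const])
      then show ?thesis by (simp add: scaleR_diff_left left_diff_distrib)
    qed
    ultimately have "((\<lambda>t. R t + (t - a k) *\<^sub>R (\<Lambda> i (y a) \<bullet> z k) + y a i) has_vector_derivative (0 + (\<Lambda> i (y a) \<bullet> z k) + 0)) (at (a k))"
      by (intro has_vector_derivative_add has_vector_derivative_const)
    then show ?thesis by (simp add: R_def)
  qed
  have cont: "continuous_on ?D (\<lambda>a. y a i)" if i: "i < n" for i
  proof (rule continuous_onI_obox[OF openE_subset[OF D]])
    fix a e assume a: "a \<in> ?D" and e: "e > (0::real)"
    define Q where "Q = c * (\<Sum>k<d. norm (z k)) + 1"
    have Q: "Q > 0" using c by (auto simp: Q_def intro!: add_nonneg_pos mult_nonneg_nonneg sum_nonneg)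
    show "\<exists>r>0. \<forall>v\<in>obox d a r \<inter> ?D. dist (y v i) (y a i) < e"
    proof (intro exI[of _ "e / Q"] conjI ballI)
      show "e / Q > 0" using e Q by simp
      fix v assume v: "v \<in> obox d a (e / Q) \<inter> ?D"
      have "G (y v) - G (y a) = (\<Sum>k<d. (v k - a k) *\<^sub>R z k)"
        using Gy[of v] Gy[OF a] v by (simp add: scaleR_diff_left sum_subtractf)
      then have "norm (G (y v) - G (y a)) \<le> (\<Sum>k<d. (e / Q) * norm (z k))"
      proof -
        have "norm ((v k - a k) *\<^sub>R z k) \<le> e / Q * norm (z k)" if "k \<in> {..<d}" for k
        proof -
          have "\<bar>v k - a k\<bar> \<le> e / Q" using v that by (simp add: obox_def less_imp_le)
          then show ?thesis by (simp only: norm_scaleR) (rule mult_right_mono, auto)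
        qed
        from sum_norm_le[of "{..<d}", OF this] show ?thesis
          using \<open>G (y v) - G (y a) = (\<Sum>k<d. (v k - a k) *\<^sub>R z k)\<close> by simp
      qed
      then have "norm (G (y v) - G (y a)) \<le> (e / Q) * (\<Sum>k<d. norm (z k))" by (simp add: sum_distrib_left)
      then have "c * norm (G (y v) - G (y a)) \<le> c * ((e / Q) * (\<Sum>k<d. norm (z k)))"
        by (rule mult_left_mono[OF _ c])
      also have "\<dots> = (e / Q) * (Q - 1)" by (simp add: Q_def)
      also have "\<dots> < e" using e Q by (simp add: field_simps)
      finally have "c * norm (G (y v) - G (y a)) < e" .
      moreover have "\<bar>y v i - y a i\<bar> \<le> (\<Sum>i<n. \<bar>y v i - y a i\<bar>)" by (rule member_le_sum) (use i in auto)
      moreover have "(\<Sum>i<n. \<bar>y v i - y a i\<bar>) \<le> c * norm (G (y v) - G (y a))" using lip[of v a] v a by simp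
      ultimately show "dist (y v i) (y a i) < e" unfolding dist_real_def by linarith
    qed
  qed
  have "Ck_on d m ?D (\<lambda>a. y a i)" if "i < n" for m i
    using that
  proof (induction m arbitrary: i)
    case 0 then show ?case using cont by simp
  next
    case (Suc m)
    show ?case
    proof (rule Ck_SucI'[OF D cont[OF Suc.prems]])
      show "has_partial k (\<lambda>a. y a i) a (\<Lambda> i (y a) \<bullet> z k)" if "k < d" "a \<in> ?D" for k a
        by (rule hp[OF that(2,1) Suc.prems])
      fix k assume k: "k < d"
      have "Cinf_on n S (\<lambda>u. \<Lambda> i u \<bullet> z k)" by (rule Cinf_inner[OF \<Lambda>[OF Suc.prems] Cinf_const[OF S]])
      then have "Ck_on n m S (\<lambda>u. \<Lambda> i u \<bullet> z k)" by (rule Cinf_Ck)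
      from Ck_compose[where G = y, OF D S y this Suc.IH] show "Ck_on d m ?D (\<lambda>a. \<Lambda> i (y a) \<bullet> z k)" by simp
    qed
  qed
  then show ?thesis using i D by (simp add: Cinf_on_def)
qed

text \<open>\<open>Zf a\<close> is linear in \<open>a\<close>, so all bounds hold uniformly for
  coefficients of modulus at most 1, and one time \<open>T\<close> works for them all. Rescaling
  trades the time \<open>T\<close> for a cube of coefficients of size \<open>T\<close>. Near
  \<open>u0\<close> preimages under \<open>G\<close> are unique and depend on the image in a
  Lipschitz manner, so the chosen ones form a smooth patch.\<close>

lemma ruling_patch:
  fixes \<beta> :: "nat \<Rightarrow> nat \<Rightarrow> (nat \<Rightarrow> real) \<Rightarrow> real" and Zf :: "(nat \<Rightarrow> real) \<Rightarrow> (nat \<Rightarrow> real) \<Rightarrow> 'e"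
  assumes \<beta>: "\<And>k i. k < d \<Longrightarrow> i < n \<Longrightarrow> Cinf_on n S (\<beta> k i)" and u0: "u0 \<in> S"
    and Zf: "\<And>a u. Zf a u = (\<Sum>k<d. a k *\<^sub>R (\<Sum>i<n. \<beta> k i u *\<^sub>R partial i G u))"
    and sing: "\<And>a u \<delta>. u \<in> S \<Longrightarrow> \<delta> > 0 \<Longrightarrow> \<exists>u'\<in>obox n u \<delta> \<inter> S. \<exists>t. 0 < \<bar>t\<bar> \<and> \<bar>t\<bar> < \<delta> \<and>
     (\<exists>c. Zf a u' = (\<Sum>i<n. c i *\<^sub>R (partial i G u' + t *\<^sub>R partial i (Zf a) u')))"
  shows "\<exists>\<epsilon>>0. \<exists>y. y (\<lambda>_. 0) = u0 \<and>
    (\<forall>a\<in>obox d (\<lambda>_. 0) \<epsilon>. y a \<in> S \<and> G (y a) = G u0 + Zf a u0) \<and>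
    (\<forall>i<n. Cinf_on d (obox d (\<lambda>_. 0) \<epsilon>) (\<lambda>a. y a i))"
proof -
  define z where "z k u = (\<Sum>i<n. \<beta> k i u *\<^sub>R partial i G u)" for k u
  have Zf': "Zf a u = (\<Sum>k<d. a k *\<^sub>R z k u)" for a u unfolding Zf z_def by simp
  have zC: "Cinf_on n S (z k)" if k: "k < d" for k
    unfolding z_def by (rule Cinf_sum[OF S], rule Cinf_scaleR) (auto intro: \<beta> k Cinf_dG)
  have azC: "Cinf_on n S (\<lambda>u. a k *\<^sub>R z k u)" if "k < d" for a k
    by (rule Cinf_scaleR[OF Cinf_const[OF S] zC[OF that]])
  have ZfC: "Cinf_on n S (Zf a)" for a
    unfolding Zf' by (rule Cinf_sum[OF S]) (simp add: azC)
  define b where "b a i u = (\<Sum>k<d. a k * \<beta> k i u)" for a i u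
  have bC: "Cinf_on n S (b a i)" if "i < n" for a i
    unfolding b_def by (rule Cinf_sum[OF S], rule Cinf_mult[OF Cinf_const[OF S]]) (use \<beta> that in auto)
  have Zb: "Zf a u = (\<Sum>i<n. b a i u *\<^sub>R partial i G u)" for a u
    unfolding Zf b_def scaleR_sum_left scaleR_sum_right by (subst sum.swap) simp
  have dZf: "partial j (Zf a) u = (\<Sum>k<d. a k *\<^sub>R partial j (z k) u)" if "u \<in> S" "j < n" for a u j
  proof -
    have "partial j (Zf a) u = partial j (\<lambda>u. \<Sum>k<d. a k *\<^sub>R z k u) u" unfolding Zf'[abs_def] by simp
    also have "\<dots> = (\<Sum>k<d. partial j (\<lambda>u. a k *\<^sub>R z k u) u)"
      by (rule partial_sum[OF S]) (use azC that in auto)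
    also have "\<dots> = (\<Sum>k<d. a k *\<^sub>R partial j (z k) u)"
      by (intro sum.cong refl) (use partial_scaleR[OF Cinf_const[OF S] zC that(2,1)] in auto)
    finally show ?thesis .
  qed
  from local_bilipschitz[OF u0] obtain r c where r: "r > 0" and c: "c > 0" and rS: "obox n u0 r \<subseteq> S"
    and lip: "\<forall>v\<in>obox n u0 r. \<forall>w\<in>obox n u0 r. (\<Sum>i<n. \<bar>v i - w i\<bar>) \<le> c * norm (G v - G w)"
    by (elim exE conjE)
  define R where "R = r / 2"
  have R: "R > 0" using r by (simp add: R_def)
  have kr: "kbox n u0 R \<subseteq> obox n u0 r" by (rule kbox_subset_obox) (use r in \<open>simp add: R_def\<close>)
  then have kS: "kbox n u0 R \<subseteq> S" using rS by blast
  have u0R: "u0 \<in> Rn n" using u0 openE_subset[OF S] by blast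
  have u0k: "u0 \<in> kbox n u0 R" using u0R R by (simp add: kbox_def)
  let ?m1 = "\<lambda>u. \<Sum>k<d. \<Sum>i<n. \<Sum>j<n. \<bar>\<Lambda> i u \<bullet> partial j (z k) u\<bar>"
  let ?m2 = "\<lambda>u. \<Sum>k<d. \<Sum>i<n. \<bar>\<beta> k i u\<bar>"
  let ?m3 = "\<lambda>u. \<Sum>i<n. norm (partial i G u)"
  have "continuous_on S ?m1"
    by (intro continuous_on_sum continuous_on_rabs Cinf_continuous[OF Cinf_inner[OF \<Lambda> Cinf_partial[OF zC]]]) auto
  moreover have "continuous_on S ?m2"
    by (intro continuous_on_sum continuous_on_rabs Cinf_continuous[OF \<beta>]) auto
  moreover have "continuous_on S ?m3"
    by (intro continuous_on_sum continuous_on_norm Cinf_continuous[OF Cinf_dG]) auto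
  ultimately have "continuous_on S (\<lambda>u. ?m1 u + ?m2 u + ?m3 u)" by (intro continuous_on_add)
  then have "continuous_on (kbox n u0 R) (\<lambda>u. ?m1 u + ?m2 u + ?m3 u)" by (rule continuous_on_subset[OF _ kS])
  from continuous_attains_sup[OF compact_kbox _ this] u0k
  obtain um where um: "\<And>u. u \<in> kbox n u0 R \<Longrightarrow> ?m1 u + ?m2 u + ?m3 u \<le> ?m1 um + ?m2 um + ?m3 um" by fastforce
  define M where "M = ?m1 um + ?m2 um + ?m3 um + 1"
  have nonneg: "?m1 u \<ge> 0" "?m2 u \<ge> 0" "?m3 u \<ge> 0" for u by (intro sum_nonneg; simp)+
  have M1: "M \<ge> 1" using nonneg[of um] unfolding M_def by linarith
  have M: "?m1 u \<le> M" "?m2 u \<le> M" "?m3 u \<le> M" if "u \<in> kbox n u0 R" for u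
    using um[OF that] nonneg[of u] unfolding M_def by linarith+
  \<comment> \<open>The first bound is the one that \<open>approximate_flow\<close> asks for; the
    second keeps the cone of speed \<open>2 * M\<close> over the closed cube of radius
    \<open>R\<close>.\<close>
  define T where "T = min (1 / (2 * M)) (R / (2 * M))"
  have T: "T > 0" "2 * M * T \<le> R" "T * M \<le> 1 / 2"
  proof -
    show "T > 0" using M1 R by (simp add: T_def)
    have "2 * M * T \<le> 2 * M * (R / (2 * M))" using M1 by (intro mult_left_mono) (auto simp: T_def)
    then show "2 * M * T \<le> R" using M1 by simp
    have "T * M \<le> 1 / (2 * M) * M" using M1 by (intro mult_right_mono) (auto simp: T_def)
    then show "T * M \<le> 1 / 2" using M1 by simp
  qed
  have reach: "G u0 + T *\<^sub>R Zf a u0 \<in> G ` kbox n u0 R" if a: "\<And>k. k < d \<Longrightarrow> \<bar>a k\<bar> \<le> 1" for a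
  proof (rule cone_reach[OF G ZfC kS u0R _ T(2)])
    show "0 \<le> 2 * M" using M1 by simp
    fix u t \<eta> assume u: "u \<in> kbox n u0 R" and t: "0 < t" "t \<le> T" and \<eta>: "\<eta> > (0::real)"
    have uS: "u \<in> S" using u kS by blast
    show "\<exists>W. (\<forall>i<n. \<bar>W i\<bar> \<le> 2 * M) \<and>
        norm ((\<Sum>i<n. W i *\<^sub>R (partial i G u + t *\<^sub>R partial i (Zf a) u)) - Zf a u) \<le> \<eta>"
    proof (rule approximate_flow[where b = "b a", OF bC ZfC Zb uS])
      show "perp u (yy (b a) (Zf a) k u) = 0" for k
        by (rule tangent_iterates[OF bC ZfC Zb sing uS])
      have "(\<Sum>i<n. \<Sum>j<n. \<bar>\<Lambda> i u \<bullet> partial j (Zf a) u\<bar>) \<le> (\<Sum>i<n. \<Sum>j<n. \<Sum>k<d. \<bar>\<Lambda> i u \<bullet> partial j (z k) u\<bar>)"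
      proof (intro sum_mono)
        fix i j assume "i \<in> {..<n}" "j \<in> {..<n}"
        then have "\<bar>\<Lambda> i u \<bullet> partial j (Zf a) u\<bar> \<le> (\<Sum>k<d. \<bar>a k * (\<Lambda> i u \<bullet> partial j (z k) u)\<bar>)"
          using dZf[OF uS, of j a] by (simp add: inner_sum_right sum_abs)
        also have "\<dots> \<le> (\<Sum>k<d. \<bar>\<Lambda> i u \<bullet> partial j (z k) u\<bar>)"
          using a by (intro sum_mono) (simp add: abs_mult mult_left_le_one_le)
        finally show "\<bar>\<Lambda> i u \<bullet> partial j (Zf a) u\<bar> \<le> (\<Sum>k<d. \<bar>\<Lambda> i u \<bullet> partial j (z k) u\<bar>)" .
      qed
      also have "\<dots> = (\<Sum>i<n. \<Sum>k<d. \<Sum>j<n. \<bar>\<Lambda> i u \<bullet> partial j (z k) u\<bar>)"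
        by (intro sum.cong refl sum.swap)
      also have "\<dots> = ?m1 u" by (rule sum.swap)
      finally show "(\<Sum>i<n. \<Sum>j<n. \<bar>\<Lambda> i u \<bullet> partial j (Zf a) u\<bar>) \<le> M" using M(1)[OF u] by linarith
      have "(\<Sum>i<n. \<bar>b a i u\<bar>) \<le> (\<Sum>i<n. \<Sum>k<d. \<bar>\<beta> k i u\<bar>)"
      proof (intro sum_mono)
        fix i
        have "\<bar>b a i u\<bar> \<le> (\<Sum>k<d. \<bar>a k * \<beta> k i u\<bar>)" unfolding b_def by (rule sum_abs)
        also have "\<dots> \<le> (\<Sum>k<d. \<bar>\<beta> k i u\<bar>)"
          using a by (intro sum_mono) (simp add: abs_mult mult_left_le_one_le)
        finally show "\<bar>b a i u\<bar> \<le> (\<Sum>k<d. \<bar>\<beta> k i u\<bar>)" .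
      qed
      also have "\<dots> = ?m2 u" by (rule sum.swap)
      finally show "(\<Sum>i<n. \<bar>b a i u\<bar>) \<le> M" using M(2)[OF u] by linarith
      show "(\<Sum>i<n. norm (partial i G u)) \<le> M" by (rule M(3)[OF u])
      have "t * M \<le> T * M" using t M1 by (intro mult_right_mono) auto
      then show "t * M \<le> 1 / 2" using T by linarith
    qed (use t \<eta> in auto)
  qed (use T in auto)
  let ?D = "obox d (\<lambda>_. 0::real) T"
  have ex: "\<exists>v. v \<in> kbox n u0 R \<and> G v = G u0 + Zf a u0" if a: "a \<in> ?D" for a
  proof -
    have "\<bar>a k / T\<bar> \<le> 1" if "k < d" for k
      using a that T by (auto simp: obox_def abs_divide pos_divide_le_eq less_imp_le)
    from reach[OF this] have "G u0 + T *\<^sub>R Zf (\<lambda>k. a k / T) u0 \<in> G ` kbox n u0 R" by simp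
    moreover have "T *\<^sub>R Zf (\<lambda>k. a k / T) u0 = Zf a u0"
      unfolding Zf' scaleR_sum_right using T by (intro sum.cong) auto
    ultimately show ?thesis by auto
  qed
  \<comment> \<open>The choice is harmless: by the Lipschitz bound \<open>G\<close> is injective on
    the larger open cube.\<close>
  define y where "y a = (SOME v. v \<in> kbox n u0 R \<and> G v = G u0 + Zf a u0)" for a
  have y: "y a \<in> kbox n u0 R" "G (y a) = G u0 + Zf a u0" if "a \<in> ?D" for a
    using someI_ex[OF ex[OF that]] unfolding y_def by auto
  have lipy: "(\<Sum>i<n. \<bar>y a i - y a' i\<bar>) \<le> c * norm (G (y a) - G (y a'))" if "a \<in> ?D" "a' \<in> ?D" for a a'
    by (rule bspec[OF bspec[OF lip subsetD[OF kr y(1)[OF that(1)]]] subsetD[OF kr y(1)[OF that(2)]]])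
  have D0: "(\<lambda>_. 0) \<in> ?D" using T by (auto simp: obox_def Rn_def)
  have "y (\<lambda>_. 0) = u0"
  proof -
    have "G (y (\<lambda>_. 0)) = G u0" using y(2)[OF D0] by (simp add: Zf)
    then have "(\<Sum>i<n. \<bar>y (\<lambda>_. 0) i - u0 i\<bar>) \<le> 0"
      using bspec[OF bspec[OF lip subsetD[OF kr y(1)[OF D0]]] subsetD[OF kr u0k]] by simp
    then have "\<bar>y (\<lambda>_. 0) i - u0 i\<bar> = 0" if "i < n" for i
      using that member_le_sum[of i "{..<n}" "\<lambda>i. \<bar>y (\<lambda>_. 0) i - u0 i\<bar>"] by simp
    moreover have "y (\<lambda>_. 0) i = u0 i" if "\<not> i < n" for i
      using y(1)[OF D0] u0R that by (auto simp: kbox_def Rn_def)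
    ultimately have "y (\<lambda>_. 0) i = u0 i" for i by (cases "i < n") auto
    then show ?thesis by (rule ext)
  qed
  moreover have "y a \<in> S \<and> G (y a) = G u0 + Zf a u0" if "a \<in> ?D" for a using y[OF that] kS by blast
  moreover have "Cinf_on d ?D (\<lambda>a. y a i)" if i: "i < n" for i
  proof (rule smooth_inverse_on_affine[where p = "G u0" and z = "\<lambda>k. z k u0" and c = c, OF _ _ _ lipy i])
    show "y a \<in> S" "G (y a) = G u0 + (\<Sum>k<d. a k *\<^sub>R z k u0)" if "a \<in> ?D" for a
      using y(1)[OF that] y(2)[OF that, unfolded Zf'] kS by auto
  qed (use c in auto)
  ultimately show ?thesis using T(1) by (intro exI[of _ T] exI[of _ y] conjI) simp_all
qed

end

section \<open>Linear algebra of finite families\<close>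

lemma lin_indep_imp:
  assumes "finite I" "lin_indep I w" shows "inj_on w I" "independent (w ` I)"
proof -
  show inj: "inj_on w I"
  proof (rule inj_onI, rule ccontr)
    fix i j assume ij: "i \<in> I" "j \<in> I" "w i = w j" "i \<noteq> j"
    define c where "c k = (if k = i then 1 else if k = j then -1 else 0::real)" for k
    have "(\<Sum>k\<in>I. c k *\<^sub>R w k) = (\<Sum>k\<in>{i, j}. c k *\<^sub>R w k)"
      by (rule sum.mono_neutral_right) (use assms ij in \<open>auto simp: c_def\<close>)
    also have "\<dots> = 0" using ij by (simp add: c_def)
    finally have "\<forall>k\<in>I. c k = 0" using assms(2) unfolding lin_indep_def by simp
    then have "c i = 0" using ij by blast
    then show False by (simp add: c_def)
  qed
  show "independent (w ` I)"
  proof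
    assume "dependent (w ` I)"
    then obtain u v where u: "v \<in> w ` I" "u v \<noteq> 0" "(\<Sum>v\<in>w ` I. u v *\<^sub>R v) = 0"
      using dependent_finite[of "w ` I"] assms(1) by auto
    have "(\<Sum>i\<in>I. u (w i) *\<^sub>R w i) = 0" using u(3) by (simp add: sum.reindex[OF inj])
    then have "\<forall>i\<in>I. u (w i) = 0" using assms(2)[unfolded lin_indep_def, rule_format, of "\<lambda>i. u (w i)"] by simp
    then show False using u by auto
  qed
qed

lemma lin_indepI:
  assumes "finite I" "inj_on w I" "independent (w ` I)" shows "lin_indep I w"
  unfolding lin_indep_def
proof (rule allI, rule impI, rule ballI)
  fix c i assume c: "(\<Sum>i\<in>I. c i *\<^sub>R w i) = 0" and i: "i \<in> I"
  have "(\<Sum>v\<in>w ` I. c (the_inv_into I w v) *\<^sub>R v) = (\<Sum>i\<in>I. c i *\<^sub>R w i)"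
    unfolding sum.reindex[OF assms(2)] by (rule sum.cong) (simp_all add: the_inv_into_f_f[OF assms(2)])
  then have "(\<Sum>v\<in>w ` I. c (the_inv_into I w v) *\<^sub>R v) = 0" using c by simp
  then have "c (the_inv_into I w (w i)) = 0"
    using assms(3) dependent_finite[of "w ` I"] assms(1) i by auto
  then show "c i = 0" using the_inv_into_f_f[OF assms(2) i] by simp
qed

lemma lin_indep_card_le_dim:
  fixes w :: "'i \<Rightarrow> 'b::euclidean_space"
  assumes "finite I" "lin_indep I w" "w ` I \<subseteq> span V" shows "card I \<le> dim V"
  using independent_card_le_dim[of "w ` I" "span V"] lin_indep_imp[OF assms(1,2)] assms(3)
  by (simp add: card_image dim_span)

lemma lin_indep_basis:
  fixes w :: "'i \<Rightarrow> 'b::euclidean_space"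
  assumes "finite I"
  obtains J where "J \<subseteq> I" "lin_indep J w" "span (w ` J) = span (w ` I)" "card J = dim (w ` I)"
proof -
  obtain B where B: "B \<subseteq> w ` I" "independent B" "w ` I \<subseteq> span B" "card B = dim (w ` I)"
    by (metis basis_exists)
  obtain J where J: "J \<subseteq> I" "inj_on w J" "B = w ` J" using B(1) by (auto simp: subset_image_inj)
  have fin: "finite J" using J(1) assms finite_subset by blast
  show thesis
  proof (rule that[OF J(1)])
    show "lin_indep J w" using lin_indepI[OF fin J(2)] B(2) J(3) by simp
    have "span (w ` I) \<subseteq> span B" using B(3) by (simp add: span_minimal)
    moreover have "span B \<subseteq> span (w ` I)" using B(1) by (rule span_mono)
    ultimately show "span (w ` J) = span (w ` I)" using J(3) by simp
    show "card J = dim (w ` I)" using B(4) J by (simp add: card_image)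
  qed
qed

text \<open>If a combination of the perturbed family vanishes, pairing the same combination of the
  original family with dual vectors bounds the sum of the \<open>\<bar>c i\<bar>\<close> by half of
  itself.\<close>

lemma lin_indep_perturb:
  fixes w :: "'i \<Rightarrow> 'b::euclidean_space"
  assumes fin: "finite I" and li: "lin_indep I w"
  shows "\<exists>\<delta>>0. \<forall>w'. (\<forall>i\<in>I. norm (w' i - w i) < \<delta>) \<longrightarrow> lin_indep I w'"
proof -
  \<comment> \<open>\<open>dual_frame\<close> is used for a single family of vectors:
    \<open>Rn 0\<close> is one point, on which constant families are smooth.\<close>
  have o: "openE 0 (Rn 0)" by (auto simp: openE_iff obox_def intro: exI[of _ 1])
  have "\<exists>S' es. openE 0 S' \<and> (\<lambda>_. 0) \<in> S' \<and> S' \<subseteq> Rn 0 \<and> (\<forall>i\<in>I. Cinf_on 0 S' (es i)) \<and>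
    (\<forall>u\<in>S'. \<forall>i\<in>I. \<forall>j\<in>I. es i u \<bullet> w j = (if i = j then 1 else 0)) \<and>
    (\<forall>u\<in>S'. \<forall>i\<in>I. es i u \<in> span ((\<lambda>j. w j) ` I))"
    by (rule dual_frame[OF fin o, where e = "\<lambda>i _. w i"]) (rule Cinf_const[OF o], simp add: Rn_def, rule li)
  then obtain S' es where H: "openE 0 S' \<and> (\<lambda>_. 0) \<in> S' \<and> S' \<subseteq> Rn 0 \<and> (\<forall>i\<in>I. Cinf_on 0 S' (es i)) \<and>
    (\<forall>u\<in>S'. \<forall>i\<in>I. \<forall>j\<in>I. es i u \<bullet> w j = (if i = j then 1 else 0)) \<and>
    (\<forall>u\<in>S'. \<forall>i\<in>I. es i u \<in> span ((\<lambda>j. w j) ` I))" by (elim exE)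
  note * = conjunct1[OF conjunct2[OF H]] conjunct1[OF conjunct2[OF conjunct2[OF conjunct2[OF conjunct2[OF H]]]]]
  define ws where "ws i = es i (\<lambda>_. 0)" for i
  have ws: "ws i \<bullet> w j = (if i = j then 1 else 0)" if "i \<in> I" "j \<in> I" for i j
    unfolding ws_def by (rule bspec[OF bspec[OF bspec[OF *(2) *(1)] that(1)] that(2)])
  define A where "A = (\<Sum>i\<in>I. norm (ws i))"
  have A: "A \<ge> 0" unfolding A_def by (intro sum_nonneg) auto
  define \<delta> where "\<delta> = 1 / (2 * (A + 1))"
  have d: "\<delta> > 0" "A * \<delta> \<le> 1 / 2" using A by (auto simp: \<delta>_def field_simps)
  have "lin_indep I w'" if w': "\<forall>i\<in>I. norm (w' i - w i) < \<delta>" for w'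
    unfolding lin_indep_def
  proof (rule allI, rule impI)
    fix c assume c: "(\<Sum>i\<in>I. c i *\<^sub>R w' i) = 0"
    have ci: "\<bar>c i\<bar> \<le> norm (ws i) * (\<delta> * (\<Sum>j\<in>I. \<bar>c j\<bar>))" if i: "i \<in> I" for i
    proof -
      have "c i = ws i \<bullet> (\<Sum>j\<in>I. c j *\<^sub>R w j)" by (rule dual_coeff[symmetric]) (use fin ws i in auto)
      also have "(\<Sum>j\<in>I. c j *\<^sub>R w j) = (\<Sum>j\<in>I. c j *\<^sub>R (w j - w' j))"
        using c by (simp add: scaleR_diff_right sum_subtractf)
      finally have "\<bar>c i\<bar> \<le> norm (ws i) * norm (\<Sum>j\<in>I. c j *\<^sub>R (w j - w' j))"
        by (simp add: Cauchy_Schwarz_ineq2)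
      also have "\<dots> \<le> norm (ws i) * (\<Sum>j\<in>I. \<bar>c j\<bar> * \<delta>)"
      proof (intro mult_left_mono sum_norm_le)
        fix j assume "j \<in> I"
        then have "norm (w j - w' j) \<le> \<delta>" using w' by (simp add: norm_minus_commute less_imp_le)
        then show "norm (c j *\<^sub>R (w j - w' j)) \<le> \<bar>c j\<bar> * \<delta>" by (simp add: mult_left_mono)
      qed simp
      finally show ?thesis unfolding sum_distrib_right[symmetric] by (simp add: mult.commute)
    qed
    let ?s = "\<Sum>j\<in>I. \<bar>c j\<bar>"
    have s0: "?s \<ge> 0" by (intro sum_nonneg) auto
    have "?s \<le> (\<Sum>i\<in>I. norm (ws i) * (\<delta> * ?s))" by (rule sum_mono) (rule ci)
    also have "\<dots> = (A * \<delta>) * ?s" unfolding A_def by (simp add: sum_distrib_right mult.assoc)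
    also have "\<dots> \<le> 1 / 2 * ?s" by (rule mult_right_mono[OF d(2) s0])
    finally have "?s = 0" using s0 by linarith
    then show "\<forall>i\<in>I. c i = 0" using fin by (simp add: sum_nonneg_eq_0_iff)
  qed
  then show ?thesis using d(1) by blast
qed

text \<open>The norm of a combination depends only on the Gram matrix. This is the route by which
  linear relations pass between \<open>f\<close> and \<open>fh\<close>.\<close>

lemma gram_lin_indep:
  fixes w :: "'i \<Rightarrow> 'b::real_inner" and w' :: "'i \<Rightarrow> 'c::real_inner"
  assumes "\<And>i j. i \<in> I \<Longrightarrow> j \<in> I \<Longrightarrow> w i \<bullet> w j = w' i \<bullet> w' j"
    and "(\<Sum>i\<in>I. c i *\<^sub>R w i) = 0"
  shows "(\<Sum>i\<in>I. c i *\<^sub>R w' i) = 0"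
proof -
  have "(\<Sum>i\<in>I. c i *\<^sub>R w' i) \<bullet> (\<Sum>i\<in>I. c i *\<^sub>R w' i) = (\<Sum>i\<in>I. c i *\<^sub>R w i) \<bullet> (\<Sum>i\<in>I. c i *\<^sub>R w i)"
    unfolding inner_sum_left inner_sum_right inner_scaleR_left inner_scaleR_right
    by (intro sum.cong refl) (simp add: assms(1))
  then show ?thesis using assms(2) by simp
qed

lemma dual_span_expand:
  fixes e :: "'i \<Rightarrow> 'b::real_inner"
  assumes fin: "finite I" and dual: "\<And>i j. i \<in> I \<Longrightarrow> j \<in> I \<Longrightarrow> es i \<bullet> e j = (if i = j then 1 else 0)"
    and v: "v \<in> span (e ` I)"
  shows "v = (\<Sum>i\<in>I. (es i \<bullet> v) *\<^sub>R e i)"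
proof -
  obtain c where c: "v = (\<Sum>i\<in>I. c i *\<^sub>R e i)" using span_image_sum[OF fin, of v e] v by auto
  have "(\<Sum>i\<in>I. (es i \<bullet> v) *\<^sub>R e i) = (\<Sum>i\<in>I. c i *\<^sub>R e i)"
    unfolding c by (intro sum.cong refl arg_cong[where f = "\<lambda>x. x *\<^sub>R _"] dual_coeff) (use fin dual in auto)
  then show ?thesis using c by simp
qed

text \<open>The dual family spans the same space: \<open>e i\<close> has coefficients
  \<open>e j \<bullet> e i\<close> with respect to the \<open>es j\<close>, because the difference
  of the two sides lies in the span of the family and is orthogonal to it.\<close>

lemma dual_orthogonal:
  fixes e :: "'i \<Rightarrow> 'b::real_inner"
  assumes fin: "finite I" and dual: "\<And>i j. i \<in> I \<Longrightarrow> j \<in> I \<Longrightarrow> es i \<bullet> e j = (if i = j then 1 else 0)"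
    and sp: "\<And>i. i \<in> I \<Longrightarrow> es i \<in> span (e ` I)"
    and z: "\<And>i. i \<in> I \<Longrightarrow> es i \<bullet> x = 0" and i: "i \<in> I"
  shows "e i \<bullet> x = 0"
proof -
  have dual': "e i \<bullet> es j = (if i = j then 1 else 0)" if "i \<in> I" "j \<in> I" for i j
    using dual[OF that(2,1)] by (simp add: inner_commute)
  define D where "D = e i - (\<Sum>j\<in>I. (e j \<bullet> e i) *\<^sub>R es j)"
  have dsp: "D \<in> span (e ` I)" unfolding D_def
    by (intro span_diff span_sum span_scale sp) (use i in \<open>auto intro: span_base\<close>)
  have dd: "D = (\<Sum>j\<in>I. (es j \<bullet> D) *\<^sub>R e j)"
    by (rule dual_span_expand[where I = I and es = es and e = e]) (fact fin, rule dual, assumption, assumption, rule dsp)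
  have z': "e k \<bullet> D = 0" if "k \<in> I" for k
    using dual_coeff[OF fin dual' that, of "\<lambda>j. e j \<bullet> e i"]
    unfolding D_def by (simp add: inner_diff_right inner_commute[of "e i"])
  have "D \<bullet> D = (\<Sum>j\<in>I. (es j \<bullet> D) *\<^sub>R e j) \<bullet> D" by (rule arg_cong2[where f = inner, OF dd refl])
  also have "\<dots> = 0" unfolding inner_sum_left using z' by simp
  finally have ei: "e i = (\<Sum>j\<in>I. (e j \<bullet> e i) *\<^sub>R es j)" by (simp add: D_def)
  have "e i \<bullet> x = (\<Sum>j\<in>I. (e j \<bullet> e i) *\<^sub>R es j) \<bullet> x" by (rule arg_cong2[where f = inner, OF ei refl])
  also have "\<dots> = 0" unfolding inner_sum_left using z by simp
  finally show ?thesis .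
qed

section \<open>Pairs of isometric parallel frames in coordinates\<close>

text \<open>Coordinate form of the given data. The first \<open>n\<close> frame vectors are the
  coordinate fields, the others frame \<open>L\<close>; \<open>eh\<close> is the image of
  \<open>e\<close> under \<open>\<tau>\<close> extended by the identity on \<open>TM\<close>. The
  condition \<open>conn\<close> unites three facts: the common Levi-Civita connection, equality of
  the second fundamental forms in \<open>L\<close>, and parallelism of
  \<open>\<tau>\<close>.\<close>

locale isometric_frames =
  fixes n m :: nat and S :: "(nat \<Rightarrow> real) set"
    and f :: "(nat \<Rightarrow> real) \<Rightarrow> 'b::euclidean_space" and fh :: "(nat \<Rightarrow> real) \<Rightarrow> 'c::euclidean_space"
    and e es :: "nat \<Rightarrow> (nat \<Rightarrow> real) \<Rightarrow> 'b" and eh esh :: "nat \<Rightarrow> (nat \<Rightarrow> real) \<Rightarrow> 'c"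
  assumes nm: "n \<le> m"
    and f: "Cinf_on n S f" and fh: "Cinf_on n S fh"
    and e: "\<And>a. a < m \<Longrightarrow> Cinf_on n S (e a)" and eh: "\<And>a. a < m \<Longrightarrow> Cinf_on n S (eh a)"
    and e_f: "\<And>i u. i < n \<Longrightarrow> u \<in> S \<Longrightarrow> e i u = partial i f u"
    and eh_fh: "\<And>i u. i < n \<Longrightarrow> u \<in> S \<Longrightarrow> eh i u = partial i fh u"
    and es: "\<And>a. a < m \<Longrightarrow> Cinf_on n S (es a)" and esh: "\<And>a. a < m \<Longrightarrow> Cinf_on n S (esh a)"
    and dual: "\<And>u a b. u \<in> S \<Longrightarrow> a < m \<Longrightarrow> b < m \<Longrightarrow> es a u \<bullet> e b u = (if a = b then 1 else 0)"
    and dualh: "\<And>u a b. u \<in> S \<Longrightarrow> a < m \<Longrightarrow> b < m \<Longrightarrow> esh a u \<bullet> eh b u = (if a = b then 1 else 0)"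
    and es_span: "\<And>u a. u \<in> S \<Longrightarrow> a < m \<Longrightarrow> es a u \<in> span ((\<lambda>b. e b u) ` {..<m})"
    and esh_span: "\<And>u a. u \<in> S \<Longrightarrow> a < m \<Longrightarrow> esh a u \<in> span ((\<lambda>b. eh b u) ` {..<m})"
    and gram: "\<And>u a b. u \<in> S \<Longrightarrow> a < m \<Longrightarrow> b < m \<Longrightarrow> e a u \<bullet> e b u = eh a u \<bullet> eh b u"
    and conn: "\<And>u i a b. u \<in> S \<Longrightarrow> i < n \<Longrightarrow> a < m \<Longrightarrow> b < m \<Longrightarrow>
        partial i (e a) u \<bullet> e b u = partial i (eh a) u \<bullet> eh b u"
begin

lemma S: "openE n S" by (rule Cinf_open[OF f])

text \<open>The dual frame lies in the span of the frame, so this is the orthogonal projection to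
  the complement of \<open>TM \<oplus> L\<close>, that is, to the complement of \<open>L\<close> in
  the normal space.\<close>

definition Q where "Q u w = w - (\<Sum>a<m. (es a u \<bullet> w) *\<^sub>R e a u)"
definition Qh where "Qh u w = w - (\<Sum>a<m. (esh a u \<bullet> w) *\<^sub>R eh a u)"
text \<open>The value of \<open>\<phi>\<^sub>\<tau>\<close> on a coordinate field and a frame
  vector. \<open>phc\<close> is the bilinear extension to coefficient vectors, and
  \<open>lor\<close> the indefinite inner product on pairs for which the form is flat.\<close>

definition ph where "ph i a u = (Q u (partial i (e a) u), Qh u (partial i (eh a) u))"
definition lor :: "'b \<times> 'c \<Rightarrow> 'b \<times> 'c \<Rightarrow> real" where "lor p q = fst p \<bullet> fst q - snd p \<bullet> snd q"
definition pa where "pa u X a = (\<Sum>i<n. X i *\<^sub>R ph i a u)"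
definition phc where "phc u X v = (\<Sum>a<m. v a *\<^sub>R pa u X a)"

lemma es_Q: "u \<in> S \<Longrightarrow> a < m \<Longrightarrow> es a u \<bullet> Q u w = 0"
  using dual_coeff[of "{..<m}" "\<lambda>a. es a u" "\<lambda>a. e a u" a "\<lambda>a. es a u \<bullet> w"] dual
  by (simp add: Q_def inner_diff_right)

lemma esh_Qh: "u \<in> S \<Longrightarrow> a < m \<Longrightarrow> esh a u \<bullet> Qh u w = 0"
  using dual_coeff[of "{..<m}" "\<lambda>a. esh a u" "\<lambda>a. eh a u" a "\<lambda>a. esh a u \<bullet> w"] dualh
  by (simp add: Qh_def inner_diff_right)

lemma e_Q: "u \<in> S \<Longrightarrow> a < m \<Longrightarrow> e a u \<bullet> Q u w = 0"
  by (rule dual_orthogonal[where I = "{..<m}" and es = "\<lambda>a. es a u" and e = "\<lambda>a. e a u"])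
     (use dual es_span es_Q in auto)

lemma eh_Qh: "u \<in> S \<Longrightarrow> a < m \<Longrightarrow> eh a u \<bullet> Qh u w = 0"
  by (rule dual_orthogonal[where I = "{..<m}" and es = "\<lambda>a. esh a u" and e = "\<lambda>a. eh a u"])
     (use dualh esh_span esh_Qh in auto)

lemma inner_split:
  assumes u: "u \<in> S"
  shows "x \<bullet> y = Q u x \<bullet> Q u y + (\<Sum>c<m. \<Sum>d<m. (es c u \<bullet> x) * (es d u \<bullet> y) * (e c u \<bullet> e d u))"
proof -
  have x: "x = Q u x + (\<Sum>a<m. (es a u \<bullet> x) *\<^sub>R e a u)" for x by (simp add: Q_def)
  have "x \<bullet> y = (Q u x + (\<Sum>a<m. (es a u \<bullet> x) *\<^sub>R e a u)) \<bullet> (Q u y + (\<Sum>a<m. (es a u \<bullet> y) *\<^sub>R e a u))"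
    using x[of x] x[of y] by simp
  also have "\<dots> = Q u x \<bullet> Q u y + (\<Sum>a<m. (es a u \<bullet> x) *\<^sub>R e a u) \<bullet> (\<Sum>a<m. (es a u \<bullet> y) *\<^sub>R e a u)"
  proof -
    have "Q u x \<bullet> (\<Sum>a<m. (es a u \<bullet> y) *\<^sub>R e a u) = 0" "(\<Sum>a<m. (es a u \<bullet> x) *\<^sub>R e a u) \<bullet> Q u y = 0"
      using e_Q[OF u] by (simp_all add: inner_sum_left inner_sum_right inner_commute[of "Q u x"])
    then show ?thesis by (simp add: inner_add_left inner_add_right)
  qed
  also have "(\<Sum>a<m. (es a u \<bullet> x) *\<^sub>R e a u) \<bullet> (\<Sum>a<m. (es a u \<bullet> y) *\<^sub>R e a u) =
      (\<Sum>c<m. \<Sum>d<m. (es c u \<bullet> x) * (es d u \<bullet> y) * (e c u \<bullet> e d u))"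
    unfolding inner_sum_left unfolding inner_sum_right by (simp add: mult_ac)
  finally show ?thesis .
qed

lemma inner_splith:
  assumes u: "u \<in> S"
  shows "x \<bullet> y = Qh u x \<bullet> Qh u y + (\<Sum>c<m. \<Sum>d<m. (esh c u \<bullet> x) * (esh d u \<bullet> y) * (eh c u \<bullet> eh d u))"
proof -
  have x: "x = Qh u x + (\<Sum>a<m. (esh a u \<bullet> x) *\<^sub>R eh a u)" for x by (simp add: Qh_def)
  have "x \<bullet> y = (Qh u x + (\<Sum>a<m. (esh a u \<bullet> x) *\<^sub>R eh a u)) \<bullet> (Qh u y + (\<Sum>a<m. (esh a u \<bullet> y) *\<^sub>R eh a u))"
    using x[of x] x[of y] by simp
  also have "\<dots> = Qh u x \<bullet> Qh u y + (\<Sum>a<m. (esh a u \<bullet> x) *\<^sub>R eh a u) \<bullet> (\<Sum>a<m. (esh a u \<bullet> y) *\<^sub>R eh a u)"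
  proof -
    have "Qh u x \<bullet> (\<Sum>a<m. (esh a u \<bullet> y) *\<^sub>R eh a u) = 0" "(\<Sum>a<m. (esh a u \<bullet> x) *\<^sub>R eh a u) \<bullet> Qh u y = 0"
      using eh_Qh[OF u] by (simp_all add: inner_sum_left inner_sum_right inner_commute[of "Qh u x"])
    then show ?thesis by (simp add: inner_add_left inner_add_right)
  qed
  also have "(\<Sum>a<m. (esh a u \<bullet> x) *\<^sub>R eh a u) \<bullet> (\<Sum>a<m. (esh a u \<bullet> y) *\<^sub>R eh a u) =
      (\<Sum>c<m. \<Sum>d<m. (esh c u \<bullet> x) * (esh d u \<bullet> y) * (eh c u \<bullet> eh d u))"
    unfolding inner_sum_left unfolding inner_sum_right by (simp add: mult_ac)
  finally show ?thesis .
qed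

lemma inner_transfer:
  assumes u: "u \<in> S" and "\<And>c. c < m \<Longrightarrow> es c u \<bullet> x = esh c u \<bullet> xh" "\<And>c. c < m \<Longrightarrow> es c u \<bullet> y = esh c u \<bullet> yh"
    and "Q u x \<bullet> Q u y = Qh u xh \<bullet> Qh u yh"
  shows "x \<bullet> y = xh \<bullet> yh"
  unfolding inner_split[OF u, of x y] inner_splith[OF u, of xh yh] assms(4)
  using assms(2,3) gram[OF u] by simp

text \<open>Equal Gram matrices have equal inverses: \<open>esh c\<close> has the same coefficients
  in the \<open>eh d\<close> as \<open>es c\<close> has in the \<open>e d\<close>.\<close>

lemma coeff_transfer:
  assumes u: "u \<in> S" and w: "\<And>b. b < m \<Longrightarrow> w \<bullet> e b u = wh \<bullet> eh b u" and c: "c < m"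
  shows "es c u \<bullet> w = esh c u \<bullet> wh"
proof -
  obtain s where s: "es c u = (\<Sum>d<m. s d *\<^sub>R e d u)"
    using span_image_sum[of "{..<m}" "es c u" "\<lambda>d. e d u"] es_span[OF u c] by auto
  let ?v = "(\<Sum>d<m. s d *\<^sub>R eh d u) - esh c u"
  have vb: "?v \<bullet> eh b u = 0" if b: "b < m" for b
  proof -
    have "(\<Sum>d<m. s d *\<^sub>R eh d u) \<bullet> eh b u = es c u \<bullet> e b u"
      unfolding s inner_sum_left using gram[OF u _ b] by simp
    then show ?thesis using dual[OF u c b] dualh[OF u c b] by (simp add: inner_diff_left)
  qed
  have "?v \<in> span ((\<lambda>d. eh d u) ` {..<m})"
    by (intro span_diff span_sum span_scale esh_span[OF u c]) (auto intro: span_base)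
  then obtain r where r: "?v = (\<Sum>d<m. r d *\<^sub>R eh d u)"
    using span_image_sum[of "{..<m}" ?v "\<lambda>d. eh d u"] by auto
  have "?v \<bullet> ?v = ?v \<bullet> (\<Sum>d<m. r d *\<^sub>R eh d u)" using r by simp
  also have "\<dots> = 0" unfolding inner_sum_right using vb by simp
  finally have "esh c u = (\<Sum>d<m. s d *\<^sub>R eh d u)" by simp
  then have "esh c u \<bullet> wh = (\<Sum>d<m. s d * (eh d u \<bullet> wh))" by (simp add: inner_sum_left)
  moreover have "es c u \<bullet> w = (\<Sum>d<m. s d * (e d u \<bullet> w))" unfolding s by (simp add: inner_sum_left)
  moreover have "e d u \<bullet> w = eh d u \<bullet> wh" if "d < m" for d using w[OF that] by (simp add: inner_commute)
  ultimately show ?thesis by simp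
qed

lemma Gamma_transfer:
  "u \<in> S \<Longrightarrow> i < n \<Longrightarrow> a < m \<Longrightarrow> c < m \<Longrightarrow> es c u \<bullet> partial i (e a) u = esh c u \<bullet> partial i (eh a) u"
  by (rule coeff_transfer) (auto intro: conn)

text \<open>The Gauss, Codazzi and Ricci equations at once: differentiate \<open>conn\<close> and antisymmetrize.\<close>

lemma flat_partial:
  assumes u: "u \<in> S" and ij: "i < n" "j < n" and ab: "a < m" "b < m"
  shows "partial i (e a) u \<bullet> partial j (e b) u - partial i (eh a) u \<bullet> partial j (eh b) u =
         partial j (e a) u \<bullet> partial i (e b) u - partial j (eh a) u \<bullet> partial i (eh b) u"
proof -
  have d: "partial i (e a) u \<bullet> partial j (e b) u + partial j (partial i (e a)) u \<bullet> e b u =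
     partial i (eh a) u \<bullet> partial j (eh b) u + partial j (partial i (eh a)) u \<bullet> eh b u"
    if "i < n" "j < n" for i j
  proof -
    have "partial j (\<lambda>u. partial i (e a) u \<bullet> e b u) u = partial j (\<lambda>u. partial i (eh a) u \<bullet> eh b u) u"
      by (rule partial_cong[OF S u that(2)]) (rule conn[OF _ that(1) ab])
    then show ?thesis
      unfolding partial_inner[OF Cinf_partial[OF e[OF ab(1)] that(1)] e[OF ab(2)] that(2) u]
        partial_inner[OF Cinf_partial[OF eh[OF ab(1)] that(1)] eh[OF ab(2)] that(2) u] .
  qed
  have "partial j (partial i (e a)) u = partial i (partial j (e a)) u"
    "partial j (partial i (eh a)) u = partial i (partial j (eh a)) u"
    by (rule Cinf_partial_commute[OF e[OF ab(1)] u ij(2,1)], rule Cinf_partial_commute[OF eh[OF ab(1)] u ij(2,1)])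
  then show ?thesis using d[OF ij] d[OF ij(2,1)] by simp
qed

lemma lor_add_left: "lor (p + p') q = lor p q + lor p' q"
  and lor_add_right: "lor q (p + p') = lor q p + lor q p'"
  and lor_scale_left: "lor (c *\<^sub>R p) q = c * lor p q"
  and lor_scale_right: "lor q (c *\<^sub>R p) = c * lor q p"
  and lor_zero [simp]: "lor 0 q = 0" "lor q 0 = 0"
  by (simp_all add: lor_def inner_add_left inner_add_right right_diff_distrib)

lemma lor_sum_left: "lor (\<Sum>a\<in>A. p a) q = (\<Sum>a\<in>A. lor (p a) q)"
  by (induction A rule: infinite_finite_induct) (simp_all add: lor_add_left)

lemma lor_sum_right: "lor q (\<Sum>a\<in>A. p a) = (\<Sum>a\<in>A. lor q (p a))"
  by (induction A rule: infinite_finite_induct) (simp_all add: lor_add_right)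

text \<open>Frame components contribute equally to the products for \<open>f\<close> and for
  \<open>fh\<close>, by \<open>Gamma_transfer\<close> and \<open>gram\<close>. Hence
  \<open>lor\<close> of the projected derivatives is the difference of the full inner products, to
  which \<open>flat_partial\<close> applies.\<close>

lemma flat_ph:
  assumes u: "u \<in> S" and ij: "i < n" "j < n" and ab: "a < m" "b < m"
  shows "lor (ph i a u) (ph j b u) = lor (ph i b u) (ph j a u)"
proof -
  have l: "lor (ph i a u) (ph j b u) = partial i (e a) u \<bullet> partial j (e b) u - partial i (eh a) u \<bullet> partial j (eh b) u"
    if "i < n" "j < n" "a < m" "b < m" for i j a b
    unfolding lor_def ph_def fst_conv snd_conv
    unfolding inner_split[OF u, of "partial i (e a) u" "partial j (e b) u"]
      inner_splith[OF u, of "partial i (eh a) u" "partial j (eh b) u"]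
    using Gamma_transfer[OF u] gram[OF u] that by simp
  show ?thesis
    unfolding l[OF ij ab] l[OF ij ab(2,1)] flat_partial[OF u ij ab]
    by (simp add: inner_commute)
qed

lemma phc_sum: "phc u X v = (\<Sum>a<m. \<Sum>i<n. (v a * X i) *\<^sub>R ph i a u)"
  by (simp add: phc_def pa_def scaleR_sum_right)

lemma flat_phc:
  assumes u: "u \<in> S"
  shows "lor (phc u X v) (phc u Y w) = lor (phc u X w) (phc u Y v)"
proof -
  have x: "lor (phc u X v) (phc u Y w) =
    (\<Sum>a<m. \<Sum>i<n. \<Sum>b<m. \<Sum>j<n. (v a * X i) * ((w b * Y j) * lor (ph i a u) (ph j b u)))" for v w
    unfolding phc_sum unfolding lor_sum_left unfolding lor_sum_right lor_scale_left lor_scale_right by (simp add: mult_ac)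
  have "lor (phc u X v) (phc u Y w) =
    (\<Sum>a<m. \<Sum>i<n. \<Sum>b<m. \<Sum>j<n. (w b * X i) * ((v a * Y j) * lor (ph i b u) (ph j a u)))"
    unfolding x by (intro sum.cong refl) (use flat_ph[OF u] in auto)
  also have "\<dots> = (\<Sum>a<m. \<Sum>b<m. \<Sum>i<n. \<Sum>j<n. (w b * X i) * ((v a * Y j) * lor (ph i b u) (ph j a u)))"
    by (intro sum.cong refl sum.swap)
  also have "\<dots> = (\<Sum>b<m. \<Sum>a<m. \<Sum>i<n. \<Sum>j<n. (w b * X i) * ((v a * Y j) * lor (ph i b u) (ph j a u)))"
    by (rule sum.swap)
  also have "\<dots> = (\<Sum>b<m. \<Sum>i<n. \<Sum>a<m. \<Sum>j<n. (w b * X i) * ((v a * Y j) * lor (ph i b u) (ph j a u)))"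
    by (intro sum.cong refl sum.swap)
  finally show ?thesis unfolding x[of w v] .
qed

lemma phc_range: "range (phc u X) = span (pa u X ` {..<m})"
  using span_image_sum[of "{..<m}" _ "pa u X"] unfolding phc_def by auto

lemma pa_add: "pa u (\<lambda>i. X i + t * Y i) a = pa u X a + t *\<^sub>R pa u Y a"
  by (simp add: pa_def scaleR_add_left sum.distrib scaleR_sum_right)

text \<open>Moore's lemma: for regular \<open>X\<close> the kernel of \<open>\<phi>\<^sup>X\<close> is mapped into the image of \<open>\<phi>\<^sup>X\<close> by every \<open>\<phi>\<^sup>Y\<close>;
  otherwise \<open>\<phi>\<^sup>X\<^sup>+\<^sup>t\<^sup>Y\<close> has larger rank for small \<open>t \<noteq> 0\<close>.\<close>

lemma regular_kernel:
  assumes reg: "\<And>X'. dim (range (phc u X')) \<le> dim (range (phc u X))" and v: "phc u X v = 0"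
  shows "phc u Y v \<in> range (phc u X)"
proof (rule ccontr)
  assume neg: "phc u Y v \<notin> range (phc u X)"
  obtain J where J: "J \<subseteq> {..<m}" "lin_indep J (pa u X)" "span (pa u X ` J) = span (pa u X ` {..<m})"
    "card J = dim (pa u X ` {..<m})"
    using lin_indep_basis[of "{..<m}" "pa u X"] by auto
  have finJ: "finite J" using J(1) finite_subset by blast
  \<comment> \<open>\<open>None\<close> indexes the vector assumed to lie outside the image. It is
    kept fixed while the independent columns \<open>pa u X a\<close> move with
    \<open>t\<close>.\<close>
  define F where "F t k = (case k of None \<Rightarrow> phc u Y v | Some a \<Rightarrow> pa u (\<lambda>i. X i + t * Y i) a)" for t k
  let ?I = "insert None (Some ` J)"
  have F0: "F 0 (Some a) = pa u X a" for a by (simp add: F_def)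
  have "lin_indep ?I (F 0)"
    unfolding lin_indep_def
  proof (rule allI, rule impI)
    fix c assume c: "(\<Sum>k\<in>?I. c k *\<^sub>R F 0 k) = 0"
    then have c': "c None *\<^sub>R phc u Y v + (\<Sum>a\<in>J. c (Some a) *\<^sub>R pa u X a) = 0"
      using finJ by (simp add: sum.reindex F0) (simp add: F_def)
    have "c None = 0"
    proof (rule ccontr)
      assume nz: "c None \<noteq> 0"
      have "(\<Sum>a\<in>J. c (Some a) *\<^sub>R pa u X a) \<in> span (pa u X ` J)"
        by (intro span_sum span_scale span_base imageI)
      then have "(- 1 / c None) *\<^sub>R (\<Sum>a\<in>J. c (Some a) *\<^sub>R pa u X a) \<in> span (pa u X ` J)" by (rule span_scale)
      moreover have "(\<Sum>a\<in>J. c (Some a) *\<^sub>R pa u X a) = - (c None *\<^sub>R phc u Y v)"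
        using c' by (simp add: eq_neg_iff_add_eq_0 add.commute)
      ultimately have "phc u Y v \<in> span (pa u X ` J)" using nz by simp
      then show False using neg J(3) by (simp add: phc_range)
    qed
    then have "(\<Sum>a\<in>J. c (Some a) *\<^sub>R pa u X a) = 0" using c' by simp
    then have "\<forall>a\<in>J. c (Some a) = 0" using J(2)[unfolded lin_indep_def, rule_format, of "\<lambda>a. c (Some a)"] by simp
    then show "\<forall>k\<in>?I. c k = 0" using \<open>c None = 0\<close> by auto
  qed
  from lin_indep_perturb[OF _ this] finJ obtain \<delta> where \<delta>: "\<delta> > 0"
    "\<And>w'. (\<forall>k\<in>?I. norm (w' k - F 0 k) < \<delta>) \<Longrightarrow> lin_indep ?I w'" by auto
  define B where "B = (\<Sum>a\<in>J. norm (pa u Y a)) + 1"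
  have B: "B > 0" unfolding B_def by (intro add_nonneg_pos sum_nonneg) auto
  define t where "t = \<delta> / (2 * B)"
  have t: "t > 0" using \<delta> B by (simp add: t_def)
  have li: "lin_indep ?I (F t)"
  proof (rule \<delta>(2), rule ballI)
    fix k assume k: "k \<in> ?I"
    show "norm (F t k - F 0 k) < \<delta>"
    proof (cases k)
      case None then show ?thesis using \<delta> by (simp add: F_def)
    next
      case (Some a)
      then have a: "a \<in> J" using k by auto
      have "norm (pa u Y a) \<le> (\<Sum>a\<in>J. norm (pa u Y a))" by (rule member_le_sum) (use a finJ in auto)
      then have "t * norm (pa u Y a) \<le> t * B" using t by (intro mult_left_mono) (auto simp: B_def)
      also have "\<dots> < \<delta>" using B \<delta> by (simp add: t_def)
      finally show ?thesis using t by (simp add: Some F_def pa_add)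
    qed
  qed
  let ?X' = "\<lambda>i. X i + t * Y i"
  have in_range: "F t k \<in> span (pa u ?X' ` {..<m})" if "k \<in> ?I" for k
  proof (cases k)
    case None
    \<comment> \<open>Because \<open>phc u X v = 0\<close>, the fixed vector lies in the image of
      the perturbed form too, as \<open>t\<close> is nonzero. So this image contains
      \<open>card J + 1\<close> independent vectors.\<close>
    have "phc u ?X' v = t *\<^sub>R phc u Y v"
      using v unfolding phc_def pa_add by (simp add: scaleR_add_right sum.distrib scaleR_sum_right mult.commute)
    then have "t *\<^sub>R phc u Y v \<in> span (pa u ?X' ` {..<m})" using phc_range[of u ?X'] by (metis rangeI)
    then have "(1 / t) *\<^sub>R (t *\<^sub>R phc u Y v) \<in> span (pa u ?X' ` {..<m})" by (rule span_scale)
    then show ?thesis using t by (simp add: None F_def)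
  next
    case (Some a)
    then have "a \<in> {..<m}" using that J(1) by auto
    then show ?thesis unfolding F_def Some by (simp add: span_base)
  qed
  have "card ?I \<le> dim (pa u ?X' ` {..<m})"
    by (rule lin_indep_card_le_dim[OF _ li]) (use finJ in_range in auto)
  also have "\<dots> \<le> dim (pa u X ` {..<m})" using reg[of ?X'] by (simp add: phc_range dim_span)
  also have "\<dots> = card J" using J(4) by simp
  finally show False using finJ by (simp add: card_image)
qed

text \<open>Write \<open>phc u Y v\<close> as \<open>phc u X w\<close>. Flatness then exchanges
  \<open>w\<close> and \<open>v\<close>, and \<open>phc u X v = 0\<close>.\<close>

lemma kernel_null:
  assumes u: "u \<in> S" and reg: "\<And>X'. dim (range (phc u X')) \<le> dim (range (phc u X))" and v: "phc u X v = 0"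
  shows "lor (phc u Y v) (phc u Y' v) = 0"
proof -
  obtain w where "phc u Y v = phc u X w" using regular_kernel[OF reg v, of Y] by auto
  then show ?thesis using flat_phc[OF u, of X w Y' v] v by simp
qed

end

lemma lin_indep_basis_ex:
  fixes w :: "'i \<Rightarrow> 'b::euclidean_space"
  assumes "finite I"
  shows "\<exists>J. J \<subseteq> I \<and> lin_indep J w \<and> card J = dim (w ` I)"
proof (rule lin_indep_basis[OF assms, of w])
  fix J assume "J \<subseteq> I" "lin_indep J w" "card J = dim (w ` I)"
  then show ?thesis by (intro exI[of _ J] conjI)
qed

section \<open>Smooth kernels and the isometric extension along a kernel section\<close>

context isometric_frames
begin

lemma Cinf_Q: "Cinf_on n U w \<Longrightarrow> U \<subseteq> S \<Longrightarrow> Cinf_on n U (\<lambda>u. Q u (w u))"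
proof -
  assume w: "Cinf_on n U w" and U: "U \<subseteq> S"
  have o: "openE n U" by (rule Cinf_open[OF w])
  show ?thesis unfolding Q_def
    by (rule Cinf_diff[OF w], rule Cinf_sum[OF o], rule Cinf_scaleR, rule Cinf_inner)
       (use w Cinf_subset[OF es o U] Cinf_subset[OF e o U] in auto)
qed

lemma Cinf_Qh: "Cinf_on n U w \<Longrightarrow> U \<subseteq> S \<Longrightarrow> Cinf_on n U (\<lambda>u. Qh u (w u))"
proof -
  assume w: "Cinf_on n U w" and U: "U \<subseteq> S"
  have o: "openE n U" by (rule Cinf_open[OF w])
  show ?thesis unfolding Qh_def
    by (rule Cinf_diff[OF w], rule Cinf_sum[OF o], rule Cinf_scaleR, rule Cinf_inner)
       (use w Cinf_subset[OF esh o U] Cinf_subset[OF eh o U] in auto)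
qed

lemma Cinf_ph: "i < n \<Longrightarrow> a < m \<Longrightarrow> Cinf_on n S (ph i a)"
  unfolding ph_def[abs_def]
  by (intro Cinf_Pair Cinf_Q Cinf_Qh Cinf_partial e eh subset_refl)

lemma Cinf_pa:
  assumes "\<And>i. i < n \<Longrightarrow> Cinf_on n S (X i)" "a < m"
  shows "Cinf_on n S (\<lambda>u. pa u (\<lambda>i. X i u) a)"
  unfolding pa_def
  by (rule Cinf_sum[OF S], rule Cinf_scaleR) (use assms Cinf_ph in auto)

text \<open>Solving the constant rank system \<open>\<phi>\<^sup>Y v = 0\<close> for the coefficients \<open>v a\<close>, \<open>a \<in> J\<close>.\<close>

lemma kernel_frame:
  assumes Y: "\<And>i. i < n \<Longrightarrow> Cinf_on n S (Y i)" and u0: "u0 \<in> S"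
    and rank: "\<And>u. u \<in> S \<Longrightarrow> dim (range (phc u (\<lambda>i. Y i u))) = r"
  shows "r \<le> m" "\<exists>S' \<kappa>. openE n S' \<and> u0 \<in> S' \<and> S' \<subseteq> S \<and>
    (\<forall>k<m - r. \<forall>a. Cinf_on n S' (\<kappa> k a)) \<and>
    (\<forall>u\<in>S'. \<forall>k<m - r. phc u (\<lambda>i. Y i u) (\<lambda>a. \<kappa> k a u) = 0) \<and>
    (\<forall>u\<in>S'. \<forall>v. phc u (\<lambda>i. Y i u) v = 0 \<longrightarrow> (\<exists>c. \<forall>a<m. v a = (\<Sum>k<m - r. c k * \<kappa> k a u))) \<and>
    (\<forall>u\<in>S'. \<forall>c. (\<forall>a<m. (\<Sum>k<m - r. c k * \<kappa> k a u) = 0) \<longrightarrow> (\<forall>k<m - r. c k = 0))"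
proof -
  define w where "w a u = pa u (\<lambda>i. Y i u) a" for a u
  have wC: "Cinf_on n S (w a)" if "a < m" for a unfolding w_def by (rule Cinf_pa[OF Y that])
  have phw: "phc u (\<lambda>i. Y i u) v = (\<Sum>a<m. v a *\<^sub>R w a u)" for u v by (simp add: phc_def w_def)
  have dimw: "dim ((\<lambda>a. w a u) ` {..<m}) = r" if "u \<in> S" for u
    using rank[OF that] by (simp add: phc_range w_def dim_span)
  have "\<exists>J. J \<subseteq> {..<m} \<and> lin_indep J (\<lambda>a. w a u0) \<and> card J = r"
    using lin_indep_basis_ex[of "{..<m}" "\<lambda>a. w a u0"] unfolding dimw[OF u0] by simp
  then obtain J where J: "J \<subseteq> {..<m}" "lin_indep J (\<lambda>a. w a u0)" "card J = r" by (elim exE conjE)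
  have finJ: "finite J" using J(1) finite_subset by blast
  show rm: "r \<le> m" using card_mono[OF _ J(1)] J(3) by simp
  have "\<exists>S' ws. openE n S' \<and> u0 \<in> S' \<and> S' \<subseteq> S \<and> (\<forall>i\<in>J. Cinf_on n S' (ws i)) \<and>
    (\<forall>u\<in>S'. \<forall>i\<in>J. \<forall>j\<in>J. ws i u \<bullet> w j u = (if i = j then 1 else 0)) \<and>
    (\<forall>u\<in>S'. \<forall>i\<in>J. ws i u \<in> span ((\<lambda>j. w j u) ` J))"
    by (rule dual_frame[where e = w and n = n and S = S and I = J]) (use wC J finJ S u0 in auto)
  then obtain S' ws where H: "openE n S' \<and> u0 \<in> S' \<and> S' \<subseteq> S \<and> (\<forall>i\<in>J. Cinf_on n S' (ws i)) \<and>
    (\<forall>u\<in>S'. \<forall>i\<in>J. \<forall>j\<in>J. ws i u \<bullet> w j u = (if i = j then 1 else 0)) \<and>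
    (\<forall>u\<in>S'. \<forall>i\<in>J. ws i u \<in> span ((\<lambda>j. w j u) ` J))" by (elim exE)
  have S': "openE n S'" "u0 \<in> S'" "S' \<subseteq> S" and wsC: "\<And>i. i \<in> J \<Longrightarrow> Cinf_on n S' (ws i)"
    and ws: "\<And>u i j. u \<in> S' \<Longrightarrow> i \<in> J \<Longrightarrow> j \<in> J \<Longrightarrow> ws i u \<bullet> w j u = (if i = j then 1 else 0)"
    using H by simp_all
  have wC': "Cinf_on n S' (w a)" if "a < m" for a by (rule Cinf_subset[OF wC[OF that] S'(1,3)])
  \<comment> \<open>Constancy of the rank enters here: the \<open>r\<close> columns in
    \<open>J\<close> stay independent near \<open>u0\<close>, so they continue to span the
    image.\<close>
  have expand: "w b u = (\<Sum>a\<in>J. (ws a u \<bullet> w b u) *\<^sub>R w a u)" if u: "u \<in> S'" and b: "b < m" for u b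
  proof (rule dual_span_expand[where I = J and es = "\<lambda>a. ws a u" and e = "\<lambda>a. w a u"])
    have li: "lin_indep J (\<lambda>a. w a u)"
      by (rule dual_imp_lin_indep[where ws = "\<lambda>a. ws a u"]) (use finJ ws[OF u] in auto)
    have inj: "inj_on (\<lambda>a. w a u) J" and ind: "independent ((\<lambda>a. w a u) ` J)"
      by (rule lin_indep_imp[OF finJ li])+
    have sub: "(\<lambda>a. w a u) ` J \<subseteq> span ((\<lambda>a. w a u) ` {..<m})" using J(1) by (auto intro!: span_base)
    have "dim (span ((\<lambda>a. w a u) ` {..<m})) \<le> card ((\<lambda>a. w a u) ` J)"
      using dimw[of u] u S'(3) J(3) card_image[OF inj] by (simp add: dim_span subset_iff)
    from card_ge_dim_independent[OF sub ind this]
    have "span ((\<lambda>a. w a u) ` {..<m}) \<subseteq> span ((\<lambda>a. w a u) ` J)" .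
    then show "w b u \<in> span ((\<lambda>a. w a u) ` J)" using b by (auto intro: span_base)
  qed (use finJ ws[OF u] in auto)
  define K where "K = {..<m} - J"
  have finK: "finite K" by (simp add: K_def)
  have cK: "card K = m - r" using J(1,3) finJ by (simp add: K_def card_Diff_subset)
  obtain h where h: "bij_betw h {..<m - r} K"
    using ex_bij_betw_nat_finite[OF finK] cK by (auto simp: atLeast0LessThan)
  have hK: "h k \<in> K" "h k < m" "h k \<notin> J" if "k < m - r" for k
    using bij_betwE[OF h] that by (auto simp: K_def)
  have hinj: "h k = h k' \<longleftrightarrow> k = k'" if "k < m - r" "k' < m - r" for k k'
    using h that by (auto simp: bij_betw_def inj_on_def)
  \<comment> \<open>The solution with the free variable \<open>h k\<close> set to 1 and the other
    free variables to 0; its entries on \<open>J\<close> are forced by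
    \<open>expand\<close>.\<close>
  define \<kappa> where "\<kappa> k a u = (if a = h k then 1 else 0) - (if a \<in> J then ws a u \<bullet> w (h k) u else 0)" for k a u
  have kC: "Cinf_on n S' (\<kappa> k a)" if "k < m - r" for k a
  proof (cases "a \<in> J")
    case True
    then show ?thesis unfolding \<kappa>_def[abs_def]
      using Cinf_diff[OF Cinf_const[OF S'(1)] Cinf_inner[OF wsC wC'[OF hK(2)[OF that]]]] by simp
  next
    case False
    then show ?thesis unfolding \<kappa>_def[abs_def] using Cinf_const[OF S'(1)] by (cases "a = h k") simp_all
  qed
  have sumJK: "(\<Sum>a<m. F a) = (\<Sum>a\<in>J. F a) + (\<Sum>a\<in>K. F a)" for F :: "nat \<Rightarrow> 'z::comm_monoid_add"
    using sum.subset_diff[OF J(1), of F] by (simp add: K_def add.commute)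
  have sumK: "(\<Sum>a\<in>K. F a) = (\<Sum>k<m - r. F (h k))" for F :: "nat \<Rightarrow> 'z::comm_monoid_add"
    using sum.reindex_bij_betw[OF h, of F] by simp
  have kK: "\<kappa> k (h k') u = (if k = k' then 1 else 0)" if "k < m - r" "k' < m - r" for k k' u
    using hK[OF that(1)] hK[OF that(2)] hinj[OF that] by (auto simp: \<kappa>_def)
  have ker: "phc u (\<lambda>i. Y i u) (\<lambda>a. \<kappa> k a u) = 0" if u: "u \<in> S'" and k: "k < m - r" for u k
  proof -
    have "(\<Sum>a\<in>J. \<kappa> k a u *\<^sub>R w a u) = - (\<Sum>a\<in>J. (ws a u \<bullet> w (h k) u) *\<^sub>R w a u)"
      unfolding sum_negf[symmetric] using hK[OF k] by (intro sum.cong) (auto simp: \<kappa>_def)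
    also have "\<dots> = - w (h k) u" using expand[OF u hK(2)[OF k]] by simp
    finally have 1: "(\<Sum>a\<in>J. \<kappa> k a u *\<^sub>R w a u) = - w (h k) u" .
    have "(\<Sum>a\<in>K. \<kappa> k a u *\<^sub>R w a u) = (\<Sum>k'<m - r. if k = k' then w (h k') u else 0)"
      unfolding sumK by (intro sum.cong) (auto simp: kK[OF k])
    also have "\<dots> = w (h k) u" using k by simp
    finally show ?thesis unfolding phw sumJK 1 by simp
  qed
  have gen: "\<exists>c. \<forall>a<m. v a = (\<Sum>k<m - r. c k * \<kappa> k a u)" if u: "u \<in> S'" and v: "phc u (\<lambda>i. Y i u) v = 0" for u v
  proof -
    define v' where "v' a = v a - (\<Sum>k<m - r. v (h k) * \<kappa> k a u)" for a
    have vK: "v' (h k') = 0" if k': "k' < m - r" for k'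
    proof -
      have "(\<Sum>k<m - r. v (h k) * \<kappa> k (h k') u) = (\<Sum>k<m - r. if k = k' then v (h k) else 0)"
        by (intro sum.cong) (auto simp: kK[OF _ k'])
      then show ?thesis using k' by (simp add: v'_def)
    qed
    have "(\<Sum>a<m. (\<Sum>k<m - r. v (h k) * \<kappa> k a u) *\<^sub>R w a u) = (\<Sum>k<m - r. v (h k) *\<^sub>R (\<Sum>a<m. \<kappa> k a u *\<^sub>R w a u))"
      unfolding scaleR_sum_left scaleR_sum_right by (subst sum.swap) simp
    also have "\<dots> = 0" using ker[OF u] by (simp add: phw)
    finally have "(\<Sum>a<m. v' a *\<^sub>R w a u) = 0" using v
      by (simp add: v'_def phw scaleR_diff_left sum_subtractf)
    moreover have "(\<Sum>a\<in>K. v' a *\<^sub>R w a u) = 0" unfolding sumK using vK by simp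
    ultimately have z: "(\<Sum>a\<in>J. v' a *\<^sub>R w a u) = 0" by (simp add: sumJK)
    have li: "lin_indep J (\<lambda>a. w a u)"
      by (rule dual_imp_lin_indep[where ws = "\<lambda>a. ws a u"]) (use finJ ws[OF u] in auto)
    have vJ: "\<forall>a\<in>J. v' a = 0" using li z unfolding lin_indep_def by simp
    have "v' a = 0" if "a < m" for a
    proof (cases "a \<in> J")
      case False
      then have "a \<in> K" using that by (simp add: K_def)
      then obtain k where "k < m - r" "a = h k" using bij_betw_imp_surj_on[OF h] by auto
      then show ?thesis using vK by simp
    qed (use vJ in simp)
    then show ?thesis by (intro exI[of _ "\<lambda>k. v (h k)"]) (simp add: v'_def)
  qed
  have indep: "\<forall>k<m - r. c k = 0" if c: "\<forall>a<m. (\<Sum>k<m - r. c k * \<kappa> k a u) = 0" for u c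
  proof (intro allI impI)
    fix k' assume k': "k' < m - r"
    have "(\<Sum>k<m - r. c k * \<kappa> k (h k') u) = (\<Sum>k<m - r. if k = k' then c k else 0)"
      by (intro sum.cong) (auto simp: kK[OF _ k'])
    then show "c k' = 0" using c hK(2)[OF k'] k' by simp
  qed
  show "\<exists>S' \<kappa>. openE n S' \<and> u0 \<in> S' \<and> S' \<subseteq> S \<and>
    (\<forall>k<m - r. \<forall>a. Cinf_on n S' (\<kappa> k a)) \<and>
    (\<forall>u\<in>S'. \<forall>k<m - r. phc u (\<lambda>i. Y i u) (\<lambda>a. \<kappa> k a u) = 0) \<and>
    (\<forall>u\<in>S'. \<forall>v. phc u (\<lambda>i. Y i u) v = 0 \<longrightarrow> (\<exists>c. \<forall>a<m. v a = (\<Sum>k<m - r. c k * \<kappa> k a u))) \<and>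
    (\<forall>u\<in>S'. \<forall>c. (\<forall>a<m. (\<Sum>k<m - r. c k * \<kappa> k a u) = 0) \<longrightarrow> (\<forall>k<m - r. c k = 0))"
    by (rule exI[of _ S'], rule exI[of _ \<kappa>]) (use S' kC ker gen indep in blast)
qed

text \<open>A section of \<open>TM \<oplus> L\<close> with coefficients \<open>v\<close>, viewed
  along \<open>f\<close>; \<open>combh v\<close> is its image under \<open>\<tau>\<close>, extended
  by the identity on \<open>TM\<close>, viewed along \<open>fh\<close>.\<close>

definition comb where "comb v u = (\<Sum>a<m. v a u *\<^sub>R e a u)"
definition combh where "combh v u = (\<Sum>a<m. v a u *\<^sub>R eh a u)"

lemma Cinf_comb:
  assumes o: "openE n U" and U: "U \<subseteq> S" and v: "\<And>a. a < m \<Longrightarrow> Cinf_on n U (v a)"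
  shows "Cinf_on n U (comb v)" "Cinf_on n U (combh v)"
  unfolding comb_def[abs_def] combh_def[abs_def]
  by (rule Cinf_sum[OF o], rule Cinf_scaleR, use v Cinf_subset[OF e o U] Cinf_subset[OF eh o U] in auto)+

lemma partial_comb:
  assumes o: "openE n U" and U: "U \<subseteq> S" and v: "\<And>a. a < m \<Longrightarrow> Cinf_on n U (v a)" and u: "u \<in> U" and i: "i < n"
  shows "partial i (comb v) u = (\<Sum>a<m. partial i (v a) u *\<^sub>R e a u) + (\<Sum>a<m. v a u *\<^sub>R partial i (e a) u)"
    and "partial i (combh v) u = (\<Sum>a<m. partial i (v a) u *\<^sub>R eh a u) + (\<Sum>a<m. v a u *\<^sub>R partial i (eh a) u)"
proof -
  have eU: "Cinf_on n U (e a)" "Cinf_on n U (eh a)" if "a < m" for a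
    using Cinf_subset[OF e[OF that] o U] Cinf_subset[OF eh[OF that] o U] .
  have "partial i (comb v) u = (\<Sum>a<m. partial i (\<lambda>u. v a u *\<^sub>R e a u) u)"
    unfolding comb_def[abs_def] by (rule partial_sum[OF o _ i u]) (use v eU in \<open>auto intro: Cinf_scaleR\<close>)
  also have "\<dots> = (\<Sum>a<m. v a u *\<^sub>R partial i (e a) u + partial i (v a) u *\<^sub>R e a u)"
    by (intro sum.cong refl partial_scaleR[OF v eU(1) i u]) auto
  finally show "partial i (comb v) u = (\<Sum>a<m. partial i (v a) u *\<^sub>R e a u) + (\<Sum>a<m. v a u *\<^sub>R partial i (e a) u)"
    by (simp add: sum.distrib add.commute)
  have "partial i (combh v) u = (\<Sum>a<m. partial i (\<lambda>u. v a u *\<^sub>R eh a u) u)"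
    unfolding combh_def[abs_def] by (rule partial_sum[OF o _ i u]) (use v eU in \<open>auto intro: Cinf_scaleR\<close>)
  also have "\<dots> = (\<Sum>a<m. v a u *\<^sub>R partial i (eh a) u + partial i (v a) u *\<^sub>R eh a u)"
    by (intro sum.cong refl partial_scaleR[OF v eU(2) i u]) auto
  finally show "partial i (combh v) u = (\<Sum>a<m. partial i (v a) u *\<^sub>R eh a u) + (\<Sum>a<m. v a u *\<^sub>R partial i (eh a) u)"
    by (simp add: sum.distrib add.commute)
qed

text \<open>\<open>ext V w i\<close> is the \<open>i\<close>-th partial derivative of \<open>f + t V\<close> at \<open>w = (u, t)\<close>.\<close>

definition ext where "ext V w i = (if i < n then partial i f (w(n := 0)) + w n *\<^sub>R partial i V (w(n := 0)) else V (w(n := 0)))"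
definition exth where "exth V w i = (if i < n then partial i fh (w(n := 0)) + w n *\<^sub>R partial i V (w(n := 0)) else V (w(n := 0)))"

lemma Q_comb: "u \<in> S \<Longrightarrow> Q u (\<Sum>a<m. c a *\<^sub>R e a u) = 0"
proof -
  assume u: "u \<in> S"
  have "es b u \<bullet> (\<Sum>a<m. c a *\<^sub>R e a u) = c b" if "b < m" for b
    using dual_coeff[of "{..<m}" "\<lambda>a. es a u" "\<lambda>a. e a u" b c] dual[OF u] that by simp
  then show ?thesis by (simp add: Q_def)
qed

lemma Qh_comb: "u \<in> S \<Longrightarrow> Qh u (\<Sum>a<m. c a *\<^sub>R eh a u) = 0"
proof -
  assume u: "u \<in> S"
  have "esh b u \<bullet> (\<Sum>a<m. c a *\<^sub>R eh a u) = c b" if "b < m" for b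
    using dual_coeff[of "{..<m}" "\<lambda>a. esh a u" "\<lambda>a. eh a u" b c] dualh[OF u] that by simp
  then show ?thesis by (simp add: Qh_def)
qed

lemma Q_add: "Q u (v + w) = Q u v + Q u w" and Q_scale: "Q u (c *\<^sub>R v) = c *\<^sub>R Q u v"
  and Qh_add: "Qh u (v' + w') = Qh u v' + Qh u w'" and Qh_scale: "Qh u (c *\<^sub>R v') = c *\<^sub>R Qh u v'"
  by (simp_all add: Q_def Qh_def inner_add_right scaleR_add_left sum.distrib scaleR_diff_right scaleR_sum_right)

lemma Q_zero [simp]: "Q u 0 = 0" "Qh u 0 = 0" by (simp_all add: Q_def Qh_def)

lemma Q_sum: "Q u (\<Sum>a\<in>A. F a) = (\<Sum>a\<in>A. Q u (F a))" and Qh_sum: "Qh u (\<Sum>a\<in>A. F' a) = (\<Sum>a\<in>A. Qh u (F' a))"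
  by (induction A rule: infinite_finite_induct) (simp_all add: Q_add Qh_add)

text \<open>Equal connection coefficients give both derivatives the same frame components. The
  remaining components are \<open>t\<close> times the two halves of
  \<open>\<phi>\<^sub>\<tau>(X, v)\<close>, whose inner products agree because these values are null
  for \<open>lor\<close>. In the direction of \<open>t\<close> the derivative is the section itself,
  which has no such component.\<close>

lemma extension_isometric:
  assumes o: "openE n U" and U: "U \<subseteq> S" and v: "\<And>a. a < m \<Longrightarrow> Cinf_on n U (v a)"
    and w: "w(n := 0) \<in> U"
    and null: "\<And>X Y. lor (phc (w(n := 0)) X (\<lambda>a. v a (w(n := 0)))) (phc (w(n := 0)) Y (\<lambda>a. v a (w(n := 0)))) = 0"
    and ij: "i < Suc n" "j < Suc n"
  shows "ext (comb v) w i \<bullet> ext (comb v) w j = exth (combh v) w i \<bullet> exth (combh v) w j"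
proof -
  define u where "u = w(n := 0)"
  define t where "t = w n"
  have uS: "u \<in> S" using w U by (auto simp: u_def)
  have uU: "u \<in> U" using w by (simp add: u_def)
  define c where "c i a = (if i < n then (if a = i then 1 else 0) + t * partial i (v a) u else v a u)" for i a
  define N where "N i = (if i < n then t else 0)" for i
  have delta: "(\<Sum>a<m. (if a = i then 1 else 0) *\<^sub>R E a) = E i" if "i < n" for i and E :: "nat \<Rightarrow> 'z::real_vector"
  proof -
    have "(\<Sum>a<m. (if a = i then 1 else 0) *\<^sub>R E a) = (\<Sum>a<m. if a = i then E a else 0)" by (intro sum.cong) auto
    then show ?thesis using that nm by simp
  qed
  have x: "ext (comb v) w i = (\<Sum>a<m. c i a *\<^sub>R e a u) + N i *\<^sub>R (\<Sum>a<m. v a u *\<^sub>R partial i (e a) u)" for i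
  proof (cases "i < n")
    case True
    have pc: "partial i (comb v) u = (\<Sum>a<m. partial i (v a) u *\<^sub>R e a u) + (\<Sum>a<m. v a u *\<^sub>R partial i (e a) u)"
      by (rule partial_comb(1)[OF o U _ uU True]) (rule v)
    show ?thesis
      using delta[OF True, of "\<lambda>a. e a u"] e_f[OF True uS] True
      unfolding ext_def u_def[symmetric] t_def[symmetric] pc
      by (simp add: c_def N_def scaleR_add_left scaleR_add_right sum.distrib scaleR_sum_right)
  qed (simp add: ext_def c_def N_def comb_def u_def)
  have xh: "exth (combh v) w i = (\<Sum>a<m. c i a *\<^sub>R eh a u) + N i *\<^sub>R (\<Sum>a<m. v a u *\<^sub>R partial i (eh a) u)" for i
  proof (cases "i < n")
    case True
    have pc: "partial i (combh v) u = (\<Sum>a<m. partial i (v a) u *\<^sub>R eh a u) + (\<Sum>a<m. v a u *\<^sub>R partial i (eh a) u)"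
      by (rule partial_comb(2)[OF o U _ uU True]) (rule v)
    show ?thesis
      using delta[OF True, of "\<lambda>a. eh a u"] eh_fh[OF True uS] True
      unfolding exth_def u_def[symmetric] t_def[symmetric] pc
      by (simp add: c_def N_def scaleR_add_left scaleR_add_right sum.distrib scaleR_sum_right)
  qed (simp add: exth_def c_def N_def combh_def u_def)
  have co: "es b u \<bullet> ext (comb v) w i = esh b u \<bullet> exth (combh v) w i" if b: "b < m" and i: "i < Suc n" for b i
  proof -
    have 1: "es b u \<bullet> (\<Sum>a<m. c i a *\<^sub>R e a u) = c i b" "esh b u \<bullet> (\<Sum>a<m. c i a *\<^sub>R eh a u) = c i b"
      using dual_coeff[of "{..<m}" "\<lambda>a. es a u" "\<lambda>a. e a u" b "c i"] dual_coeff[of "{..<m}" "\<lambda>a. esh a u" "\<lambda>a. eh a u" b "c i"]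
        dual[OF uS] dualh[OF uS] b by simp_all
    have 2: "N i * (es b u \<bullet> (\<Sum>a<m. v a u *\<^sub>R partial i (e a) u)) = N i * (esh b u \<bullet> (\<Sum>a<m. v a u *\<^sub>R partial i (eh a) u))"
      using Gamma_transfer[OF uS _ _ b] by (simp add: N_def inner_sum_right)
    show ?thesis unfolding x xh inner_add_right inner_scaleR_right 1 2 ..
  qed
  have Qx: "Q u (ext (comb v) w i) = N i *\<^sub>R (\<Sum>a<m. v a u *\<^sub>R Q u (partial i (e a) u))" for i
    unfolding x Q_add Q_scale Q_sum Q_comb[OF uS] by (simp add: Q_comb[OF uS] Q_sum[symmetric] Q_scale[symmetric])
  have Qxh: "Qh u (exth (combh v) w i) = N i *\<^sub>R (\<Sum>a<m. v a u *\<^sub>R Qh u (partial i (eh a) u))" for i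
    unfolding xh Qh_add Qh_scale Qh_sum Qh_comb[OF uS] by (simp add: Qh_comb[OF uS] Qh_sum[symmetric] Qh_scale[symmetric])
  have QQ: "Q u (ext (comb v) w i) \<bullet> Q u (ext (comb v) w j) = Qh u (exth (combh v) w i) \<bullet> Qh u (exth (combh v) w j)"
  proof (cases "i < n \<and> j < n")
    case False
    then show ?thesis unfolding Qx Qxh by (auto simp: N_def)
  next
    case True
    have ph: "phc u (\<lambda>k. if k = i then 1 else 0) (\<lambda>a. v a u) = (\<Sum>a<m. v a u *\<^sub>R ph i a u)" if "i < n" for i
    proof -
      have "pa u (\<lambda>k. if k = i then 1 else 0) a = ph i a u" for a
      proof -
        have "(\<Sum>k<n. (if k = i then 1 else 0) *\<^sub>R ph k a u) = (\<Sum>k<n. if k = i then ph k a u else 0)" by (intro sum.cong) auto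
        then show ?thesis using that by (simp add: pa_def)
      qed
      then show ?thesis by (simp add: phc_def)
    qed
    have "lor (\<Sum>a<m. v a u *\<^sub>R ph i a u) (\<Sum>a<m. v a u *\<^sub>R ph j a u) = 0"
      using null[of "\<lambda>k. if k = i then 1 else 0" "\<lambda>k. if k = j then 1 else 0"] ph True unfolding u_def[symmetric] by simp
    moreover have "fst (\<Sum>a<m. v a u *\<^sub>R ph i a u) = (\<Sum>a<m. v a u *\<^sub>R Q u (partial i (e a) u))"
      "snd (\<Sum>a<m. v a u *\<^sub>R ph i a u) = (\<Sum>a<m. v a u *\<^sub>R Qh u (partial i (eh a) u))" for i
      by (simp_all add: fst_sum snd_sum ph_def)
    ultimately have "(\<Sum>a<m. v a u *\<^sub>R Q u (partial i (e a) u)) \<bullet> (\<Sum>a<m. v a u *\<^sub>R Q u (partial j (e a) u)) =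
       (\<Sum>a<m. v a u *\<^sub>R Qh u (partial i (eh a) u)) \<bullet> (\<Sum>a<m. v a u *\<^sub>R Qh u (partial j (eh a) u))"
      by (simp add: lor_def)
    then show ?thesis unfolding Qx Qxh by simp
  qed
  show ?thesis by (rule inner_transfer[OF uS co co QQ]) (use ij in auto)
qed

end

section \<open>Strong genuineness in coordinates\<close>

lemma sum_initial_segment:
  fixes v :: "nat \<Rightarrow> real" and E :: "nat \<Rightarrow> 'z::real_vector"
  assumes "n \<le> m" "\<And>b. n \<le> b \<Longrightarrow> b < m \<Longrightarrow> v b = 0"
  shows "(\<Sum>b<m. v b *\<^sub>R E b) = (\<Sum>i<n. v i *\<^sub>R E i)"
  by (rule sum.mono_neutral_right) (use assms in auto)

text \<open>A dual frame at \<open>w0\<close> extends smoothly to nearby points and certifies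
  independence there.\<close>

lemma lin_indep_near:
  fixes X :: "'i \<Rightarrow> (nat \<Rightarrow> real) \<Rightarrow> 'b::euclidean_space"
  assumes "finite I" "\<And>i. i \<in> I \<Longrightarrow> Cinf_on k N (X i)" "openE k N" "w0 \<in> N" "lin_indep I (\<lambda>i. X i w0)"
  shows "\<exists>r>0. obox k w0 r \<subseteq> N \<and> (\<forall>w\<in>obox k w0 r. lin_indep I (\<lambda>i. X i w))"
proof -
  have "\<exists>S' es. openE k S' \<and> w0 \<in> S' \<and> S' \<subseteq> N \<and> (\<forall>i\<in>I. Cinf_on k S' (es i)) \<and>
    (\<forall>u\<in>S'. \<forall>i\<in>I. \<forall>j\<in>I. es i u \<bullet> X j u = (if i = j then 1 else 0)) \<and>
    (\<forall>u\<in>S'. \<forall>i\<in>I. es i u \<in> span ((\<lambda>j. X j u) ` I))"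
    by (rule dual_frame[where e = X and n = k and S = N and I = I]) (use assms in auto)
  then obtain S' es where H: "openE k S' \<and> w0 \<in> S' \<and> S' \<subseteq> N \<and> (\<forall>i\<in>I. Cinf_on k S' (es i)) \<and>
    (\<forall>u\<in>S'. \<forall>i\<in>I. \<forall>j\<in>I. es i u \<bullet> X j u = (if i = j then 1 else 0)) \<and>
    (\<forall>u\<in>S'. \<forall>i\<in>I. es i u \<in> span ((\<lambda>j. X j u) ` I))" by (elim exE)
  have S': "openE k S'" "w0 \<in> S'" "S' \<subseteq> N"
    and d: "\<And>u i j. u \<in> S' \<Longrightarrow> i \<in> I \<Longrightarrow> j \<in> I \<Longrightarrow> es i u \<bullet> X j u = (if i = j then 1 else 0)"
    using H by simp_all
  obtain r where r: "r > 0" "obox k w0 r \<subseteq> S'" using S' by (auto simp: openE_iff)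
  have "lin_indep I (\<lambda>i. X i w)" if "w \<in> obox k w0 r" for w
    by (rule dual_imp_lin_indep[where ws = "\<lambda>i. es i w"]) (use assms(1) d that r(2) in auto)
  then show ?thesis using r S'(3) by (intro exI[of _ r]) auto
qed

lemma cylinder:
  assumes o: "openE n U" shows "openE (Suc n) {w \<in> Rn (Suc n). w(n := 0) \<in> U}"
  unfolding openE_iff
proof (intro conjI ballI)
  fix w assume w: "w \<in> {w \<in> Rn (Suc n). w(n := 0) \<in> U}"
  then obtain r where r: "r > 0" "obox n (w(n := 0)) r \<subseteq> U" using o by (auto simp: openE_iff)
  have "obox (Suc n) w r \<subseteq> {w \<in> Rn (Suc n). w(n := 0) \<in> U}"
  proof
    fix v assume v: "v \<in> obox (Suc n) w r"
    then have "v(n := 0) \<in> obox n (w(n := 0)) r" by (auto simp: obox_def Rn_def)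
    then show "v \<in> {w \<in> Rn (Suc n). w(n := 0) \<in> U}" using r v by (auto simp: obox_def)
  qed
  then show "\<exists>r>0. obox (Suc n) w r \<subseteq> {w \<in> Rn (Suc n). w(n := 0) \<in> U}" using r(1) by blast
qed auto

lemma Cinf_cyl:
  assumes F: "Cinf_on n U F"
  shows "Cinf_on (Suc n) {w \<in> Rn (Suc n). w(n := 0) \<in> U} (\<lambda>w. F (w(n := 0)))"
proof (rule Cinf_compose[OF F cylinder[OF Cinf_open[OF F]]])
  fix j assume "j < n"
  then show "Cinf_on (Suc n) {w \<in> Rn (Suc n). w(n := 0) \<in> U} (\<lambda>w. (w(n := 0)) j)"
    using Cinf_coord[OF cylinder[OF Cinf_open[OF F]], of j] by simp
qed simp

text \<open>\<open>gen\<close> says that no open piece of \<open>f\<close>, \<open>fh\<close> extends isometrically by \<open>f + t V\<close>, \<open>fh + t Vh\<close>, with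
  singularities at most at \<open>t = 0\<close>; the last coordinate of \<open>w \<in> N\<close> is \<open>t\<close>.\<close>

locale genuine_frames = isometric_frames +
  assumes gen: "\<And>U V Vh N. U \<noteq> {} \<Longrightarrow> openE n U \<Longrightarrow> U \<subseteq> S \<Longrightarrow> Cinf_on n U V \<Longrightarrow> Cinf_on n U Vh \<Longrightarrow>
    openE (Suc n) N \<Longrightarrow> U \<subseteq> N \<Longrightarrow> (\<And>w. w \<in> N \<Longrightarrow> w(n := 0) \<in> U) \<Longrightarrow>
    (\<And>w i j. w \<in> N \<Longrightarrow> i < Suc n \<Longrightarrow> j < Suc n \<Longrightarrow> ext V w i \<bullet> ext V w j = exth Vh w i \<bullet> exth Vh w j) \<Longrightarrow>
    \<exists>w\<in>N - U. \<not> lin_indep {..<Suc n} (ext V w)"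
begin

lemma Cinf_ext:
  assumes V: "Cinf_on n U V" and U: "U \<subseteq> S" and i: "i < Suc n"
  shows "Cinf_on (Suc n) {w \<in> Rn (Suc n). w(n := 0) \<in> U} (\<lambda>w. ext V w i)"
proof (cases "i < n")
  case True
  have o: "openE n U" by (rule Cinf_open[OF V])
  show ?thesis unfolding ext_def using True
    by (simp add: Cinf_add Cinf_scaleR Cinf_coord cylinder[OF o]
        Cinf_cyl[OF Cinf_partial[OF V True]] Cinf_cyl[OF Cinf_partial[OF Cinf_subset[OF f o U] True]])
next
  case False
  then show ?thesis unfolding ext_def using Cinf_cyl[OF V] by simp
qed

lemma slab:
  assumes r: "r > 0" and u: "u \<in> Rn n"
  shows "obox n u r \<subseteq> obox (Suc n) u r" "\<And>w. w \<in> obox (Suc n) u r \<Longrightarrow> w(n := 0) \<in> obox n u r"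
    "\<And>w. w \<in> obox (Suc n) u r \<Longrightarrow> w \<notin> obox n u r \<Longrightarrow> w n \<noteq> 0 \<and> \<bar>w n\<bar> < r"
proof -
  show "obox n u r \<subseteq> obox (Suc n) u r"
  proof
    fix w assume w: "w \<in> obox n u r"
    then have "w n = 0" "u n = 0" using u by (auto simp: obox_def Rn_def)
    then show "w \<in> obox (Suc n) u r" using w r by (auto simp: obox_def Rn_def less_Suc_eq)
  qed
  show "w(n := 0) \<in> obox n u r" if "w \<in> obox (Suc n) u r" for w
    using that by (auto simp: obox_def Rn_def)
  then show "w n \<noteq> 0 \<and> \<bar>w n\<bar> < r" if "w \<in> obox (Suc n) u r" "w \<notin> obox n u r" for w
  proof -
    have "u n = 0" using u by (simp add: Rn_def)
    then have "\<bar>w n\<bar> < r" using that(1) by (auto simp: obox_def)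
    moreover have "w n \<noteq> 0"
    proof
      assume "w n = 0"
      then have "w(n := 0) = w" by auto
      then show False using \<open>\<And>w. w \<in> obox (Suc n) u r \<Longrightarrow> w(n := 0) \<in> obox n u r\<close>[OF that(1)] that(2) by simp
    qed
    ultimately show ?thesis by simp
  qed
qed

section \<open>Sections of the kernel of a regular element\<close>

context
  fixes Y :: "nat \<Rightarrow> (nat \<Rightarrow> real) \<Rightarrow> real"
  assumes Y: "\<And>i. i < n \<Longrightarrow> Cinf_on n S (Y i)"
    and reg: "\<And>u X'. u \<in> S \<Longrightarrow> dim (range (phc u X')) \<le> dim (range (phc u (\<lambda>i. Y i u)))"
begin

lemma e_lin_indep: "u \<in> S \<Longrightarrow> lin_indep {..<m} (\<lambda>a. e a u)"
  by (rule dual_imp_lin_indep[where ws = "\<lambda>a. es a u"]) (use dual in auto)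

lemma kernel_isometric:
  assumes U: "U \<subseteq> S" and v: "\<And>a. a < m \<Longrightarrow> Cinf_on n U (v a)" and o: "openE n U"
    and ker: "\<And>u. u \<in> U \<Longrightarrow> phc u (\<lambda>i. Y i u) (\<lambda>a. v a u) = 0"
    and w: "w(n := 0) \<in> U" and ij: "i < Suc n" "j < Suc n"
  shows "ext (comb v) w i \<bullet> ext (comb v) w j = exth (combh v) w i \<bullet> exth (combh v) w j"
  by (rule extension_isometric[OF o U _ w _ ij])
     (use v kernel_null[OF subsetD[OF U w] reg ker[OF w]] U w in auto)

lemma ext_at_0:
  assumes "u \<in> S" "i < n" shows "ext V u i = e i u"
proof -
  have "u \<in> Rn n" using assms openE_subset[OF S] by blast
  then have "u n = 0" by (simp add: Rn_def)
  then have "u(n := 0) = u" by auto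
  then show ?thesis using e_f assms \<open>u n = 0\<close> by (simp add: ext_def)
qed

text \<open>A nonzero component along \<open>L\<close> at \<open>u0\<close> would make the section
  transversal to the tangent space, so that \<open>f + t V\<close> would be an immersion on a full
  neighbourhood of \<open>u0\<close>, values \<open>t \<noteq> 0\<close> included. As the extension
  is isometric by \<open>kernel_isometric\<close>, this contradicts \<open>gen\<close>.\<close>

lemma kernel_tangent:
  assumes U0: "openE n U0" "U0 \<subseteq> S" and v: "\<And>a. a < m \<Longrightarrow> Cinf_on n U0 (v a)"
    and ker: "\<And>u. u \<in> U0 \<Longrightarrow> phc u (\<lambda>i. Y i u) (\<lambda>a. v a u) = 0"
    and u0: "u0 \<in> U0" and a0: "n \<le> a0" "a0 < m"
  shows "v a0 u0 = 0"
proof (rule ccontr)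
  assume nz: "v a0 u0 \<noteq> 0"
  let ?N = "{w \<in> Rn (Suc n). w(n := 0) \<in> U0}"
  have u0S: "u0 \<in> S" using u0 U0 by auto
  have u0R: "u0 \<in> Rn n" using u0S openE_subset[OF S] by blast
  then have un: "u0 n = 0" by (simp add: Rn_def)
  then have u0n: "u0(n := 0) = u0" by auto
  have VC: "Cinf_on n U0 (comb v)" "Cinf_on n U0 (combh v)" using Cinf_comb[OF U0 v] by auto
  have li: "lin_indep {..<Suc n} (\<lambda>i. ext (comb v) u0 i)"
    unfolding lin_indep_def
  proof (rule allI, rule impI)
    fix c assume c: "(\<Sum>i<Suc n. c i *\<^sub>R ext (comb v) u0 i) = 0"
    have "ext (comb v) u0 n = comb v u0" unfolding ext_def u0n by simp
    then have 1: "(\<Sum>i<n. c i *\<^sub>R e i u0) + c n *\<^sub>R comb v u0 = 0" using c ext_at_0[OF u0S] by simp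
    have 2: "(\<Sum>i<n. c i *\<^sub>R e i u0) = (\<Sum>a<m. (if a < n then c a else 0) *\<^sub>R e a u0)"
    proof -
      have "(\<Sum>a<m. (if a < n then c a else 0) *\<^sub>R e a u0) = (\<Sum>a<n. (if a < n then c a else 0) *\<^sub>R e a u0)"
        by (rule sum.mono_neutral_right) (use nm in auto)
      then show ?thesis by simp
    qed
    have "(\<Sum>a<m. ((if a < n then c a else 0) + c n * v a u0) *\<^sub>R e a u0) = 0"
      using 1 unfolding 2 comb_def by (simp add: scaleR_add_left sum.distrib scaleR_sum_right)
    then have z: "(if a < n then c a else 0) + c n * v a u0 = 0" if "a < m" for a
      using e_lin_indep[OF u0S, unfolded lin_indep_def, rule_format, of "\<lambda>a. (if a < n then c a else 0) + c n * v a u0" a] that by simp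
    have "c n = 0" using z[OF a0(2)] a0(1) nz by simp
    moreover have "c i = 0" if "i < n" for i using z[of i] that nm \<open>c n = 0\<close> by simp
    ultimately show "\<forall>i\<in>{..<Suc n}. c i = 0" by (auto simp: less_Suc_eq)
  qed
  have "u0 \<in> ?N" using u0 u0n u0R Rn_mono[of n "Suc n"] by auto
  from lin_indep_near[OF _ Cinf_ext[OF VC(1) U0(2)] cylinder[OF U0(1)] this li]
  have "\<exists>r>0. obox (Suc n) u0 r \<subseteq> ?N \<and> (\<forall>w\<in>obox (Suc n) u0 r. lin_indep {..<Suc n} (\<lambda>i. ext (comb v) w i))"
    by simp
  then obtain r where r: "r > 0" "obox (Suc n) u0 r \<subseteq> ?N"
    and lr: "\<forall>w\<in>obox (Suc n) u0 r. lin_indep {..<Suc n} (\<lambda>i. ext (comb v) w i)" by (elim exE conjE)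
  let ?U = "obox n u0 r"
  have UU0: "?U \<subseteq> U0"
  proof
    fix w assume w: "w \<in> ?U"
    then have "w \<in> ?N" using slab(1)[OF r(1) u0R] r(2) by blast
    moreover have "w(n := 0) = w" using w by (auto simp: obox_def Rn_def)
    ultimately show "w \<in> U0" by simp
  qed
  have "\<exists>w\<in>obox (Suc n) u0 r - ?U. \<not> lin_indep {..<Suc n} (ext (comb v) w)"
  proof (rule gen[where V = "comb v" and Vh = "combh v" and U = ?U and N = "obox (Suc n) u0 r"])
    show "?U \<noteq> {}" using u0R r by (metis empty_iff obox_self)
    show "openE n ?U" "openE (Suc n) (obox (Suc n) u0 r)" by (rule openE_obox)+
    show "Cinf_on n ?U (comb v)" "Cinf_on n ?U (combh v)"
      by (rule Cinf_subset[OF VC(1) openE_obox UU0], rule Cinf_subset[OF VC(2) openE_obox UU0])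
    show "ext (comb v) w i \<bullet> ext (comb v) w j = exth (combh v) w i \<bullet> exth (combh v) w j"
      if "w \<in> obox (Suc n) u0 r" "i < Suc n" "j < Suc n" for w i j
      by (rule kernel_isometric[OF U0(2) v U0(1) ker _ that(2,3)]) (use that(1) r(2) in auto)
  qed (use UU0 U0(2) slab[OF r(1) u0R] in auto)
  then show False using lr by blast
qed

text \<open>\<open>gen\<close> supplies a dependence at some point with \<open>t \<noteq> 0\<close>.
  The first \<open>n\<close> derivatives stay independent near \<open>t = 0\<close>, so the
  coefficient of \<open>V\<close> in it is nonzero and the relation can be solved for
  \<open>V\<close>. The Gram matrices of both extensions agree, which transfers the relation to
  \<open>fh\<close> with the same coefficients.\<close>

lemma kernel_singular:
  assumes U0: "openE n U0" "U0 \<subseteq> S" and v: "\<And>a. a < m \<Longrightarrow> Cinf_on n U0 (v a)"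
    and ker: "\<And>u. u \<in> U0 \<Longrightarrow> phc u (\<lambda>i. Y i u) (\<lambda>a. v a u) = 0"
    and u: "u \<in> U0" and d: "\<delta> > 0"
  shows "\<exists>u'\<in>obox n u \<delta> \<inter> U0. \<exists>t. 0 < \<bar>t\<bar> \<and> \<bar>t\<bar> < \<delta> \<and>
     (\<exists>c. comb v u' = (\<Sum>i<n. c i *\<^sub>R (partial i f u' + t *\<^sub>R partial i (comb v) u')) \<and>
          combh v u' = (\<Sum>i<n. c i *\<^sub>R (partial i fh u' + t *\<^sub>R partial i (combh v) u')))"
proof -
  let ?N = "{w \<in> Rn (Suc n). w(n := 0) \<in> U0}"
  have uS: "u \<in> S" using u U0 by auto
  have uR: "u \<in> Rn n" using uS openE_subset[OF S] by blast
  then have "u n = 0" by (simp add: Rn_def)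
  then have u0n: "u(n := 0) = u" by auto
  have VC: "Cinf_on n U0 (comb v)" "Cinf_on n U0 (combh v)" using Cinf_comb[OF U0 v] by auto
  have li: "lin_indep {..<n} (\<lambda>i. ext (comb v) u i)"
  proof -
    have "lin_indep {..<n} (\<lambda>i. e i u)" by (rule lin_indep_subset[OF e_lin_indep[OF uS]]) (use nm in auto)
    then show ?thesis unfolding lin_indep_def using ext_at_0[OF uS] by simp
  qed
  have uN: "u \<in> ?N" using u u0n uR Rn_mono[of n "Suc n"] by auto
  have "\<exists>r>0. obox (Suc n) u r \<subseteq> ?N \<and> (\<forall>w\<in>obox (Suc n) u r. lin_indep {..<n} (\<lambda>i. ext (comb v) w i))"
    by (rule lin_indep_near[where X = "\<lambda>i w. ext (comb v) w i", OF _ _ cylinder[OF U0(1)] uN li]) (auto intro: Cinf_ext[OF VC(1) U0(2)])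
  then obtain r where r: "r > 0" "obox (Suc n) u r \<subseteq> ?N"
    and lr: "\<forall>w\<in>obox (Suc n) u r. lin_indep {..<n} (\<lambda>i. ext (comb v) w i)" by (elim exE conjE)
  \<comment> \<open>Capping the radius by \<open>\<delta>\<close> places the singular point as close
    to \<open>u\<close>, and its time as close to 0, as the claim demands.\<close>
  define \<rho> where "\<rho> = min r \<delta>"
  have \<rho>: "\<rho> > 0" "\<rho> \<le> r" "\<rho> \<le> \<delta>" using r d by (auto simp: \<rho>_def)
  let ?U = "obox n u \<rho>"
  have Nr: "obox (Suc n) u \<rho> \<subseteq> obox (Suc n) u r" by (rule obox_mono[OF \<rho>(2)])
  have UU0: "?U \<subseteq> U0"
  proof
    fix w assume w: "w \<in> ?U"
    then have "w \<in> ?N" using slab(1)[OF \<rho>(1) uR] r(2) Nr by blast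
    moreover have "w(n := 0) = w" using w by (auto simp: obox_def Rn_def)
    ultimately show "w \<in> U0" by simp
  qed
  have iso: "ext (comb v) w i \<bullet> ext (comb v) w j = exth (combh v) w i \<bullet> exth (combh v) w j"
    if "w \<in> obox (Suc n) u \<rho>" "i < Suc n" "j < Suc n" for w i j
    by (rule kernel_isometric[OF U0(2) v U0(1) ker _ that(2,3)]) (use that(1) r(2) Nr in auto)
  have "\<exists>w\<in>obox (Suc n) u \<rho> - ?U. \<not> lin_indep {..<Suc n} (ext (comb v) w)"
  proof (rule gen[where V = "comb v" and Vh = "combh v" and U = ?U and N = "obox (Suc n) u \<rho>"])
    show "?U \<noteq> {}" using uR \<rho> by (metis empty_iff obox_self)
    show "openE n ?U" "openE (Suc n) (obox (Suc n) u \<rho>)" by (rule openE_obox)+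
    show "Cinf_on n ?U (comb v)" "Cinf_on n ?U (combh v)"
      by (rule Cinf_subset[OF VC(1) openE_obox UU0], rule Cinf_subset[OF VC(2) openE_obox UU0])
  qed (use UU0 U0(2) slab[OF \<rho>(1) uR] iso in auto)
  then obtain w where w: "w \<in> obox (Suc n) u \<rho>" "w \<notin> ?U" and nli: "\<not> lin_indep {..<Suc n} (ext (comb v) w)"
    by blast
  define u' where "u' = w(n := 0)"
  define t where "t = w n"
  have u': "u' \<in> ?U" unfolding u'_def by (rule slab(2)[OF \<rho>(1) uR w(1)])
  have t: "t \<noteq> 0" "\<bar>t\<bar> < \<delta>" using slab(3)[OF \<rho>(1) uR w] \<rho> by (auto simp: t_def)
  from nli obtain c where c: "(\<Sum>i<Suc n. c i *\<^sub>R ext (comb v) w i) = 0" and cn: "\<not> (\<forall>i\<in>{..<Suc n}. c i = 0)"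
    unfolding lin_indep_def by blast
  have ch: "(\<Sum>i<Suc n. c i *\<^sub>R exth (combh v) w i) = 0"
    by (rule gram_lin_indep[where w = "ext (comb v) w", OF _ c]) (use iso[OF w(1)] in auto)
  have cz: "c n \<noteq> 0"
  proof
    assume 0: "c n = 0"
    then have "(\<Sum>i<n. c i *\<^sub>R ext (comb v) w i) = 0" using c by simp
    then have "\<forall>i\<in>{..<n}. c i = 0" using lr Nr w(1) unfolding lin_indep_def by blast
    then show False using cn 0 by (auto simp: less_Suc_eq)
  qed
  define c' where "c' i = - c i / c n" for i
  have solve: "z = (\<Sum>i<n. c' i *\<^sub>R x i)" if "(\<Sum>i<n. c i *\<^sub>R x i) + c n *\<^sub>R z = 0" for x and z :: "'z::real_vector"
  proof -
    have "c n *\<^sub>R z = - (\<Sum>i<n. c i *\<^sub>R x i)" using that by (simp add: eq_neg_iff_add_eq_0 add.commute)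
    then have "(1 / c n) *\<^sub>R (c n *\<^sub>R z) = (1 / c n) *\<^sub>R (- (\<Sum>i<n. c i *\<^sub>R x i))" by simp
    then have "z = - ((1 / c n) *\<^sub>R (\<Sum>i<n. c i *\<^sub>R x i))" using cz by simp
    then show ?thesis by (simp add: c'_def scaleR_sum_right sum_negf)
  qed
  have "comb v u' = (\<Sum>i<n. c' i *\<^sub>R (partial i f u' + t *\<^sub>R partial i (comb v) u'))"
    by (rule solve) (use c in \<open>simp add: ext_def u'_def t_def\<close>)
  moreover have "combh v u' = (\<Sum>i<n. c' i *\<^sub>R (partial i fh u' + t *\<^sub>R partial i (combh v) u'))"
    by (rule solve) (use ch in \<open>simp add: exth_def u'_def t_def\<close>)
  moreover have "u' \<in> obox n u \<delta> \<inter> U0" using u' UU0 obox_mono[OF \<rho>(3)] by blast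
  ultimately show ?thesis using t by (intro bexI[of _ u'] exI[of _ t] exI[of _ c'] conjI) auto
qed

text \<open>What the geometric part needs around one point: a frame \<open>\<kappa>\<close> of the
  kernel made of tangent fields, and a lift \<open>y\<close> of an affine disc. The lift is common
  to \<open>f\<close> and \<open>fh\<close> because \<open>ruling_patch\<close> is applied to the
  pair. The conclusion \<open>r \<le> m\<close> makes the subtraction \<open>m - r\<close>
  exact.\<close>

lemma coordinate_rulings:
  assumes rank: "\<And>u. u \<in> S \<Longrightarrow> dim (range (phc u (\<lambda>i. Y i u))) = r" and u0: "u0 \<in> S"
  shows "r \<le> m" "\<exists>S' \<kappa> \<epsilon> y. openE n S' \<and> u0 \<in> S' \<and> S' \<subseteq> S \<and>
    (\<forall>k<m - r. \<forall>i<n. Cinf_on n S' (\<kappa> k i)) \<and>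
    (\<forall>u\<in>S'. \<forall>v. phc u (\<lambda>i. Y i u) v = 0 \<longleftrightarrow>
       (\<forall>a. n \<le> a \<and> a < m \<longrightarrow> v a = 0) \<and> (\<exists>c. \<forall>i<n. v i = (\<Sum>k<m - r. c k * \<kappa> k i u))) \<and>
    (\<forall>u\<in>S'. \<forall>c. (\<forall>i<n. (\<Sum>k<m - r. c k * \<kappa> k i u) = 0) \<longrightarrow> (\<forall>k<m - r. c k = 0)) \<and>
    \<epsilon> > 0 \<and> y (\<lambda>_. 0) = u0 \<and>
    (\<forall>i<n. Cinf_on (m - r) (obox (m - r) (\<lambda>_. 0) \<epsilon>) (\<lambda>a. y a i)) \<and>
    (\<forall>a\<in>obox (m - r) (\<lambda>_. 0) \<epsilon>. y a \<in> S' \<and>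
       f (y a) = f u0 + (\<Sum>k<m - r. a k *\<^sub>R (\<Sum>i<n. \<kappa> k i u0 *\<^sub>R partial i f u0)) \<and>
       fh (y a) = fh u0 + (\<Sum>k<m - r. a k *\<^sub>R (\<Sum>i<n. \<kappa> k i u0 *\<^sub>R partial i fh u0)))"
proof -
  show "r \<le> m" by (rule kernel_frame(1)[OF Y u0 rank])
  let ?d = "m - r"
  have "\<exists>S' \<kappa>. openE n S' \<and> u0 \<in> S' \<and> S' \<subseteq> S \<and>
    (\<forall>k<m - r. \<forall>a. Cinf_on n S' (\<kappa> k a)) \<and>
    (\<forall>u\<in>S'. \<forall>k<m - r. phc u (\<lambda>i. Y i u) (\<lambda>a. \<kappa> k a u) = 0) \<and>
    (\<forall>u\<in>S'. \<forall>v. phc u (\<lambda>i. Y i u) v = 0 \<longrightarrow> (\<exists>c. \<forall>a<m. v a = (\<Sum>k<m - r. c k * \<kappa> k a u))) \<and>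
    (\<forall>u\<in>S'. \<forall>c. (\<forall>a<m. (\<Sum>k<m - r. c k * \<kappa> k a u) = 0) \<longrightarrow> (\<forall>k<m - r. c k = 0))"
    by (rule kernel_frame(2)[OF Y u0 rank])
  then obtain S' \<kappa> where H: "openE n S' \<and> u0 \<in> S' \<and> S' \<subseteq> S \<and>
    (\<forall>k<m - r. \<forall>a. Cinf_on n S' (\<kappa> k a)) \<and>
    (\<forall>u\<in>S'. \<forall>k<m - r. phc u (\<lambda>i. Y i u) (\<lambda>a. \<kappa> k a u) = 0) \<and>
    (\<forall>u\<in>S'. \<forall>v. phc u (\<lambda>i. Y i u) v = 0 \<longrightarrow> (\<exists>c. \<forall>a<m. v a = (\<Sum>k<m - r. c k * \<kappa> k a u))) \<and>
    (\<forall>u\<in>S'. \<forall>c. (\<forall>a<m. (\<Sum>k<m - r. c k * \<kappa> k a u) = 0) \<longrightarrow> (\<forall>k<m - r. c k = 0))" by (elim exE)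
  have S': "openE n S'" "u0 \<in> S'" "S' \<subseteq> S" and kC: "\<And>k a. k < ?d \<Longrightarrow> Cinf_on n S' (\<kappa> k a)"
    and kker: "\<And>u k. u \<in> S' \<Longrightarrow> k < ?d \<Longrightarrow> phc u (\<lambda>i. Y i u) (\<lambda>a. \<kappa> k a u) = 0"
    using H by simp_all
  have kgen: "\<exists>c. \<forall>a<m. v a = (\<Sum>k<?d. c k * \<kappa> k a u)" if "u \<in> S'" "phc u (\<lambda>i. Y i u) v = 0" for u v
    using H that by simp
  have kind: "\<forall>k<?d. c k = 0" if "u \<in> S'" "\<forall>a<m. (\<Sum>k<?d. c k * \<kappa> k a u) = 0" for u c
    using H that by simp
  have ktan: "\<kappa> k a u = 0" if "u \<in> S'" "k < ?d" "n \<le> a" "a < m" for k a u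
    by (rule kernel_tangent[where v = "\<kappa> k", OF S'(1,3) _ _ that(1,3,4)]) (use kC kker that(2) in auto)
  \<comment> \<open>Constant coefficients \<open>a\<close> keep the combination in the kernel, since
    \<open>phc\<close> is linear in its last argument; this provides singular points for every
    direction of the disc.\<close>
  define vv where "vv a b u = (\<Sum>k<?d. a k * \<kappa> k b u)" for a :: "nat \<Rightarrow> real" and b u
  have vvC: "Cinf_on n S' (vv a b)" for a b
    unfolding vv_def[abs_def] by (rule Cinf_sum[OF S'(1)], rule Cinf_mult[OF Cinf_const[OF S'(1)]]) (use kC in auto)
  have vvker: "phc u (\<lambda>i. Y i u) (\<lambda>b. vv a b u) = 0" if u: "u \<in> S'" for a u
  proof -
    have "phc u (\<lambda>i. Y i u) (\<lambda>b. vv a b u) = (\<Sum>k<?d. a k *\<^sub>R phc u (\<lambda>i. Y i u) (\<lambda>b. \<kappa> k b u))"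
      unfolding phc_def vv_def scaleR_sum_left scaleR_sum_right by (subst sum.swap) simp
    then show ?thesis using kker[OF u] by simp
  qed
  have vvtan: "vv a b u = 0" if "u \<in> S'" "n \<le> b" "b < m" for a b u
    using ktan[OF that(1) _ that(2,3)] by (simp add: vv_def)
  let ?G = "\<lambda>u. (f u, fh u)"
  have fC: "Cinf_on n S' f" "Cinf_on n S' fh"
    by (rule Cinf_subset[OF f S'(1,3)], rule Cinf_subset[OF fh S'(1,3)])
  have dG: "partial i ?G u = (partial i f u, partial i fh u)" if "i < n" "u \<in> S'" for i u
    by (rule partial_Pair[OF fC that])
  \<comment> \<open>Duality for the pair already holds with the dual frame of \<open>f\<close> in
    the first slot and 0 in the second.\<close>
  interpret P: framed_immersion n S' ?G "\<lambda>i u. (es i u, 0)"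
  proof
    show "Cinf_on n S' ?G" by (rule Cinf_Pair[OF fC])
    show "Cinf_on n S' (\<lambda>u. (es i u, 0))" if "i < n" for i
      by (rule Cinf_Pair[OF Cinf_subset[OF es S'(1,3)] Cinf_const[OF S'(1)]]) (use that nm in simp)
    show "(es i u, 0) \<bullet> partial j ?G u = (if i = j then 1 else 0)" if "u \<in> S'" "i < n" "j < n" for u i j
      using dual[of u i j] e_f[of j u] that S'(3) nm by (auto simp: dG inner_Pair)
  qed
  define Zf where "Zf a u = (\<Sum>k<?d. a k *\<^sub>R (\<Sum>i<n. \<kappa> k i u *\<^sub>R partial i ?G u))" for a u
  have ZfP: "Zf a u = (comb (vv a) u, combh (vv a) u)" if u: "u \<in> S'" for a u
  proof -
    have "Zf a u = (\<Sum>i<n. vv a i u *\<^sub>R partial i ?G u)"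
      unfolding Zf_def vv_def scaleR_sum_left scaleR_sum_right by (subst sum.swap) simp
    also have "\<dots> = (\<Sum>i<n. (vv a i u *\<^sub>R e i u, vv a i u *\<^sub>R eh i u))"
      using e_f eh_fh S'(3) u by (intro sum.cong) (auto simp: dG)
    also have "\<dots> = (\<Sum>i<n. vv a i u *\<^sub>R e i u, \<Sum>i<n. vv a i u *\<^sub>R eh i u)" by (simp add: sum_prod)
    \<comment> \<open>The kernel sections have no component in \<open>L\<close>, so the sums over
      the whole frame reduce to its first \<open>n\<close> vectors.\<close>
    also have "\<dots> = (comb (vv a) u, combh (vv a) u)"
      unfolding comb_def combh_def by (simp only: sum_initial_segment[of n m "\<lambda>b. vv a b u", OF nm vvtan[OF u]])
    finally show ?thesis .
  qed
  have cC: "Cinf_on n S' (comb (vv a))" "Cinf_on n S' (combh (vv a))" for a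
    using Cinf_comb[OF S'(1,3), of "vv a"] vvC by auto
  have dZf: "partial i (Zf a) u = (partial i (comb (vv a)) u, partial i (combh (vv a)) u)" if "u \<in> S'" "i < n" for i a u
    using partial_cong[OF S'(1) that ZfP[of _ a]] partial_Pair[OF cC that(2,1), of a a] by simp
  have "\<exists>\<epsilon>>0. \<exists>y. y (\<lambda>_. 0) = u0 \<and>
    (\<forall>a\<in>obox ?d (\<lambda>_. 0) \<epsilon>. y a \<in> S' \<and> ?G (y a) = ?G u0 + Zf a u0) \<and>
    (\<forall>i<n. Cinf_on ?d (obox ?d (\<lambda>_. 0) \<epsilon>) (\<lambda>a. y a i))"
  proof (rule P.ruling_patch[where \<beta> = \<kappa> and Zf = Zf, OF _ S'(2) Zf_def])
    show "Cinf_on n S' (\<kappa> k i)" if "k < ?d" "i < n" for k i by (rule kC[OF that(1)])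
    fix a u and \<delta> :: real assume u: "u \<in> S'" and d: "\<delta> > 0"
    have "\<exists>u'\<in>obox n u \<delta> \<inter> S'. \<exists>t. 0 < \<bar>t\<bar> \<and> \<bar>t\<bar> < \<delta> \<and>
     (\<exists>c. comb (vv a) u' = (\<Sum>i<n. c i *\<^sub>R (partial i f u' + t *\<^sub>R partial i (comb (vv a)) u')) \<and>
          combh (vv a) u' = (\<Sum>i<n. c i *\<^sub>R (partial i fh u' + t *\<^sub>R partial i (combh (vv a)) u')))"
      by (rule kernel_singular[where v = "vv a", OF S'(1,3) vvC vvker u d])
    then obtain u' t c where u': "u' \<in> obox n u \<delta> \<inter> S'" and t: "0 < \<bar>t\<bar>" "\<bar>t\<bar> < \<delta>"
      and c: "comb (vv a) u' = (\<Sum>i<n. c i *\<^sub>R (partial i f u' + t *\<^sub>R partial i (comb (vv a)) u'))"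
         "combh (vv a) u' = (\<Sum>i<n. c i *\<^sub>R (partial i fh u' + t *\<^sub>R partial i (combh (vv a)) u'))"
      by (elim bexE exE conjE)
    have u'S: "u' \<in> S'" using u' by simp
    have "(\<Sum>i<n. c i *\<^sub>R (partial i ?G u' + t *\<^sub>R partial i (Zf a) u')) =
       (\<Sum>i<n. (c i *\<^sub>R (partial i f u' + t *\<^sub>R partial i (comb (vv a)) u'), c i *\<^sub>R (partial i fh u' + t *\<^sub>R partial i (combh (vv a)) u')))"
      by (intro sum.cong refl) (simp add: dG dZf u'S)
    also have "\<dots> = Zf a u'" unfolding sum_prod ZfP[OF u'S] using c by simp
    finally have "Zf a u' = (\<Sum>i<n. c i *\<^sub>R (partial i ?G u' + t *\<^sub>R partial i (Zf a) u'))" by simp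
    then show "\<exists>u'\<in>obox n u \<delta> \<inter> S'. \<exists>t. 0 < \<bar>t\<bar> \<and> \<bar>t\<bar> < \<delta> \<and>
     (\<exists>c. Zf a u' = (\<Sum>i<n. c i *\<^sub>R (partial i ?G u' + t *\<^sub>R partial i (Zf a) u')))"
      using u' t by (intro bexI[of _ u'] exI[of _ t] exI[of _ c] conjI)
  qed
  then obtain \<epsilon> y where \<epsilon>: "\<epsilon> > 0" and y0: "y (\<lambda>_. 0) = u0"
    and y: "\<forall>a\<in>obox ?d (\<lambda>_. 0) \<epsilon>. y a \<in> S' \<and> ?G (y a) = ?G u0 + Zf a u0"
    and yC: "\<forall>i<n. Cinf_on ?d (obox ?d (\<lambda>_. 0) \<epsilon>) (\<lambda>a. y a i)" by (elim exE conjE)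
  have Zfst: "fst (Zf a u0) = (\<Sum>k<?d. a k *\<^sub>R (\<Sum>i<n. \<kappa> k i u0 *\<^sub>R partial i f u0))"
    "snd (Zf a u0) = (\<Sum>k<?d. a k *\<^sub>R (\<Sum>i<n. \<kappa> k i u0 *\<^sub>R partial i fh u0))" for a
    unfolding Zf_def by (simp_all add: fst_sum snd_sum dG S'(2))
  have y': "y a \<in> S' \<and>
       f (y a) = f u0 + (\<Sum>k<?d. a k *\<^sub>R (\<Sum>i<n. \<kappa> k i u0 *\<^sub>R partial i f u0)) \<and>
       fh (y a) = fh u0 + (\<Sum>k<?d. a k *\<^sub>R (\<Sum>i<n. \<kappa> k i u0 *\<^sub>R partial i fh u0))"
    if "a \<in> obox ?d (\<lambda>_. 0) \<epsilon>" for a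
  proof -
    have "y a \<in> S'" and G: "?G (y a) = ?G u0 + Zf a u0" using y that by auto
    moreover have "f (y a) = f u0 + fst (Zf a u0)" "fh (y a) = fh u0 + snd (Zf a u0)"
      using arg_cong[OF G, of fst] arg_cong[OF G, of snd] by simp_all
    ultimately show ?thesis unfolding Zfst by simp
  qed
  have ker_iff: "phc u (\<lambda>i. Y i u) v = 0 \<longleftrightarrow>
       (\<forall>a. n \<le> a \<and> a < m \<longrightarrow> v a = 0) \<and> (\<exists>c. \<forall>i<n. v i = (\<Sum>k<?d. c k * \<kappa> k i u))" if u: "u \<in> S'" for u v
  proof
    assume "phc u (\<lambda>i. Y i u) v = 0"
    from kgen[OF u this] obtain c where c: "\<forall>a<m. v a = (\<Sum>k<?d. c k * \<kappa> k a u)" ..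
    then show "(\<forall>a. n \<le> a \<and> a < m \<longrightarrow> v a = 0) \<and> (\<exists>c. \<forall>i<n. v i = (\<Sum>k<?d. c k * \<kappa> k i u))"
      using ktan[OF u] nm by auto
  next
    assume A: "(\<forall>a. n \<le> a \<and> a < m \<longrightarrow> v a = 0) \<and> (\<exists>c. \<forall>i<n. v i = (\<Sum>k<?d. c k * \<kappa> k i u))"
    then obtain c where c: "\<forall>i<n. v i = (\<Sum>k<?d. c k * \<kappa> k i u)" by auto
    have "v b = vv c b u" if "b < m" for b
      using A c vvtan[OF u _ that] that by (cases "b < n") (auto simp: vv_def)
    then have "phc u (\<lambda>i. Y i u) v = phc u (\<lambda>i. Y i u) (\<lambda>b. vv c b u)" by (simp add: phc_def)
    then show "phc u (\<lambda>i. Y i u) v = 0" using vvker[OF u] by simp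
  qed
  have kind': "\<forall>k<?d. c k = 0" if u: "u \<in> S'" and c: "\<forall>i<n. (\<Sum>k<?d. c k * \<kappa> k i u) = 0" for u c
  proof (rule kind[OF u], intro allI impI)
    fix a assume "a < m"
    then show "(\<Sum>k<?d. c k * \<kappa> k a u) = 0" using c ktan[OF u] by (cases "a < n") auto
  qed
  show "\<exists>S' \<kappa> \<epsilon> y. openE n S' \<and> u0 \<in> S' \<and> S' \<subseteq> S \<and>
    (\<forall>k<m - r. \<forall>i<n. Cinf_on n S' (\<kappa> k i)) \<and>
    (\<forall>u\<in>S'. \<forall>v. phc u (\<lambda>i. Y i u) v = 0 \<longleftrightarrow>
       (\<forall>a. n \<le> a \<and> a < m \<longrightarrow> v a = 0) \<and> (\<exists>c. \<forall>i<n. v i = (\<Sum>k<m - r. c k * \<kappa> k i u))) \<and>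
    (\<forall>u\<in>S'. \<forall>c. (\<forall>i<n. (\<Sum>k<m - r. c k * \<kappa> k i u) = 0) \<longrightarrow> (\<forall>k<m - r. c k = 0)) \<and>
    \<epsilon> > 0 \<and> y (\<lambda>_. 0) = u0 \<and>
    (\<forall>i<n. Cinf_on (m - r) (obox (m - r) (\<lambda>_. 0) \<epsilon>) (\<lambda>a. y a i)) \<and>
    (\<forall>a\<in>obox (m - r) (\<lambda>_. 0) \<epsilon>. y a \<in> S' \<and>
       f (y a) = f u0 + (\<Sum>k<m - r. a k *\<^sub>R (\<Sum>i<n. \<kappa> k i u0 *\<^sub>R partial i f u0)) \<and>
       fh (y a) = fh u0 + (\<Sum>k<m - r. a k *\<^sub>R (\<Sum>i<n. \<kappa> k i u0 *\<^sub>R partial i fh u0)))"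
    apply (rule exI[of _ S'], rule exI[of _ \<kappa>], rule exI[of _ \<epsilon>], rule exI[of _ y])
    apply (intro conjI S' ballI allI ker_iff kind' y' \<epsilon> y0 yC)
    using kC kind' y' yC by auto
qed

end

end

section \<open>Smooth manifolds in charts\<close>

lemma Cinf_partial_compose:
  assumes F: "Cinf_on m S' F" and S: "openE n S" and G: "\<And>u. u \<in> S \<Longrightarrow> G u \<in> S'"
    and GC: "\<And>j. j < m \<Longrightarrow> Cinf_on n S (\<lambda>u. G u j)" and u: "u \<in> S" and i: "i < n"
  shows "partial i (\<lambda>u. F (G u)) u = (\<Sum>j<m. partial i (\<lambda>u. G u j) u *\<^sub>R partial j F (G u))"
proof -
  have "has_partial i (\<lambda>u. F (G u)) u (\<Sum>j<m. partial i (\<lambda>u. G u j) u *\<^sub>R partial j F (G u))"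
    by (rule has_partial_compose[where G = G, OF S Cinf_open[OF F] Cinf_Ck[OF F] G u i])
      (use Cinf_has_partial[OF GC i u] in auto)
  then show ?thesis unfolding partial_def[of i "\<lambda>u. F (G u)"] by (rule vector_derivative_at)
qed

text \<open>The tangent vector with coefficients \<open>a\<close> in a named chart;
  \<open>tangent_space\<close> hides both in an existential quantifier.\<close>

definition tv :: "'a mfd \<Rightarrow> 'a set \<Rightarrow> ('a \<Rightarrow> nat \<Rightarrow> real) \<Rightarrow> 'a \<Rightarrow> (nat \<Rightarrow> real) \<Rightarrow> 'a tvec"
  where "tv M C c x a =
    (\<lambda>h. if smooth_near M x h then \<Sum>i<mdim M. a i * partial i (h \<circ> inv_into C c) (c x) else 0)"

locale smooth_mfd =
  fixes M :: "'a mfd"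
  assumes M: "smooth_manifold M"
begin

abbreviation n where "n \<equiv> mdim M"

lemma
  assumes "(C, c) \<in> atlas M"
  shows chart_open_dom: "openin (mtop M) C" and chart_open_image: "openE n (c ` C)"
    and chart_embedding: "embedding_map (subtopology (mtop M) C) (Euclidean_space n) c"
  using M assms unfolding smooth_manifold_def by auto

lemma chart_transition:
  assumes "(C, c) \<in> atlas M" "(C', c') \<in> atlas M" "i < n"
  shows "Cinf_on n (c ` (C \<inter> C')) (\<lambda>u. c' (inv_into C c u) i)"
proof -
  have "\<forall>(C, c)\<in>atlas M. \<forall>(C', c')\<in>atlas M. \<forall>i<n. Cinf_on n (c ` (C \<inter> C')) (\<lambda>u. c' (inv_into C c u) i)"
    using M unfolding smooth_manifold_def by simp
  from bspec[OF this assms(1)] have "\<forall>(C', c')\<in>atlas M. \<forall>i<n. Cinf_on n (c ` (C \<inter> C')) (\<lambda>u. c' (inv_into C c u) i)"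
    by simp
  from bspec[OF this assms(2)] show ?thesis using assms(3) by simp
qed

lemma chart_cover: "x \<in> pts M \<Longrightarrow> \<exists>C c. (C, c) \<in> atlas M \<and> x \<in> C"
proof -
  assume x: "x \<in> pts M"
  have "(\<Union>(C, c)\<in>atlas M. C) = pts M" using M unfolding smooth_manifold_def by simp
  then show ?thesis using x by fastforce
qed

context
  fixes C c assumes Cc: "(C, c) \<in> atlas M"
begin

lemma chart_sub: "C \<subseteq> pts M" using chart_open_dom[OF Cc] openin_subset by blast

lemma chart_homeo: "homeomorphic_map (subtopology (mtop M) C) (subtopology (Euclidean_space n) (c ` C)) c"
  using chart_embedding[OF Cc] chart_sub unfolding embedding_map_def by (simp add: inf.absorb2)

lemma chart_inj: "inj_on c C"
  using homeomorphic_imp_injective_map[OF chart_homeo] chart_sub by (simp add: inf.absorb2)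

lemma chart_inv [simp]: "x \<in> C \<Longrightarrow> inv_into C c (c x) = x"
  using chart_inj by simp

lemma chart_inv2: "u \<in> c ` C \<Longrightarrow> inv_into C c u \<in> C" "u \<in> c ` C \<Longrightarrow> c (inv_into C c u) = u"
  by (rule inv_into_into, assumption) (rule f_inv_into_f)

lemma chart_open: "U \<subseteq> C \<Longrightarrow> openin (mtop M) U \<longleftrightarrow> openE n (c ` U)"
proof -
  assume U: "U \<subseteq> C"
  have "openin (subtopology (Euclidean_space n) (c ` C)) (c ` U) \<longleftrightarrow> openin (subtopology (mtop M) C) U"
    by (rule homeomorphic_map_openness[OF chart_homeo]) (use U chart_sub in auto)
  then show ?thesis
    using openin_open_subtopology[OF chart_open_dom[OF Cc]] openin_open_subtopology[OF chart_open_image[OF Cc]] U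
    by (metis image_mono)
qed

lemma chart_image_Rn: "x \<in> C \<Longrightarrow> c x \<in> Rn n"
  using openE_subset[OF chart_open_image[OF Cc]] by auto

end

section \<open>Smooth functions on a manifold\<close>

lemma smooth_on_open: "smooth_on M U h \<Longrightarrow> openin (mtop M) U"
  by (simp add: smooth_on_def)

lemma smooth_on_chartD: "smooth_on M U h \<Longrightarrow> (C, c) \<in> atlas M \<Longrightarrow> Cinf_on n (c ` (C \<inter> U)) (h \<circ> inv_into C c)"
  unfolding smooth_on_def by auto

lemma smooth_on_chartI:
  assumes Cc: "(C, c) \<in> atlas M" and U: "U \<subseteq> C" and h: "Cinf_on n (c ` U) (h \<circ> inv_into C c)"
  shows "smooth_on M U h"
  unfolding smooth_on_def
proof (intro conjI ballI)
  show oU: "openin (mtop M) U" using chart_open[OF Cc U] Cinf_open[OF h] by simp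
  fix p assume "p \<in> atlas M"
  then obtain C' c' where p: "p = (C', c')" and C': "(C', c') \<in> atlas M" by (cases p) auto
  let ?G = "\<lambda>u. c (inv_into C' c' u)"
  have "openin (mtop M) (C' \<inter> U)" using oU chart_open_dom[OF C'] by (simp add: openin_Int)
  then have o: "openE n (c' ` (C' \<inter> U))" using chart_open[OF C', of "C' \<inter> U"] by simp
  have "Cinf_on n (c' ` (C' \<inter> U)) (\<lambda>u. (h \<circ> inv_into C c) (?G u))"
  proof (rule Cinf_compose[where G = ?G, OF h o])
    show "?G u \<in> c ` U" if "u \<in> c' ` (C' \<inter> U)" for u using that chart_inv[OF C'] by auto
    show "Cinf_on n (c' ` (C' \<inter> U)) (\<lambda>u. ?G u j)" if "j < n" for j
      by (rule Cinf_subset[OF chart_transition[OF C' Cc that] o]) (use U in auto)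
  qed
  then have "Cinf_on n (c' ` (C' \<inter> U)) (h \<circ> inv_into C' c')"
  proof (rule Cinf_cong)
    fix u assume "u \<in> c' ` (C' \<inter> U)"
    then obtain y where "y \<in> C'" "y \<in> U" "u = c' y" by auto
    then show "(h \<circ> inv_into C c) (?G u) = (h \<circ> inv_into C' c') u"
      using chart_inv[OF C'] chart_inv[OF Cc] U by auto
  qed
  then show "case p of (C, c) \<Rightarrow> Cinf_on n (c ` (C \<inter> U)) (h \<circ> inv_into C c)" by (simp add: p)
qed

lemma smooth_on_subset:
  assumes h: "smooth_on M U h" and V: "openin (mtop M) V" "V \<subseteq> U"
  shows "smooth_on M V h"
  unfolding smooth_on_def
proof (intro conjI ballI V)
  fix p assume "p \<in> atlas M"
  then obtain C c where p: "p = (C, c)" and Cc: "(C, c) \<in> atlas M" by (cases p) auto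
  have "openin (mtop M) (C \<inter> V)" using V chart_open_dom[OF Cc] by (simp add: openin_Int)
  then have o: "openE n (c ` (C \<inter> V))" using chart_open[OF Cc, of "C \<inter> V"] by simp
  have "Cinf_on n (c ` (C \<inter> V)) (h \<circ> inv_into C c)"
    by (rule Cinf_subset[OF smooth_on_chartD[OF h Cc] o]) (use V in auto)
  then show "case p of (C, c) \<Rightarrow> Cinf_on n (c ` (C \<inter> V)) (h \<circ> inv_into C c)" by (simp add: p)
qed

lemma smooth_on_cong:
  assumes h: "smooth_on M U h" and eq: "\<And>y. y \<in> U \<Longrightarrow> h y = k y"
  shows "smooth_on M U k"
  unfolding smooth_on_def
proof (intro conjI ballI smooth_on_open[OF h])
  fix p assume "p \<in> atlas M"
  then obtain C c where p: "p = (C, c)" and Cc: "(C, c) \<in> atlas M" by (cases p) auto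
  have "Cinf_on n (c ` (C \<inter> U)) (k \<circ> inv_into C c)"
    by (rule Cinf_cong[OF smooth_on_chartD[OF h Cc]]) (use eq chart_inv[OF Cc] in auto)
  then show "case p of (C, c) \<Rightarrow> Cinf_on n (c ` (C \<inter> U)) (k \<circ> inv_into C c)" by (simp add: p)
qed

lemma smooth_onI:
  "openin (mtop M) U \<Longrightarrow> (\<And>C c. (C, c) \<in> atlas M \<Longrightarrow> Cinf_on n (c ` (C \<inter> U)) (h \<circ> inv_into C c)) \<Longrightarrow> smooth_on M U h"
  unfolding smooth_on_def by (simp add: split_paired_all)

lemma smooth_on_linear:
  assumes L: "bounded_linear L" and h: "smooth_on M U h" shows "smooth_on M U (\<lambda>x. L (h x))"
proof (rule smooth_onI[OF smooth_on_open[OF h]])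
  fix C c assume Cc: "(C, c) \<in> atlas M"
  show "Cinf_on n (c ` (C \<inter> U)) ((\<lambda>x. L (h x)) \<circ> inv_into C c)"
    using Cinf_linear[OF L smooth_on_chartD[OF h Cc]] unfolding o_def .
qed

lemma smooth_on_bilinear:
  assumes B: "bounded_bilinear B" and h: "smooth_on M U h" and k: "smooth_on M U k"
  shows "smooth_on M U (\<lambda>x. B (h x) (k x))"
proof (rule smooth_onI[OF smooth_on_open[OF h]])
  fix C c assume Cc: "(C, c) \<in> atlas M"
  show "Cinf_on n (c ` (C \<inter> U)) ((\<lambda>x. B (h x) (k x)) \<circ> inv_into C c)"
    using Cinf_bilinear[OF B smooth_on_chartD[OF h Cc] smooth_on_chartD[OF k Cc]] unfolding o_def .
qed

lemma smooth_on_add: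
  assumes h: "smooth_on M U h" and k: "smooth_on M U k"
  shows "smooth_on M U (\<lambda>x. h x + k x)"
proof (rule smooth_onI[OF smooth_on_open[OF h]])
  fix C c assume Cc: "(C, c) \<in> atlas M"
  show "Cinf_on n (c ` (C \<inter> U)) ((\<lambda>x. h x + k x) \<circ> inv_into C c)"
    using Cinf_add[OF smooth_on_chartD[OF h Cc] smooth_on_chartD[OF k Cc]] unfolding o_def .
qed

lemma smooth_on_local:
  assumes "\<And>x. x \<in> U \<Longrightarrow> \<exists>V. x \<in> V \<and> V \<subseteq> U \<and> smooth_on M V h"
  shows "smooth_on M U h"
  unfolding smooth_on_def
proof (intro conjI ballI)
  show oU: "openin (mtop M) U"
  proof (subst openin_subopen, intro ballI)
    fix x assume "x \<in> U"
    then obtain V where "x \<in> V" "V \<subseteq> U" "smooth_on M V h" using assms by blast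
    then show "\<exists>T. openin (mtop M) T \<and> x \<in> T \<and> T \<subseteq> U" using smooth_on_open by blast
  qed
  fix p assume "p \<in> atlas M"
  then obtain C c where p: "p = (C, c)" and Cc: "(C, c) \<in> atlas M" by (cases p) auto
  have "Cinf_on n (c ` (C \<inter> U)) (h \<circ> inv_into C c)"
  proof (rule Cinf_local)
    fix u assume "u \<in> c ` (C \<inter> U)"
    then obtain x where x: "x \<in> C" "x \<in> U" "u = c x" by auto
    obtain V where V: "x \<in> V" "V \<subseteq> U" "smooth_on M V h" using assms[OF x(2)] by blast
    show "\<exists>T. u \<in> T \<and> T \<subseteq> c ` (C \<inter> U) \<and> Cinf_on n T (h \<circ> inv_into C c)"
      using smooth_on_chartD[OF V(3) Cc] V x by (intro exI[of _ "c ` (C \<inter> V)"]) auto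
  qed
  then show "case p of (C, c) \<Rightarrow> Cinf_on n (c ` (C \<inter> U)) (h \<circ> inv_into C c)" by (simp add: p)
qed

lemma smooth_near_local:
  assumes "smooth_near M x h" "openin (mtop M) W" "x \<in> W"
  shows "\<exists>U. x \<in> U \<and> U \<subseteq> W \<and> smooth_on M U h"
proof -
  obtain U where U: "x \<in> U" "smooth_on M U h" using assms(1) by (auto simp: smooth_near_def)
  then have "smooth_on M (U \<inter> W) h"
    using smooth_on_subset[OF U(2)] smooth_on_open[OF U(2)] assms(2) by (simp add: openin_Int)
  then show ?thesis using U(1) assms(3) by (intro exI[of _ "U \<inter> W"]) simp
qed

lemma smooth_nearI: "smooth_on M U h \<Longrightarrow> x \<in> U \<Longrightarrow> smooth_near M x h"
  by (auto simp: smooth_near_def)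

subsection \<open>Tangent vectors\<close>

context
  fixes C c assumes Cc: "(C, c) \<in> atlas M"
begin

lemma smooth_coord: "i < n \<Longrightarrow> smooth_on M C (\<lambda>y. c y i)"
proof (rule smooth_on_chartI[OF Cc subset_refl])
  assume "i < n"
  show "Cinf_on n (c ` C) ((\<lambda>y. c y i) \<circ> inv_into C c)"
    by (rule Cinf_cong[OF Cinf_coord[OF chart_open_image[OF Cc], of i]]) (use chart_inv[OF Cc] in auto)
qed

lemma tv_apply:
  "smooth_on M U h \<Longrightarrow> x \<in> U \<Longrightarrow> tv M C c x a h = (\<Sum>i<n. a i * partial i (h \<circ> inv_into C c) (c x))"
  by (auto simp: tv_def smooth_near_def)

lemma chart_partial_cong:
  assumes "openin (mtop M) U" "x \<in> U" "x \<in> C" "i < n" "\<And>y. y \<in> U \<Longrightarrow> h y = k y"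
  shows "partial i (h \<circ> inv_into C c) (c x) = partial i (k \<circ> inv_into C c) (c x)"
proof (rule partial_cong)
  have "openin (mtop M) (C \<inter> U)" using assms(1) chart_open_dom[OF Cc] by (simp add: openin_Int)
  then show "openE n (c ` (C \<inter> U))" using chart_open[OF Cc, of "C \<inter> U"] by simp
qed (use assms chart_inv[OF Cc] in auto)

lemma tv_coord:
  assumes x: "x \<in> C" and i: "i < n" shows "tv M C c x a (\<lambda>y. c y i) = a i"
proof -
  have "partial j ((\<lambda>y. c y i) \<circ> inv_into C c) (c x) = (if j = i then 1 else 0)" if j: "j < n" for j
  proof -
    have "partial j ((\<lambda>y. c y i) \<circ> inv_into C c) (c x) = partial j (\<lambda>u. u i) (c x)"
      by (rule partial_cong[OF chart_open_image[OF Cc] _ j]) (use x chart_inv[OF Cc] in auto)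
    then show ?thesis by (simp add: partial_coord)
  qed
  then have "tv M C c x a (\<lambda>y. c y i) = (\<Sum>j<n. a j * (if j = i then 1 else 0))"
    using tv_apply[OF smooth_coord[OF i] x] by simp
  also have "\<dots> = (\<Sum>j<n. if j = i then a j else 0)" by (intro sum.cong) auto
  finally show ?thesis using i by simp
qed

lemma tv_cong: "(\<And>i. i < n \<Longrightarrow> a i = b i) \<Longrightarrow> tv M C c x a = tv M C c x b"
  by (auto simp: tv_def fun_eq_iff)

lemma tv_zero_iff: "x \<in> C \<Longrightarrow> tv M C c x a = (\<lambda>_. 0) \<longleftrightarrow> (\<forall>i<n. a i = 0)"
proof
  assume "x \<in> C" "tv M C c x a = (\<lambda>_. 0)"
  then show "\<forall>i<n. a i = 0" using tv_coord[of x _ a] by auto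
next
  assume "\<forall>i<n. a i = 0" then show "tv M C c x a = (\<lambda>_. 0)" by (auto simp: tv_def fun_eq_iff)
qed

lemma tv_sum: "(\<lambda>h. \<Sum>k\<in>K. s k * tv M C c x (a k) h) = tv M C c x (\<lambda>i. \<Sum>k\<in>K. s k * a k i)"
proof
  fix h
  show "(\<Sum>k\<in>K. s k * tv M C c x (a k) h) = tv M C c x (\<lambda>i. \<Sum>k\<in>K. s k * a k i) h"
  proof (cases "smooth_near M x h")
    case True
    have "(\<Sum>k\<in>K. s k * (\<Sum>i<n. a k i * partial i (h \<circ> inv_into C c) (c x))) =
      (\<Sum>i<n. (\<Sum>k\<in>K. s k * a k i) * partial i (h \<circ> inv_into C c) (c x))"
      unfolding sum_distrib_left sum_distrib_right by (subst sum.swap) (simp add: mult.assoc)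
    then show ?thesis using True by (simp add: tv_def)
  qed (simp add: tv_def)
qed

end

text \<open>The chain rule for the transition map. It frees the description of a tangent vector from
  the chart that was used to introduce it.\<close>

lemma tv_change_chart:
  assumes Cc: "(C, c) \<in> atlas M" and Cc': "(C', c') \<in> atlas M" and x: "x \<in> C" "x \<in> C'"
  shows "tv M C' c' x a = tv M C c x (\<lambda>i. \<Sum>j<n. a j * partial j (\<lambda>u. c (inv_into C' c' u) i) (c' x))"
proof
  fix h
  let ?b = "\<lambda>i. \<Sum>j<n. a j * partial j (\<lambda>u. c (inv_into C' c' u) i) (c' x)"
  show "tv M C' c' x a h = tv M C c x ?b h"
  proof (cases "smooth_near M x h")
    case True
    have "openin (mtop M) (C \<inter> C')" using chart_open_dom[OF Cc] chart_open_dom[OF Cc'] by (simp add: openin_Int)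
    from smooth_near_local[OF True this] x obtain U where U: "x \<in> U" "U \<subseteq> C \<inter> C'" "smooth_on M U h" by blast
    have CU: "C \<inter> U = U" "C' \<inter> U = U" using U(2) by auto
    have hC: "Cinf_on n (c ` U) (h \<circ> inv_into C c)" using smooth_on_chartD[OF U(3) Cc] CU by simp
    have o': "openE n (c' ` U)" using chart_open[OF Cc', of U] U smooth_on_open by auto
    let ?G = "\<lambda>u. c (inv_into C' c' u)"
    have p: "partial j (h \<circ> inv_into C' c') (c' x) =
        (\<Sum>i<n. partial j (\<lambda>u. ?G u i) (c' x) * partial i (h \<circ> inv_into C c) (c x))" if j: "j < n" for j
    proof -
      have "partial j (h \<circ> inv_into C' c') (c' x) = partial j (\<lambda>u. (h \<circ> inv_into C c) (?G u)) (c' x)"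
      proof (rule partial_cong[OF o' _ j])
        fix v assume "v \<in> c' ` U"
        then obtain y where "y \<in> U" "v = c' y" by auto
        moreover from this have "y \<in> C" "y \<in> C'" using U(2) by auto
        ultimately show "(h \<circ> inv_into C' c') v = (h \<circ> inv_into C c) (?G v)"
          using chart_inv[OF Cc] chart_inv[OF Cc'] by auto
      qed (use U in auto)
      also have "\<dots> = (\<Sum>i<n. partial j (\<lambda>u. ?G u i) (c' x) *\<^sub>R partial i (h \<circ> inv_into C c) (?G (c' x)))"
      proof (rule Cinf_partial_compose[where G = ?G, OF hC o' _ _ _ j])
        show "?G u \<in> c ` U" if "u \<in> c' ` U" for u using that chart_inv[OF Cc'] U(2) by auto
        show "Cinf_on n (c' ` U) (\<lambda>u. ?G u i)" if "i < n" for i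
          by (rule Cinf_subset[OF chart_transition[OF Cc' Cc that] o']) (use U in auto)
      qed (use U in auto)
      finally show ?thesis using x chart_inv[OF Cc'] by simp
    qed
    have "tv M C' c' x a h = (\<Sum>j<n. a j * (\<Sum>i<n. partial j (\<lambda>u. ?G u i) (c' x) * partial i (h \<circ> inv_into C c) (c x)))"
      using True p by (simp add: tv_def)
    also have "\<dots> = (\<Sum>i<n. ?b i * partial i (h \<circ> inv_into C c) (c x))"
      unfolding sum_distrib_left sum_distrib_right by (subst sum.swap) (simp add: mult.assoc)
    finally show ?thesis using True by (simp add: tv_def)
  qed (simp add: tv_def)
qed

lemma tangent_space_chart:
  assumes Cc: "(C, c) \<in> atlas M" and x: "x \<in> C"
  shows "tangent_space M x = range (tv M C c x)"
proof
  show "tangent_space M x \<subseteq> range (tv M C c x)"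
  proof
    fix X assume "X \<in> tangent_space M x"
    then obtain C' c' a where C': "(C', c') \<in> atlas M" "x \<in> C'" and X: "X = tv M C' c' x a"
      unfolding tangent_space_def tv_def by auto
    show "X \<in> range (tv M C c x)" unfolding X tv_change_chart[OF Cc C'(1) x C'(2)] by (rule rangeI)
  qed
  show "range (tv M C c x) \<subseteq> tangent_space M x"
    using Cc x unfolding tangent_space_def tv_def by blast
qed

context
  fixes C c assumes Cc: "(C, c) \<in> atlas M"
begin

lemma deriv_along_tv:
  fixes F :: "'a \<Rightarrow> 'b::euclidean_space"
  assumes x: "x \<in> C" "x \<in> U" and F: "smooth_on M U F"
  shows "deriv_along (tv M C c x a) F = (\<Sum>i<n. a i *\<^sub>R partial i (F \<circ> inv_into C c) (c x))"
proof -
  let ?p = "\<lambda>i. partial i (F \<circ> inv_into C c) (c x)"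
  have "tv M C c x a (\<lambda>y. F y \<bullet> b) = (\<Sum>i<n. a i * (?p i \<bullet> b))" for b
  proof -
    have "smooth_on M U (\<lambda>y. F y \<bullet> b)" by (rule smooth_on_linear[OF bounded_linear_inner_left F])
    from tv_apply[OF Cc this x(2)]
    have "tv M C c x a (\<lambda>y. F y \<bullet> b) = (\<Sum>i<n. a i * partial i (\<lambda>u. (F \<circ> inv_into C c) u \<bullet> b) (c x))"
      by (simp add: o_def)
    also have "\<dots> = (\<Sum>i<n. a i * (?p i \<bullet> b))"
      by (intro sum.cong refl arg_cong2[where f = "(*)"] partial_linear[OF bounded_linear_inner_left smooth_on_chartD[OF F Cc]])
         (use x in auto)
    finally show ?thesis .
  qed
  then have "deriv_along (tv M C c x a) F = (\<Sum>b\<in>Basis. ((\<Sum>i<n. a i *\<^sub>R ?p i) \<bullet> b) *\<^sub>R b)"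
    by (simp add: deriv_along_def inner_sum_left)
  then show ?thesis by (simp add: euclidean_representation)
qed

lemma vector_field_tv:
  assumes U: "openin (mtop M) U" "U \<subseteq> C" and \<alpha>: "\<And>i. i < n \<Longrightarrow> Cinf_on n (c ` U) (\<alpha> i)"
  shows "vector_field M U (\<lambda>y. tv M C c y (\<lambda>i. \<alpha> i (c y)))"
  unfolding vector_field_def
proof (intro conjI ballI allI impI U(1))
  show "tv M C c x (\<lambda>i. \<alpha> i (c x)) \<in> tangent_space M x" if "x \<in> U" for x
    using tangent_space_chart[OF Cc, of x] that U(2) by auto
  fix V and h :: "'a \<Rightarrow> real" assume Vh: "V \<subseteq> U \<and> smooth_on M V h"
  have CV: "C \<inter> V = V" using Vh U by auto
  have hC: "Cinf_on n (c ` V) (h \<circ> inv_into C c)" using smooth_on_chartD[OF conjunct2[OF Vh] Cc] CV by simp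
  have o: "openE n (c ` V)" by (rule Cinf_open[OF hC])
  show "smooth_on M V (\<lambda>y. tv M C c y (\<lambda>i. \<alpha> i (c y)) h)"
  proof (rule smooth_on_chartI[OF Cc])
    show "V \<subseteq> C" using CV by auto
    have "Cinf_on n (c ` V) (\<lambda>u. \<Sum>i<n. \<alpha> i u * partial i (h \<circ> inv_into C c) u)"
      by (rule Cinf_sum[OF o], rule Cinf_mult)
         (use Cinf_subset[OF \<alpha> o] Vh Cinf_partial[OF hC] in auto)
    then show "Cinf_on n (c ` V) ((\<lambda>y. tv M C c y (\<lambda>i. \<alpha> i (c y)) h) \<circ> inv_into C c)"
    proof (rule Cinf_cong)
      fix u assume "u \<in> c ` V"
      then obtain y where y: "y \<in> V" "u = c y" by auto
      then have "inv_into C c u = y" using CV chart_inv[OF Cc] by auto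
      then show "(\<Sum>i<n. \<alpha> i u * partial i (h \<circ> inv_into C c) u) = ((\<lambda>y. tv M C c y (\<lambda>i. \<alpha> i (c y)) h) \<circ> inv_into C c) u"
        using tv_apply[OF Cc conjunct2[OF Vh] y(1), of "\<lambda>i. \<alpha> i (c y)"] y by simp
    qed
  qed
qed

text \<open>A smooth vector field maps smooth functions to smooth functions; applied to the
  coordinate functions this is smoothness of its components.\<close>

lemma vector_field_coeffs:
  assumes X: "vector_field M U X" and i: "i < n"
  shows "Cinf_on n (c ` (C \<inter> U)) (\<lambda>u. X (inv_into C c u) (\<lambda>y. c y i))"
proof -
  have oU: "openin (mtop M) (C \<inter> U)" using X chart_open_dom[OF Cc] by (simp add: vector_field_def openin_Int)
  have "smooth_on M (C \<inter> U) (\<lambda>y. c y i)" by (rule smooth_on_subset[OF smooth_coord[OF Cc i] oU]) auto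
  then have "smooth_on M (C \<inter> U) (\<lambda>y. X y (\<lambda>y. c y i))"
    using X unfolding vector_field_def by (meson Int_lower2)
  from smooth_on_chartD[OF this Cc] show ?thesis by (simp add: o_def Int_absorb1)
qed

lemma tangent_coeffs:
  assumes x: "x \<in> C" and X: "X \<in> tangent_space M x"
  shows "X = tv M C c x (\<lambda>i. X (\<lambda>y. c y i))"
proof -
  obtain a where a: "X = tv M C c x a" using X tangent_space_chart[OF Cc x] by auto
  show ?thesis unfolding a using tv_coord[OF Cc x] by (intro tv_cong[OF Cc]) auto
qed

end

lemma vector_field_subset:
  "vector_field M U X \<Longrightarrow> openin (mtop M) V \<Longrightarrow> V \<subseteq> U \<Longrightarrow> vector_field M V X"
  unfolding vector_field_def by (meson subset_iff subset_trans)

lemma vector_field_tangent: "vector_field M U X \<Longrightarrow> x \<in> U \<Longrightarrow> X x \<in> tangent_space M x"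
  unfolding vector_field_def by blast

lemma vector_field_open: "vector_field M U X \<Longrightarrow> openin (mtop M) U"
  unfolding vector_field_def by blast

text \<open>Tangent vectors act on total functions, whereas identities such as those for the metric
  or for \<open>deriv_along\<close> hold on an open set only. Locality bridges the two.\<close>

lemma tangent_local:
  assumes X: "X \<in> tangent_space M x" and x: "x \<in> pts M" and U: "x \<in> U" and h: "smooth_on M U h"
    and eq: "\<And>y. y \<in> U \<Longrightarrow> h y = k y"
  shows "X h = X k"
proof -
  obtain C c where Cc: "(C, c) \<in> atlas M" "x \<in> C" using chart_cover[OF x] by blast
  obtain a where a: "X = tv M C c x a" using X tangent_space_chart[OF Cc] by auto
  have k: "smooth_on M U k" by (rule smooth_on_cong[OF h eq])
  show ?thesis unfolding a tv_apply[OF Cc(1) h U] tv_apply[OF Cc(1) k U]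
    by (intro sum.cong refl arg_cong2[where f = "(*)"] chart_partial_cong[OF Cc(1) smooth_on_open[OF h] U Cc(2) _ eq]) auto
qed

end

subsection \<open>Open submanifolds\<close>

locale open_submfd = smooth_mfd +
  fixes V assumes V: "openin (mtop M) V"
begin

abbreviation "M' \<equiv> open_sub M V"

lemma V_sub [simp]: "pts M \<inter> V = V" using openin_subset[OF V] by auto

lemma sub_simps [simp]: "mdim M' = n" "mtop M' = subtopology (mtop M) V"
  by (auto simp: open_sub_def)

lemma sub_atlas: "atlas M' = (\<lambda>(C, c). (C \<inter> V, c)) ` atlas M" by (simp add: open_sub_def)

lemma sub_open: "openin (mtop M') U \<longleftrightarrow> openin (mtop M) U \<and> U \<subseteq> V"
  by (simp add: openin_open_subtopology[OF V])

lemma sub_inv: "(C, c) \<in> atlas M \<Longrightarrow> x \<in> C \<Longrightarrow> x \<in> V \<Longrightarrow> inv_into (C \<inter> V) c (c x) = x"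
  using chart_inj by (metis IntI inf_le1 inj_on_subset inv_into_f_f)

lemma sub_smooth_on: "smooth_on M' U h \<longleftrightarrow> smooth_on M U h \<and> U \<subseteq> V"
proof (cases "U \<subseteq> V")
  case False
  then show ?thesis unfolding smooth_on_def sub_open by simp
next
  case U: True
  have key: "Cinf_on n (c ` (C \<inter> V \<inter> U)) (h \<circ> inv_into (C \<inter> V) c) \<longleftrightarrow> Cinf_on n (c ` (C \<inter> U)) (h \<circ> inv_into C c)"
    if Cc: "(C, c) \<in> atlas M" for C c
  proof -
    have CU: "C \<inter> V \<inter> U = C \<inter> U" using U by auto
    have eq: "(h \<circ> inv_into (C \<inter> V) c) u = (h \<circ> inv_into C c) u" if u: "u \<in> c ` (C \<inter> U)" for u
    proof -
      from u obtain y where "y \<in> C" "y \<in> U" "u = c y" by blast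
      moreover from this have "y \<in> V" using U by auto
      ultimately show ?thesis using sub_inv[OF Cc] chart_inv[OF Cc] by simp
    qed
    show ?thesis unfolding CU
    proof
      assume "Cinf_on n (c ` (C \<inter> U)) (h \<circ> inv_into (C \<inter> V) c)"
      then show "Cinf_on n (c ` (C \<inter> U)) (h \<circ> inv_into C c)" by (rule Cinf_cong) (rule eq)
    next
      assume "Cinf_on n (c ` (C \<inter> U)) (h \<circ> inv_into C c)"
      then show "Cinf_on n (c ` (C \<inter> U)) (h \<circ> inv_into (C \<inter> V) c)" by (rule Cinf_cong) (rule eq[symmetric])
    qed
  qed
  have "(\<forall>p\<in>atlas M'. case p of (C, c) \<Rightarrow> Cinf_on n (c ` (C \<inter> U)) (h \<circ> inv_into C c)) \<longleftrightarrow>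
     (\<forall>p\<in>atlas M. case p of (C, c) \<Rightarrow> Cinf_on n (c ` (C \<inter> V \<inter> U)) (h \<circ> inv_into (C \<inter> V) c))"
    unfolding sub_atlas by (simp add: split_def)
  also have "\<dots> \<longleftrightarrow> (\<forall>p\<in>atlas M. case p of (C, c) \<Rightarrow> Cinf_on n (c ` (C \<inter> U)) (h \<circ> inv_into C c))"
    by (rule ball_cong[OF refl]) (use key in \<open>simp add: split_paired_all\<close>)
  finally show ?thesis using U unfolding smooth_on_def sub_open by simp
qed

lemma sub_smooth_near:
  assumes x: "x \<in> V" shows "smooth_near M' x h \<longleftrightarrow> smooth_near M x h"
proof
  assume "smooth_near M' x h"
  then obtain U where "x \<in> U" "smooth_on M' U h" by (auto simp: smooth_near_def)
  then show "smooth_near M x h" by (intro smooth_nearI[of U h x]) (simp_all add: sub_smooth_on)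
next
  assume "smooth_near M x h"
  from smooth_near_local[OF this V x] obtain U where "x \<in> U" "U \<subseteq> V" "smooth_on M U h" by (elim exE conjE)
  then have "smooth_on M' U h" by (simp add: sub_smooth_on)
  then show "smooth_near M' x h" using \<open>x \<in> U\<close> unfolding smooth_near_def by (intro exI[of _ U] conjI)
qed

lemma sub_tv:
  assumes Cc: "(C, c) \<in> atlas M" and x: "x \<in> C" "x \<in> V"
  shows "tv M' (C \<inter> V) c x a = tv M C c x a"
proof
  fix h :: "'a \<Rightarrow> real"
  have o: "openE n (c ` (C \<inter> V))"
    using chart_open[OF Cc, of "C \<inter> V"] V chart_open_dom[OF Cc] by (simp add: openin_Int)
  have "partial i (h \<circ> inv_into (C \<inter> V) c) (c x) = partial i (h \<circ> inv_into C c) (c x)" if "i < n" for i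
    by (rule partial_cong[OF o _ that]) (use x sub_inv[OF Cc] chart_inv[OF Cc] in auto)
  then show "tv M' (C \<inter> V) c x a h = tv M C c x a h" by (simp add: tv_def sub_smooth_near[OF x(2)])
qed

lemma smooth_sub: "smooth_manifold M'"
  unfolding smooth_manifold_def sub_simps
proof (intro conjI)
  show "Hausdorff_space (subtopology (mtop M) V)" "second_countable (subtopology (mtop M) V)"
    using M unfolding smooth_manifold_def by (simp_all add: Hausdorff_space_subtopology second_countable_subtopology)
  show "(\<Union>(C, c)\<in>atlas M'. C) = topspace (subtopology (mtop M) V)"
  proof -
    have "(\<Union>(C, c)\<in>atlas M. C) = pts M" using M unfolding smooth_manifold_def by simp
    then have "(\<Union>p\<in>atlas M. fst p \<inter> V) = V" using openin_subset[OF V] by (simp add: split_def flip: UN_extend_simps(5))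
    then show ?thesis unfolding sub_atlas by (simp add: split_def)
  qed
  show "\<forall>(C, c)\<in>atlas M'. openin (subtopology (mtop M) V) C \<and> openE n (c ` C) \<and>
       embedding_map (subtopology (subtopology (mtop M) V) C) (Euclidean_space n) c"
  proof (clarify)
    fix C' c assume "(C', c) \<in> atlas M'"
    then obtain C where Cc: "(C, c) \<in> atlas M" and C': "C' = C \<inter> V" unfolding sub_atlas by auto
    have oCV: "openin (mtop M) (C \<inter> V)" using V chart_open_dom[OF Cc] by (simp add: openin_Int)
    have "homeomorphic_map (subtopology (subtopology (mtop M) C) (C \<inter> V)) (subtopology (subtopology (Euclidean_space n) (c ` C)) (c ` (C \<inter> V))) c"
      by (rule homeomorphic_map_subtopologies[OF chart_homeo[OF Cc]])
         (use chart_sub[OF Cc] openE_subset[OF chart_open_image[OF Cc]] in auto)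
    moreover have "C \<inter> (C \<inter> V) = C \<inter> V" "V \<inter> (C \<inter> V) = C \<inter> V" "c ` C \<inter> c ` (C \<inter> V) = c ` (C \<inter> V)" by auto
    ultimately have "homeomorphic_map (subtopology (subtopology (mtop M) V) C') (subtopology (Euclidean_space n) (c ` C')) c"
      unfolding C' subtopology_subtopology by (simp only:)
    moreover have "topspace (subtopology (subtopology (mtop M) V) C') = C'"
      using chart_sub[OF Cc] by (auto simp: C')
    ultimately show "openin (subtopology (mtop M) V) C' \<and> openE n (c ` C') \<and>
       embedding_map (subtopology (subtopology (mtop M) V) C') (Euclidean_space n) c"
      using oCV chart_open[OF Cc, of "C \<inter> V"] unfolding embedding_map_def C'
      by (simp add: openin_open_subtopology[OF V])
  qed
  show "\<forall>(C, c)\<in>atlas M'. \<forall>(C', c')\<in>atlas M'. \<forall>i<n. Cinf_on n (c ` (C \<inter> C')) (\<lambda>u. c' (inv_into C c u) i)"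
  proof (clarify)
    fix D c D' c' i assume D: "(D, c) \<in> atlas M'" "(D', c') \<in> atlas M'" and i: "i < n"
    obtain C C' where Cc: "(C, c) \<in> atlas M" "D = C \<inter> V" and C': "(C', c') \<in> atlas M" "D' = C' \<inter> V"
      using D unfolding sub_atlas by auto
    have o: "openE n (c ` (D \<inter> D'))"
      using chart_open[OF Cc(1), of "D \<inter> D'"] V chart_open_dom[OF Cc(1)] chart_open_dom[OF C'(1)] Cc(2) C'(2)
      by (auto simp: openin_Int)
    have "Cinf_on n (c ` (D \<inter> D')) (\<lambda>u. c' (inv_into C c u) i)"
      by (rule Cinf_subset[OF chart_transition[OF Cc(1) C'(1) i] o]) (use Cc C' in auto)
    then show "Cinf_on n (c ` (D \<inter> D')) (\<lambda>u. c' (inv_into D c u) i)"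
      by (rule Cinf_cong) (use sub_inv[OF Cc(1)] chart_inv[OF Cc(1)] Cc(2) in auto)
  qed
qed

sublocale sub: smooth_mfd M' by unfold_locales (rule smooth_sub)

text \<open>Equality as sets of derivations: at a point of \<open>V\<close> both manifolds have the
  same functions that are smooth nearby, and vectors are 0 on all others. So no identification has
  to be carried along.\<close>

lemma sub_tangent_space: "x \<in> V \<Longrightarrow> tangent_space M' x = tangent_space M x"
proof -
  assume x: "x \<in> V"
  then obtain C c where Cc: "(C, c) \<in> atlas M" "x \<in> C" using chart_cover openin_subset[OF V] by blast
  have "(C \<inter> V, c) \<in> atlas M'" using Cc unfolding sub_atlas by force
  from sub.tangent_space_chart[OF this] tangent_space_chart[OF Cc] sub_tv[OF Cc x] x Cc(2) show ?thesis by auto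
qed

lemma sub_vector_field: "vector_field M' U X \<longleftrightarrow> vector_field M U X \<and> U \<subseteq> V"
  unfolding vector_field_def sub_open sub_smooth_on using sub_tangent_space by (auto simp: subset_iff)

end

section \<open>Deformations in charts\<close>

lemma proj_eqI:
  assumes S: "subspace S" and w: "w \<in> S" "\<And>s. s \<in> S \<Longrightarrow> (v - w) \<bullet> s = 0"
  shows "proj S v = w"
  unfolding proj_def
proof (rule the_equality)
  show "w \<in> S \<and> v - w \<in> S\<^sup>\<bottom>"
    using w by (auto simp: orthogonal_comp_def orthogonal_def inner_commute)
  fix w' assume w': "w' \<in> S \<and> v - w' \<in> S\<^sup>\<bottom>"
  then have "s \<bullet> (v - w') = 0" if "s \<in> S" for s using that by (auto simp: orthogonal_comp_def orthogonal_def)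
  moreover have "w - w' \<in> S" using S w w' by (simp add: subspace_diff)
  ultimately have "(w - w') \<bullet> (v - w') = 0" "(v - w) \<bullet> (w - w') = 0" using w(2) by auto
  then have "(w - w') \<bullet> (w - w') = 0" by (simp add: inner_diff_left inner_diff_right inner_commute)
  then show "w' = w" by simp
qed

lemma proj_in: "subspace S \<Longrightarrow> proj S v \<in> S"
  and proj_inner: "subspace S \<Longrightarrow> s \<in> S \<Longrightarrow> proj S v \<bullet> s = v \<bullet> s"
proof -
  assume S: "subspace S"
  obtain y z where y: "y \<in> span S" and z: "\<And>w. w \<in> span S \<Longrightarrow> orthogonal z w" and v: "v = y + z"
    using orthogonal_subspace_decomp_exists[of S v] by metis
  have sp: "span S = S" using S by (simp add: span_eq_iff)
  have z0: "z \<bullet> s = 0" if "s \<in> S" for s using z[of s] that sp by (simp add: orthogonal_def)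
  have p: "proj S v = y" by (rule proj_eqI[OF S]) (use y v sp z0 in auto)
  show "proj S v \<in> S" using p y sp by simp
  show "proj S v \<bullet> s = v \<bullet> s" if "s \<in> S" using z0[OF that] v p by (simp add: inner_add_left)
qed

lemma span_dim_lin_indep:
  fixes w :: "nat \<Rightarrow> 'b::euclidean_space"
  assumes "dim (span (w ` {..<l})) = l" shows "lin_indep {..<l} w"
proof -
  have "\<exists>J. J \<subseteq> {..<l} \<and> lin_indep J w \<and> card J = dim (w ` {..<l})" by (rule lin_indep_basis_ex) simp
  then obtain J where J: "J \<subseteq> {..<l}" "lin_indep J w" "card J = dim (w ` {..<l})" by (elim exE conjE)
  have "card J = card {..<l}" using J(3) assms by (simp add: dim_span)
  then have "J = {..<l}" using J(1) card_subset_eq[of "{..<l}" J] by simp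
  then show ?thesis using J(2) by simp
qed

lemma sum_lessThan_add: "(\<Sum>a<n + l. F a) = (\<Sum>a<n. F a) + (\<Sum>j<l. F (n + j))"
  for F :: "nat \<Rightarrow> 'z::comm_monoid_add"
  by (induction l) (simp_all add: add.assoc)

text \<open>The two isometric immersions and the data of \<open>\<tau>\<close>. Genuineness is kept
  apart from them; it enters only through \<open>genuine_frame_chart\<close>.\<close>

locale deformation = smooth_mfd M for M :: "'m mfd" +
  fixes g :: "'m metric" and f :: "'m \<Rightarrow> 'b::euclidean_space" and fh :: "'m \<Rightarrow> 'c::euclidean_space"
    and L :: "'m \<Rightarrow> 'b set" and Lh :: "'m \<Rightarrow> 'c set" and \<tau> :: "'m \<Rightarrow> 'b \<Rightarrow> 'c" and l :: nat
  assumes iso: "isometric_immersion M g f" and isoh: "isometric_immersion M g fh"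
    and nsb: "normal_subbundle M f l L" and nsbh: "normal_subbundle M fh l Lh"
    and bi: "bundle_isometry M L Lh \<tau>"
    and par: "parallel_isometry M f fh L Lh \<tau>"
    and sff: "preserves_second_fundamental_forms M f fh L Lh \<tau>"
begin

abbreviation "m \<equiv> n + l"

lemma smooth_f: "smooth_on M (pts M) f" and smooth_fh: "smooth_on M (pts M) fh"
  using iso isoh by (simp_all add: isometric_immersion_def)

lemma L_sub: "x \<in> pts M \<Longrightarrow> subspace (L x)" "x \<in> pts M \<Longrightarrow> dim (L x) = l" "x \<in> pts M \<Longrightarrow> L x \<subseteq> normal_space M f x"
  and Lh_sub: "x \<in> pts M \<Longrightarrow> subspace (Lh x)" "x \<in> pts M \<Longrightarrow> dim (Lh x) = l" "x \<in> pts M \<Longrightarrow> Lh x \<subseteq> normal_space M fh x"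
  using nsb nsbh unfolding normal_subbundle_def by auto

lemma tau_image: "x \<in> pts M \<Longrightarrow> \<tau> x ` L x = Lh x"
  and tau_inner: "x \<in> pts M \<Longrightarrow> \<xi> \<in> L x \<Longrightarrow> \<eta> \<in> L x \<Longrightarrow> \<tau> x \<xi> \<bullet> \<tau> x \<eta> = \<xi> \<bullet> \<eta>"
  and tau_linear: "x \<in> pts M \<Longrightarrow> \<xi> \<in> L x \<Longrightarrow> \<eta> \<in> L x \<Longrightarrow> \<tau> x (a *\<^sub>R \<xi> + b *\<^sub>R \<eta>) = a *\<^sub>R \<tau> x \<xi> + b *\<^sub>R \<tau> x \<eta>"
  and tau_smooth: "bundle_section M L U \<zeta> \<Longrightarrow> smooth_on M U (\<lambda>y. \<tau> y (\<zeta> y))"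
  using bi unfolding bundle_isometry_def by auto

lemma tau_sum:
  assumes x: "x \<in> pts M" and e: "\<And>j. j \<in> A \<Longrightarrow> e j \<in> L x"
  shows "\<tau> x (\<Sum>j\<in>A. s j *\<^sub>R e j) = (\<Sum>j\<in>A. s j *\<^sub>R \<tau> x (e j))"
  using e
proof (induction A rule: infinite_finite_induct)
  case (insert j A)
  have "(\<Sum>j\<in>A. s j *\<^sub>R e j) \<in> L x" using insert.prems L_sub(1)[OF x] by (intro subspace_sum subspace_scale) auto
  then have "\<tau> x (s j *\<^sub>R e j + 1 *\<^sub>R (\<Sum>j\<in>A. s j *\<^sub>R e j)) = s j *\<^sub>R \<tau> x (e j) + 1 *\<^sub>R \<tau> x (\<Sum>j\<in>A. s j *\<^sub>R e j)"
    using insert.prems by (intro tau_linear[OF x]) auto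
  then show ?case using insert by simp
next
  have "0 \<in> L x" using L_sub(1)[OF x] by (simp add: subspace_0)
  then have z: "\<tau> x 0 = 0" using tau_linear[OF x, of 0 0 0 0] by simp
  { case (infinite A) then show ?case using z by simp }
  { case empty then show ?case using z by simp }
qed

section \<open>Frames of \<open>TM \<oplus> L\<close> in a chart\<close>

context
  fixes C c assumes Cc: "(C, c) \<in> atlas M"
begin

definition "fc = f \<circ> inv_into C c"
definition "fhc = fh \<circ> inv_into C c"

lemma fc_smooth: "Cinf_on n (c ` C) fc" "Cinf_on n (c ` C) fhc"
  using smooth_on_chartD[OF smooth_f Cc] smooth_on_chartD[OF smooth_fh Cc] chart_sub[OF Cc]
  by (simp_all add: fc_def fhc_def Int_absorb2)

lemma deriv_f:
  assumes "x \<in> C"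
  shows "deriv_along (tv M C c x a) f = (\<Sum>i<n. a i *\<^sub>R partial i fc (c x))"
    "deriv_along (tv M C c x a) fh = (\<Sum>i<n. a i *\<^sub>R partial i fhc (c x))"
  unfolding fc_def fhc_def
  using deriv_along_tv[OF Cc assms _ smooth_f] deriv_along_tv[OF Cc assms _ smooth_fh] assms chart_sub[OF Cc] by auto

lemma sum_delta: "i < n \<Longrightarrow> (\<Sum>j<n. (if j = i then 1 else 0) *\<^sub>R E j) = (E i :: 'z::real_vector)"
proof -
  assume "i < n"
  have "(\<Sum>j<n. (if j = i then 1 else 0) *\<^sub>R E j) = (\<Sum>j<n. if j = i then E j else 0)" by (intro sum.cong) auto
  then show ?thesis using \<open>i < n\<close> by simp
qed

lemma normal_space_iff:
  assumes x: "x \<in> C"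
  shows "z \<in> normal_space M f x \<longleftrightarrow> (\<forall>i<n. z \<bullet> partial i fc (c x) = 0)"
    "zh \<in> normal_space M fh x \<longleftrightarrow> (\<forall>i<n. zh \<bullet> partial i fhc (c x) = 0)"
proof -
  have 1: "z \<in> normal_space M f x \<longleftrightarrow> (\<forall>a. (\<Sum>i<n. a i *\<^sub>R partial i fc (c x)) \<bullet> z = 0)"
    unfolding normal_space_def tangent_space_chart[OF Cc x] orthogonal_comp_def orthogonal_def
    by (auto simp: deriv_f[OF x])
  have 2: "zh \<in> normal_space M fh x \<longleftrightarrow> (\<forall>a. (\<Sum>i<n. a i *\<^sub>R partial i fhc (c x)) \<bullet> zh = 0)"
    unfolding normal_space_def tangent_space_chart[OF Cc x] orthogonal_comp_def orthogonal_def
    by (auto simp: deriv_f[OF x])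
  show "z \<in> normal_space M f x \<longleftrightarrow> (\<forall>i<n. z \<bullet> partial i fc (c x) = 0)"
  proof
    assume z: "z \<in> normal_space M f x"
    show "\<forall>i<n. z \<bullet> partial i fc (c x) = 0"
    proof (intro allI impI)
      fix i assume "i < n"
      then show "z \<bullet> partial i fc (c x) = 0"
        using z[unfolded 1, rule_format, of "\<lambda>j. if j = i then 1 else 0"] unfolding sum_delta[OF \<open>i < n\<close>] by (simp add: inner_commute)
    qed
  qed (unfold 1, simp add: inner_sum_left inner_sum_right inner_commute)
  show "zh \<in> normal_space M fh x \<longleftrightarrow> (\<forall>i<n. zh \<bullet> partial i fhc (c x) = 0)"
  proof
    assume z: "zh \<in> normal_space M fh x"
    show "\<forall>i<n. zh \<bullet> partial i fhc (c x) = 0"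
    proof (intro allI impI)
      fix i assume "i < n"
      then show "zh \<bullet> partial i fhc (c x) = 0"
        using z[unfolded 2, rule_format, of "\<lambda>j. if j = i then 1 else 0"] unfolding sum_delta[OF \<open>i < n\<close>] by (simp add: inner_commute)
    qed
  qed (unfold 2, simp add: inner_sum_left inner_sum_right inner_commute)
qed

lemma subspace_normal: "subspace (normal_space M f x)" "subspace (normal_space M fh x)"
  unfolding normal_space_def by (rule subspace_orthogonal_comp)+

lemma metric_eq:
  assumes "x \<in> C" "a < n" "b < n"
  shows "partial a fc (c x) \<bullet> partial b fc (c x) = partial a fhc (c x) \<bullet> partial b fhc (c x)"
proof -
  let ?X = "\<lambda>a. tv M C c x (\<lambda>j. if j = a then 1 else 0)"
  have t: "?X a \<in> tangent_space M x" for a using tangent_space_chart[OF Cc assms(1)] by simp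
  have x: "x \<in> pts M" using assms(1) chart_sub[OF Cc] by blast
  have "g x (?X a) (?X b) = deriv_along (?X a) f \<bullet> deriv_along (?X b) f"
    "g x (?X a) (?X b) = deriv_along (?X a) fh \<bullet> deriv_along (?X b) fh"
    using iso isoh x t unfolding isometric_immersion_def by blast+
  then show ?thesis unfolding deriv_f[OF assms(1)] sum_delta[OF assms(2)] sum_delta[OF assms(3)] by simp
qed

lemma immersion_coords:
  assumes x: "x \<in> C" shows "lin_indep {..<n} (\<lambda>i. partial i fc (c x))"
  unfolding lin_indep_def
proof (rule allI, rule impI)
  fix a assume a: "(\<Sum>i\<in>{..<n}. a i *\<^sub>R partial i fc (c x)) = 0"
  have "x \<in> pts M" using x chart_sub[OF Cc] by blast
  then have im: "immersion_at M f x" using iso by (simp add: isometric_immersion_def)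
  have "tv M C c x a \<in> tangent_space M x" using tangent_space_chart[OF Cc x] by simp
  moreover have "deriv_along (tv M C c x a) f = 0" using a deriv_f[OF x] by simp
  ultimately have "tv M C c x a = (\<lambda>_. 0)" using im unfolding immersion_at_def by blast
  then show "\<forall>i\<in>{..<n}. a i = 0" using tv_zero_iff[OF Cc x] by simp
qed

lemma deriv_along_coord:
  fixes F :: "'m \<Rightarrow> 'd::euclidean_space"
  assumes F: "smooth_on M U F" and U: "U \<subseteq> C" and x: "x \<in> U" and i: "i < n"
    and eq: "\<And>y. y \<in> U \<Longrightarrow> F y = H (c y)"
  shows "deriv_along (tv M C c x (\<lambda>j. if j = i then 1 else 0)) F = partial i H (c x)"
proof -
  have "deriv_along (tv M C c x (\<lambda>j. if j = i then 1 else 0)) F = partial i (F \<circ> inv_into C c) (c x)"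
    using deriv_along_tv[OF Cc _ x F] x U sum_delta[OF i, of "\<lambda>i. partial i (F \<circ> inv_into C c) (c x)"] by auto
  also have "\<dots> = partial i H (c x)"
  proof (rule partial_cong[OF _ _ i])
    show "openE n (c ` U)" using chart_open[OF Cc U] smooth_on_open[OF F] by simp
    fix v assume "v \<in> c ` U"
    then obtain y where y: "y \<in> U" "v = c y" by blast
    then have "inv_into C c v = y" using U chart_inv[OF Cc] by auto
    then show "(F \<circ> inv_into C c) v = H v" using eq[OF y(1)] y(2) by simp
  qed (use x in auto)
  finally show ?thesis .
qed

context
  fixes U and \<xi> :: "nat \<Rightarrow> 'm \<Rightarrow> 'b"
  assumes U: "openin (mtop M) U" "U \<subseteq> C"
    and \<xi>: "\<And>j. j < l \<Longrightarrow> smooth_on M U (\<xi> j)"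
    and span: "\<And>y. y \<in> U \<Longrightarrow> L y = span ((\<lambda>j. \<xi> j y) ` {..<l})"
begin

definition "E a u = (if a < n then partial a fc u else \<xi> (a - n) (inv_into C c u))"
definition "Eh a u = (if a < n then partial a fhc u else \<tau> (inv_into C c u) (\<xi> (a - n) (inv_into C c u)))"

lemma U_pts: "x \<in> U \<Longrightarrow> x \<in> pts M" using U(2) chart_sub[OF Cc] by blast

lemma open_cU: "openE n (c ` U)" using chart_open[OF Cc U(2)] U(1) by simp

lemma \<xi>_L: "j < l \<Longrightarrow> y \<in> U \<Longrightarrow> \<xi> j y \<in> L y"
  using span by (auto intro!: span_base)

lemma \<xi>_section: "j < l \<Longrightarrow> bundle_section M L U (\<xi> j)"
  using \<xi> \<xi>_L by (simp add: bundle_section_def)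

lemma \<tau>\<xi>_smooth: "j < l \<Longrightarrow> smooth_on M U (\<lambda>y. \<tau> y (\<xi> j y))"
  by (rule tau_smooth[OF \<xi>_section])

lemma inv_U: "y \<in> U \<Longrightarrow> inv_into C c (c y) = y" using chart_inv[OF Cc] U(2) by blast

lemma CU: "C \<inter> U = U" using U(2) by auto

lemma E_smooth:
  assumes "a < m" shows "Cinf_on n (c ` U) (E a)" "Cinf_on n (c ` U) (Eh a)"
proof -
  show "Cinf_on n (c ` U) (E a)"
  proof (cases "a < n")
    case True
    then show ?thesis unfolding E_def[abs_def] using Cinf_subset[OF Cinf_partial[OF fc_smooth(1) True] open_cU] U(2) by auto
  next
    case False
    then have "a - n < l" using assms by simp
    then show ?thesis using False smooth_on_chartD[OF \<xi> Cc, of "a - n"] unfolding E_def[abs_def] CU by (simp add: o_def)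
  qed
  show "Cinf_on n (c ` U) (Eh a)"
  proof (cases "a < n")
    case True
    then show ?thesis unfolding Eh_def[abs_def] using Cinf_subset[OF Cinf_partial[OF fc_smooth(2) True] open_cU] U(2) by auto
  next
    case False
    then have "a - n < l" using assms by simp
    then show ?thesis using False smooth_on_chartD[OF \<tau>\<xi>_smooth Cc, of "a - n"] unfolding Eh_def[abs_def] CU by (simp add: o_def)
  qed
qed

lemma L_pair: "y \<in> U \<Longrightarrow> j < l \<Longrightarrow> a < n \<Longrightarrow> \<xi> j y \<bullet> partial a fc (c y) = 0"
   "y \<in> U \<Longrightarrow> j < l \<Longrightarrow> a < n \<Longrightarrow> \<tau> y (\<xi> j y) \<bullet> partial a fhc (c y) = 0"
proof -
  assume y: "y \<in> U" and j: "j < l" and a: "a < n"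
  have yC: "y \<in> C" using y U(2) by blast
  have "\<xi> j y \<in> normal_space M f y" using L_sub(3)[OF U_pts[OF y]] \<xi>_L[OF j y] by blast
  then show "\<xi> j y \<bullet> partial a fc (c y) = 0" using normal_space_iff(1)[OF yC] a by blast
  have "\<tau> y (\<xi> j y) \<in> Lh y" using tau_image[OF U_pts[OF y]] \<xi>_L[OF j y] by blast
  then have "\<tau> y (\<xi> j y) \<in> normal_space M fh y" using Lh_sub(3)[OF U_pts[OF y]] by blast
  then show "\<tau> y (\<xi> j y) \<bullet> partial a fhc (c y) = 0" using normal_space_iff(2)[OF yC] a by blast
qed

lemma E_gram:
  assumes u: "u \<in> c ` U" and ab: "a < m" "b < m" shows "E a u \<bullet> E b u = Eh a u \<bullet> Eh b u"
proof -
  obtain y where y: "y \<in> U" "u = c y" using u by blast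
  have yC: "y \<in> C" using y U(2) by blast
  have iy: "inv_into C c u = y" using inv_U[OF y(1)] y(2) by simp
  consider "a < n" "b < n" | "a < n" "\<not> b < n" | "\<not> a < n" "b < n" | "\<not> a < n" "\<not> b < n" by blast
  then show ?thesis
  proof cases
    case 1 then show ?thesis using metric_eq[OF yC] by (simp add: E_def Eh_def y)
  next
    case 2
    then have "b - n < l" using ab by simp
    then show ?thesis using 2 L_pair[OF y(1)] by (simp add: E_def Eh_def iy y(2)[symmetric] inner_commute[of "partial a _ u"]; simp add: y(2))
  next
    case 3
    then have "a - n < l" using ab by simp
    then show ?thesis using 3 L_pair[OF y(1)] by (simp add: E_def Eh_def iy; simp add: y(2))
  next
    case 4
    then have "a - n < l" "b - n < l" using ab by simp_all
    then show ?thesis using 4 tau_inner[OF U_pts[OF y(1)] \<xi>_L[OF _ y(1)] \<xi>_L[OF _ y(1)]] by (simp add: E_def Eh_def iy)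
  qed
qed

text \<open>Tangent and normal parts of a vanishing combination are orthogonal, so each vanishes by
  itself. The immersion property treats the one, the rank of \<open>L\<close> the other.\<close>

lemma E_lin_indep:
  assumes u: "u \<in> c ` U" shows "lin_indep {..<m} (\<lambda>a. E a u)"
proof -
  obtain y where y: "y \<in> U" "u = c y" using u by blast
  have yC: "y \<in> C" using y U(2) by blast
  have iy: "inv_into C c u = y" using inv_U[OF y(1)] y(2) by simp
  have split: "(\<Sum>a<m. k a *\<^sub>R E a u) = (\<Sum>a<n. k a *\<^sub>R partial a fc u) + (\<Sum>j<l. k (n + j) *\<^sub>R \<xi> j y)" for k
  proof -
    have "(\<Sum>a<m. k a *\<^sub>R E a u) = (\<Sum>a<n. k a *\<^sub>R E a u) + (\<Sum>j<l. k (n + j) *\<^sub>R E (n + j) u)"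
      by (rule sum_lessThan_add)
    then show ?thesis by (simp add: E_def iy)
  qed
  have "dim (span ((\<lambda>j. \<xi> j y) ` {..<l})) = l" using L_sub(2)[OF U_pts[OF y(1)]] span[OF y(1)] by simp
  then have li: "lin_indep {..<l} (\<lambda>j. \<xi> j y)" by (rule span_dim_lin_indep)
  show ?thesis unfolding lin_indep_def
  proof (rule allI, rule impI)
    fix k assume k: "(\<Sum>a<m. k a *\<^sub>R E a u) = 0"
    let ?t = "\<Sum>a<n. k a *\<^sub>R partial a fc u" and ?s = "\<Sum>j<l. k (n + j) *\<^sub>R \<xi> j y"
    have ts: "?t + ?s = 0" using k split by simp
    have "?s \<bullet> ?t = 0" unfolding inner_sum_left inner_sum_right using L_pair(1)[OF y(1)] y(2) by simp
    moreover have "?s = - ?t" using ts by (simp add: eq_neg_iff_add_eq_0 add.commute)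
    ultimately have t0: "?t = 0" by simp
    then have s0: "?s = 0" using ts by simp
    have "\<forall>a\<in>{..<n}. k a = 0" using immersion_coords[OF yC, unfolded lin_indep_def, rule_format, of k] t0 unfolding y(2) by simp
    moreover have "\<forall>j\<in>{..<l}. k (n + j) = 0"
      using li[unfolded lin_indep_def, rule_format, of "\<lambda>j. k (n + j)"] s0 by simp
    ultimately show "\<forall>a\<in>{..<m}. k a = 0"
    proof (intro ballI)
      fix a assume a: "\<forall>a\<in>{..<n}. k a = 0" "\<forall>j\<in>{..<l}. k (n + j) = 0" "a \<in> {..<m}"
      show "k a = 0"
      proof (cases "a < n")
        case False
        then have "a - n \<in> {..<l}" "n + (a - n) = a" using a(3) by auto
        then show ?thesis using a(2) by metis
      qed (use a in simp)
    qed
  qed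
qed

lemma Eh_lin_indep:
  assumes u: "u \<in> c ` U" shows "lin_indep {..<m} (\<lambda>a. Eh a u)"
  unfolding lin_indep_def
proof (rule allI, rule impI)
  fix k assume k: "(\<Sum>a<m. k a *\<^sub>R Eh a u) = 0"
  have "(\<Sum>a<m. k a *\<^sub>R E a u) = 0"
    by (rule gram_lin_indep[where w = "\<lambda>a. Eh a u", OF _ k]) (use E_gram[OF u] in auto)
  then show "\<forall>a\<in>{..<m}. k a = 0" using E_lin_indep[OF u] unfolding lin_indep_def by simp
qed

lemma normal_transfer:
  assumes y: "y \<in> U" and j: "j < l"
    and eq: "\<tau> y (proj (L y) (proj (normal_space M f y) w)) = proj (Lh y) (proj (normal_space M fh y) wh)"
  shows "w \<bullet> \<xi> j y = wh \<bullet> \<tau> y (\<xi> j y)"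
proof -
  have yM: "y \<in> pts M" by (rule U_pts[OF y])
  have x: "\<xi> j y \<in> L y" by (rule \<xi>_L[OF j y])
  then have xh: "\<tau> y (\<xi> j y) \<in> Lh y" using tau_image[OF yM] by blast
  have "w \<bullet> \<xi> j y = proj (L y) (proj (normal_space M f y) w) \<bullet> \<xi> j y"
    using proj_inner[OF L_sub(1)[OF yM] x] proj_inner[OF subspace_normal(1) subsetD[OF L_sub(3)[OF yM] x]] by simp
  also have "\<dots> = \<tau> y (proj (L y) (proj (normal_space M f y) w)) \<bullet> \<tau> y (\<xi> j y)"
    by (rule tau_inner[OF yM proj_in[OF L_sub(1)[OF yM]] x, symmetric])
  also have "\<dots> = wh \<bullet> \<tau> y (\<xi> j y)"
    unfolding eq using proj_inner[OF Lh_sub(1)[OF yM] xh] proj_inner[OF subspace_normal(2) subsetD[OF Lh_sub(3)[OF yM] xh]] by simp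
  finally show ?thesis .
qed

text \<open>Let \<open>A i a b\<close> be the difference of the two sides; it is skew in
  \<open>a\<close>, \<open>b\<close> because the Gram matrices agree. For two tangent indices this
  is the uniqueness of the Levi-Civita connection. Tangent \<open>a\<close> with \<open>b\<close> in
  \<open>L\<close> is preservation of the second fundamental forms, the reverse case follows by
  skewness, and two indices in \<open>L\<close> express parallelism.\<close>

lemma E_conn:
  assumes u: "u \<in> c ` U" and i: "i < n" and ab: "a < m" "b < m"
  shows "partial i (E a) u \<bullet> E b u = partial i (Eh a) u \<bullet> Eh b u"
proof -
  obtain y where y: "y \<in> U" "u = c y" using u by blast
  have yC: "y \<in> C" using y U(2) by blast
  have yM: "y \<in> pts M" by (rule U_pts[OF y(1)])
  have iy: "inv_into C c u = y" using inv_U[OF y(1)] y(2) by simp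
  have der: "partial i (E a) u \<bullet> E b u + partial i (E b) u \<bullet> E a u =
      partial i (Eh a) u \<bullet> Eh b u + partial i (Eh b) u \<bullet> Eh a u" if "i < n" "a < m" "b < m" for i a b
  proof -
    have "partial i (\<lambda>u. E a u \<bullet> E b u) u = partial i (\<lambda>u. Eh a u \<bullet> Eh b u) u"
      by (rule partial_cong[OF open_cU u that(1)]) (rule E_gram[OF _ that(2,3)])
    then show ?thesis
      unfolding partial_inner[OF E_smooth(1)[OF that(2)] E_smooth(1)[OF that(3)] that(1) u]
        partial_inner[OF E_smooth(2)[OF that(2)] E_smooth(2)[OF that(3)] that(1) u]
      by (simp add: inner_commute)
  qed
  let ?X = "tv M C c y (\<lambda>k. if k = i then 1 else 0)"
  have X: "?X \<in> tangent_space M y" using tangent_space_chart[OF Cc yC] by simp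
  define A where "A i a b = partial i (E a) u \<bullet> E b u - partial i (Eh a) u \<bullet> Eh b u" for i a b
  have sym: "A i a b = A a i b" if "i < n" "a < n" for i a b
  proof -
    have "partial i (E a) u = partial a (E i) u" "partial i (Eh a) u = partial a (Eh i) u"
      using Cinf_partial_commute[OF fc_smooth(1) _ that, of u] Cinf_partial_commute[OF fc_smooth(2) _ that, of u] yC y(2) that
      unfolding E_def[abs_def] Eh_def[abs_def] by simp_all
    then show ?thesis by (simp add: A_def)
  qed
  have skew: "A i a b = - A i b a" if "i < n" "a < m" "b < m" for i a b
    using der[OF that] by (simp add: A_def)
  \<comment> \<open>Symmetry in the first two indices and skewness in the last two are applied
    alternately, three times each, which returns \<open>A i a b\<close> to its own negative.\<close>
  have tan: "A i a b = 0" if "i < n" "a < n" "b < n" for i a b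
  proof -
    have le: "i < m" "a < m" "b < m" using that by auto
    have "A i a b = - A i b a" by (rule skew[OF that(1) le(2,3)])
    also have "A i b a = A b i a" by (rule sym[OF that(1,3)])
    also have "A b i a = - A b a i" by (rule skew[OF that(3) le(1,2)])
    also have "A b a i = A a b i" by (rule sym[OF that(3,2)])
    also have "A a b i = - A a i b" by (rule skew[OF that(2) le(3,1)])
    also have "A a i b = A i a b" by (rule sym[OF that(2,1)])
    finally show ?thesis by simp
  qed
  have nor: "A i a b = 0" if an: "a < n" and b: "\<not> b < n" "b < m" for a b
  proof -
    let ?Y = "\<lambda>y. tv M C c y (\<lambda>k. if k = a then 1 else 0)"
    have vf: "vector_field M U ?Y"
      by (rule vector_field_tv[OF Cc U, where \<alpha> = "\<lambda>k u. if k = a then 1 else 0"]) (simp add: Cinf_const[OF open_cU])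
    have Yf: "deriv_along (?Y z) f = partial a fc (c z)" "deriv_along (?Y z) fh = partial a fhc (c z)" if "z \<in> U" for z
    proof -
      have zC: "z \<in> C" using that U(2) by blast
      show "deriv_along (?Y z) f = partial a fc (c z)" "deriv_along (?Y z) fh = partial a fhc (c z)"
        unfolding deriv_f[OF zC] sum_delta[OF an] by (rule refl)+
    qed
    have s1: "smooth_on M U (\<lambda>z. deriv_along (?Y z) f)"
    proof (rule smooth_on_chartI[OF Cc U(2)])
      show "Cinf_on n (c ` U) ((\<lambda>z. deriv_along (?Y z) f) \<circ> inv_into C c)"
      proof (rule Cinf_cong[OF Cinf_subset[OF Cinf_partial[OF fc_smooth(1) an] open_cU]])
        fix v assume "v \<in> c ` U"
        then obtain z where "z \<in> U" "v = c z" by blast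
        then show "partial a fc v = ((\<lambda>z. deriv_along (?Y z) f) \<circ> inv_into C c) v" using Yf(1) inv_U by simp
      qed (use U(2) in auto)
    qed
    have s2: "smooth_on M U (\<lambda>z. deriv_along (?Y z) fh)"
    proof (rule smooth_on_chartI[OF Cc U(2)])
      show "Cinf_on n (c ` U) ((\<lambda>z. deriv_along (?Y z) fh) \<circ> inv_into C c)"
      proof (rule Cinf_cong[OF Cinf_subset[OF Cinf_partial[OF fc_smooth(2) an] open_cU]])
        fix v assume "v \<in> c ` U"
        then obtain z where "z \<in> U" "v = c z" by blast
        then show "partial a fhc v = ((\<lambda>z. deriv_along (?Y z) fh) \<circ> inv_into C c) v" using Yf(2) inv_U by simp
      qed (use U(2) in auto)
    qed
    have d: "deriv_along ?X (\<lambda>z. deriv_along (?Y z) f) = partial i (partial a fc) (c y)"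
      "deriv_along ?X (\<lambda>z. deriv_along (?Y z) fh) = partial i (partial a fhc) (c y)"
      by (rule deriv_along_coord[OF s1 U(2) y(1) i Yf(1)], assumption)
         (rule deriv_along_coord[OF s2 U(2) y(1) i Yf(2)])
    have "\<tau> y (proj (L y) (second_fundamental_form M f y ?X ?Y)) = proj (Lh y) (second_fundamental_form M fh y ?X ?Y)"
      using sff vf y(1) X unfolding preserves_second_fundamental_forms_def by blast
    then have "\<tau> y (proj (L y) (proj (normal_space M f y) (partial i (partial a fc) (c y)))) =
        proj (Lh y) (proj (normal_space M fh y) (partial i (partial a fhc) (c y)))"
      unfolding second_fundamental_form_def d .
    from normal_transfer[OF y(1) _ this, of "b - n"] show ?thesis
      using an b i unfolding A_def E_def[abs_def] Eh_def[abs_def] by (simp add: iy y(2)[symmetric])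
  qed
  have mixed: "A i a b = 0" if "\<not> a < n" "a < m" "b < n" for a b
    using skew[OF i that(2), of b] nor[OF that(3,1,2)] that by simp
  have LL: "A i a b = 0" if a: "\<not> a < n" "a < m" and b: "\<not> b < n" "b < m" for a b
  proof -
    have al: "a - n < l" using a by simp
    have d: "deriv_along ?X (\<xi> (a - n)) = partial i (E a) u"
      "deriv_along ?X (\<lambda>z. \<tau> z (\<xi> (a - n) z)) = partial i (Eh a) u"
      unfolding y(2)
      by (rule deriv_along_coord[OF \<xi>[OF al] U(2) y(1) i], use a inv_U in \<open>simp add: E_def\<close>)
         (rule deriv_along_coord[OF \<tau>\<xi>_smooth[OF al] U(2) y(1) i], use a inv_U in \<open>simp add: Eh_def\<close>)
    have "\<tau> y (proj (L y) (normal_connection M f y ?X (\<xi> (a - n)))) =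
       proj (Lh y) (normal_connection M fh y ?X (\<lambda>z. \<tau> z (\<xi> (a - n) z)))"
      using par \<xi>_section[OF al] y(1) X unfolding parallel_isometry_def by blast
    then have "\<tau> y (proj (L y) (proj (normal_space M f y) (partial i (E a) u))) =
        proj (Lh y) (proj (normal_space M fh y) (partial i (Eh a) u))"
      unfolding normal_connection_def d .
    from normal_transfer[OF y(1) _ this, of "b - n"] show ?thesis
      using b unfolding A_def by (simp add: E_def[of b] Eh_def[of b] iy)
  qed
  have "A i a b = 0"
    using tan[OF i, of a b] nor[of a b] mixed[of a b] LL[of a b] ab by (cases "a < n"; cases "b < n") auto
  then show ?thesis by (simp add: A_def)
qed

end

end

end

section \<open>The form \<open>\<phi>\<^sub>\<tau>\<close> in a frame chart\<close>

lemma (in smooth_mfd) deriv_along_coords: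
  fixes F :: "'a \<Rightarrow> 'b::euclidean_space"
  assumes Cc: "(C, c) \<in> atlas M" and U: "U \<subseteq> C" and H: "Cinf_on n (c ` U) H" and eq: "\<And>y. y \<in> U \<Longrightarrow> F y = H (c y)"
  shows "smooth_on M U F" "x \<in> U \<Longrightarrow> deriv_along (tv M C c x b) F = (\<Sum>i<n. b i *\<^sub>R partial i H (c x))"
proof -
  have e: "(F \<circ> inv_into C c) v = H v" if "v \<in> c ` U" for v
  proof -
    from that obtain y where y: "y \<in> U" "v = c y" by blast
    then have "inv_into C c v = y" using U chart_inv[OF Cc] by auto
    then show ?thesis using eq[OF y(1)] y(2) by simp
  qed
  show s: "smooth_on M U F" by (rule smooth_on_chartI[OF Cc U]) (rule Cinf_cong[OF H], rule e[symmetric])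
  assume x: "x \<in> U"
  have "partial i (F \<circ> inv_into C c) (c x) = partial i H (c x)" if "i < n" for i
    by (rule partial_cong[OF Cinf_open[OF H] _ that e]) (use x in auto)
  then show "deriv_along (tv M C c x b) F = (\<Sum>i<n. b i *\<^sub>R partial i H (c x))"
    using deriv_along_tv[OF Cc _ x s] x U by auto
qed

text \<open>The domain is small enough for both frames to have smooth dual frames on all of
  \<open>U\<close>. The two frames are then an instance of \<open>isometric_frames\<close>, so the
  coordinate results become available on \<open>U\<close>.\<close>

locale frame_chart = deformation M g f fh L Lh \<tau> l
  for M :: "'m mfd" and g and f :: "'m \<Rightarrow> 'b::euclidean_space" and fh :: "'m \<Rightarrow> 'c::euclidean_space" and L Lh \<tau> l +
  fixes C c U \<xi> es esh
  assumes Cc: "(C, c) \<in> atlas M" and U: "openin (mtop M) U" "U \<subseteq> C"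
    and \<xi>: "\<And>j. j < l \<Longrightarrow> smooth_on M U (\<xi> j)"
    and span: "\<And>y. y \<in> U \<Longrightarrow> L y = span ((\<lambda>j. \<xi> j y) ` {..<l})"
    and es: "\<And>a. a < m \<Longrightarrow> Cinf_on n (c ` U) (es a)" and esh: "\<And>a. a < m \<Longrightarrow> Cinf_on n (c ` U) (esh a)"
    and dual: "\<And>u a b. u \<in> c ` U \<Longrightarrow> a < m \<Longrightarrow> b < m \<Longrightarrow> es a u \<bullet> E C c \<xi> b u = (if a = b then 1 else 0)"
    and dualh: "\<And>u a b. u \<in> c ` U \<Longrightarrow> a < m \<Longrightarrow> b < m \<Longrightarrow> esh a u \<bullet> Eh C c \<xi> b u = (if a = b then 1 else 0)"
    and es_span: "\<And>u a. u \<in> c ` U \<Longrightarrow> a < m \<Longrightarrow> es a u \<in> span ((\<lambda>b. E C c \<xi> b u) ` {..<m})"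
    and esh_span: "\<And>u a. u \<in> c ` U \<Longrightarrow> a < m \<Longrightarrow> esh a u \<in> span ((\<lambda>b. Eh C c \<xi> b u) ` {..<m})"
begin

abbreviation "e \<equiv> E C c \<xi>"
abbreviation "eh \<equiv> Eh C c \<xi>"
abbreviation "ff \<equiv> fc C c"
abbreviation "ffh \<equiv> fhc C c"

lemmas frame_facts = Cc U \<xi> span

lemma cU_sub: "c ` U \<subseteq> c ` C" using U by auto

lemma e_tan: "i < n \<Longrightarrow> e i u = partial i ff u" "i < n \<Longrightarrow> eh i u = partial i ffh u"
  by (simp_all add: E_def[OF frame_facts] Eh_def[OF frame_facts])

lemma e_nor: "y \<in> U \<Longrightarrow> e (n + j) (c y) = \<xi> j y" "y \<in> U \<Longrightarrow> eh (n + j) (c y) = \<tau> y (\<xi> j y)"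
  using inv_U[OF frame_facts] by (simp_all add: E_def[OF frame_facts] Eh_def[OF frame_facts])

sublocale F: isometric_frames n m "c ` U" ff ffh e es eh esh
proof
  have o: "openE n (c ` U)" by (rule open_cU[OF frame_facts])
  show "n \<le> m" by simp
  show "Cinf_on n (c ` U) ff" by (rule Cinf_subset[OF fc_smooth(1)[OF Cc] o cU_sub])
  show "Cinf_on n (c ` U) ffh" by (rule Cinf_subset[OF fc_smooth(2)[OF Cc] o cU_sub])
  show "Cinf_on n (c ` U) (e a)" if "a < m" for a by (rule E_smooth(1)[OF frame_facts that])
  show "Cinf_on n (c ` U) (eh a)" if "a < m" for a by (rule E_smooth(2)[OF frame_facts that])
  show "e a u \<bullet> e b u = eh a u \<bullet> eh b u" if "u \<in> c ` U" "a < m" "b < m" for u a b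
    by (rule E_gram[OF frame_facts that])
  show "partial i (e a) u \<bullet> e b u = partial i (eh a) u \<bullet> eh b u" if "u \<in> c ` U" "i < n" "a < m" "b < m" for u i a b
    by (rule E_conn[OF frame_facts that])
qed (use e_tan es esh dual dualh es_span esh_span in auto)

lemma y_facts: "y \<in> U \<Longrightarrow> y \<in> C" "y \<in> U \<Longrightarrow> y \<in> pts M" "y \<in> U \<Longrightarrow> c y \<in> c ` U"
  using U U_pts[OF frame_facts] by auto

lemma Lh_span: "y \<in> U \<Longrightarrow> Lh y = span ((\<lambda>j. \<tau> y (\<xi> j y)) ` {..<l})"
proof (intro set_eqI iffI)
  fix z assume y: "y \<in> U" and "z \<in> Lh y"
  then obtain \<eta> where \<eta>: "\<eta> \<in> L y" "z = \<tau> y \<eta>" using tau_image[OF y_facts(2)[OF y]] by auto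
  then have "\<eta> \<in> span ((\<lambda>j. \<xi> j y) ` {..<l})" using span[OF y] by simp
  then obtain s where "\<eta> = (\<Sum>j<l. s j *\<^sub>R \<xi> j y)" using span_image_sum[of "{..<l}" \<eta> "\<lambda>j. \<xi> j y"] by auto
  then have "z = (\<Sum>j<l. s j *\<^sub>R \<tau> y (\<xi> j y))"
    using tau_sum[OF y_facts(2)[OF y], of "{..<l}" "\<lambda>j. \<xi> j y" s] \<xi>_L[OF frame_facts _ y] \<eta> by simp
  then show "z \<in> span ((\<lambda>j. \<tau> y (\<xi> j y)) ` {..<l})"
    using span_image_sum[of "{..<l}" z "\<lambda>j. \<tau> y (\<xi> j y)"] by auto
next
  fix z assume y: "y \<in> U" and z: "z \<in> span ((\<lambda>j. \<tau> y (\<xi> j y)) ` {..<l})"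
  have "(\<lambda>j. \<tau> y (\<xi> j y)) ` {..<l} \<subseteq> Lh y" using tau_image[OF y_facts(2)[OF y]] \<xi>_L[OF frame_facts _ y] by auto
  then show "z \<in> Lh y" using z span_minimal[OF _ Lh_sub(1)[OF y_facts(2)[OF y]]] by blast
qed

lemma orth_span_iff: "z \<in> (span (w ` I))\<^sup>\<bottom> \<longleftrightarrow> (\<forall>j\<in>I. z \<bullet> w j = 0)" for z :: "'z::real_inner"
proof
  assume "z \<in> (span (w ` I))\<^sup>\<bottom>"
  then show "\<forall>j\<in>I. z \<bullet> w j = 0"
    by (auto simp: orthogonal_comp_def orthogonal_def span_base inner_commute)
next
  assume A: "\<forall>j\<in>I. z \<bullet> w j = 0"
  have "orthogonal z x" if "x \<in> span (w ` I)" for x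
    by (rule orthogonal_to_span[OF that]) (use A in \<open>auto simp: orthogonal_def\<close>)
  then show "z \<in> (span (w ` I))\<^sup>\<bottom>" by (auto simp: orthogonal_comp_def orthogonal_commute)
qed

lemma less_m_cases:
  assumes "\<And>a. a < n \<Longrightarrow> P a" "\<And>j. j < l \<Longrightarrow> P (n + j)" shows "a < m \<Longrightarrow> P a"
proof -
  assume "a < m"
  then show "P a" using assms(1)[of a] assms(2)[of "a - n"] by (cases "a < n") auto
qed

lemma compl_iff:
  assumes y: "y \<in> U"
  shows "z \<in> normal_space M f y \<inter> (L y)\<^sup>\<bottom> \<longleftrightarrow> (\<forall>a<m. z \<bullet> e a (c y) = 0)"
    "zh \<in> normal_space M fh y \<inter> (Lh y)\<^sup>\<bottom> \<longleftrightarrow> (\<forall>a<m. zh \<bullet> eh a (c y) = 0)"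
proof -
  have 1: "z \<in> normal_space M f y \<inter> (L y)\<^sup>\<bottom> \<longleftrightarrow> (\<forall>i<n. z \<bullet> e i (c y) = 0) \<and> (\<forall>j<l. z \<bullet> e (n + j) (c y) = 0)"
    unfolding Int_iff normal_space_iff(1)[OF Cc y_facts(1)[OF y]] span[OF y] orth_span_iff
    using e_tan e_nor[OF y] by auto
  have 2: "zh \<in> normal_space M fh y \<inter> (Lh y)\<^sup>\<bottom> \<longleftrightarrow> (\<forall>i<n. zh \<bullet> eh i (c y) = 0) \<and> (\<forall>j<l. zh \<bullet> eh (n + j) (c y) = 0)"
    unfolding Int_iff normal_space_iff(2)[OF Cc y_facts(1)[OF y]] Lh_span[OF y] orth_span_iff
    using e_tan e_nor[OF y] by auto
  show "z \<in> normal_space M f y \<inter> (L y)\<^sup>\<bottom> \<longleftrightarrow> (\<forall>a<m. z \<bullet> e a (c y) = 0)"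
    unfolding 1 using less_m_cases[of "\<lambda>a. z \<bullet> e a (c y) = 0"] by auto
  show "zh \<in> normal_space M fh y \<inter> (Lh y)\<^sup>\<bottom> \<longleftrightarrow> (\<forall>a<m. zh \<bullet> eh a (c y) = 0)"
    unfolding 2 using less_m_cases[of "\<lambda>a. zh \<bullet> eh a (c y) = 0"] by auto
qed

text \<open>The vectors orthogonal to the whole frame are exactly the normal vectors orthogonal to
  \<open>L\<close>, so the intrinsic projections are the coordinate ones.\<close>

lemma compl_proj_Q:
  assumes y: "y \<in> U"
  shows "compl_proj M f L y w = F.Q (c y) w" "compl_proj M fh Lh y wh = F.Qh (c y) wh"
proof -
  note cy = y_facts(3)[OF y]
  show "compl_proj M f L y w = F.Q (c y) w"
    unfolding compl_proj_def
  proof (rule proj_eqI)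
    show "subspace (normal_space M f y \<inter> (L y)\<^sup>\<bottom>)"
      by (intro subspace_inter subspace_normal[OF Cc] subspace_orthogonal_comp)
    show "F.Q (c y) w \<in> normal_space M f y \<inter> (L y)\<^sup>\<bottom>"
      unfolding compl_iff(1)[OF y] using F.e_Q[OF cy] by (simp add: inner_commute)
    fix s assume "s \<in> normal_space M f y \<inter> (L y)\<^sup>\<bottom>"
    then have "\<forall>a<m. s \<bullet> e a (c y) = 0" unfolding compl_iff(1)[OF y] .
    then show "(w - F.Q (c y) w) \<bullet> s = 0" by (simp add: F.Q_def inner_sum_left inner_sum_right inner_commute)
  qed
  show "compl_proj M fh Lh y wh = F.Qh (c y) wh"
    unfolding compl_proj_def
  proof (rule proj_eqI)
    show "subspace (normal_space M fh y \<inter> (Lh y)\<^sup>\<bottom>)"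
      by (intro subspace_inter subspace_normal[OF Cc] subspace_orthogonal_comp)
    show "F.Qh (c y) wh \<in> normal_space M fh y \<inter> (Lh y)\<^sup>\<bottom>"
      unfolding compl_iff(2)[OF y] using F.eh_Qh[OF cy] by (simp add: inner_commute)
    fix s assume "s \<in> normal_space M fh y \<inter> (Lh y)\<^sup>\<bottom>"
    then have "\<forall>a<m. s \<bullet> eh a (c y) = 0" unfolding compl_iff(2)[OF y] .
    then show "(wh - F.Qh (c y) wh) \<bullet> s = 0" by (simp add: F.Qh_def inner_sum_left inner_sum_right inner_commute)
  qed
qed

definition elem :: "'m \<Rightarrow> (nat \<Rightarrow> real) \<Rightarrow> 'm tvec \<times> 'b"
  where "elem y v = (tv M C c y v, \<Sum>j<l. v (n + j) *\<^sub>R \<xi> j y)"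

text \<open>The projections annihilate the terms in which the coefficients are differentiated. What
  remains depends only on the values \<open>v a (c x)\<close>: this is the tensoriality of
  \<open>\<phi>\<^sub>\<tau>\<close>.\<close>

lemma deriv_comb:
  assumes W: "openin (mtop M) W" "W \<subseteq> U" and v: "\<And>a. a < m \<Longrightarrow> Cinf_on n (c ` W) (v a)" and x: "x \<in> W"
    and F1: "\<And>y. y \<in> W \<Longrightarrow> F1 y = F.comb v (c y)" and F2: "\<And>y. y \<in> W \<Longrightarrow> F2 y = F.combh v (c y)"
  shows "(compl_proj M f L x (deriv_along (tv M C c x b) F1), compl_proj M fh Lh x (deriv_along (tv M C c x b) F2))
     = F.phc (c x) b (\<lambda>a. v a (c x))"
proof -
  have xU: "x \<in> U" using x W by blast
  note cx = y_facts(3)[OF xU]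
  have WC: "W \<subseteq> C" using W U by blast
  have o: "openE n (c ` W)" using chart_open[OF Cc WC] W(1) by simp
  have WU: "c ` W \<subseteq> c ` U" using W by blast
  have cxW: "c x \<in> c ` W" using x by blast
  note CC = F.Cinf_comb[OF o WU, of v, OF v]
  have d1: "deriv_along (tv M C c x b) F1 = (\<Sum>i<n. b i *\<^sub>R partial i (F.comb v) (c x))"
    by (rule deriv_along_coords(2)[where U = W, OF Cc WC CC(1) _ x]) (simp_all add: F1)
  have d2: "deriv_along (tv M C c x b) F2 = (\<Sum>i<n. b i *\<^sub>R partial i (F.combh v) (c x))"
    by (rule deriv_along_coords(2)[where U = W, OF Cc WC CC(2) _ x]) (simp_all add: F2)
  have q: "F.Q (c x) (partial i (F.comb v) (c x)) = (\<Sum>a<m. v a (c x) *\<^sub>R F.Q (c x) (partial i (e a) (c x)))"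
    "F.Qh (c x) (partial i (F.combh v) (c x)) = (\<Sum>a<m. v a (c x) *\<^sub>R F.Qh (c x) (partial i (eh a) (c x)))" if i: "i < n" for i
  proof -
    note pc = F.partial_comb[where v = v, OF o WU v cxW i]
    show "F.Q (c x) (partial i (F.comb v) (c x)) = (\<Sum>a<m. v a (c x) *\<^sub>R F.Q (c x) (partial i (e a) (c x)))"
      by (simp only: pc F.Q_add F.Q_comb[OF cx] F.Q_sum[of "c x" "\<lambda>a. v a (c x) *\<^sub>R partial i (e a) (c x)"] F.Q_scale add_0)
    show "F.Qh (c x) (partial i (F.combh v) (c x)) = (\<Sum>a<m. v a (c x) *\<^sub>R F.Qh (c x) (partial i (eh a) (c x)))"
      by (simp only: pc F.Qh_add F.Qh_comb[OF cx] F.Qh_sum[of "c x" "\<lambda>a. v a (c x) *\<^sub>R partial i (eh a) (c x)"] F.Qh_scale add_0)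
  qed
  have "F.Q (c x) (deriv_along (tv M C c x b) F1) = (\<Sum>i<n. b i *\<^sub>R (\<Sum>a<m. v a (c x) *\<^sub>R F.Q (c x) (partial i (e a) (c x))))"
    unfolding d1 F.Q_sum F.Q_scale using q by simp
  also have "\<dots> = fst (F.phc (c x) b (\<lambda>a. v a (c x)))"
    unfolding F.phc_sum fst_sum fst_scaleR F.ph_def fst_conv scaleR_sum_right by (subst sum.swap) (simp add: mult.commute)
  finally have 1: "F.Q (c x) (deriv_along (tv M C c x b) F1) = fst (F.phc (c x) b (\<lambda>a. v a (c x)))" .
  have "F.Qh (c x) (deriv_along (tv M C c x b) F2) = (\<Sum>i<n. b i *\<^sub>R (\<Sum>a<m. v a (c x) *\<^sub>R F.Qh (c x) (partial i (eh a) (c x))))"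
    unfolding d2 F.Qh_sum F.Qh_scale using q by simp
  also have "\<dots> = snd (F.phc (c x) b (\<lambda>a. v a (c x)))"
    unfolding F.phc_sum snd_sum snd_scaleR F.ph_def snd_conv scaleR_sum_right by (subst sum.swap) (simp add: mult.commute)
  finally show ?thesis using 1 by (simp add: compl_proj_Q[OF xU])
qed

lemma comb_split: "F.comb v (c y) = (\<Sum>i<n. v i (c y) *\<^sub>R partial i ff (c y)) + (\<Sum>j<l. v (n + j) (c y) *\<^sub>R \<xi> j y)"
  "F.combh v (c y) = (\<Sum>i<n. v i (c y) *\<^sub>R partial i ffh (c y)) + (\<Sum>j<l. v (n + j) (c y) *\<^sub>R \<tau> y (\<xi> j y))" if "y \<in> U"
  unfolding F.comb_def F.combh_def sum_lessThan_add using e_tan e_nor[OF that] by simp_all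

text \<open>Any local section has smooth coefficients in the frame, so \<open>deriv_comb\<close>
  evaluates it. The result involves the section at \<open>x\<close> alone and is therefore the same
  for all extensions.\<close>

lemma section_comb:
  assumes Z: "vector_field M U1 Z" and \<zeta>: "bundle_section M L U1 \<zeta>" and x: "x \<in> U" "x \<in> U1" and v: "(Z x, \<zeta> x) = elem x v"
  shows "(compl_proj M f L x (deriv_along (tv M C c x b) (\<lambda>y. deriv_along (Z y) f + \<zeta> y)),
     compl_proj M fh Lh x (deriv_along (tv M C c x b) (\<lambda>y. deriv_along (Z y) fh + \<tau> y (\<zeta> y)))) = F.phc (c x) b v"
proof -
  define W where "W = U \<inter> U1"
  have \<zeta>s: "smooth_on M U1 \<zeta>" and \<zeta>L: "\<And>y. y \<in> U1 \<Longrightarrow> \<zeta> y \<in> L y" using \<zeta> by (auto simp: bundle_section_def)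
  have W: "openin (mtop M) W" "W \<subseteq> U" "x \<in> W"
    using U(1) vector_field_open[OF Z] x by (auto simp: W_def openin_Int)
  have WC: "W \<subseteq> C" using W U by blast
  have o: "openE n (c ` W)" using chart_open[OF Cc WC] W(1) by simp
  have WU: "c ` W \<subseteq> c ` U" using W by blast
  have W1: "c ` W \<subseteq> c ` (C \<inter> U1)" using WC by (auto simp: W_def)
  \<comment> \<open>Tangential coefficients come from applying the field to the coordinate
    functions, those along \<open>L\<close> from pairing with the dual frame; both descriptions are
    visibly smooth.\<close>
  define vv where "vv a u = (if a < n then Z (inv_into C c u) (\<lambda>y. c y a) else es a u \<bullet> \<zeta> (inv_into C c u))" for a u
  have inv: "inv_into C c (c y) = y" if "y \<in> W" for y using chart_inv[OF Cc] WC that by blast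
  have vvC: "Cinf_on n (c ` W) (vv a)" if a: "a < m" for a
  proof (cases "a < n")
    case True
    then show ?thesis unfolding vv_def[abs_def] using Cinf_subset[OF vector_field_coeffs[OF Cc Z True] o W1] by simp
  next
    case False
    have "Cinf_on n (c ` W) (\<lambda>u. es a u \<bullet> (\<zeta> \<circ> inv_into C c) u)"
      by (rule Cinf_inner[OF Cinf_subset[OF es[OF a] o WU] Cinf_subset[OF smooth_on_chartD[OF \<zeta>s Cc] o W1]])
    then show ?thesis using False unfolding vv_def[abs_def] by simp
  qed
  have es_sum: "es (n + j) (c y) \<bullet> (\<Sum>k<l. s k *\<^sub>R \<xi> k y) = s j" if "y \<in> U" "j < l" for y j s
  proof -
    have "(\<Sum>k<l. s k *\<^sub>R \<xi> k y) = (\<Sum>k<l. s k *\<^sub>R e (n + k) (c y))" using e_nor[OF that(1)] by simp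
    also have "es (n + j) (c y) \<bullet> \<dots> = s j"
      by (rule dual_coeff[where ws = "\<lambda>j. es (n + j) (c y)" and w = "\<lambda>j. e (n + j) (c y)"])
         (use dual[OF y_facts(3)[OF that(1)]] that(2) in auto)
    finally show ?thesis .
  qed
  have \<zeta>e: "\<zeta> y = (\<Sum>j<l. vv (n + j) (c y) *\<^sub>R \<xi> j y)" if y: "y \<in> W" for y
  proof -
    have yU: "y \<in> U" "y \<in> U1" using y by (auto simp: W_def)
    have "\<zeta> y \<in> span ((\<lambda>j. \<xi> j y) ` {..<l})" using \<zeta>L[OF yU(2)] span[OF yU(1)] by simp
    then obtain s where s: "\<zeta> y = (\<Sum>j<l. s j *\<^sub>R \<xi> j y)" using span_image_sum[of "{..<l}" "\<zeta> y" "\<lambda>j. \<xi> j y"] by auto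
    have "vv (n + j) (c y) = s j" if "j < l" for j
      using es_sum[OF yU(1) that, of s] unfolding s[symmetric] by (simp add: vv_def inv[OF y])
    then show ?thesis using s by simp
  qed
  have Zt: "Z y = tv M C c y (\<lambda>i. vv i (c y))" if y: "y \<in> W" for y
  proof -
    have "Z y = tv M C c y (\<lambda>i. Z y (\<lambda>y. c y i))"
      by (rule tangent_coeffs[OF Cc]) (use y WC vector_field_tangent[OF Z] in \<open>auto simp: W_def\<close>)
    also have "\<dots> = tv M C c y (\<lambda>i. vv i (c y))" by (rule tv_cong[OF Cc]) (simp add: vv_def inv[OF y])
    finally show ?thesis .
  qed
  have \<xi>L: "\<xi> j y \<in> L y" if "j \<in> {..<l}" "y \<in> W" for j y using \<xi>_L[OF frame_facts, of j y] that W by auto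
  have key: "(compl_proj M f L x (deriv_along (tv M C c x b) (\<lambda>y. deriv_along (Z y) f + \<zeta> y)),
     compl_proj M fh Lh x (deriv_along (tv M C c x b) (\<lambda>y. deriv_along (Z y) fh + \<tau> y (\<zeta> y)))) = F.phc (c x) b (\<lambda>a. vv a (c x))"
  proof (rule deriv_comb[OF W(1,2) vvC W(3)])
    fix y assume y: "y \<in> W"
    have yU: "y \<in> U" using y W by blast
    show "deriv_along (Z y) f + \<zeta> y = F.comb vv (c y)"
      unfolding comb_split(1)[OF yU] Zt[OF y] deriv_f(1)[OF Cc y_facts(1)[OF yU]] using \<zeta>e[OF y] by simp
    have "\<tau> y (\<zeta> y) = (\<Sum>j<l. vv (n + j) (c y) *\<^sub>R \<tau> y (\<xi> j y))"
      unfolding \<zeta>e[OF y] by (rule tau_sum[OF y_facts(2)[OF yU]]) (rule \<xi>L[OF _ y])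
    then show "deriv_along (Z y) fh + \<tau> y (\<zeta> y) = F.combh vv (c y)"
      unfolding comb_split(2)[OF yU] Zt[OF y] deriv_f(2)[OF Cc y_facts(1)[OF yU]] by simp
  qed
  have Zx: "Z x = tv M C c x v" and \<zeta>x: "\<zeta> x = (\<Sum>j<l. v (n + j) *\<^sub>R \<xi> j x)" using v by (simp_all add: elem_def)
  have v1: "vv a (c x) = v a" if "a < n" for a
    using that tv_coord[OF Cc y_facts(1)[OF x(1)]] by (simp add: vv_def inv[OF W(3)] Zx)
  have v2: "vv (n + j) (c x) = v (n + j)" if "j < l" for j
    using that es_sum[OF x(1), of j "\<lambda>j. v (n + j)"] by (simp add: vv_def inv[OF W(3)] \<zeta>x)
  have "vv a (c x) = v a" if "a < m" for a
    by (rule less_m_cases[where P = "\<lambda>a. vv a (c x) = v a", OF v1 v2 that])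
  then have "F.phc (c x) b (\<lambda>a. vv a (c x)) = F.phc (c x) b v" by (simp add: F.phc_def)
  then show ?thesis using key by simp
qed

lemma phi_elem:
  assumes x: "x \<in> U"
  shows "phi M f fh L Lh \<tau> x (tv M C c x b) (elem x v) = F.phc (c x) b v"
  unfolding phi_def
proof (rule the_equality)
  let ?P = "\<lambda>w. \<forall>U Z \<xi>. x \<in> U \<and> vector_field M U Z \<and> bundle_section M L U \<xi> \<and> (Z x, \<xi> x) = elem x v \<longrightarrow>
       w = (compl_proj M f L x (deriv_along (tv M C c x b) (\<lambda>y. deriv_along (Z y) f + \<xi> y)),
            compl_proj M fh Lh x (deriv_along (tv M C c x b) (\<lambda>y. deriv_along (Z y) fh + \<tau> y (\<xi> y))))"
  show "?P (F.phc (c x) b v)"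
  proof (intro allI impI, elim conjE)
    fix U1 Z \<zeta> assume "x \<in> U1" "vector_field M U1 Z" "bundle_section M L U1 \<zeta>" "(Z x, \<zeta> x) = elem x v"
    from section_comb[OF this(2,3) x this(1,4)]
    show "F.phc (c x) b v = (compl_proj M f L x (deriv_along (tv M C c x b) (\<lambda>y. deriv_along (Z y) f + \<zeta> y)),
            compl_proj M fh Lh x (deriv_along (tv M C c x b) (\<lambda>y. deriv_along (Z y) fh + \<tau> y (\<zeta> y))))" by simp
  qed
  fix w assume w: "?P w"
  \<comment> \<open>The extension with constant coefficients shows that the condition defining
    \<open>phi\<close> is not vacuous, and so pins down \<open>w\<close>.\<close>
  let ?Z = "\<lambda>y. tv M C c y v" and ?\<zeta> = "\<lambda>y. \<Sum>j<l. v (n + j) *\<^sub>R \<xi> j y"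
  have Z: "vector_field M U ?Z"
    by (rule vector_field_tv[OF Cc U, where \<alpha> = "\<lambda>i u. v i"]) (simp add: Cinf_const[OF F.S])
  have \<zeta>s: "smooth_on M U (\<lambda>y. \<Sum>j\<in>A. v (n + j) *\<^sub>R \<xi> j y)" if "finite A" "A \<subseteq> {..<l}" for A
    using that
  proof (induction A)
    case empty
    have "Cinf_on n (c ` U) ((\<lambda>y. 0::'b) \<circ> inv_into C c)" using Cinf_const[OF F.S] by (simp add: o_def)
    from smooth_on_chartI[OF Cc U(2) this] show ?case by simp
  next
    case (insert j A)
    have "smooth_on M U (\<lambda>y. v (n + j) *\<^sub>R \<xi> j y)"
      by (rule smooth_on_linear[OF bounded_linear_scaleR_right \<xi>]) (use insert.prems in auto)
    from smooth_on_add[OF this insert.IH] show ?case using insert by simp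
  qed
  have "?\<zeta> y \<in> L y" if "y \<in> U" for y
    using \<xi>_L[OF frame_facts _ that] L_sub(1)[OF y_facts(2)[OF that]] by (intro subspace_sum subspace_scale) auto
  then have \<zeta>: "bundle_section M L U ?\<zeta>" using \<zeta>s[of "{..<l}"] by (simp add: bundle_section_def)
  have el: "(?Z x, ?\<zeta> x) = elem x v" by (simp add: elem_def)
  from w[rule_format, of U ?Z ?\<zeta>] x Z \<zeta> el
  have "w = (compl_proj M f L x (deriv_along (tv M C c x b) (\<lambda>y. deriv_along (?Z y) f + ?\<zeta> y)),
            compl_proj M fh Lh x (deriv_along (tv M C c x b) (\<lambda>y. deriv_along (?Z y) fh + \<tau> y (?\<zeta> y))))" by blast
  also have "\<dots> = F.phc (c x) b v" by (rule section_comb[OF Z \<zeta> x x el])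
  finally show "w = F.phc (c x) b v" .
qed

lemma elem_surj:
  assumes x: "x \<in> U" shows "tangent_space M x \<times> L x = range (elem x)"
proof (intro set_eqI iffI)
  fix p assume p: "p \<in> tangent_space M x \<times> L x"
  obtain X \<eta> where X: "p = (X, \<eta>)" "X \<in> tangent_space M x" "\<eta> \<in> L x" using p by auto
  obtain a where a: "X = tv M C c x a" using X(2) tangent_space_chart[OF Cc y_facts(1)[OF x]] by auto
  have "\<eta> \<in> span ((\<lambda>j. \<xi> j x) ` {..<l})" using X(3) span[OF x] by simp
  then obtain s where s: "\<eta> = (\<Sum>j<l. s j *\<^sub>R \<xi> j x)" using span_image_sum[of "{..<l}" \<eta> "\<lambda>j. \<xi> j x"] by auto
  define v where "v a' = (if a' < n then a a' else s (a' - n))" for a'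
  have "tv M C c x v = X" unfolding a by (rule tv_cong[OF Cc]) (simp add: v_def)
  moreover have "(\<Sum>j<l. v (n + j) *\<^sub>R \<xi> j x) = \<eta>" unfolding s by (simp add: v_def)
  ultimately have "p = elem x v" using X(1) by (simp add: elem_def)
  then show "p \<in> range (elem x)" by simp
next
  fix p assume "p \<in> range (elem x)"
  then obtain v where v: "p = elem x v" by auto
  have "(\<Sum>j<l. v (n + j) *\<^sub>R \<xi> j x) \<in> L x"
    using \<xi>_L[OF frame_facts _ x] L_sub(1)[OF y_facts(2)[OF x]] by (intro subspace_sum subspace_scale) auto
  then show "p \<in> tangent_space M x \<times> L x" using tangent_space_chart[OF Cc y_facts(1)[OF x]] v by (simp add: elem_def)
qed

abbreviation "rk x b \<equiv> dim (range (F.phc (c x) b))"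

lemma phi_rank_tv: "x \<in> U \<Longrightarrow> phi_rank M f fh L Lh \<tau> x (tv M C c x b) = rk x b"
  unfolding phi_rank_def elem_surj by (simp add: image_image phi_elem)

lemma phi_ker_tv: "x \<in> U \<Longrightarrow> phi_ker M f fh L Lh \<tau> x (tv M C c x b) = {elem x v | v. F.phc (c x) b v = 0}"
  unfolding phi_ker_def elem_surj by (auto simp: phi_elem)

lemma rk_le: "rk x b \<le> DIM('b \<times> 'c)" by (rule dim_subset_UNIV)

text \<open>Ranks are bounded by the dimension of the target, so the \<open>Max\<close> in
  \<open>phi_index\<close> is taken over a finite set, and coefficient vectors can replace tangent
  vectors in it.\<close>

lemma phi_index_eq:
  assumes x: "x \<in> U"
  shows "phi_index M f fh L Lh \<tau> x = Max (range (rk x))" "finite (range (rk x))"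
proof -
  show fin: "finite (range (rk x))" by (rule finite_subset[of _ "{..DIM('b \<times> 'c)}"]) (use rk_le in auto)
  have "phi_rank M f fh L Lh \<tau> x ` tangent_space M x = range (rk x)"
    unfolding tangent_space_chart[OF Cc y_facts(1)[OF x]] by (simp add: image_image phi_rank_tv[OF x])
  then show "phi_index M f fh L Lh \<tau> x = Max (range (rk x))" unfolding phi_index_def by simp
qed

lemma regular_iff:
  assumes x: "x \<in> U"
  shows "tv M C c x b \<in> regular_elements M f fh L Lh \<tau> x \<longleftrightarrow> (\<forall>b'. rk x b' \<le> rk x b)"
    "tv M C c x b \<in> regular_elements M f fh L Lh \<tau> x \<Longrightarrow> phi_index M f fh L Lh \<tau> x = rk x b"
proof -
  have 1: "tv M C c x b \<in> regular_elements M f fh L Lh \<tau> x \<longleftrightarrow> rk x b = Max (range (rk x))"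
    unfolding regular_elements_def using tangent_space_chart[OF Cc y_facts(1)[OF x]] by (simp add: phi_rank_tv[OF x] phi_index_eq[OF x])
  show "tv M C c x b \<in> regular_elements M f fh L Lh \<tau> x \<longleftrightarrow> (\<forall>b'. rk x b' \<le> rk x b)"
  proof
    assume "tv M C c x b \<in> regular_elements M f fh L Lh \<tau> x"
    then have "rk x b = Max (range (rk x))" using 1 by simp
    then show "\<forall>b'. rk x b' \<le> rk x b" using Max_ge[OF phi_index_eq(2)[OF x]] by simp
  next
    assume "\<forall>b'. rk x b' \<le> rk x b"
    then have "Max (range (rk x)) = rk x b" by (intro Max_eqI phi_index_eq(2)[OF x]) auto
    then show "tv M C c x b \<in> regular_elements M f fh L Lh \<tau> x" using 1 by simp
  qed
  show "tv M C c x b \<in> regular_elements M f fh L Lh \<tau> x \<Longrightarrow> phi_index M f fh L Lh \<tau> x = rk x b"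
    using 1 phi_index_eq(1)[OF x] by simp
qed

end

context deformation
begin

text \<open>The two dual frames come from \<open>dual_frame\<close>, each on its own neighbourhood;
  the chart is restricted to the intersection.\<close>

lemma frame_chart_exists:
  assumes x0: "x0 \<in> pts M"
  shows "\<exists>C c U \<xi> es esh. x0 \<in> U \<and> frame_chart M g f fh L Lh \<tau> l C c U \<xi> es esh"
proof -
  obtain C c where Cc: "(C, c) \<in> atlas M" "x0 \<in> C" using chart_cover[OF x0] by blast
  obtain U0 \<xi> where U0: "x0 \<in> U0" "\<forall>i<l. smooth_on M U0 (\<xi> i)" "openin (mtop M) U0"
      "\<forall>y\<in>U0. L y = span ((\<lambda>i. \<xi> i y) ` {..<l})"
    using bspec[OF nsb[unfolded normal_subbundle_def] x0] by (elim conjE exE)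
  define U1 where "U1 = C \<inter> U0"
  have U1: "openin (mtop M) U1" "U1 \<subseteq> C" "x0 \<in> U1"
    using U0 Cc chart_open_dom[OF Cc(1)] by (auto simp: U1_def openin_Int)
  have \<xi>1: "smooth_on M U1 (\<xi> j)" if "j < l" for j
    by (rule smooth_on_subset[OF _ U1(1), of U0]) (use U0 that in \<open>auto simp: U1_def\<close>)
  have sp1: "L y = span ((\<lambda>j. \<xi> j y) ` {..<l})" if "y \<in> U1" for y using U0(4) that by (simp add: U1_def)
  note ff = Cc(1) U1(1,2) \<xi>1 sp1
  let ?S = "c ` U1"
  have oS: "openE n ?S" by (rule open_cU[OF ff])
  have u0: "c x0 \<in> ?S" using U1 by blast
  have "\<exists>S' es. openE n S' \<and> c x0 \<in> S' \<and> S' \<subseteq> ?S \<and> (\<forall>i\<in>{..<m}. Cinf_on n S' (es i)) \<and>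
    (\<forall>u\<in>S'. \<forall>i\<in>{..<m}. \<forall>j\<in>{..<m}. es i u \<bullet> E C c \<xi> j u = (if i = j then 1 else 0)) \<and>
    (\<forall>u\<in>S'. \<forall>i\<in>{..<m}. es i u \<in> span ((\<lambda>j. E C c \<xi> j u) ` {..<m}))"
    by (rule dual_frame[where e = "E C c \<xi>" and n = n and S = ?S and I = "{..<m}"])
       (use oS u0 E_smooth(1)[OF ff] E_lin_indep[OF ff u0] in auto)
  then obtain S1 es where S1: "openE n S1 \<and> c x0 \<in> S1 \<and> S1 \<subseteq> ?S \<and> (\<forall>i\<in>{..<m}. Cinf_on n S1 (es i)) \<and>
    (\<forall>u\<in>S1. \<forall>i\<in>{..<m}. \<forall>j\<in>{..<m}. es i u \<bullet> E C c \<xi> j u = (if i = j then 1 else 0)) \<and>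
    (\<forall>u\<in>S1. \<forall>i\<in>{..<m}. es i u \<in> span ((\<lambda>j. E C c \<xi> j u) ` {..<m}))" by (elim exE)
  have "\<exists>S' es. openE n S' \<and> c x0 \<in> S' \<and> S' \<subseteq> ?S \<and> (\<forall>i\<in>{..<m}. Cinf_on n S' (es i)) \<and>
    (\<forall>u\<in>S'. \<forall>i\<in>{..<m}. \<forall>j\<in>{..<m}. es i u \<bullet> Eh C c \<xi> j u = (if i = j then 1 else 0)) \<and>
    (\<forall>u\<in>S'. \<forall>i\<in>{..<m}. es i u \<in> span ((\<lambda>j. Eh C c \<xi> j u) ` {..<m}))"
    by (rule dual_frame[where e = "Eh C c \<xi>" and n = n and S = ?S and I = "{..<m}"])
       (use oS u0 E_smooth(2)[OF ff] Eh_lin_indep[OF ff u0] in auto)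
  then obtain S2 esh where S2: "openE n S2 \<and> c x0 \<in> S2 \<and> S2 \<subseteq> ?S \<and> (\<forall>i\<in>{..<m}. Cinf_on n S2 (esh i)) \<and>
    (\<forall>u\<in>S2. \<forall>i\<in>{..<m}. \<forall>j\<in>{..<m}. esh i u \<bullet> Eh C c \<xi> j u = (if i = j then 1 else 0)) \<and>
    (\<forall>u\<in>S2. \<forall>i\<in>{..<m}. esh i u \<in> span ((\<lambda>j. Eh C c \<xi> j u) ` {..<m}))" by (elim exE)
  define S3 where "S3 = S1 \<inter> S2"
  define U where "U = {y \<in> U1. c y \<in> S3}"
  have cU: "c ` U = S3" using S1 S2 by (auto simp: U_def S3_def)
  have o3: "openE n S3" using S1 S2 by (simp add: S3_def openin_Int)
  have UU: "U \<subseteq> U1" "U \<subseteq> C" using U1(2) by (auto simp: U_def)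
  have oU: "openin (mtop M) U" using chart_open[OF Cc(1) UU(2)] cU o3 by simp
  have "frame_chart M g f fh L Lh \<tau> l C c U \<xi> es esh"
  proof (intro frame_chart.intro frame_chart_axioms.intro)
    show "deformation M g f fh L Lh \<tau> l" by unfold_locales
    show "(C, c) \<in> atlas M" "openin (mtop M) U" "U \<subseteq> C" by (rule Cc oU UU)+
    show "smooth_on M U (\<xi> j)" if "j < l" for j by (rule smooth_on_subset[OF \<xi>1[OF that] oU UU(1)])
    show "L y = span ((\<lambda>j. \<xi> j y) ` {..<l})" if "y \<in> U" for y using sp1 that UU by blast
    show "Cinf_on n (c ` U) (es a)" if "a < m" for a
      unfolding cU by (rule Cinf_subset[OF _ o3, of S1]) (use S1 that in \<open>auto simp: S3_def\<close>)
    show "Cinf_on n (c ` U) (esh a)" if "a < m" for a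
      unfolding cU by (rule Cinf_subset[OF _ o3, of S2]) (use S2 that in \<open>auto simp: S3_def\<close>)
  qed (use S1 S2 in \<open>auto simp: cU S3_def\<close>)
  moreover have "x0 \<in> U" using U1 S1 S2 by (auto simp: U_def S3_def)
  ultimately show ?thesis by (intro exI conjI)
qed

end

section \<open>Singular extensions in charts\<close>

lemma second_countable_Euclidean_space: "second_countable (Euclidean_space n)"
proof -
  have "second_countable (euclidean :: (nat \<Rightarrow> real) topology)"
  proof -
    obtain B :: "(nat \<Rightarrow> real) set set" where B: "countable B" "topological_basis B"
      using ex_countable_basis by blast
    have 1: "\<forall>V\<in>B. openin euclidean V" using topological_basis_open[OF B(2)] by simp
    have "\<exists>V\<in>B. x \<in> V \<and> V \<subseteq> U" if "open U" "x \<in> U" for U x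
      using topological_basisE[OF B(2) that] by metis
    then show ?thesis unfolding second_countable_def using B(1) 1 by (intro exI[of _ B]) simp
  qed
  then show ?thesis unfolding Euclidean_space_top_of_set by (rule second_countable_subtopology)
qed

text \<open>Both kinds of manifolds to be constructed, the extension space \<open>N\<close> and the
  rulings, are covered by one chart, whose only transition map is the identity.\<close>

lemma one_chart_manifold:
  assumes X: "Hausdorff_space X" "second_countable X" and o: "openE d (\<rho> ` topspace X)"
    and emb: "embedding_map X (Euclidean_space d) \<rho>"
  shows "smooth_manifold \<lparr>mtop = X, mdim = d, atlas = {(topspace X, \<rho>)}\<rparr>"
proof -
  have "Cinf_on d (\<rho> ` topspace X) (\<lambda>u. \<rho> (inv_into (topspace X) \<rho> u) i)" for i
    by (rule Cinf_cong[OF Cinf_coord[OF o]]) (simp add: f_inv_into_f)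
  then show ?thesis unfolding smooth_manifold_def using X o emb by simp
qed

lemma embedding_map_Euclidean_space_iff:
  "embedding_map X (Euclidean_space n) c \<longleftrightarrow> embedding_map X euclidean c \<and> c ` topspace X \<subseteq> Rn n"
  unfolding Euclidean_space_top_of_set embedding_map_in_subtopology by simp

lemma embedding_map_subtopology:
  assumes "embedding_map X Y f" shows "embedding_map (subtopology X S) Y f"
proof -
  have h: "homeomorphic_map X (subtopology Y (f ` topspace X)) f" using assms by (simp add: embedding_map_def)
  have "homeomorphic_map (subtopology X (topspace X \<inter> S)) (subtopology (subtopology Y (f ` topspace X)) (f ` (topspace X \<inter> S))) f"
    by (rule homeomorphic_map_subtopologies_alt[OF h]) (use homeomorphic_imp_injective_map[OF h] in \<open>auto simp: inj_on_def\<close>)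
  moreover have "f ` topspace X \<inter> f ` (topspace X \<inter> S) = f ` (topspace X \<inter> S)" by auto
  moreover have "subtopology X (topspace X \<inter> S) = subtopology X S" by (simp add: subtopology_restrict)
  ultimately show ?thesis unfolding embedding_map_def by (simp add: subtopology_subtopology)
qed

lemma partial_cyl:
  assumes "i < Suc n"
  shows "partial i (\<lambda>w. G (w(n := 0))) y = (if i < n then partial i G (y(n := 0)) else 0)"
proof (cases "i < n")
  case True
  then have "(y(i := t))(n := 0) = (y(n := 0))(i := t)" for t by auto
  then show ?thesis using True by (simp add: partial_def)
next
  case False
  then have "i = n" using assms by simp
  then show ?thesis by (simp add: partial_def)
qed

section \<open>The extension \<open>f + t V\<close> as a pair of maps on a manifold\<close>

context frame_chart
begin

lemma ext_partial:
  assumes o: "openE (Suc n) T" and A: "openE n A" "A \<subseteq> c ` U" and T: "\<And>w. w \<in> T \<Longrightarrow> w(n := 0) \<in> A"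
    and V: "Cinf_on n A V" "Cinf_on n A Vh"
  shows "Cinf_on (Suc n) T (\<lambda>w. ff (w(n := 0)) + w n *\<^sub>R V (w(n := 0)))"
    "y \<in> T \<Longrightarrow> i < Suc n \<Longrightarrow> partial i (\<lambda>w. ff (w(n := 0)) + w n *\<^sub>R V (w(n := 0))) y = F.ext V y i"
    "Cinf_on (Suc n) T (\<lambda>w. ffh (w(n := 0)) + w n *\<^sub>R Vh (w(n := 0)))"
    "y \<in> T \<Longrightarrow> i < Suc n \<Longrightarrow> partial i (\<lambda>w. ffh (w(n := 0)) + w n *\<^sub>R Vh (w(n := 0))) y = F.exth Vh y i"
proof -
  have sub: "T \<subseteq> {w \<in> Rn (Suc n). w(n := 0) \<in> A}" using T openE_subset[OF o] by auto
  have 1: "Cinf_on (Suc n) T (\<lambda>w. ff (w(n := 0)))"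
    by (rule Cinf_subset[OF Cinf_cyl[OF Cinf_subset[OF F.f A]] o sub])
  have 2: "Cinf_on (Suc n) T (\<lambda>w. V (w(n := 0)))" by (rule Cinf_subset[OF Cinf_cyl[OF V(1)] o sub])
  have 3: "Cinf_on (Suc n) T (\<lambda>w. w n *\<^sub>R V (w(n := 0)))" by (rule Cinf_scaleR[OF Cinf_coord[OF o] 2])
  show "Cinf_on (Suc n) T (\<lambda>w. ff (w(n := 0)) + w n *\<^sub>R V (w(n := 0)))" by (rule Cinf_add[OF 1 3])
  show "partial i (\<lambda>w. ff (w(n := 0)) + w n *\<^sub>R V (w(n := 0))) y = F.ext V y i" if "y \<in> T" "i < Suc n"
    unfolding partial_add[OF 1 3 that(2,1)] partial_scaleR[OF Cinf_coord[OF o, of n] 2 that(2,1)] partial_coord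
      partial_cyl[OF that(2)] F.ext_def using that(2) by auto
  have 1: "Cinf_on (Suc n) T (\<lambda>w. ffh (w(n := 0)))"
    by (rule Cinf_subset[OF Cinf_cyl[OF Cinf_subset[OF F.fh A]] o sub])
  have 2: "Cinf_on (Suc n) T (\<lambda>w. Vh (w(n := 0)))" by (rule Cinf_subset[OF Cinf_cyl[OF V(2)] o sub])
  have 3: "Cinf_on (Suc n) T (\<lambda>w. w n *\<^sub>R Vh (w(n := 0)))" by (rule Cinf_scaleR[OF Cinf_coord[OF o] 2])
  show "Cinf_on (Suc n) T (\<lambda>w. ffh (w(n := 0)) + w n *\<^sub>R Vh (w(n := 0)))" by (rule Cinf_add[OF 1 3])
  show "partial i (\<lambda>w. ffh (w(n := 0)) + w n *\<^sub>R Vh (w(n := 0))) y = F.exth Vh y i" if "y \<in> T" "i < Suc n"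
    unfolding partial_add[OF 1 3 that(2,1)] partial_scaleR[OF Cinf_coord[OF o, of n] 2 that(2,1)] partial_coord
      partial_cyl[OF that(2)] F.exth_def using that(2) by auto
qed

text \<open>\<open>N\<close> is the open set \<open>T\<close> with the identity as chart, of one
  dimension more than \<open>M\<close>. The embedding \<open>j\<close> is the chart \<open>c\<close>
  itself, because \<open>Rn n\<close> lies in \<open>Rn (Suc n)\<close> as the slice
  \<open>t = 0\<close>. Independence of the derivatives is assumed for the extension of
  \<open>f\<close> only and reaches that of \<open>fh\<close> through the Gram matrices.\<close>

lemma extension_singular:
  assumes A: "openE n A" "A \<subseteq> c ` U" and V: "Cinf_on n A V" "Cinf_on n A Vh"
    and o: "openE (Suc n) T" and AT: "A \<subseteq> T" and T: "\<And>w. w \<in> T \<Longrightarrow> w(n := 0) \<in> A"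
    and iso: "\<And>w i j. w \<in> T \<Longrightarrow> i < Suc n \<Longrightarrow> j < Suc n \<Longrightarrow> F.ext V w i \<bullet> F.ext V w j = F.exth Vh w i \<bullet> F.exth Vh w j"
    and li: "\<And>w. w \<in> T - A \<Longrightarrow> lin_indep {..<Suc n} (F.ext V w)"
  shows "singularly_extends (open_sub M (inv_into C c ` A)) f fh"
proof -
  define V0 where "V0 = inv_into C c ` A"
  have AC: "A \<subseteq> c ` C" using A(2) cU_sub by blast
  have V0C: "V0 \<subseteq> C" using AC chart_inv2(1)[OF Cc] by (auto simp: V0_def)
  have cV0: "c ` V0 = A" unfolding V0_def image_image using AC chart_inv2(2)[OF Cc] by force
  have oV0: "openin (mtop M) V0" using chart_open[OF Cc V0C] cV0 A(1) by simp
  interpret O: open_submfd M V0 by unfold_locales (rule oV0)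
  define X where "X = subtopology (Euclidean_space (Suc n)) T"
  have tX: "topspace X = T" using openE_subset[OF o] by (auto simp: X_def)
  define N where "N = \<lparr>mtop = X, mdim = Suc n, atlas = {(topspace X, \<lambda>u. u)}\<rparr>"
  have embT: "embedding_map X (Euclidean_space (Suc n)) (\<lambda>u. u)"
  proof -
    have "homeomorphic_map (Euclidean_space (Suc n)) (Euclidean_space (Suc n)) id" by simp
    then have "embedding_map (Euclidean_space (Suc n)) (Euclidean_space (Suc n)) id"
      unfolding embedding_map_def by (simp del: topspace_Rn)
    then show ?thesis unfolding X_def id_def by (rule embedding_map_subtopology)
  qed
  have smN: "smooth_manifold N" unfolding N_def
    by (rule one_chart_manifold)
      (use embT o tX in \<open>auto simp: X_def Hausdorff_space_subtopology Hausdorff_Euclidean_space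
         second_countable_subtopology second_countable_Euclidean_space\<close>)
  interpret N: smooth_mfd N by unfold_locales (rule smN)
  have N [simp]: "mtop N = X" "mdim N = Suc n" "atlas N = {(T, \<lambda>u. u)}" by (simp_all add: N_def tX)
  have Nc: "(T, \<lambda>u. u) \<in> atlas N" by simp
  have invT: "inv_into T (\<lambda>u. u) w = w" if "w \<in> T" for w using N.chart_inv[OF Nc that] .
  let ?F = "\<lambda>w. ff (w(n := 0)) + w n *\<^sub>R V (w(n := 0))" and ?Fh = "\<lambda>w. ffh (w(n := 0)) + w n *\<^sub>R Vh (w(n := 0))"
  note EP0 = ext_partial[OF o A T V]
  have EP: "Cinf_on (Suc n) T ?F" "Cinf_on (Suc n) T ?Fh" using EP0 by simp_all
  have EP2: "partial i ?F y = F.ext V y i" if "y \<in> T" "i < Suc n" for y i by (rule EP0(2)[OF _ that])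
  have EP4: "partial i ?Fh y = F.exth Vh y i" if "y \<in> T" "i < Suc n" for y i by (rule EP0(4)[OF _ that])
  have F: "smooth_on N T ?F" "smooth_on N T ?Fh"
    by (rule N.deriv_along_coords(1)[OF Nc, where H = ?F]; use EP in simp)
       (rule N.deriv_along_coords(1)[OF Nc, where H = ?Fh]; use EP in simp)
  have D: "deriv_along (tv N T (\<lambda>u. u) w b) ?F = (\<Sum>i<Suc n. b i *\<^sub>R F.ext V w i)"
     if "w \<in> T" for w b
  proof -
    have "deriv_along (tv N T (\<lambda>u. u) w b) ?F = (\<Sum>i<Suc n. b i *\<^sub>R partial i ?F w)"
      by (rule N.deriv_along_coords(2)[OF Nc, where H = ?F and U = T, unfolded N(2)]) (use EP(1) that in auto)
    also have "\<dots> = (\<Sum>i<Suc n. b i *\<^sub>R F.ext V w i)" by (rule sum.cong) (use EP2[OF that] in auto)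
    finally show ?thesis .
  qed
  have Dh: "deriv_along (tv N T (\<lambda>u. u) w b) ?Fh = (\<Sum>i<Suc n. b i *\<^sub>R F.exth Vh w i)"
     if "w \<in> T" for w b
  proof -
    have "deriv_along (tv N T (\<lambda>u. u) w b) ?Fh = (\<Sum>i<Suc n. b i *\<^sub>R partial i ?Fh w)"
      by (rule N.deriv_along_coords(2)[OF Nc, where H = ?Fh and U = T, unfolded N(2)]) (use EP(2) that in auto)
    also have "\<dots> = (\<Sum>i<Suc n. b i *\<^sub>R F.exth Vh w i)" by (rule sum.cong) (use EP4[OF that] in auto)
    finally show ?thesis .
  qed
  have TN: "tangent_space N w = range (tv N T (\<lambda>u. u) w)" if "w \<in> T" for w
    by (rule N.tangent_space_chart[OF Nc that])
  have cT: "c x \<in> T" "c x \<in> A" "x \<in> C" if "x \<in> V0" for x using that cV0 AT V0C by auto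
  have cn: "c x n = 0" if "x \<in> V0" for x using chart_image_Rn[OF Cc cT(3)[OF that]] by (simp add: Rn_def)
  have ptsM': "pts (open_sub M V0) = V0" using O.sub_simps by simp
  have "embedding (open_sub M V0) N c"
    unfolding embedding_def smooth_map_def
  proof (intro conjI ballI impI)
    have e: "embedding_map (subtopology (mtop M) V0) (Euclidean_space n) c"
      using embedding_map_subtopology[OF chart_embedding[OF Cc], of V0] V0C by (simp add: subtopology_subtopology Int_absorb1)
    have "embedding_map (subtopology (mtop M) V0) (Euclidean_space (Suc n)) c"
      using e Rn_mono[of n "Suc n"] unfolding embedding_map_Euclidean_space_iff by auto
    then show e2: "embedding_map (mtop (open_sub M V0)) (mtop N) c"
      using cT by (auto simp: X_def embedding_map_in_subtopology)
    then show "continuous_map (mtop (open_sub M V0)) (mtop N) c"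
      by (auto simp: embedding_map_def homeomorphic_imp_continuous_map continuous_map_in_subtopology dest: homeomorphic_imp_continuous_map)
    have "smooth_on (open_sub M V0) V0 (\<lambda>x. c x i)" if "i < Suc n" for i
    proof (cases "i < n")
      case True
      show ?thesis unfolding O.sub_smooth_on
        using smooth_on_subset[OF smooth_coord[OF Cc True] oV0 V0C] by simp
    next
      case False
      \<comment> \<open>The last coordinate is \<open>t\<close>, which is 0 on the image of the
        chart.\<close>
      then have "i = n" using that by simp
      have "smooth_on M V0 (\<lambda>x. 0::real)" by (rule smooth_on_chartI[OF Cc V0C]) (simp add: cV0 A(1) o_def)
      then have "smooth_on M V0 (\<lambda>x. c x n)" by (rule smooth_on_cong) (simp add: cn)
      then show ?thesis unfolding O.sub_smooth_on \<open>i = n\<close> by simp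
    qed
    moreover have "{x \<in> pts (open_sub M V0). c x \<in> T} = V0" using cT ptsM' by auto
    ultimately show "case p of (C', c') \<Rightarrow> \<forall>i<mdim N. smooth_on (open_sub M V0) {x \<in> pts (open_sub M V0). c x \<in> C'} (\<lambda>x. c' (c x) i)"
      if "p \<in> atlas N" for p using that by auto
    fix x Z assume x: "x \<in> pts (open_sub M V0)" and Z: "Z \<in> tangent_space (open_sub M V0) x"
      and 0: "push N c x Z = (\<lambda>_. 0)"
    have xV: "x \<in> V0" using x ptsM' by simp
    obtain b where b: "Z = tv M C c x b"
      using Z unfolding O.sub_tangent_space[OF xV] tangent_space_chart[OF Cc cT(3)[OF xV]] by auto
    have "b i = 0" if i: "i < n" for i
    proof -
      have "smooth_on N T (\<lambda>w. w i)" using N.smooth_coord[OF Nc, of i] i by simp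
      then have "smooth_near N (c x) (\<lambda>w. w i)" by (rule N.smooth_nearI) (rule cT(1)[OF xV])
      then have "push N c x Z (\<lambda>w. w i) = Z (\<lambda>y. c y i)" by (simp add: push_def o_def)
      then have "Z (\<lambda>y. c y i) = 0" using 0 by simp
      then show ?thesis using tv_coord[OF Cc cT(3)[OF xV] i] b by simp
    qed
    then show "Z = (\<lambda>_. 0)" using tv_zero_iff[OF Cc cT(3)[OF xV]] b by simp
  qed
  moreover have "deriv_along Y ?F \<bullet> deriv_along Z ?F = deriv_along Y ?Fh \<bullet> deriv_along Z ?Fh"
    if "w \<in> T" "Y \<in> tangent_space N w" "Z \<in> tangent_space N w" for w Y Z
  proof -
    from that TN[OF that(1)] obtain a where "Y = tv N T (\<lambda>u. u) w a" by auto
    moreover from that TN[OF that(1)] obtain b where "Z = tv N T (\<lambda>u. u) w b" by auto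
    ultimately show ?thesis using D[OF that(1)] Dh[OF that(1)] iso[OF that(1)]
      by (simp add: inner_sum_left inner_sum_right del: sum.lessThan_Suc)
  qed
  moreover have "f x = ?F (c x) \<and> fh x = ?Fh (c x)" if "x \<in> V0" for x
  proof -
    have "(c x)(n := 0) = c x" using cn[OF that] by auto
    then show ?thesis using cn[OF that] chart_inv[OF Cc cT(3)[OF that]] by (simp add: fc_def[OF Cc] fhc_def[OF Cc])
  qed
  moreover have "immersion_at N ?F w \<and> immersion_at N ?Fh w" if w: "w \<in> T - A" for w
  proof -
    have wT: "w \<in> T" using w by blast
    have lih: "lin_indep {..<Suc n} (F.exth Vh w)" unfolding lin_indep_def
    proof (rule allI, rule impI)
      fix k assume k: "(\<Sum>i\<in>{..<Suc n}. k i *\<^sub>R F.exth Vh w i) = 0"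
      have "(\<Sum>i\<in>{..<Suc n}. k i *\<^sub>R F.ext V w i) = 0"
        by (rule gram_lin_indep[where w = "F.exth Vh w", OF _ k]) (use iso[OF wT] in auto)
      then show "\<forall>i\<in>{..<Suc n}. k i = 0" using li[OF w] unfolding lin_indep_def by blast
    qed
    show ?thesis unfolding immersion_at_def TN[OF wT]
    proof (intro conjI ballI impI)
      fix Z assume "Z \<in> range (tv N T (\<lambda>u. u) w)" and 0: "deriv_along Z ?F = 0"
      then obtain b where b: "Z = tv N T (\<lambda>u. u) w b" by auto
      then have "(\<Sum>i<Suc n. b i *\<^sub>R F.ext V w i) = 0" using D[OF wT] 0 by simp
      then show "Z = (\<lambda>_. 0)" using li[OF w] N.tv_zero_iff[OF Nc wT] unfolding lin_indep_def b by (simp del: sum.lessThan_Suc)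
    next
      fix Z assume "Z \<in> range (tv N T (\<lambda>u. u) w)" and 0: "deriv_along Z ?Fh = 0"
      then obtain b where b: "Z = tv N T (\<lambda>u. u) w b" by auto
      then have "(\<Sum>i<Suc n. b i *\<^sub>R F.exth Vh w i) = 0" using Dh[OF wT] 0 by simp
      then show "Z = (\<lambda>_. 0)" using lih N.tv_zero_iff[OF Nc wT] unfolding lin_indep_def b by (simp del: sum.lessThan_Suc)
    qed
  qed
  ultimately show ?thesis unfolding singularly_extends_def V0_def[symmetric]
    by (intro exI[of _ N] exI[of _ "1::nat"] exI[of _ c] exI[of _ ?F] exI[of _ ?Fh])
       (use smN F cV0 tX ptsM' in auto)
qed

lemma genuine_frame_chart:
  assumes gd: "strongly_genuine_deformation M g f fh"
  shows "genuine_frames n m (c ` U) ff ffh e es eh esh"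
proof (intro genuine_frames.intro genuine_frames_axioms.intro)
  show "isometric_frames n m (c ` U) ff ffh e es eh esh" by unfold_locales
  fix A V Vh T
  assume A: "A \<noteq> {}" "openE n A" "A \<subseteq> c ` U" and V: "Cinf_on n A V" "Cinf_on n A Vh"
    and o: "openE (Suc n) T" and AT: "A \<subseteq> T" and T: "\<And>w. w \<in> T \<Longrightarrow> w(n := 0) \<in> A"
    and iso: "\<And>w i j. w \<in> T \<Longrightarrow> i < Suc n \<Longrightarrow> j < Suc n \<Longrightarrow> F.ext V w i \<bullet> F.ext V w j = F.exth Vh w i \<bullet> F.exth Vh w j"
  show "\<exists>w\<in>T - A. \<not> lin_indep {..<Suc n} (F.ext V w)"
  proof (rule ccontr)
    assume "\<not> (\<exists>w\<in>T - A. \<not> lin_indep {..<Suc n} (F.ext V w))"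
    then have li: "lin_indep {..<Suc n} (F.ext V w)" if "w \<in> T - A" for w using that by blast
    have "singularly_extends (open_sub M (inv_into C c ` A)) f fh"
      by (rule extension_singular[OF A(2,3) V o AT T iso li])
    moreover have "openin (mtop M) (inv_into C c ` A)" "inv_into C c ` A \<noteq> {}"
    proof -
      have AC: "A \<subseteq> c ` C" using A(3) cU_sub by blast
      have "inv_into C c ` A \<subseteq> C" using AC chart_inv2(1)[OF Cc] by auto
      moreover have "c ` inv_into C c ` A = A" unfolding image_image using AC chart_inv2(2)[OF Cc] by force
      ultimately show "openin (mtop M) (inv_into C c ` A)" using chart_open[OF Cc, of "inv_into C c ` A"] A(2) by simp
      show "inv_into C c ` A \<noteq> {}" using A(1) by simp
    qed
    ultimately show False using gd unfolding strongly_genuine_deformation_def by blast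
  qed
qed

end

section \<open>Totally geodesic submanifolds with flat image\<close>

context smooth_mfd
begin

lemma smooth_on_inner: "smooth_on M U F \<Longrightarrow> smooth_on M U G \<Longrightarrow> smooth_on M U (\<lambda>y. F y \<bullet> G y)"
  for F G :: "'a \<Rightarrow> 'b::euclidean_space"
  by (rule smooth_on_bilinear[OF bounded_bilinear_inner])

lemma smooth_on_const: "openin (mtop M) U \<Longrightarrow> smooth_on M U (\<lambda>y. k)"
proof (rule smooth_onI)
  fix C c assume U: "openin (mtop M) U" and Cc: "(C, c) \<in> atlas M"
  have "openE n (c ` (C \<inter> U))" using chart_open[OF Cc, of "C \<inter> U"] chart_open_dom[OF Cc] U by auto
  then show "Cinf_on n (c ` (C \<inter> U)) ((\<lambda>y. k) \<circ> inv_into C c)" by (simp add: o_def)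
qed

lemma tangent_apply:
  assumes X: "X \<in> tangent_space M x" and Cc: "(C, c) \<in> atlas M" and x: "x \<in> C" "x \<in> U" and h: "smooth_on M U h"
  shows "X h = (\<Sum>i<n. X (\<lambda>y. c y i) * partial i (h \<circ> inv_into C c) (c x))"
  using tangent_coeffs[OF Cc x(1) X] tv_apply[OF Cc h x(2)] by metis

lemma deriv_along_apply:
  fixes F :: "'a \<Rightarrow> 'b::euclidean_space"
  assumes X: "X \<in> tangent_space M x" and Cc: "(C, c) \<in> atlas M" and x: "x \<in> C" "x \<in> U" and F: "smooth_on M U F"
  shows "deriv_along X F = (\<Sum>i<n. X (\<lambda>y. c y i) *\<^sub>R partial i (F \<circ> inv_into C c) (c x))"
  using tangent_coeffs[OF Cc x(1) X] deriv_along_tv[OF Cc x F] by metis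

lemma pts_chart: assumes "x \<in> U" "openin (mtop M) U" obtains C c where "(C, c) \<in> atlas M" "x \<in> C"
  using assms chart_cover[of x] openin_subset by (metis subsetD)

lemma deriv_along_inner:
  fixes F :: "'a \<Rightarrow> 'b::euclidean_space"
  assumes X: "X \<in> tangent_space M x" and x: "x \<in> U" and F: "smooth_on M U F"
  shows "deriv_along X F \<bullet> b = X (\<lambda>y. F y \<bullet> b)"
proof -
  obtain C c where Cc: "(C, c) \<in> atlas M" "x \<in> C" by (rule pts_chart[OF x smooth_on_open[OF F]])
  have s: "smooth_on M U (\<lambda>y. F y \<bullet> b)" by (rule smooth_on_linear[OF bounded_linear_inner_left F])
  have cx: "c x \<in> c ` (C \<inter> U)" using x Cc by blast
  have "partial i ((\<lambda>y. F y \<bullet> b) \<circ> inv_into C c) (c x) = partial i (F \<circ> inv_into C c) (c x) \<bullet> b" if "i < n" for i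
    using partial_linear[OF bounded_linear_inner_left smooth_on_chartD[OF F Cc(1)] that cx, of b] by (simp add: o_def)
  then show ?thesis unfolding deriv_along_apply[OF X Cc x F] tangent_apply[OF X Cc x s] by (simp add: inner_sum_left)
qed

lemma deriv_along_smooth:
  fixes F :: "'a \<Rightarrow> 'b::euclidean_space"
  assumes X: "vector_field M U X" and F: "smooth_on M W F" and UW: "U \<subseteq> W"
  shows "smooth_on M U (\<lambda>y. deriv_along (X y) F)"
proof -
  have "smooth_on M U (\<lambda>y. \<Sum>b\<in>A. X y (\<lambda>z. F z \<bullet> b) *\<^sub>R b)" if "finite A" for A
    using that
  proof (induction A)
    case empty then show ?case using smooth_on_const[OF vector_field_open[OF X]] by simp
  next
    case (insert b A)
    have "smooth_on M U (\<lambda>z. F z \<bullet> b)"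
      by (rule smooth_on_subset[OF smooth_on_linear[OF bounded_linear_inner_left F] vector_field_open[OF X] UW])
    then have "smooth_on M U (\<lambda>y. X y (\<lambda>z. F z \<bullet> b))" using X unfolding vector_field_def by simp
    then have "smooth_on M U (\<lambda>y. X y (\<lambda>z. F z \<bullet> b) *\<^sub>R b)"
      by (rule smooth_on_linear[OF bounded_linear_scaleR_left])
    from smooth_on_add[OF this insert.IH] show ?case using insert by simp
  qed
  from this[OF finite_Basis] show ?thesis by (simp add: deriv_along_def)
qed

text \<open>In a chart the second derivatives of \<open>h\<close> cancel by symmetry, and first
  derivatives with coefficients \<open>\<gamma>\<close> remain. Tangency matters because
  \<open>koszul\<close> applies the metric to brackets, while the isometry condition evaluates
  \<open>g\<close> on tangent vectors only.\<close>

lemma bracket_tangent: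
  assumes X: "vector_field M U X" and Y: "vector_field M U Y" and x: "x \<in> U"
  shows "bracket M X Y x \<in> tangent_space M x"
proof -
  note oU = vector_field_open[OF X]
  obtain C c where Cc: "(C, c) \<in> atlas M" and xC: "x \<in> C" by (rule pts_chart[OF x oU])
  have oCU: "openin (mtop M) (C \<inter> U)" using chart_open_dom[OF Cc] oU by blast
  have cx: "c x \<in> c ` (C \<inter> U)" using x xC by blast
  define \<alpha> \<beta> where "\<alpha> i u = X (inv_into C c u) (\<lambda>y. c y i)" and "\<beta> i u = Y (inv_into C c u) (\<lambda>y. c y i)" for i u
  have \<alpha>: "Cinf_on n (c ` (C \<inter> U)) (\<alpha> i)" and \<beta>: "Cinf_on n (c ` (C \<inter> U)) (\<beta> i)" if "i < n" for i
    unfolding \<alpha>_def[abs_def] \<beta>_def[abs_def] using vector_field_coeffs[OF Cc X that] vector_field_coeffs[OF Cc Y that] by auto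
  have step: "A x (\<lambda>y. B y h) = (\<Sum>j<n. \<Sum>i<n. a j * (partial j (b i) (c x) * partial i (h \<circ> inv_into C c) (c x)))
       + (\<Sum>j<n. \<Sum>i<n. a j * b i (c x) * partial j (partial i (h \<circ> inv_into C c)) (c x))"
    if A: "vector_field M U A" and B: "vector_field M U B" and h: "smooth_on M W h" "x \<in> W" "W \<subseteq> C \<inter> U"
      and b: "\<And>i u. b i u = B (inv_into C c u) (\<lambda>y. c y i)" and a: "\<And>j. a j = A x (\<lambda>y. c y j)" for A B h W a b
  proof -
    let ?h = "h \<circ> inv_into C c"
    have oW: "openin (mtop M) W" by (rule smooth_on_open[OF h(1)])
    have BW: "vector_field M W B" by (rule vector_field_subset[OF B oW]) (use h in auto)
    have s: "smooth_on M W (\<lambda>y. B y h)" using BW h(1) unfolding vector_field_def by blast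
    have CW: "C \<inter> W = W" using h(3) by auto
    have cW: "c ` W \<subseteq> c ` (C \<inter> U)" "c x \<in> c ` W" using h by auto
    have hc: "Cinf_on n (c ` W) ?h" using smooth_on_chartD[OF h(1) Cc] CW by simp
    note o = Cinf_open[OF hc]
    have bC: "Cinf_on n (c ` W) (b i)" if "i < n" for i
      unfolding b[abs_def] by (rule Cinf_subset[OF vector_field_coeffs[OF Cc B that] o cW(1)])
    have bh: "Cinf_on n (c ` W) (\<lambda>u. b i u * partial i ?h u)" if "i < n" for i
      by (rule Cinf_mult[OF bC[OF that] Cinf_partial[OF hc that]])
    have p: "partial j ((\<lambda>y. B y h) \<circ> inv_into C c) (c x) =
      (\<Sum>i<n. b i (c x) * partial j (partial i ?h) (c x) + partial j (b i) (c x) * partial i ?h (c x))" if j: "j < n" for j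
    proof -
      have "partial j ((\<lambda>y. B y h) \<circ> inv_into C c) (c x) = partial j (\<lambda>u. \<Sum>i<n. b i u * partial i ?h u) (c x)"
      proof (rule partial_cong[OF o cW(2) j])
        fix v assume "v \<in> c ` W"
        then obtain y where y: "y \<in> W" "v = c y" by blast
        then have yC: "y \<in> C" "y \<in> U" using h(3) by auto
        have "B y h = (\<Sum>i<n. B y (\<lambda>y. c y i) * partial i ?h (c y))"
          by (rule tangent_apply[OF vector_field_tangent[OF B yC(2)] Cc yC(1) y(1) h(1)])
        then show "((\<lambda>y. B y h) \<circ> inv_into C c) v = (\<Sum>i<n. b i v * partial i ?h v)"
          using chart_inv[OF Cc yC(1)] by (simp add: b y(2))
      qed
      also have "\<dots> = (\<Sum>i\<in>{..<n}. partial j (\<lambda>u. b i u * partial i ?h u) (c x))"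
        by (rule partial_sum[OF o _ j cW(2)]) (use bh in auto)
      also have "\<dots> = (\<Sum>i<n. b i (c x) * partial j (partial i ?h) (c x) + partial j (b i) (c x) * partial i ?h (c x))"
        by (rule sum.cong) (use partial_mult[OF bC Cinf_partial[OF hc] j cW(2)] in auto)
      finally show ?thesis .
    qed
    have "A x (\<lambda>y. B y h) = (\<Sum>j<n. a j * partial j ((\<lambda>y. B y h) \<circ> inv_into C c) (c x))"
      unfolding a by (rule tangent_apply[OF vector_field_tangent[OF A x] Cc xC h(2) s])
    then show ?thesis by (simp add: p sum_distrib_left algebra_simps sum.distrib)
  qed
  define \<gamma> where "\<gamma> i = (\<Sum>j<n. \<alpha> j (c x) * partial j (\<beta> i) (c x) - \<beta> j (c x) * partial j (\<alpha> i) (c x))" for i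
  have "bracket M X Y x = tv M C c x \<gamma>"
  proof
    fix h
    show "bracket M X Y x h = tv M C c x \<gamma> h"
    proof (cases "smooth_near M x h")
      case True
      obtain W where W: "x \<in> W" "W \<subseteq> C \<inter> U" "smooth_on M W h"
        using smooth_near_local[OF True oCU] x xC by auto
      let ?h = "h \<circ> inv_into C c"
      have CW: "C \<inter> W = W" using W(2) by auto
      have hc: "Cinf_on n (c ` W) ?h" using smooth_on_chartD[OF W(3) Cc] CW by simp
      have cxW: "c x \<in> c ` W" using W(1) by blast
      have ax: "\<alpha> j (c x) = X x (\<lambda>y. c y j)" "\<beta> j (c x) = Y x (\<lambda>y. c y j)" for j
        using chart_inv[OF Cc xC] by (simp_all add: \<alpha>_def \<beta>_def)
      have 1: "X x (\<lambda>y. Y y h) = (\<Sum>j<n. \<Sum>i<n. \<alpha> j (c x) * (partial j (\<beta> i) (c x) * partial i ?h (c x)))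
       + (\<Sum>j<n. \<Sum>i<n. \<alpha> j (c x) * \<beta> i (c x) * partial j (partial i ?h) (c x))"
        by (rule step[OF X Y W(3,1,2) \<beta>_def ax(1)])
      have 2: "Y x (\<lambda>y. X y h) = (\<Sum>j<n. \<Sum>i<n. \<beta> j (c x) * (partial j (\<alpha> i) (c x) * partial i ?h (c x)))
       + (\<Sum>j<n. \<Sum>i<n. \<beta> j (c x) * \<alpha> i (c x) * partial j (partial i ?h) (c x))"
        by (rule step[OF Y X W(3,1,2) \<alpha>_def ax(2)])
      have "(\<Sum>j<n. \<Sum>i<n. \<beta> j (c x) * \<alpha> i (c x) * partial j (partial i ?h) (c x)) =
        (\<Sum>i<n. \<Sum>j<n. \<beta> j (c x) * \<alpha> i (c x) * partial j (partial i ?h) (c x))" by (rule sum.swap)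
      also have "\<dots> = (\<Sum>i<n. \<Sum>j<n. \<alpha> i (c x) * \<beta> j (c x) * partial i (partial j ?h) (c x))"
        by (intro sum.cong refl) (simp add: Cinf_partial_commute[OF hc cxW] mult.commute)
      finally have sw: "(\<Sum>j<n. \<Sum>i<n. \<beta> j (c x) * \<alpha> i (c x) * partial j (partial i ?h) (c x)) =
         (\<Sum>j<n. \<Sum>i<n. \<alpha> j (c x) * \<beta> i (c x) * partial j (partial i ?h) (c x))" .
      have "X x (\<lambda>y. Y y h) - Y x (\<lambda>y. X y h) =
         (\<Sum>j<n. \<Sum>i<n. \<alpha> j (c x) * (partial j (\<beta> i) (c x) * partial i ?h (c x))) -
         (\<Sum>j<n. \<Sum>i<n. \<beta> j (c x) * (partial j (\<alpha> i) (c x) * partial i ?h (c x)))"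
        unfolding 1 2 sw by simp
      also have "\<dots> = (\<Sum>i<n. \<gamma> i * partial i ?h (c x))"
        unfolding \<gamma>_def sum_distrib_right sum_subtractf[symmetric]
        by (subst sum.swap) (simp add: algebra_simps sum_subtractf)
      finally show ?thesis using True tv_apply[OF Cc W(3,1), of \<gamma>] by (simp add: bracket_def)
    next
      case False then show ?thesis by (simp add: bracket_def tv_def)
    qed
  qed
  then show ?thesis using tangent_space_chart[OF Cc xC] by simp
qed

lemma smooth_nbhd_inner:
  fixes f :: "'a \<Rightarrow> 'b::euclidean_space"
  assumes "smooth_on M (pts M) f" "x \<in> pts M" shows "smooth_near M x (\<lambda>y. f y \<bullet> b)"
  by (rule smooth_nearI[OF smooth_on_linear[OF bounded_linear_inner_left assms(1)] assms(2)])

lemma deriv_along_bracket: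
  fixes f :: "'a \<Rightarrow> 'b::euclidean_space"
  assumes f: "smooth_on M (pts M) f" and X: "vector_field M U X" and Y: "vector_field M U Y" and x: "x \<in> U"
  shows "deriv_along (bracket M X Y x) f = deriv_along (X x) (\<lambda>y. deriv_along (Y y) f) - deriv_along (Y x) (\<lambda>y. deriv_along (X y) f)"
proof -
  have U: "U \<subseteq> pts M" using vector_field_open[OF X] openin_subset by blast
  have b: "bracket M X Y x (\<lambda>y. f y \<bullet> b) = X x (\<lambda>y. Y y (\<lambda>z. f z \<bullet> b)) - Y x (\<lambda>y. X y (\<lambda>z. f z \<bullet> b))" for b
    using smooth_nbhd_inner[OF f] x U by (auto simp: bracket_def)
  have e: "A x (\<lambda>y. B y (\<lambda>z. f z \<bullet> b)) = A x (\<lambda>y. deriv_along (B y) f \<bullet> b)"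
    if A: "vector_field M U A" and B: "vector_field M U B" for A B b
  proof -
    have "A x (\<lambda>y. deriv_along (B y) f \<bullet> b) = A x (\<lambda>y. B y (\<lambda>z. f z \<bullet> b))"
    proof (rule tangent_local[OF vector_field_tangent[OF A x] _ x])
      show "x \<in> pts M" using x U by blast
      show "smooth_on M U (\<lambda>y. deriv_along (B y) f \<bullet> b)"
        by (rule smooth_on_linear[OF bounded_linear_inner_left deriv_along_smooth[OF B f U]])
      show "deriv_along (B y) f \<bullet> b = B y (\<lambda>z. f z \<bullet> b)" if "y \<in> U" for y
        by (rule deriv_along_inner[OF vector_field_tangent[OF B that] _ f]) (use that U in blast)
    qed
    then show ?thesis by simp
  qed
  have "deriv_along (bracket M X Y x) f = (\<Sum>b\<in>Basis. (X x (\<lambda>y. deriv_along (Y y) f \<bullet> b) - Y x (\<lambda>y. deriv_along (X y) f \<bullet> b)) *\<^sub>R b)"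
    unfolding deriv_along_def[of "bracket M X Y x"] b e[OF X Y] e[OF Y X] ..
  also have "\<dots> = deriv_along (X x) (\<lambda>y. deriv_along (Y y) f) - deriv_along (Y x) (\<lambda>y. deriv_along (X y) f)"
    unfolding deriv_along_def[of "X x"] deriv_along_def[of "Y x"] by (simp add: scaleR_diff_left sum_subtractf)
  finally show ?thesis .
qed

lemma deriv_along_inner_product:
  fixes F G :: "'a \<Rightarrow> 'b::euclidean_space"
  assumes X: "X \<in> tangent_space M x" and x: "x \<in> U" and F: "smooth_on M U F" and G: "smooth_on M U G"
  shows "X (\<lambda>y. F y \<bullet> G y) = deriv_along X F \<bullet> G x + F x \<bullet> deriv_along X G"
proof -
  obtain C c where Cc: "(C, c) \<in> atlas M" "x \<in> C" by (rule pts_chart[OF x smooth_on_open[OF F]])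
  have cx: "c x \<in> c ` (C \<inter> U)" using x Cc by blast
  have "partial i ((\<lambda>y. F y \<bullet> G y) \<circ> inv_into C c) (c x) =
    partial i (F \<circ> inv_into C c) (c x) \<bullet> G x + F x \<bullet> partial i (G \<circ> inv_into C c) (c x)" if "i < n" for i
    using partial_inner[OF smooth_on_chartD[OF F Cc(1)] smooth_on_chartD[OF G Cc(1)] that cx] chart_inv[OF Cc]
    by (simp add: o_def)
  then show ?thesis
    unfolding deriv_along_apply[OF X Cc x F] deriv_along_apply[OF X Cc x G] tangent_apply[OF X Cc x smooth_on_inner[OF F G]]
    by (simp add: inner_sum_left inner_sum_right distrib_left sum.distrib)
qed

context
  fixes g and f :: "'a \<Rightarrow> 'b::euclidean_space"
  assumes iso: "isometric_immersion M g f"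
begin

lemma iso_smooth: "smooth_on M (pts M) f" using iso by (simp add: isometric_immersion_def)

lemma iso_metric: "x \<in> pts M \<Longrightarrow> X \<in> tangent_space M x \<Longrightarrow> Y \<in> tangent_space M x \<Longrightarrow> g x X Y = deriv_along X f \<bullet> deriv_along Y f"
  using iso by (simp add: isometric_immersion_def)

text \<open>For the induced metric each metric term splits by the product rule and each bracket
  becomes a commutator of ambient derivatives. Everything cancels except twice the stated product,
  which accounts for the division by 2.\<close>

lemma iso_koszul:
  assumes X: "vector_field M U X" and Y: "vector_field M U Y" and Z: "vector_field M U Z" and x: "x \<in> U"
  shows "koszul M g X Y Z x = deriv_along (X x) (\<lambda>y. deriv_along (Y y) f) \<bullet> deriv_along (Z x) f"
proof -
  have U: "U \<subseteq> pts M" using vector_field_open[OF X] openin_subset by blast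
  have xM: "x \<in> pts M" using x U by blast
  let ?D = "\<lambda>A y. deriv_along (A y) f"
  have sm: "smooth_on M U (?D A)" if "vector_field M U A" for A by (rule deriv_along_smooth[OF that iso_smooth U])
  have d: "A x (\<lambda>y. g y (B y) (E y)) = deriv_along (A x) (?D B) \<bullet> ?D E x + ?D B x \<bullet> deriv_along (A x) (?D E)"
    if A: "vector_field M U A" and B: "vector_field M U B" and E: "vector_field M U E" for A B E
  proof -
    have "A x (\<lambda>y. ?D B y \<bullet> ?D E y) = A x (\<lambda>y. g y (B y) (E y))"
    proof (rule tangent_local[OF vector_field_tangent[OF A x] xM x smooth_on_inner[OF sm[OF B] sm[OF E]]])
      fix y assume y: "y \<in> U"
      show "?D B y \<bullet> ?D E y = g y (B y) (E y)"
        using iso_metric[OF _ vector_field_tangent[OF B y] vector_field_tangent[OF E y]] y U by auto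
    qed
    then show ?thesis using deriv_along_inner_product[OF vector_field_tangent[OF A x] x sm[OF B] sm[OF E]] by simp
  qed
  have br: "g x (bracket M A B x) (E x) = (deriv_along (A x) (?D B) - deriv_along (B x) (?D A)) \<bullet> ?D E x"
    if A: "vector_field M U A" and B: "vector_field M U B" and E: "vector_field M U E" for A B E
    unfolding iso_metric[OF xM bracket_tangent[OF A B x] vector_field_tangent[OF E x]] deriv_along_bracket[OF iso_smooth A B x] ..
  show ?thesis
    unfolding koszul_def d[OF X Y Z] d[OF Y X Z] d[OF Z X Y] br[OF X Y Z] br[OF X Z Y] br[OF Y Z X]
    by (simp add: inner_diff_left inner_diff_right inner_commute)
qed

lemma iso_injective:
  assumes x: "x \<in> pts M" and X: "X \<in> tangent_space M x" "Y \<in> tangent_space M x" and eq: "deriv_along X f = deriv_along Y f"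
  shows "X = Y"
proof -
  obtain C c where Cc: "(C, c) \<in> atlas M" "x \<in> C" using chart_cover[OF x] by blast
  obtain a b where ab: "X = tv M C c x a" "Y = tv M C c x b" using X tangent_space_chart[OF Cc] by auto
  let ?Z = "tv M C c x (\<lambda>i. a i - b i)"
  have "?Z \<in> tangent_space M x" using tangent_space_chart[OF Cc] by simp
  moreover have "deriv_along ?Z f = 0"
    using eq unfolding ab deriv_along_tv[OF Cc x iso_smooth] by (simp add: scaleR_diff_left sum_subtractf)
  moreover have "immersion_at M f x" using iso x by (simp add: isometric_immersion_def)
  ultimately have "?Z = (\<lambda>_. 0)" unfolding immersion_at_def by blast
  then have "\<forall>i<n. a i = b i" using tv_zero_iff[OF Cc] by simp
  then show ?thesis unfolding ab by (intro tv_cong[OF Cc(1)]) simp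
qed

text \<open>The case where the ambient derivative is already tangent, so that no projection occurs:
  uniqueness in the Koszul formula together with injectivity of the differential of \<open>f\<close>
  identifies \<open>W\<close>.\<close>

lemma levi_civita_eqI:
  assumes X: "vector_field M U X" and Y: "vector_field M U Y" and x: "x \<in> U"
    and W: "W \<in> tangent_space M x" "deriv_along W f = deriv_along (X x) (\<lambda>y. deriv_along (Y y) f)"
  shows "levi_civita M g X Y x = W"
  unfolding levi_civita_def
proof (rule the_equality)
  have xM: "x \<in> pts M" using x vector_field_open[OF X] openin_subset by blast
  have K: "g x W (Z x) = koszul M g X Y Z x" if "x \<in> U'" "vector_field M U' Z" for U' Z
  proof -
    let ?U = "U \<inter> U'"
    have o: "openin (mtop M) ?U" using vector_field_open[OF X] vector_field_open[OF that(2)] by blast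
    have xU: "x \<in> ?U" using x that by blast
    have "koszul M g X Y Z x = deriv_along (X x) (\<lambda>y. deriv_along (Y y) f) \<bullet> deriv_along (Z x) f"
      by (rule iso_koszul[OF vector_field_subset[OF X o] vector_field_subset[OF Y o] vector_field_subset[OF that(2) o] xU]) auto
    then show ?thesis using iso_metric[OF xM W(1) vector_field_tangent[OF that(2,1)]] W(2) by simp
  qed
  then show "W \<in> tangent_space M x \<and> (\<forall>U Z. x \<in> U \<and> vector_field M U Z \<longrightarrow> g x W (Z x) = koszul M g X Y Z x)"
    using W(1) by blast
  fix W' assume W': "W' \<in> tangent_space M x \<and> (\<forall>U Z. x \<in> U \<and> vector_field M U Z \<longrightarrow> g x W' (Z x) = koszul M g X Y Z x)"
  have WT: "W' \<in> tangent_space M x" using W' by blast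
  obtain C c where Cc: "(C, c) \<in> atlas M" "x \<in> C" using chart_cover[OF xM] by blast
  \<comment> \<open>Every tangent vector at \<open>x\<close> is the value of a field with constant
    coefficients in a chart, so the defining identity determines all inner products of the image of
    \<open>W'\<close> with tangent directions.\<close>
  have eq: "deriv_along W' f \<bullet> deriv_along Z f = deriv_along W f \<bullet> deriv_along Z f" if Z: "Z \<in> tangent_space M x" for Z
  proof -
    obtain a where a: "Z = tv M C c x a" using Z tangent_space_chart[OF Cc] by auto
    have vf: "vector_field M C (\<lambda>y. tv M C c y a)"
      by (rule vector_field_tv[OF Cc(1) chart_open_dom[OF Cc(1)], where \<alpha> = "\<lambda>i u. a i"]) (simp_all add: chart_open_image[OF Cc(1)])
    then have "g x W' Z = koszul M g X Y (\<lambda>y. tv M C c y a) x" using W' Cc(2) unfolding a by blast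
    moreover have "g x W Z = koszul M g X Y (\<lambda>y. tv M C c y a) x" using K[OF Cc(2) vf] unfolding a .
    ultimately show ?thesis using iso_metric[OF xM WT Z] iso_metric[OF xM W(1) Z] by simp
  qed
  have "(deriv_along W' f - deriv_along W f) \<bullet> (deriv_along W' f - deriv_along W f) = 0"
    using eq[OF WT] eq[OF W(1)] by (simp add: inner_diff_left inner_diff_right)
  then have "deriv_along W' f = deriv_along W f" by simp
  then show "W' = W" by (rule iso_injective[OF xM WT W(1)])
qed

end

section \<open>Smooth maps and submanifolds with flat image\<close>

lemma smooth_map_compose:
  assumes j: "smooth_map P M j" and P: "smooth_mfd P" and h: "smooth_on M U h"
  shows "smooth_on P {x \<in> pts P. j x \<in> U} (h \<circ> j)"
proof (rule smooth_mfd.smooth_on_local[OF P])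
  interpret P: smooth_mfd P by (rule P)
  fix x assume x: "x \<in> {x \<in> pts P. j x \<in> U}"
  have cont: "continuous_map (mtop P) (mtop M) j" using j by (simp add: smooth_map_def)
  obtain C c where Cc: "(C, c) \<in> atlas M" "j x \<in> C" by (rule pts_chart[OF _ smooth_on_open[OF h]]) (use x in auto)
  let ?V = "{x \<in> pts P. j x \<in> C \<inter> U}"
  have oV: "openin (mtop P) ?V"
    by (rule openin_continuous_map_preimage[OF cont]) (use chart_open_dom[OF Cc(1)] smooth_on_open[OF h] in blast)
  have co: "smooth_on P ?V (\<lambda>x. c (j x) i)" if "i < n" for i
  proof -
    have "smooth_on P {x \<in> pts P. j x \<in> C} (\<lambda>x. c (j x) i)" using j Cc(1) that unfolding smooth_map_def by auto
    from P.smooth_on_subset[OF this oV] show ?thesis by auto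
  qed
  have "smooth_on P ?V (h \<circ> j)"
  proof (rule P.smooth_onI[OF oV])
    fix B b assume Bb: "(B, b) \<in> atlas P"
    have o: "openE P.n (b ` (B \<inter> ?V))"
      using P.chart_open[OF Bb, of "B \<inter> ?V"] P.chart_open_dom[OF Bb] oV by auto
    have "Cinf_on P.n (b ` (B \<inter> ?V)) (\<lambda>u. (h \<circ> inv_into C c) (c (j (inv_into B b u))))"
    proof (rule Cinf_compose[OF smooth_on_chartD[OF h Cc(1)] o, where G = "\<lambda>u. c (j (inv_into B b u))"])
      fix u assume "u \<in> b ` (B \<inter> ?V)"
      then show "c (j (inv_into B b u)) \<in> c ` (C \<inter> U)" using P.chart_inv[OF Bb] by auto
    next
      fix i assume "i < n"
      then show "Cinf_on P.n (b ` (B \<inter> ?V)) (\<lambda>u. c (j (inv_into B b u)) i)"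
        using P.smooth_on_chartD[OF co Bb, of i] by (simp add: o_def)
    qed
    then show "Cinf_on P.n (b ` (B \<inter> ?V)) ((h \<circ> j) \<circ> inv_into B b)"
    proof (rule Cinf_cong)
      fix u assume "u \<in> b ` (B \<inter> ?V)"
      then obtain y where y: "y \<in> B" "y \<in> ?V" "u = b y" by blast
      then show "(h \<circ> inv_into C c) (c (j (inv_into B b u))) = ((h \<circ> j) \<circ> inv_into B b) u"
        using P.chart_inv[OF Bb y(1)] chart_inv[OF Cc(1)] by simp
    qed
  qed
  then show "\<exists>V. x \<in> V \<and> V \<subseteq> {x \<in> pts P. j x \<in> U} \<and> smooth_on P V (h \<circ> j)"
    using x Cc(2) by (intro exI[of _ ?V]) auto
qed

lemma push_apply: "smooth_near M (j x) h \<Longrightarrow> push M j x X h = X (h \<circ> j)"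
  by (simp add: push_def)

lemma push_tangent:
  assumes j: "smooth_map P M j" and P: "smooth_mfd P" and x: "x \<in> pts P" and X: "X \<in> tangent_space P x"
  shows "push M j x X \<in> tangent_space M (j x)"
proof -
  interpret P: smooth_mfd P by (rule P)
  have jx: "j x \<in> pts M" using j x unfolding smooth_map_def by (auto dest: continuous_map_image_subset_topspace)
  obtain C c where Cc: "(C, c) \<in> atlas M" "j x \<in> C" using chart_cover[OF jx] by blast
  obtain B b where Bb: "(B, b) \<in> atlas P" "x \<in> B" using P.chart_cover[OF x] by blast
  have "push M j x X = tv M C c (j x) (\<lambda>i. X (\<lambda>z. c (j z) i))"
  proof
    fix h
    show "push M j x X h = tv M C c (j x) (\<lambda>i. X (\<lambda>z. c (j z) i)) h"
    proof (cases "smooth_near M (j x) h")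
      case True
      obtain U where U: "j x \<in> U" "U \<subseteq> C" "smooth_on M U h"
        using smooth_near_local[OF True chart_open_dom[OF Cc(1)] Cc(2)] by blast
      let ?V = "{x \<in> pts P. j x \<in> U}"
      have s: "smooth_on P ?V (h \<circ> j)" by (rule smooth_map_compose[OF j P U(3)])
      have xV: "x \<in> ?V" using x U by simp
      have oV: "openin (mtop P) (B \<inter> ?V)" using P.chart_open_dom[OF Bb(1)] P.smooth_on_open[OF s] by blast
      have o: "openE P.n (b ` (B \<inter> ?V))" using P.chart_open[OF Bb(1), of "B \<inter> ?V"] oV by auto
      have bx: "b x \<in> b ` (B \<inter> ?V)" using Bb xV by blast
      have hC: "Cinf_on n (c ` U) (h \<circ> inv_into C c)" using smooth_on_chartD[OF U(3) Cc(1)] U(2) by (simp add: Int_absorb1)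
      have co: "smooth_on P {x \<in> pts P. j x \<in> C} (\<lambda>x. c (j x) i)" if "i < n" for i
        using j Cc(1) that unfolding smooth_map_def by auto
      have co2: "Cinf_on P.n (b ` (B \<inter> ?V)) (\<lambda>u. c (j (inv_into B b u)) i)" if "i < n" for i
        by (rule Cinf_subset[OF P.smooth_on_chartD[OF co[OF that] Bb(1), unfolded o_def] o]) (use U(2) in auto)
      have pk: "partial k ((h \<circ> j) \<circ> inv_into B b) (b x) =
         (\<Sum>i<n. partial k (\<lambda>u. c (j (inv_into B b u)) i) (b x) *\<^sub>R partial i (h \<circ> inv_into C c) (c (j x)))" if k: "k < P.n" for k
      proof -
        have "partial k ((h \<circ> j) \<circ> inv_into B b) (b x) = partial k (\<lambda>u. (h \<circ> inv_into C c) (c (j (inv_into B b u)))) (b x)"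
        proof (rule partial_cong[OF o bx k])
          fix u assume "u \<in> b ` (B \<inter> ?V)"
          then obtain y where y: "y \<in> B" "y \<in> ?V" "u = b y" by blast
          then show "((h \<circ> j) \<circ> inv_into B b) u = (h \<circ> inv_into C c) (c (j (inv_into B b u)))"
            using P.chart_inv[OF Bb(1) y(1)] chart_inv[OF Cc(1)] U(2) by auto
        qed
        also have "\<dots> = (\<Sum>i<n. partial k (\<lambda>u. c (j (inv_into B b u)) i) (b x) *\<^sub>R partial i (h \<circ> inv_into C c) (c (j (inv_into B b (b x)))))"
        proof (rule Cinf_partial_compose[OF hC o _ _ bx k, where G = "\<lambda>u. c (j (inv_into B b u))"])
          fix u assume "u \<in> b ` (B \<inter> ?V)"
          then show "c (j (inv_into B b u)) \<in> c ` U" using P.chart_inv[OF Bb(1)] by auto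
        qed (rule co2)
        finally show ?thesis using P.chart_inv[OF Bb] by simp
      qed
      have "X (h \<circ> j) = (\<Sum>k<P.n. X (\<lambda>y. b y k) * partial k ((h \<circ> j) \<circ> inv_into B b) (b x))"
        by (rule P.tangent_apply[OF X Bb xV s])
      also have "\<dots> = (\<Sum>k<P.n. \<Sum>i<n. X (\<lambda>y. b y k) * partial k (\<lambda>u. c (j (inv_into B b u)) i) (b x) * partial i (h \<circ> inv_into C c) (c (j x)))"
        by (rule sum.cong) (simp_all add: pk sum_distrib_left mult.assoc)
      also have "\<dots> = (\<Sum>i<n. (\<Sum>k<P.n. X (\<lambda>y. b y k) * partial k (\<lambda>u. c (j (inv_into B b u)) i) (b x)) * partial i (h \<circ> inv_into C c) (c (j x)))"
        by (subst sum.swap) (simp add: sum_distrib_right)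
      also have "\<dots> = (\<Sum>i<n. X (\<lambda>z. c (j z) i) * partial i (h \<circ> inv_into C c) (c (j x)))"
      proof (rule sum.cong[OF refl])
        fix i assume "i \<in> {..<n}"
        then have i: "i < n" by simp
        have xW: "x \<in> {x \<in> pts P. j x \<in> C}" using x Cc(2) by simp
        show "(\<Sum>k<P.n. X (\<lambda>y. b y k) * partial k (\<lambda>u. c (j (inv_into B b u)) i) (b x)) * partial i (h \<circ> inv_into C c) (c (j x)) =
            X (\<lambda>z. c (j z) i) * partial i (h \<circ> inv_into C c) (c (j x))"
          unfolding P.tangent_apply[OF X Bb xW co[OF i]] by (simp add: o_def)
      qed
      finally show ?thesis using tv_apply[OF Cc(1) U(3,1)] push_apply[of j, OF True] by simp
    next
      case False then show ?thesis by (simp add: push_def tv_def)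
    qed
  qed
  then show ?thesis using tangent_space_chart[OF Cc] by simp
qed

lemma deriv_along_push:
  fixes f :: "'a \<Rightarrow> 'b::euclidean_space"
  assumes "smooth_on M U f" "j x \<in> U"
  shows "deriv_along (push M j x X) f = deriv_along X (f \<circ> j)"
proof -
  have "push M j x X (\<lambda>y. f y \<bullet> b) = X (\<lambda>y. f (j y) \<bullet> b)" for b
    using push_apply[where j = j, OF smooth_nearI[OF smooth_on_linear[OF bounded_linear_inner_left assms(1)] assms(2)], of X b] by (simp add: o_def)
  then show ?thesis by (simp add: deriv_along_def)
qed

lemma totally_geodesic_flat:
  fixes f :: "'a \<Rightarrow> 'b::euclidean_space"
  assumes iso: "isometric_immersion M g f" and P: "submanifold M P" and \<Sigma>: "subspace \<Sigma>"
    and st: "\<And>x. x \<in> pts P \<Longrightarrow> (\<lambda>X. deriv_along X f) ` sub_tangent M P x = \<Sigma>"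
  shows "totally_geodesic M g P"
    "x \<in> pts P \<Longrightarrow> sub_tangent M P x = {X \<in> tangent_space M x. deriv_along X f \<in> \<Sigma>}"
proof -
  have smP: "smooth_mfd P" by unfold_locales (use P in \<open>simp add: submanifold_def\<close>)
  interpret P: smooth_mfd P by (rule smP)
  have j: "smooth_map P M (\<lambda>x. x)" using P by (simp add: submanifold_def embedding_def)
  have PM: "pts P \<subseteq> pts M" using j unfolding smooth_map_def by (auto dest: continuous_map_image_subset_topspace)
  have tan: "sub_tangent M P x \<subseteq> tangent_space M x" if "x \<in> pts P" for x
    unfolding sub_tangent_def using push_tangent[OF j smP that] by auto
  have st2: "sub_tangent M P x = {X \<in> tangent_space M x. deriv_along X f \<in> \<Sigma>}" if x: "x \<in> pts P" for x
  proof (intro set_eqI iffI)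
    fix X assume "X \<in> sub_tangent M P x"
    then show "X \<in> {X \<in> tangent_space M x. deriv_along X f \<in> \<Sigma>}" using tan[OF x] st[OF x] by blast
  next
    fix X assume X: "X \<in> {X \<in> tangent_space M x. deriv_along X f \<in> \<Sigma>}"
    then obtain X' where X': "X' \<in> sub_tangent M P x" "deriv_along X' f = deriv_along X f" using st[OF x] by (metis (no_types, lifting) imageE mem_Collect_eq)
    have "X' = X" by (rule iso_injective[OF iso subsetD[OF PM x] subsetD[OF tan[OF x] X'(1)] _ X'(2)]) (use X in simp)
    then show "X \<in> sub_tangent M P x" using X' by simp
  qed
  then show "x \<in> pts P \<Longrightarrow> sub_tangent M P x = {X \<in> tangent_space M x. deriv_along X f \<in> \<Sigma>}" .
  show "totally_geodesic M g P" unfolding totally_geodesic_def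
  proof (intro conjI allI impI ballI, rule P, elim conjE)
    fix U X Y x
    assume X: "vector_field M U X" and Y: "vector_field M U Y"
      and XY: "\<forall>y\<in>U \<inter> pts P. X y \<in> sub_tangent M P y \<and> Y y \<in> sub_tangent M P y" and xx: "x \<in> U \<inter> pts P"
    then have x: "x \<in> U" "x \<in> pts P" "x \<in> pts M" using PM by auto
    have UM: "U \<subseteq> pts M" using vector_field_open[OF X] openin_subset by blast
    let ?G = "\<lambda>y. deriv_along (Y y) f"
    have G: "smooth_on M U ?G" by (rule deriv_along_smooth[OF Y iso_smooth[OF iso] UM])
    obtain X0 where X0: "X0 \<in> tangent_space P x" "X x = push M (\<lambda>y. y) x X0"
      using XY xx unfolding sub_tangent_def by auto
    have dG: "deriv_along (X x) ?G = deriv_along X0 (?G \<circ> (\<lambda>y. y))"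
      unfolding X0(2) by (rule deriv_along_push[where j = "\<lambda>y. y", OF G x(1)])
    let ?V = "{x \<in> pts P. x \<in> U}"
    have GP: "smooth_on P ?V (?G \<circ> (\<lambda>y. y))" by (rule smooth_map_compose[OF j smP G])
    have xV: "x \<in> ?V" using x by simp
    \<comment> \<open>Pairing the field with a vector orthogonal to \<open>\<Sigma>\<close> gives a
      function that vanishes on \<open>P\<close>, so its derivative along \<open>P\<close> is
      0.\<close>
    have "deriv_along X0 (?G \<circ> (\<lambda>y. y)) \<bullet> b = 0" if b: "b \<in> \<Sigma>\<^sup>\<bottom>" for b
    proof -
      have "X0 (\<lambda>y. 0::real) = X0 (\<lambda>y. (?G \<circ> (\<lambda>y. y)) y \<bullet> b)"
      proof (rule P.tangent_local[OF X0(1) x(2) xV P.smooth_on_const[OF P.smooth_on_open[OF GP]]])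
        fix y assume "y \<in> ?V"
        then have "Y y \<in> sub_tangent M P y" "y \<in> pts P" using XY by auto
        then have "?G y \<in> \<Sigma>" using st[of y] by blast
        then show "0 = (?G \<circ> (\<lambda>y. y)) y \<bullet> b" using b by (simp add: orthogonal_comp_def orthogonal_def)
      qed
      moreover have "X0 (\<lambda>y. 0::real) = 0"
      proof -
        obtain B b where Bb: "(B, b) \<in> atlas P" "x \<in> B" using P.chart_cover[OF x(2)] by blast
        have "X0 (\<lambda>y. 0::real) = (\<Sum>i<P.n. X0 (\<lambda>y. b y i) * partial i ((\<lambda>y. 0) \<circ> inv_into B b) (b x))"
          by (rule P.tangent_apply[OF X0(1) Bb xV P.smooth_on_const[OF P.smooth_on_open[OF GP]]])
        then show ?thesis by (simp add: o_def)
      qed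
      ultimately show ?thesis using P.deriv_along_inner[OF X0(1) xV GP, of b] by simp
    qed
    then have "deriv_along (X x) ?G \<in> \<Sigma>\<^sup>\<bottom>\<^sup>\<bottom>" unfolding dG by (auto simp: orthogonal_comp_def orthogonal_def inner_commute)
    then have "deriv_along (X x) ?G \<in> \<Sigma>" using orthogonal_comp_self[OF \<Sigma>] by simp
    then obtain W where W: "W \<in> sub_tangent M P x" "deriv_along W f = deriv_along (X x) ?G" using st[OF x(2)] by (metis (no_types, lifting) imageE)
    have "levi_civita M g X Y x = W"
      by (rule levi_civita_eqI[OF iso X Y x(1) subsetD[OF tan[OF x(2)] W(1)] W(2)])
    then show "levi_civita M g X Y x \<in> sub_tangent M P x" using W(1) by simp
  qed
qed

end

section \<open>Rulings as submanifolds\<close>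

lemma lin_indep_dual:
  fixes z :: "nat \<Rightarrow> 'b::euclidean_space"
  assumes "lin_indep {..<d} z"
  shows "\<exists>w. \<forall>i<d. \<forall>j<d. w i \<bullet> z j = (if i = j then 1 else 0)"
proof -
  have o: "openE 0 (Rn 0)" by (simp add: openE_iff obox_def) (auto intro: exI[of _ 1])
  have "\<exists>S' es. openE 0 S' \<and> (\<lambda>_. 0) \<in> S' \<and> S' \<subseteq> Rn 0 \<and> (\<forall>i\<in>{..<d}. Cinf_on 0 S' (es i)) \<and>
    (\<forall>u\<in>S'. \<forall>i\<in>{..<d}. \<forall>j\<in>{..<d}. es i u \<bullet> z j = (if i = j then 1 else 0)) \<and>
    (\<forall>u\<in>S'. \<forall>i\<in>{..<d}. es i u \<in> span ((\<lambda>j. z j) ` {..<d}))"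
    by (rule dual_frame[where e = "\<lambda>i u. z i" and n = 0 and S = "Rn 0" and I = "{..<d}"])
       (use o assms in \<open>auto simp: Rn_def\<close>)
  then obtain S' es where H: "openE 0 S' \<and> (\<lambda>_. 0) \<in> S' \<and> S' \<subseteq> Rn 0 \<and> (\<forall>i\<in>{..<d}. Cinf_on 0 S' (es i)) \<and>
    (\<forall>u\<in>S'. \<forall>i\<in>{..<d}. \<forall>j\<in>{..<d}. es i u \<bullet> z j = (if i = j then 1 else 0)) \<and>
    (\<forall>u\<in>S'. \<forall>i\<in>{..<d}. es i u \<in> span ((\<lambda>j. z j) ` {..<d}))" by (elim exE)
  then show ?thesis by (intro exI[of _ "\<lambda>i. es i (\<lambda>_. 0)"]) auto
qed

text \<open>In the affine span of the \<open>z k\<close> through \<open>p\<close>, the cube of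
  coefficients is cut out by finitely many open slabs, described by dual functionals. So its image
  is relatively open.\<close>

lemma affine_piece:
  fixes z :: "nat \<Rightarrow> 'b::euclidean_space"
  assumes li: "lin_indep {..<d} z" and im: "h ` S = (\<lambda>a. p + (\<Sum>k<d. a k *\<^sub>R z k)) ` obox d (\<lambda>_. 0) \<epsilon>"
  shows "maps_onto_affine_piece h S d"
proof -
  obtain w where w: "\<forall>i<d. \<forall>j<d. w i \<bullet> z j = (if i = j then 1 else 0)" using lin_indep_dual[OF li] by blast
  let ?A = "(+) p ` span (z ` {..<d})"
  have "card (z ` {..<d}) = d" using lin_indep_imp(1)[OF _ li] by (simp add: card_image)
  then have dim: "dim (span (z ` {..<d})) = d"
    using lin_indep_imp(2)[OF _ li] by (simp add: dim_eq_card_independent)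
  have A: "affine ?A" "aff_dim ?A = int d"
    using affine_translation[of "span (z ` {..<d})" p] subspace_imp_affine[OF subspace_span, of "z ` {..<d}"]
      aff_dim_translation_eq[of p "span (z ` {..<d})"] aff_dim_subspace[OF subspace_span, of "z ` {..<d}"] dim by simp_all
  have wc: "w k \<bullet> (\<Sum>j<d. a j *\<^sub>R z j) = a k" if "k < d" for k a
    by (rule dual_coeff[where ws = w and w = z]) (use w that in auto)
  let ?T = "\<Inter>k<d. {v. \<bar>w k \<bullet> (v - p)\<bar> < \<epsilon>}"
  have "open ?T" by (intro open_INT ballI open_Collect_less continuous_intros) auto
  moreover have "h ` S = ?A \<inter> ?T"
  proof (intro set_eqI iffI)
    fix v assume "v \<in> h ` S"
    then obtain a where a: "a \<in> obox d (\<lambda>_. 0) \<epsilon>" "v = p + (\<Sum>k<d. a k *\<^sub>R z k)" unfolding im by auto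
    have "(\<Sum>k<d. a k *\<^sub>R z k) \<in> span (z ` {..<d})" by (intro span_sum span_scale span_base) auto
    then show "v \<in> ?A \<inter> ?T" using a wc[of _ a] by (auto simp: obox_def)
  next
    fix v assume v: "v \<in> ?A \<inter> ?T"
    then obtain b where b: "v = p + (\<Sum>k<d. b k *\<^sub>R z k)"
      using span_image_sum[of "{..<d}" _ z] by auto
    define a where "a k = (if k < d then b k else 0)" for k
    have "a \<in> obox d (\<lambda>_. 0) \<epsilon>" using v wc[of _ b] by (auto simp: obox_def Rn_def a_def b)
    moreover have "v = p + (\<Sum>k<d. a k *\<^sub>R z k)" unfolding b a_def by simp
    ultimately show "v \<in> h ` S" unfolding im by blast
  qed
  ultimately have "openin (top_of_set ?A) (h ` S)" by (auto simp: openin_open)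
  then show ?thesis unfolding maps_onto_affine_piece_def using A by blast
qed

lemma lin_indep_combine:
  assumes E: "lin_indep {..<n} E" and \<kappa>: "\<And>c. (\<And>i. i < n \<Longrightarrow> (\<Sum>k<d. c k * \<kappa> k i) = 0) \<Longrightarrow> \<forall>k<d. c k = 0"
  shows "lin_indep {..<d::nat} (\<lambda>k. \<Sum>i<n::nat. \<kappa> k i *\<^sub>R E i)"
  unfolding lin_indep_def
proof (rule allI, rule impI)
  fix c assume 0: "(\<Sum>k\<in>{..<d}. c k *\<^sub>R (\<Sum>i<n. \<kappa> k i *\<^sub>R E i)) = 0"
  have "(\<Sum>i<n. (\<Sum>k<d. c k * \<kappa> k i) *\<^sub>R E i) = 0"
    using 0 unfolding scaleR_sum_left scaleR_sum_right by (subst sum.swap) simp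
  then have "(\<Sum>k<d. c k * \<kappa> k i) = 0" if "i < n" for i
    using E[unfolded lin_indep_def, rule_format, of "\<lambda>i. \<Sum>k<d. c k * \<kappa> k i" i] that by simp
  then show "\<forall>k\<in>{..<d}. c k = 0" using \<kappa>[of c] by simp
qed

lemma continuous_map_euclidean_coords:
  "continuous_map X euclidean F \<longleftrightarrow> (\<forall>k. continuous_map X euclideanreal (\<lambda>x. F x k))"
  for F :: "'a \<Rightarrow> nat \<Rightarrow> real"
  unfolding euclidean_product_topology[symmetric, where 'b = real] continuous_map_componentwise_UNIV ..

context smooth_mfd
begin

lemma smooth_continuous_chart:
  fixes F :: "'a \<Rightarrow> 'b::euclidean_space"
  assumes Cc: "(C, c) \<in> atlas M" and F: "smooth_on M (pts M) F"
  shows "continuous_map (subtopology (mtop M) C) euclidean F"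
proof -
  have "openin (mtop M) {x \<in> C. F x \<in> T}" if "open T" for T
  proof -
    have "Cinf_on n (c ` C) (F \<circ> inv_into C c)"
      using smooth_on_chartD[OF F Cc] chart_sub[OF Cc] by (simp add: Int_absorb2)
    from openE_vimage[OF Cinf_open[OF this] Cinf_continuous[OF this] that]
    have "openE n {u \<in> c ` C. F (inv_into C c u) \<in> T}" by simp
    moreover have "{u \<in> c ` C. F (inv_into C c u) \<in> T} = c ` {x \<in> C. F x \<in> T}" using chart_inv[OF Cc] by auto
    ultimately show ?thesis using chart_open[OF Cc, of "{x \<in> C. F x \<in> T}"] by auto
  qed
  then show ?thesis using chart_sub[OF Cc] chart_open_dom[OF Cc]
    by (auto simp: continuous_map_def openin_open_subtopology Int_absorb1)
qed

lemma chart_inverse_continuous: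
  assumes Cc: "(C, c) \<in> atlas M"
  shows "continuous_map (subtopology (Euclidean_space n) (c ` C)) (mtop M) (inv_into C c)"
proof -
  obtain k where k: "homeomorphic_maps (subtopology (mtop M) C) (subtopology (Euclidean_space n) (c ` C)) c k"
    using chart_homeo[OF Cc] unfolding homeomorphic_map_maps by blast
  have kc: "k (c x) = x" if "x \<in> C" for x using k that chart_sub[OF Cc] by (auto simp: homeomorphic_maps_def)
  have "continuous_map (subtopology (Euclidean_space n) (c ` C)) (mtop M) k"
    using k by (auto simp: homeomorphic_maps_def continuous_map_in_subtopology)
  then show ?thesis
    by (rule continuous_map_eq) (auto simp: kc chart_inv[OF Cc])
qed

text \<open>The patch gets a single chart \<open>\<rho>\<close>, which is continuous because
  \<open>f\<close> is; its inverse \<open>q\<close> is continuous because \<open>y\<close> is. This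
  makes the patch an embedded submanifold with the subspace topology, and smoothness of
  \<open>y\<close> is smoothness of the inclusion.\<close>

lemma affine_submanifold:
  fixes f :: "'a \<Rightarrow> 'b::euclidean_space"
  assumes f: "smooth_on M (pts M) f" and Cc: "(C, c) \<in> atlas M"
    and y: "\<And>a. a \<in> obox d (\<lambda>_. 0) \<epsilon> \<Longrightarrow> y a \<in> c ` C"
    and yC: "\<And>i. i < n \<Longrightarrow> Cinf_on d (obox d (\<lambda>_. 0) \<epsilon>) (\<lambda>a. y a i)"
    and fy: "\<And>a. a \<in> obox d (\<lambda>_. 0) \<epsilon> \<Longrightarrow> f (inv_into C c (y a)) = p + (\<Sum>k<d. a k *\<^sub>R z k)"
    and li: "lin_indep {..<d} z"
  shows "\<exists>P. submanifold M P \<and> mdim P = d \<and> pts P = (\<lambda>a. inv_into C c (y a)) ` obox d (\<lambda>_. 0) \<epsilon> \<and>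
    (\<forall>x\<in>pts P. (\<lambda>X. deriv_along X f) ` sub_tangent M P x = span (z ` {..<d}))"
proof -
  define O' where "O' = obox d (\<lambda>_. 0) \<epsilon>"
  define q where "q a = inv_into C c (y a)" for a
  have oO: "openE d O'" unfolding O'_def by (rule openE_obox)
  have ORn: "O' \<subseteq> Rn d" by (rule openE_subset[OF oO])
  have qC: "q a \<in> C" "c (q a) = y a" if "a \<in> O'" for a
    using chart_inv2[OF Cc y] that unfolding q_def O'_def by auto
  obtain w where w: "\<forall>i<d. \<forall>j<d. w i \<bullet> z j = (if i = j then 1 else 0)" using lin_indep_dual[OF li] by blast
  \<comment> \<open>Dual functionals read the parameter \<open>a\<close> back from the value of
    \<open>f\<close>. Entries from \<open>d\<close> on are set to 0 so as to land in
    \<open>Rn d\<close>.\<close>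
  define \<rho> where "\<rho> x k = (if k < d then w k \<bullet> (f x - p) else 0)" for x k
  have \<rho>q: "\<rho> (q a) = a" if "a \<in> O'" for a
  proof
    fix k
    have "w k \<bullet> (\<Sum>j<d. a j *\<^sub>R z j) = a k" if "k < d"
      by (rule dual_coeff[where ws = w and w = z]) (use w that in auto)
    moreover have "f (q a) - p = (\<Sum>j<d. a j *\<^sub>R z j)" using fy that by (simp add: q_def O'_def)
    ultimately show "\<rho> (q a) k = a k" using subsetD[OF ORn that] by (simp add: \<rho>_def Rn_def)
  qed
  define X where "X = subtopology (mtop M) (q ` O')"
  have QC: "q ` O' \<subseteq> C" using qC by blast
  have tX: "topspace X = q ` O'" using QC chart_sub[OF Cc] by (auto simp: X_def)
  have \<rho>X: "\<rho> ` topspace X = O'" unfolding tX image_image using \<rho>q by simp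
  have XC: "X = subtopology (subtopology (mtop M) C) (q ` O')" using QC by (simp add: X_def subtopology_subtopology Int_absorb1)
  have sO: "subtopology (Euclidean_space d) O' = top_of_set O'"
    using ORn by (simp add: Euclidean_space_top_of_set subtopology_subtopology Int_absorb1)
  have yc: "continuous_on O' y"
  proof -
    have "continuous_on O' (\<lambda>a. y a i)" for i
    proof (cases "i < n")
      case True then show ?thesis using Cinf_continuous[OF yC] by (simp add: O'_def)
    next
      case False
      have "continuous_on O' (\<lambda>a. 0::real)" by simp
      then show ?thesis
      proof (rule continuous_on_eq)
        fix a assume "a \<in> O'"
        then have "y a \<in> Rn n" using y openE_subset[OF chart_open_image[OF Cc]] unfolding O'_def by blast
        then show "0 = y a i" using False by (simp add: Rn_def)
      qed
    qed
    then show ?thesis using continuous_map_euclidean_coords[of "top_of_set O'" y] by simp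
  qed
  have "homeomorphic_maps X (subtopology (Euclidean_space d) O') \<rho> q"
    unfolding homeomorphic_maps_def
  proof (intro conjI ballI)
    have fX: "continuous_map X euclidean f"
      unfolding XC by (rule continuous_map_from_subtopology[OF smooth_continuous_chart[OF Cc f]])
    have "continuous_map X euclideanreal (\<lambda>x. \<rho> x k)" for k
    proof (cases "k < d")
      case True
      have "continuous_map X euclideanreal ((\<lambda>v. w k \<bullet> (v - p)) \<circ> f)"
        by (rule continuous_map_compose[OF fX]) (simp add: continuous_intros)
      then show ?thesis using True by (simp add: \<rho>_def o_def)
    qed (simp add: \<rho>_def)
    then have "continuous_map X euclidean \<rho>" unfolding continuous_map_euclidean_coords by blast
    then show "continuous_map X (subtopology (Euclidean_space d) O') \<rho>"
      unfolding sO using \<rho>X by (auto simp: continuous_map_in_subtopology)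
    have "continuous_map (top_of_set O') (subtopology (Euclidean_space n) (c ` C)) y"
      using yc y subsetD[OF openE_subset[OF chart_open_image[OF Cc]]]
      by (auto simp: Euclidean_space_top_of_set continuous_map_in_subtopology O'_def image_subset_iff simp del: image_iff)
    from continuous_map_compose[OF this chart_inverse_continuous[OF Cc]]
    have "continuous_map (top_of_set O') (mtop M) q" by (simp add: o_def q_def[abs_def])
    then show "continuous_map (subtopology (Euclidean_space d) O') X q"
      unfolding sO X_def by (simp add: continuous_map_in_subtopology)
  qed (use \<rho>q tX sO in auto)
  then have "homeomorphic_map X (subtopology (Euclidean_space d) (\<rho> ` topspace X)) \<rho>"
    unfolding \<rho>X homeomorphic_map_maps by blast
  then have emb: "embedding_map X (Euclidean_space d) \<rho>" by (simp add: embedding_map_def)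
  define P where "P = \<lparr>mtop = X, mdim = d, atlas = {(topspace X, \<rho>)}\<rparr>"
  have smP: "smooth_manifold P" unfolding P_def
  proof (rule one_chart_manifold[OF _ _ _ emb])
    show "openE d (\<rho> ` topspace X)" unfolding \<rho>X by (rule oO)
  qed (use M in \<open>simp_all add: X_def Hausdorff_space_subtopology second_countable_subtopology smooth_manifold_def\<close>)
  interpret P: smooth_mfd P by unfold_locales (rule smP)
  have P [simp]: "mtop P = X" "mdim P = d" "atlas P = {(q ` O', \<rho>)}" by (simp_all add: P_def tX)
  have Pc: "(q ` O', \<rho>) \<in> atlas P" by simp
  have inv\<rho>: "inv_into (q ` O') \<rho> a = q a" if "a \<in> O'" for a
    using P.chart_inv[OF Pc, of "q a"] \<rho>q[OF that] that by auto
  have sm: "smooth_map P M (\<lambda>x. x)" unfolding smooth_map_def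
  proof (intro conjI ballI)
    show "continuous_map (mtop P) (mtop M) (\<lambda>x. x)" by (simp add: X_def continuous_map_from_subtopology)
    fix B assume B: "B \<in> atlas M"
    obtain C' c' where Cc': "B = (C', c')" "(C', c') \<in> atlas M" using B by (cases B) auto
    let ?W = "{x \<in> pts P. x \<in> C'}"
    have "smooth_on P ?W (\<lambda>x. c' x i)" if i: "i < n" for i
    proof (rule P.smooth_on_chartI[OF Pc])
      show "?W \<subseteq> q ` O'" by (auto simp: tX)
      have \<rho>W: "\<rho> ` ?W = {a \<in> O'. y a \<in> c ` (C \<inter> C')}"
      proof (intro set_eqI iffI)
        fix a assume "a \<in> \<rho> ` ?W"
        then obtain b where b: "b \<in> O'" "q b \<in> C'" "a = \<rho> (q b)" by (auto simp: tX)
        then show "a \<in> {a \<in> O'. y a \<in> c ` (C \<inter> C')}" using \<rho>q qC[OF b(1)] by (metis (no_types, lifting) IntI image_eqI mem_Collect_eq)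
      next
        fix a assume "a \<in> {a \<in> O'. y a \<in> c ` (C \<inter> C')}"
        then obtain x where x: "a \<in> O'" "x \<in> C" "x \<in> C'" "y a = c x" by auto
        then have "q a = x" using chart_inv[OF Cc] by (simp add: q_def)
        then show "a \<in> \<rho> ` ?W" using x \<rho>q[OF x(1)] by (auto simp: tX intro!: image_eqI[of a \<rho> x])
      qed
      have "openE n (c ` (C \<inter> C'))" using chart_open[OF Cc, of "C \<inter> C'"] chart_open_dom[OF Cc] chart_open_dom[OF Cc'(2)] by auto
      then obtain T where T: "open T" "c ` (C \<inter> C') = Rn n \<inter> T" unfolding Euclidean_space_top_of_set openin_open by blast
      have "{a \<in> O'. y a \<in> c ` (C \<inter> C')} = {a \<in> O'. y a \<in> T}"
        unfolding T(2) using y openE_subset[OF chart_open_image[OF Cc]] by (auto simp: O'_def)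
      then have oW: "openE d (\<rho> ` ?W)" unfolding \<rho>W using openE_vimage[OF oO yc T(1)] by simp
      have WO: "\<rho> ` ?W \<subseteq> O'" unfolding \<rho>W by auto
      have "Cinf_on d (\<rho> ` ?W) (\<lambda>a. (\<lambda>u. c' (inv_into C c u) i) (y a))"
        by (rule Cinf_compose[OF chart_transition[OF Cc Cc'(2) i] oW, where G = y])
           (use \<rho>W Cinf_subset[OF yC[folded O'_def] oW WO] in auto)
      then have "Cinf_on d (\<rho> ` ?W) ((\<lambda>x. c' x i) \<circ> inv_into (q ` O') \<rho>)"
        by (rule Cinf_cong) (use WO inv\<rho> in \<open>auto simp: q_def\<close>)
      then show "Cinf_on P.n (\<rho> ` ?W) ((\<lambda>x. c' x i) \<circ> inv_into (q ` O') \<rho>)" by simp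
    qed
    then show "case B of (C, c) \<Rightarrow> \<forall>i<n. smooth_on P {x \<in> pts P. x \<in> C} (\<lambda>x. c x i)" unfolding Cc'(1) by simp
  qed
  have QM: "q ` O' \<subseteq> pts M" using QC chart_sub[OF Cc] by blast
  have D: "deriv_along (push M (\<lambda>x. x) x (tv P (q ` O') \<rho> x b)) f = (\<Sum>k<d. b k *\<^sub>R z k)" if x: "x \<in> q ` O'" for x b
  proof -
    \<comment> \<open>In the chart \<open>\<rho>\<close> the map \<open>f\<close> is this affine
      parametrization, so its derivatives are the same vectors \<open>z k\<close> at every point of
      the patch.\<close>
    let ?H = "\<lambda>a. p + (\<Sum>j\<in>{..<d}. a j *\<^sub>R z j)"
    have s: "Cinf_on d O' (\<lambda>a. a j *\<^sub>R z j)" for j by (rule Cinf_scaleR[OF Cinf_coord[OF oO] Cinf_const[OF oO]])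
    have ss: "Cinf_on d O' (\<lambda>a. \<Sum>j\<in>{..<d}. a j *\<^sub>R z j)" by (rule Cinf_sum[OF oO s])
    have H: "Cinf_on d O' ?H" by (rule Cinf_add[OF Cinf_const[OF oO] ss])
    have pk: "partial k ?H a = z k" if a: "a \<in> O'" and k: "k < d" for k a
    proof -
      have "partial k ?H a = (\<Sum>j\<in>{..<d}. partial k (\<lambda>a. a j *\<^sub>R z j) a)"
        unfolding partial_add[OF Cinf_const[OF oO] ss k a] partial_sum[OF oO s k a] by simp
      also have "\<dots> = (\<Sum>j\<in>{..<d}. if j = k then z j else 0)"
        by (rule sum.cong) (auto simp: partial_scaleR[OF Cinf_coord[OF oO] Cinf_const[OF oO] k a] partial_coord)
      finally show ?thesis using k by simp
    qed
    have "deriv_along (push M (\<lambda>x. x) x (tv P (q ` O') \<rho> x b)) f = deriv_along (tv P (q ` O') \<rho> x b) (f \<circ> (\<lambda>x. x))"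
      by (rule deriv_along_push[where j = "\<lambda>x. x", OF f]) (use x QM in auto)
    also have "\<dots> = (\<Sum>k<d. b k *\<^sub>R partial k ?H (\<rho> x))"
    proof (rule P.deriv_along_coords(2)[OF Pc, where U = "q ` O'" and H = ?H, unfolded P(2)])
      show "Cinf_on d (\<rho> ` q ` O') ?H" using H \<rho>X tX by simp
      fix x' assume "x' \<in> q ` O'"
      then obtain a where a: "a \<in> O'" "x' = q a" by auto
      then show "(f \<circ> (\<lambda>x. x)) x' = ?H (\<rho> x')" using \<rho>q[OF a(1)] fy[of a] by (simp add: q_def O'_def)
    qed (use x in auto)
    also have "\<dots> = (\<Sum>k<d. b k *\<^sub>R z k)" by (rule sum.cong) (use x \<rho>q pk in auto)
    finally show ?thesis .
  qed
  have TP: "tangent_space P x = range (tv P (q ` O') \<rho> x)" if "x \<in> q ` O'" for x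
    by (rule P.tangent_space_chart[OF Pc that])
  have "embedding P M (\<lambda>x. x)" unfolding embedding_def
  proof (intro conjI ballI impI, rule sm)
    have "homeomorphic_map (mtop M) (mtop M) id" by simp
    then have "embedding_map (mtop M) (mtop M) id" unfolding embedding_map_def by simp
    then show "embedding_map (mtop P) (mtop M) (\<lambda>x. x)" unfolding P(1) X_def id_def by (rule embedding_map_subtopology)
    fix x Z assume x: "x \<in> pts P" and Z: "Z \<in> tangent_space P x" and 0: "push M (\<lambda>x. x) x Z = (\<lambda>_. 0)"
    have xq: "x \<in> q ` O'" using x tX by simp
    obtain b where b: "Z = tv P (q ` O') \<rho> x b" using Z unfolding TP[OF xq] by auto
    have "(\<Sum>k<d. b k *\<^sub>R z k) = 0" using D[OF xq, of b] 0 unfolding b[symmetric] by (simp add: deriv_along_def)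
    then have "\<forall>k<d. b k = 0" using li unfolding lin_indep_def by simp
    then show "Z = (\<lambda>_. 0)" unfolding b using P.tv_zero_iff[OF Pc xq] by simp
  qed
  then have "submanifold M P" using smP by (simp add: submanifold_def)
  moreover have "(\<lambda>X. deriv_along X f) ` sub_tangent M P x = span (z ` {..<d})" if "x \<in> pts P" for x
  proof -
    have xq: "x \<in> q ` O'" using that tX by simp
    have "(\<lambda>X. deriv_along X f) ` sub_tangent M P x = range (\<lambda>b. \<Sum>k<d. b k *\<^sub>R z k)"
      unfolding sub_tangent_def TP[OF xq] image_image D[OF xq] ..
    also have "\<dots> = span (z ` {..<d})" using span_image_sum[of "{..<d}" _ z] by auto
    finally show ?thesis .
  qed
  moreover have "mdim P = d" "pts P = q ` O'" using tX by simp_all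
  ultimately show ?thesis unfolding q_def[abs_def] O'_def by (intro exI[of _ P]) auto
qed

end

lemma (in open_submfd) sub_isometric:
  assumes "isometric_immersion M g f" shows "isometric_immersion M' g f"
proof -
  have VM: "V \<subseteq> pts M" using openin_subset[OF V] .
  have "smooth_on M (pts M) f" using assms by (simp add: isometric_immersion_def)
  from smooth_on_subset[OF this V VM] have "smooth_on M' V f" unfolding sub_smooth_on by simp
  then show ?thesis using assms VM sub_tangent_space
    unfolding isometric_immersion_def immersion_at_def by auto
qed

section \<open>The rulings in a frame chart\<close>

context frame_chart
begin

context
  fixes Y r
  assumes gd: "strongly_genuine_deformation M g f fh"
    and Y: "vector_field M U Y" and reg: "\<And>x. x \<in> U \<Longrightarrow> Y x \<in> regular_elements M f fh L Lh \<tau> x"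
    and rank: "\<And>x. x \<in> U \<Longrightarrow> phi_index M f fh L Lh \<tau> x = r"
begin

definition "Yc i u = Y (inv_into C c u) (\<lambda>y. c y i)"
text \<open>Only the tangential part of a kernel element is kept; \<open>frame_chart_ruled\<close>
  shows that its part in \<open>L\<close> is 0.\<close>

definition "Dist x = {tv M C c x v | v. F.phc (c x) (\<lambda>i. Yc i (c x)) v = 0}"

lemma Y_tv: assumes "x \<in> U" shows "Y x = tv M C c x (\<lambda>i. Yc i (c x))"
  using tangent_coeffs[OF Cc y_facts(1)[OF assms] vector_field_tangent[OF Y assms]] chart_inv[OF Cc y_facts(1)[OF assms]]
  by (simp add: Yc_def)

lemma Yc_smooth: "i < n \<Longrightarrow> Cinf_on n (c ` U) (Yc i)"
  using vector_field_coeffs[OF Cc Y] U(2) unfolding Yc_def[abs_def] by (simp add: Int_absorb1)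

lemma Yc_reg: "u \<in> c ` U \<Longrightarrow> dim (range (F.phc u X')) \<le> dim (range (F.phc u (\<lambda>i. Yc i u)))"
proof -
  assume "u \<in> c ` U"
  then obtain x where x: "x \<in> U" "u = c x" by blast
  show ?thesis using reg[OF x(1)] unfolding Y_tv[OF x(1)] regular_iff(1)[OF x(1)] x(2) by blast
qed

lemma Yc_rank: "u \<in> c ` U \<Longrightarrow> dim (range (F.phc u (\<lambda>i. Yc i u))) = r"
proof -
  assume "u \<in> c ` U"
  then obtain x where x: "x \<in> U" "u = c x" by blast
  show ?thesis using regular_iff(2)[OF x(1), of "\<lambda>i. Yc i (c x)"] reg[OF x(1)] rank[OF x(1)] unfolding Y_tv[OF x(1)] x(2) by simp
qed

interpretation G: genuine_frames n m "c ` U" ff ffh e es eh esh by (rule genuine_frame_chart[OF gd])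

lemmas rulings = G.coordinate_rulings[OF Yc_smooth Yc_reg Yc_rank]

lemma rank_le: "U \<noteq> {} \<Longrightarrow> r \<le> m"
  using rulings(1) by blast

text \<open>The ruling \<open>P\<close> is constructed from \<open>f\<close>, and its tangent space
  and geodesy are read off from \<open>f\<close> as well. The same \<open>P\<close> rules
  \<open>fh\<close>, since the lift \<open>y\<close> parametrizes affine pieces in both images over
  one cube.\<close>

lemma frame_chart_ruled:
  shows "\<And>x. x \<in> U \<Longrightarrow> phi_ker M f fh L Lh \<tau> x (Y x) = Dist x \<times> {0}"
    "mutually_bar_ruled (open_sub M U) g f fh (m - r) Dist"
proof -
  let ?d = "m - r"
  define good where "good u0 S' \<kappa> \<epsilon> y \<longleftrightarrow> openE n S' \<and> u0 \<in> S' \<and> S' \<subseteq> c ` U \<and>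
    (\<forall>k<m - r. \<forall>i<n. Cinf_on n S' (\<kappa> k i)) \<and>
    (\<forall>u\<in>S'. \<forall>v. F.phc u (\<lambda>i. Yc i u) v = 0 \<longleftrightarrow>
       (\<forall>a. n \<le> a \<and> a < m \<longrightarrow> v a = 0) \<and> (\<exists>c. \<forall>i<n. v i = (\<Sum>k<m - r. c k * \<kappa> k i u))) \<and>
    (\<forall>u\<in>S'. \<forall>c. (\<forall>i<n. (\<Sum>k<m - r. c k * \<kappa> k i u) = 0) \<longrightarrow> (\<forall>k<m - r. c k = 0)) \<and>
    \<epsilon> > 0 \<and> y (\<lambda>_. 0) = u0 \<and>
    (\<forall>i<n. Cinf_on (m - r) (obox (m - r) (\<lambda>_. 0) \<epsilon>) (\<lambda>a. y a i)) \<and>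
    (\<forall>a\<in>obox (m - r) (\<lambda>_. 0) \<epsilon>. y a \<in> S' \<and>
       ff (y a) = ff u0 + (\<Sum>k<m - r. a k *\<^sub>R (\<Sum>i<n. \<kappa> k i u0 *\<^sub>R partial i ff u0)) \<and>
       ffh (y a) = ffh u0 + (\<Sum>k<m - r. a k *\<^sub>R (\<Sum>i<n. \<kappa> k i u0 *\<^sub>R partial i ffh u0)))"
    for u0 S' \<epsilon> and \<kappa> :: "nat \<Rightarrow> nat \<Rightarrow> (nat \<Rightarrow> real) \<Rightarrow> real" and y :: "(nat \<Rightarrow> real) \<Rightarrow> nat \<Rightarrow> real"
  have ex: "\<exists>S' \<kappa> \<epsilon> y. good u0 S' \<kappa> \<epsilon> y" if "u0 \<in> c ` U" for u0
    unfolding good_def by (rule rulings(2)[OF _ _ _ that])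
  show "phi_ker M f fh L Lh \<tau> x (Y x) = Dist x \<times> {0}" if x: "x \<in> U" for x
  proof -
    obtain S' \<kappa> \<epsilon> y where g: "good (c x) S' \<kappa> \<epsilon> y" using ex[OF y_facts(3)[OF x]] by blast
    have v0: "v (n + j) = 0" if "F.phc (c x) (\<lambda>i. Yc i (c x)) v = 0" "j < l" for v j
      using g that unfolding good_def by auto
    have "elem x v = (tv M C c x v, 0)" if "F.phc (c x) (\<lambda>i. Yc i (c x)) v = 0" for v
      using v0[OF that] by (simp add: elem_def)
    then have el: "F.phc (c x) (\<lambda>i. Yc i (c x)) v = 0 \<Longrightarrow> elem x v = (tv M C c x v, 0)" for v .
    show ?thesis unfolding Y_tv[OF x] phi_ker_tv[OF x]
    proof (intro set_eqI iffI)
      fix w assume "w \<in> {elem x v | v. F.phc (c x) (\<lambda>i. Yc i (c x)) v = 0}"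
      then obtain v where v: "w = elem x v" "F.phc (c x) (\<lambda>i. Yc i (c x)) v = 0" by blast
      then show "w \<in> Dist x \<times> {0}" using el[OF v(2)] unfolding Dist_def by auto
    next
      fix w assume "w \<in> Dist x \<times> {0::'b}"
      then obtain v where v: "w = (tv M C c x v, 0)" "F.phc (c x) (\<lambda>i. Yc i (c x)) v = 0" by (auto simp: Dist_def)
      have "w = elem x v" using v(1) el[OF v(2)] by simp
      then show "w \<in> {elem x v | v. F.phc (c x) (\<lambda>i. Yc i (c x)) v = 0}" using v(2) by blast
    qed
  qed
  interpret O: open_submfd M U by unfold_locales (rule U(1))
  let ?M = "open_sub M U"
  have ptsM: "pts ?M = U" using O.sub_simps O.V_sub by simp
  have isoM: "isometric_immersion ?M g f" "isometric_immersion ?M g fh"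
    by (rule O.sub_isometric[OF iso], rule O.sub_isometric[OF isoh])
  \<comment> \<open>The kernel frame \<open>\<kappa>\<close> describes \<open>Dist\<close> at all
    points of its neighbourhood, which gives smoothness of the distribution, and at the base point,
    which gives the tangent space of the ruling.\<close>
  have Dist_char: "tv M C c y v \<in> Dist y \<longleftrightarrow> (\<exists>b. \<forall>i<n. v i = (\<Sum>k<?d. b k * \<kappa> k i (c y)))"
    if g: "good u0 S' \<kappa> \<epsilon> yy" and y: "y \<in> U" "c y \<in> S'" for u0 S' \<kappa> \<epsilon> yy y v
  proof
    assume "tv M C c y v \<in> Dist y"
    then obtain v' where v': "tv M C c y v = tv M C c y v'" "F.phc (c y) (\<lambda>i. Yc i (c y)) v' = 0" by (auto simp: Dist_def)
    have "v i = v' i" if "i < n" for i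
      using tv_coord[OF Cc y_facts(1)[OF y(1)] that] v'(1) by metis
    moreover have "\<exists>b. \<forall>i<n. v' i = (\<Sum>k<?d. b k * \<kappa> k i (c y))" using g v'(2) y(2) unfolding good_def by auto
    ultimately show "\<exists>b. \<forall>i<n. v i = (\<Sum>k<?d. b k * \<kappa> k i (c y))" by auto
  next
    assume b: "\<exists>b. \<forall>i<n. v i = (\<Sum>k<?d. b k * \<kappa> k i (c y))"
    let ?v = "\<lambda>i. if i < n then v i else 0"
    have "F.phc (c y) (\<lambda>i. Yc i (c y)) ?v = 0" using g y(2) b unfolding good_def by auto
    moreover have "tv M C c y v = tv M C c y ?v" by (rule tv_cong[OF Cc]) simp
    ultimately show "tv M C c y v \<in> Dist y" by (auto simp: Dist_def)
  qed
  have Dist_sub: "Dist y \<subseteq> tangent_space M y" if "y \<in> U" for y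
    unfolding Dist_def tangent_space_chart[OF Cc y_facts(1)[OF that]] by auto
  show "mutually_bar_ruled ?M g f fh ?d Dist" unfolding mutually_bar_ruled_def
  proof (intro conjI ballI)
    show "distribution ?M ?d Dist" unfolding distribution_def ptsM
    proof
      fix x assume x: "x \<in> U"
      obtain S' \<kappa> \<epsilon> yy where g: "good (c x) S' \<kappa> \<epsilon> yy" using ex[OF y_facts(3)[OF x]] by blast
      define U' where "U' = {y \<in> U. c y \<in> S'}"
      have cU': "c ` U' = S'" using g by (auto simp: U'_def good_def)
      have U'C: "U' \<subseteq> C" "U' \<subseteq> U" using U by (auto simp: U'_def)
      have oU': "openin (mtop M) U'" using chart_open[OF Cc U'C(1)] cU' g by (simp add: good_def)
      define X where "X k y = tv M C c y (\<lambda>i. \<kappa> k i (c y))" for k y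
      have "vector_field ?M U' (X k)" if "k < ?d" for k
        unfolding O.sub_vector_field X_def
        using vector_field_tv[OF Cc oU' U'C(1), where \<alpha> = "\<kappa> k"] g that U'C(2) unfolding cU' good_def by simp
      moreover have "Dist y = {\<lambda>h. \<Sum>k<?d. a k * X k y h | a. True}" if y: "y \<in> U'" for y
      proof -
        have yU: "y \<in> U" "c y \<in> S'" using y by (auto simp: U'_def)
        have s: "(\<lambda>h. \<Sum>k<?d. a k * X k y h) = tv M C c y (\<lambda>i. \<Sum>k<?d. a k * \<kappa> k i (c y))" for a
          unfolding X_def by (rule tv_sum[OF Cc])
        show ?thesis
        proof (intro set_eqI iffI)
          fix Z assume Z: "Z \<in> Dist y"
          then obtain v where v: "Z = tv M C c y v" by (auto simp: Dist_def)
          obtain b where "\<forall>i<n. v i = (\<Sum>k<?d. b k * \<kappa> k i (c y))" using Z Dist_char[OF g yU] v by blast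
          then have "Z = (\<lambda>h. \<Sum>k<?d. b k * X k y h)" unfolding v s by (intro tv_cong[OF Cc]) simp
          then show "Z \<in> {\<lambda>h. \<Sum>k<?d. a k * X k y h | a. True}" by blast
        next
          fix Z assume "Z \<in> {\<lambda>h. \<Sum>k<?d. a k * X k y h | a. True}"
          then obtain a where "Z = (\<lambda>h. \<Sum>k<?d. a k * X k y h)" by blast
          then show "Z \<in> Dist y" unfolding s using Dist_char[OF g yU] by blast
        qed
      qed
      moreover have "\<forall>k<?d. a k = 0" if y: "y \<in> U'" and 0: "(\<lambda>h. \<Sum>k<?d. a k * X k y h) = (\<lambda>_. 0)" for y a
      proof -
        have "tv M C c y (\<lambda>i. \<Sum>k<?d. a k * \<kappa> k i (c y)) = (\<lambda>_. 0)"
          using 0 unfolding X_def tv_sum[OF Cc] .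
        then have "\<forall>i<n. (\<Sum>k<?d. a k * \<kappa> k i (c y)) = 0" using tv_zero_iff[OF Cc subsetD[OF U'C(1) y]] by simp
        then show ?thesis using g y unfolding good_def U'_def by auto
      qed
      moreover have "openin (mtop ?M) U'" using O.sub_open oU' U'C(2) by simp
      moreover have "x \<in> U'" using x g by (simp add: U'_def good_def)
      ultimately show "\<exists>U X. x \<in> U \<and> openin (mtop ?M) U \<and> (\<forall>k<?d. vector_field ?M U (X k)) \<and>
       (\<forall>y\<in>U. Dist y = {\<lambda>h. \<Sum>k<?d. a k * X k y h | a. True} \<and>
          (\<forall>a. (\<lambda>h. \<Sum>k<?d. a k * X k y h) = (\<lambda>_. 0) \<longrightarrow> (\<forall>k<?d. a k = 0)))"
        by (intro exI[of _ U'] exI[of _ X]) auto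
    qed
  next
    fix x assume "x \<in> pts ?M"
    then have x: "x \<in> U" using ptsM by simp
    have xC: "x \<in> C" by (rule y_facts(1)[OF x])
    obtain S' \<kappa> \<epsilon> y where g: "good (c x) S' \<kappa> \<epsilon> y" using ex[OF y_facts(3)[OF x]] by blast
    let ?O = "obox ?d (\<lambda>_. 0) \<epsilon>"
    define z where "z k = (\<Sum>i<n. \<kappa> k i (c x) *\<^sub>R partial i ff (c x))" for k
    define zh where "zh k = (\<Sum>i<n. \<kappa> k i (c x) *\<^sub>R partial i ffh (c x))" for k
    have gS: "c x \<in> S'" "S' \<subseteq> c ` U" "\<epsilon> > 0" "y (\<lambda>_. 0) = c x" using g by (auto simp: good_def)
    have ind: "\<forall>k<?d. b k = 0" if "\<And>i. i < n \<Longrightarrow> (\<Sum>k<?d. b k * \<kappa> k i (c x)) = 0" for b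
      using g that unfolding good_def by auto
    have liE: "lin_indep {..<n} (\<lambda>i. partial i ff (c x))" by (rule immersion_coords[OF Cc xC])
    have liEh: "lin_indep {..<n} (\<lambda>i. partial i ffh (c x))"
    proof -
      have "lin_indep {..<n} (\<lambda>a. eh a (c x))"
        by (rule lin_indep_subset[OF Eh_lin_indep[OF frame_facts y_facts(3)[OF x]]]) auto
      then show ?thesis unfolding lin_indep_def using e_tan by simp
    qed
    have liz: "lin_indep {..<?d} z" "lin_indep {..<?d} zh"
      unfolding z_def[abs_def] zh_def[abs_def]
      by (rule lin_indep_combine[OF liE ind], assumption) (rule lin_indep_combine[OF liEh ind], assumption)
    \<comment> \<open>In the open submanifold the chart domain is cut down to \<open>U\<close>; the
      two inverses of the chart agree over \<open>U\<close>.\<close>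
    have CU: "C \<inter> U = U" using U by auto
    have Uc: "(U, c) \<in> atlas ?M" unfolding O.sub_atlas using Cc CU by (force intro: image_eqI[of _ _ "(C, c)"])
    have invU: "inv_into U c u = inv_into C c u" if u: "u \<in> c ` U" for u
    proof -
      from u obtain y where "y \<in> U" "u = c y" by blast
      then show ?thesis using O.sub.chart_inv[OF Uc] chart_inv[OF Cc] y_facts(1) by simp
    qed
    have yO: "y a \<in> c ` U" if "a \<in> ?O" for a using g that unfolding good_def by blast
    have fy: "f (inv_into U c (y a)) = f x + (\<Sum>k<?d. a k *\<^sub>R z k)" "fh (inv_into U c (y a)) = fh x + (\<Sum>k<?d. a k *\<^sub>R zh k)"
      if "a \<in> ?O" for a
    proof -
      have "ff (y a) = ff (c x) + (\<Sum>k<?d. a k *\<^sub>R z k)" "ffh (y a) = ffh (c x) + (\<Sum>k<?d. a k *\<^sub>R zh k)"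
        using g that unfolding good_def z_def zh_def by blast+
      then show "f (inv_into U c (y a)) = f x + (\<Sum>k<?d. a k *\<^sub>R z k)" "fh (inv_into U c (y a)) = fh x + (\<Sum>k<?d. a k *\<^sub>R zh k)"
        unfolding invU[OF yO[OF that]] fc_def[OF Cc] fhc_def[OF Cc] using chart_inv[OF Cc xC] by simp_all
    qed
    have smf: "smooth_on ?M (pts ?M) f" using isoM by (simp add: isometric_immersion_def)
    have "\<exists>P. submanifold ?M P \<and> mdim P = ?d \<and> pts P = (\<lambda>a. inv_into U c (y a)) ` ?O \<and>
      (\<forall>x\<in>pts P. (\<lambda>X. deriv_along X f) ` sub_tangent ?M P x = span (z ` {..<?d}))"
    proof (rule O.sub.affine_submanifold[OF smf Uc _ _ _ liz(1)])
      show "Cinf_on ?d ?O (\<lambda>a. y a i)" if "i < O.sub.n" for i using g that by (simp add: good_def)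
    qed (use yO fy in auto)
    then obtain P where P: "submanifold ?M P" "mdim P = ?d" "pts P = (\<lambda>a. inv_into U c (y a)) ` ?O"
      and st: "\<forall>x\<in>pts P. (\<lambda>X. deriv_along X f) ` sub_tangent ?M P x = span (z ` {..<?d})" by (elim exE conjE)
    note tg = O.sub.totally_geodesic_flat[OF isoM(1) P(1) subspace_span bspec[OF st]]
    have tgP: "totally_geodesic ?M g P" by (rule tg(1))
    have stP: "sub_tangent ?M P x = {X \<in> tangent_space ?M x. deriv_along X f \<in> span (z ` {..<?d})}" if "x \<in> pts P"
      by (rule tg(2)[OF _ that])
    have 0: "(\<lambda>_. 0) \<in> ?O" using gS(3) by (simp add: Rn_def)
    have xP: "x \<in> pts P" unfolding P(3) using 0 gS(4) O.sub.chart_inv[OF Uc x] by (metis (mono_tags, lifting) image_eqI)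
    \<comment> \<open>Both sides are compared through their images under \<open>f\<close>:
      coefficients with respect to the independent vectors \<open>partial i ff\<close> are
      unique.\<close>
    have "sub_tangent ?M P x = Dist x" unfolding stP[OF xP]
    proof (intro set_eqI iffI)
      fix Z assume "Z \<in> {X \<in> tangent_space ?M x. deriv_along X f \<in> span (z ` {..<?d})}"
      then have Z: "Z \<in> tangent_space M x" "deriv_along Z f \<in> span (z ` {..<?d})" using O.sub_tangent_space[OF x] by auto
      obtain v where v: "Z = tv M C c x v" using Z(1) tangent_space_chart[OF Cc xC] by auto
      obtain b where b: "deriv_along Z f = (\<Sum>k<?d. b k *\<^sub>R z k)" using Z(2) span_image_sum[of "{..<?d}" _ z] by auto
      have "(\<Sum>k<?d. b k *\<^sub>R z k) = (\<Sum>i<n. (\<Sum>k<?d. b k * \<kappa> k i (c x)) *\<^sub>R partial i ff (c x))"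
        unfolding z_def scaleR_sum_left scaleR_sum_right by (subst sum.swap) simp
      then have "(\<Sum>i<n. (v i - (\<Sum>k<?d. b k * \<kappa> k i (c x))) *\<^sub>R partial i ff (c x)) = 0"
        using b unfolding v deriv_f(1)[OF Cc xC] by (simp add: scaleR_diff_left sum_subtractf)
      then have "\<forall>i\<in>{..<n}. v i - (\<Sum>k<?d. b k * \<kappa> k i (c x)) = 0"
        using liE[unfolded lin_indep_def, rule_format, of "\<lambda>i. v i - (\<Sum>k<?d. b k * \<kappa> k i (c x))"] by simp
      then have "\<exists>b. \<forall>i<n. v i = (\<Sum>k<?d. b k * \<kappa> k i (c x))" by auto
      then show "Z \<in> Dist x" unfolding v Dist_char[OF g x gS(1)] .
    next
      fix Z assume Z: "Z \<in> Dist x"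
      then obtain v where v: "Z = tv M C c x v" by (auto simp: Dist_def)
      obtain b where b: "\<forall>i<n. v i = (\<Sum>k<?d. b k * \<kappa> k i (c x))" using Z Dist_char[OF g x gS(1)] v by blast
      have "deriv_along Z f = (\<Sum>i<n. (\<Sum>k<?d. b k * \<kappa> k i (c x)) *\<^sub>R partial i ff (c x))"
        unfolding v deriv_f(1)[OF Cc xC] using b by simp
      also have "\<dots> = (\<Sum>k<?d. b k *\<^sub>R z k)"
        unfolding z_def scaleR_sum_left scaleR_sum_right by (subst sum.swap) simp
      also have "\<dots> \<in> span (z ` {..<?d})" by (intro span_sum span_scale span_base) auto
      finally show "Z \<in> {X \<in> tangent_space ?M x. deriv_along X f \<in> span (z ` {..<?d})}"
        using Z Dist_sub[OF x] O.sub_tangent_space[OF x] by auto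
    qed
    moreover have "maps_onto_affine_piece f (pts P) ?d"
      by (rule affine_piece[OF liz(1), of _ _ "f x" \<epsilon>]) (simp add: P(3) image_image fy(1) cong: image_cong)
    moreover have "maps_onto_affine_piece fh (pts P) ?d"
      by (rule affine_piece[OF liz(2), of _ _ "fh x" \<epsilon>]) (simp add: P(3) image_image fy(2) cong: image_cong)
    ultimately show "\<exists>P. totally_geodesic ?M g P \<and> mdim P = ?d \<and> x \<in> pts P \<and> sub_tangent ?M P x = Dist x \<and>
       maps_onto_affine_piece f (pts P) ?d \<and> maps_onto_affine_piece fh (pts P) ?d"
      using tgP P(2) xP by blast
  qed
qed

end

end

section \<open>Pieces of constant rank\<close>

lemma connectedin_obox: "connectedin (Euclidean_space n) (obox n u r)"
proof -
  let ?S = "\<lambda>i. if i < n then {u i - r<..<u i + r} else {0::real}"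
  have "obox n u r = Pi\<^sub>E UNIV ?S"
  proof (intro set_eqI iffI)
    fix v assume "v \<in> obox n u r"
    then show "v \<in> Pi\<^sub>E UNIV ?S" by (auto simp: obox_def Rn_def abs_less_iff)
  next
    fix v assume "v \<in> Pi\<^sub>E UNIV ?S"
    then have "v i \<in> ?S i" for i by (auto simp: PiE_iff)
    then show "v \<in> obox n u r" unfolding obox_def Rn_def
      by (auto simp: abs_less_iff) (metis (no_types, lifting) greaterThanLessThan_iff diff_less_eq less_diff_eq add.commute minus_diff_eq neg_less_iff_less leD singletonD)+
  qed
  moreover have "connectedin (product_topology (\<lambda>i. euclideanreal) UNIV) (Pi\<^sub>E UNIV ?S)"
    unfolding connectedin_PiE by simp
  ultimately have "connectedin (euclidean :: (nat \<Rightarrow> real) topology) (obox n u r)"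
    by (simp only: euclidean_product_topology)
  then show ?thesis unfolding Euclidean_space_top_of_set connectedin_subtopology by (auto simp: obox_def)
qed

context frame_chart
begin

lemma frame_chart_restrict:
  assumes V: "openin (mtop M) V" "V \<subseteq> U"
  shows "frame_chart M g f fh L Lh \<tau> l C c V \<xi> es esh"
proof (intro frame_chart.intro frame_chart_axioms.intro)
  have VC: "V \<subseteq> C" using V U by blast
  have o: "openE n (c ` V)" using chart_open[OF Cc VC] V by simp
  have sub: "c ` V \<subseteq> c ` U" using V by blast
  show "deformation M g f fh L Lh \<tau> l" by unfold_locales
  show "(C, c) \<in> atlas M" "openin (mtop M) V" "V \<subseteq> C" by (rule Cc V VC)+
  show "smooth_on M V (\<xi> j)" if "j < l" for j by (rule smooth_on_subset[OF \<xi>[OF that] V])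
  show "L y = span ((\<lambda>j. \<xi> j y) ` {..<l})" if "y \<in> V" for y using span that V by blast
  show "Cinf_on n (c ` V) (es a)" if "a < m" for a by (rule Cinf_subset[OF es[OF that] o sub])
  show "Cinf_on n (c ` V) (esh a)" if "a < m" for a by (rule Cinf_subset[OF esh[OF that] o sub])
  show "es a u \<bullet> E C c \<xi> b u = (if a = b then 1 else 0)" if "u \<in> c ` V" "a < m" "b < m" for u a b
    by (rule dual[OF subsetD[OF sub that(1)] that(2,3)])
  show "esh a u \<bullet> Eh C c \<xi> b u = (if a = b then 1 else 0)" if "u \<in> c ` V" "a < m" "b < m" for u a b
    by (rule dualh[OF subsetD[OF sub that(1)] that(2,3)])
  show "es a u \<in> span ((\<lambda>b. E C c \<xi> b u) ` {..<m})" if "u \<in> c ` V" "a < m" for u a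
    by (rule es_span[OF subsetD[OF sub that(1)] that(2)])
  show "esh a u \<in> span ((\<lambda>b. Eh C c \<xi> b u) ` {..<m})" if "u \<in> c ` V" "a < m" for u a
    by (rule esh_span[OF subsetD[OF sub that(1)] that(2)])
qed

text \<open>Values of \<open>\<phi>\<^sub>\<tau>\<close> are orthogonal to the frame in each of the
  two slots, and each frame spans a space of dimension \<open>m\<close>. So the image has at most
  the dimension of the product of two complements.\<close>

lemma rank_bound:
  assumes x: "x \<in> U" shows "rk x b + 2 * m \<le> DIM('b) + DIM('c)"
proof -
  let ?u = "c x"
  note u = y_facts(3)[OF x]
  define A where "A = span ((\<lambda>a. e a ?u) ` {..<m})"
  define Ah where "Ah = span ((\<lambda>a. eh a ?u) ` {..<m})"
  note li = E_lin_indep[OF frame_facts u] Eh_lin_indep[OF frame_facts u]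
  have dA: "dim A = m"
    using lin_indep_imp[OF _ li(1)] by (simp add: A_def dim_eq_card_independent card_image)
  have dAh: "dim Ah = m"
    using lin_indep_imp[OF _ li(2)] by (simp add: Ah_def dim_eq_card_independent card_image)
  let ?N = "{y \<in> UNIV. \<forall>x\<in>A. orthogonal x y}" and ?Nh = "{y \<in> UNIV. \<forall>x\<in>Ah. orthogonal x y}"
  have dN: "dim ?N + m = DIM('b)" using dim_subspace_orthogonal_to_vectors[of A UNIV] dA by (simp add: A_def)
  have dNh: "dim ?Nh + m = DIM('c)" using dim_subspace_orthogonal_to_vectors[of Ah UNIV] dAh by (simp add: Ah_def)
  have inN: "w \<in> ?N" if "\<And>a. a < m \<Longrightarrow> e a ?u \<bullet> w = 0" for w
  proof -
    have "w \<in> A\<^sup>\<bottom>" unfolding A_def orth_span_iff using that by (simp add: inner_commute)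
    then show ?thesis by (simp add: orthogonal_comp_def)
  qed
  have inNh: "w \<in> ?Nh" if "\<And>a. a < m \<Longrightarrow> eh a ?u \<bullet> w = 0" for w
  proof -
    have "w \<in> Ah\<^sup>\<bottom>" unfolding Ah_def orth_span_iff using that by (simp add: inner_commute)
    then show ?thesis by (simp add: orthogonal_comp_def)
  qed
  have "range (F.phc ?u b) \<subseteq> ?N \<times> ?Nh"
  proof
    fix p assume "p \<in> range (F.phc ?u b)"
    then obtain v where p: "p = F.phc ?u b v" by auto
    have "e a ?u \<bullet> fst p = 0" if "a < m" for a
      unfolding p F.phc_sum fst_sum fst_scaleR F.ph_def fst_conv using F.e_Q[OF u that] by (simp add: inner_sum_right)
    then have 1: "fst p \<in> ?N" by (rule inN)
    have "eh a ?u \<bullet> snd p = 0" if "a < m" for a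
      unfolding p F.phc_sum snd_sum snd_scaleR F.ph_def snd_conv using F.eh_Qh[OF u that] by (simp add: inner_sum_right)
    then have "snd p \<in> ?Nh" by (rule inNh)
    with 1 show "p \<in> ?N \<times> ?Nh" by (simp add: mem_Times_iff)
  qed
  then have "rk x b \<le> dim (?N \<times> ?Nh)" by (rule dim_subset)
  also have "\<dots> = dim ?N + dim ?Nh"
    by (rule dim_Times) (simp_all add: subspace_orthogonal_to_vectors)
  finally have "rk x b \<le> dim ?N + dim ?Nh" .
  then have "rk x b + 2 * m \<le> dim ?N + dim ?Nh + 2 * m" by (rule add_right_mono)
  also have "\<dots> = (dim ?N + m) + (dim ?Nh + m)" by simp
  finally show ?thesis unfolding dN dNh .
qed

text \<open>A point and a coefficient vector \<open>b\<close> are chosen with the largest rank over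
  all of \<open>W\<close>. Rank cannot drop nearby and cannot exceed this maximum, so it is constant
  for the fixed coefficients \<open>b\<close>, which thus define a regular field. A cube is taken in
  order to have a connected set.\<close>

lemma constant_rank_piece:
  assumes W: "openin (mtop M) W" "W \<subseteq> U" "W \<noteq> {}"
  shows "\<exists>V r Y. V \<subseteq> W \<and> V \<noteq> {} \<and> openin (mtop M) V \<and> connectedin (mtop M) V \<and>
    (\<forall>x\<in>V. phi_index M f fh L Lh \<tau> x = r) \<and> vector_field M V Y \<and> (\<forall>x\<in>V. Y x \<in> regular_elements M f fh L Lh \<tau> x)"
proof -
  define R where "R = {rk x b | x b. x \<in> W}"
  have fin: "finite R" by (rule finite_subset[of _ "{..DIM('b \<times> 'c)}"]) (use rk_le in \<open>auto simp: R_def\<close>)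
  have "R \<noteq> {}" using W(3) by (auto simp: R_def)
  then have "Max R \<in> R" by (rule Max_in[OF fin])
  then obtain x1 b where x1: "x1 \<in> W" "Max R = rk x1 b" by (auto simp: R_def)
  define r where "r = rk x1 b"
  have le: "rk x b' \<le> r" if "x \<in> W" for x b'
    unfolding r_def x1(2)[symmetric] by (rule Max_ge[OF fin]) (use that in \<open>auto simp: R_def\<close>)
  have WC: "W \<subseteq> C" using W U by blast
  have oW: "openE n (c ` W)" using chart_open[OF Cc WC] W by simp
  have WU: "c ` W \<subseteq> c ` U" using W by blast
  have u1: "c x1 \<in> c ` W" using x1 by blast
  have "\<exists>J. J \<subseteq> {..<m} \<and> lin_indep J (F.pa (c x1) b) \<and> card J = dim (F.pa (c x1) b ` {..<m})"
    by (rule lin_indep_basis_ex) simp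
  then obtain J where J: "J \<subseteq> {..<m}" "lin_indep J (F.pa (c x1) b)" "card J = dim (F.pa (c x1) b ` {..<m})"
    by (elim exE conjE)
  have fJ: "finite J" using J(1) finite_subset by blast
  have cJ: "card J = r" unfolding J(3) r_def F.phc_range by (simp add: dim_span)
  have sm: "Cinf_on n (c ` W) (\<lambda>u. F.pa u b a)" if "a \<in> J" for a
    by (rule Cinf_subset[OF _ oW WU])
      (rule F.Cinf_pa[where X = "\<lambda>i u. b i"], use that J(1) Cinf_const[OF F.S] in auto)
  have "\<exists>r>0. obox n (c x1) r \<subseteq> c ` W \<and> (\<forall>w\<in>obox n (c x1) r. lin_indep J (\<lambda>a. F.pa w b a))"
    by (rule lin_indep_near[where X = "\<lambda>a u. F.pa u b a" and N = "c ` W"]) (use fJ sm oW u1 J(2) in auto)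
  then obtain s where s: "s > 0" "obox n (c x1) s \<subseteq> c ` W" "\<forall>w\<in>obox n (c x1) s. lin_indep J (\<lambda>a. F.pa w b a)"
    by (elim exE conjE)
  let ?B = "obox n (c x1) s"
  define V where "V = inv_into C c ` ?B"
  have BC: "?B \<subseteq> c ` C" using s(2) WC by blast
  have VW: "V \<subseteq> W"
  proof
    fix y assume "y \<in> V"
    then obtain u where "u \<in> ?B" "y = inv_into C c u" by (auto simp: V_def)
    then obtain z where "z \<in> W" "y = inv_into C c (c z)" using s(2) by blast
    then show "y \<in> W" using chart_inv[OF Cc] WC by auto
  qed
  have VC: "V \<subseteq> C" using VW WC by blast
  have cV: "c ` V = ?B" unfolding V_def image_image using BC chart_inv2(2)[OF Cc] by force
  have oV: "openin (mtop M) V" using chart_open[OF Cc VC] cV openE_obox by simp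
  have "connectedin (subtopology (Euclidean_space n) (c ` C)) ?B"
    using connectedin_obox BC by (simp add: connectedin_subtopology)
  then have con: "connectedin (mtop M) V"
    unfolding V_def by (rule connectedin_continuous_map_image[OF chart_inverse_continuous[OF Cc]])
  have "c x1 \<in> Rn n" using u1 openE_subset[OF oW] by blast
  then have "c x1 \<in> ?B" using s(1) by simp
  then have ne: "V \<noteq> {}" unfolding V_def by blast
  have rkV: "rk x b = r" if x: "x \<in> V" for x
  proof -
    have "lin_indep J (F.pa (c x) b)" using s(3) x cV by auto
    then have "card J \<le> dim (F.pa (c x) b ` {..<m})"
      by (rule lin_indep_card_le_dim[OF fJ _ order_trans[OF image_mono[OF J(1)] span_superset]])
    then have "r \<le> rk x b" unfolding cJ F.phc_range by (simp add: dim_span)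
    then show ?thesis using le[of x b] VW x by (simp add: le_antisym subsetD)
  qed
  have xU: "x \<in> U" if "x \<in> V" for x using that VW W by blast
  let ?Y = "\<lambda>y. tv M C c y (\<lambda>i. b i)"
  have "vector_field M V ?Y"
    by (rule vector_field_tv[OF Cc oV VC, where \<alpha> = "\<lambda>i u. b i"]) (simp add: cV openE_obox)
  moreover have reg: "?Y x \<in> regular_elements M f fh L Lh \<tau> x" if x: "x \<in> V" for x
    unfolding regular_iff(1)[OF xU[OF x]] using le rkV[OF x] VW x by auto
  moreover have "phi_index M f fh L Lh \<tau> x = r" if x: "x \<in> V" for x
    using regular_iff(2)[OF xU[OF x] reg[OF x]] rkV[OF x] by simp
  ultimately show ?thesis using VW ne oV con by (intro exI[of _ V] exI[of _ r] exI[of _ ?Y]) auto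
qed

end

section \<open>The dense open set of pieces\<close>

context deformation
begin

text \<open>One regular field is demanded explicitly: the statement for all regular fields would be
  empty without one, and \<open>mutually_ruled\<close> has to be inferred from some field.\<close>

definition piece :: "'m set \<Rightarrow> bool" where
  "piece V \<longleftrightarrow> V \<noteq> {} \<and> openin (mtop M) V \<and> connectedin (mtop M) V \<and>
    (\<exists>C c \<xi> es esh. frame_chart M g f fh L Lh \<tau> l C c V \<xi> es esh) \<and>
    (\<exists>r Y. (\<forall>x\<in>V. phi_index M f fh L Lh \<tau> x = r) \<and> vector_field M V Y \<and> (\<forall>x\<in>V. Y x \<in> regular_elements M f fh L Lh \<tau> x))"

lemma piece_exists:
  assumes W: "openin (mtop M) W" "W \<noteq> {}" shows "\<exists>V. V \<subseteq> W \<and> piece V"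
proof -
  obtain x0 where x0: "x0 \<in> W" using W by blast
  then have "x0 \<in> pts M" using openin_subset[OF W(1)] by blast
  from frame_chart_exists[OF this] obtain C c U \<xi> es esh
    where U: "x0 \<in> U" "frame_chart M g f fh L Lh \<tau> l C c U \<xi> es esh" by (elim exE conjE)
  have oU: "openin (mtop M) U" using U(2) by (simp add: frame_chart_def frame_chart_axioms_def)
  have "\<exists>V r Y. V \<subseteq> W \<inter> U \<and> V \<noteq> {} \<and> openin (mtop M) V \<and> connectedin (mtop M) V \<and>
    (\<forall>x\<in>V. phi_index M f fh L Lh \<tau> x = r) \<and> vector_field M V Y \<and> (\<forall>x\<in>V. Y x \<in> regular_elements M f fh L Lh \<tau> x)"
    by (rule frame_chart.constant_rank_piece[OF U(2)]) (use W(1) oU x0 U(1) in auto)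
  then obtain V r Y where V: "V \<subseteq> W \<inter> U" "V \<noteq> {}" "openin (mtop M) V" "connectedin (mtop M) V"
    "\<forall>x\<in>V. phi_index M f fh L Lh \<tau> x = r" "vector_field M V Y" "\<forall>x\<in>V. Y x \<in> regular_elements M f fh L Lh \<tau> x"
    by (elim exE conjE)
  have VU: "V \<subseteq> U" using V(1) by blast
  have "piece V" unfolding piece_def
    using V(2-7) frame_chart.frame_chart_restrict[OF U(2) V(3) VU] by blast
  then show ?thesis using V(1) by blast
qed

lemma piece_ruled:
  assumes gd: "strongly_genuine_deformation M g f fh" and V: "piece V"
  shows "\<exists>r d. (\<forall>x\<in>V. phi_index M f fh L Lh \<tau> x = r) \<and> int d = int n + int l - int r \<and>
    (\<forall>Y. vector_field M V Y \<and> (\<forall>x\<in>V. Y x \<in> regular_elements M f fh L Lh \<tau> x) \<longrightarrow>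
      (\<exists>D. (\<forall>x\<in>V. phi_ker M f fh L Lh \<tau> x (Y x) = D x \<times> {0}) \<and>
           mutually_bar_ruled (open_sub M V) g f fh d D)) \<and>
    mutually_ruled (open_sub M V) g f fh d \<and> r + 2 * (n + l) \<le> DIM('b) + DIM('c)"
proof -
  obtain C c \<xi> es esh where fr: "frame_chart M g f fh L Lh \<tau> l C c V \<xi> es esh"
    using V unfolding piece_def by (elim exE conjE)
  interpret FC: frame_chart M g f fh L Lh \<tau> l C c V \<xi> es esh by (rule fr)
  obtain r Y0 where r: "\<forall>x\<in>V. phi_index M f fh L Lh \<tau> x = r" and Y0: "vector_field M V Y0"
     "\<forall>x\<in>V. Y0 x \<in> regular_elements M f fh L Lh \<tau> x"
    using V unfolding piece_def by (elim exE conjE)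
  have main: "\<exists>D. (\<forall>x\<in>V. phi_ker M f fh L Lh \<tau> x (Y x) = D x \<times> {0}) \<and> mutually_bar_ruled (open_sub M V) g f fh (m - r) D"
    if Y: "vector_field M V Y" "\<forall>x\<in>V. Y x \<in> regular_elements M f fh L Lh \<tau> x" for Y
    using FC.frame_chart_ruled[OF gd Y(1) bspec[OF Y(2)] bspec[OF r]] by (intro exI conjI ballI) simp_all
  have ne: "V \<noteq> {}" using V by (simp add: piece_def)
  have rm: "r \<le> m" by (rule FC.rank_le[OF gd Y0(1) bspec[OF Y0(2)] bspec[OF r] ne])
  obtain x where x: "x \<in> V" using ne by blast
  \<comment> \<open>The index is the maximum of a nonempty finite set of ranks and so is itself a
    rank, to which the dimension bound applies.\<close>
  have "r \<in> range (\<lambda>b. dim (range (FC.F.phc (c x) b)))"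
    using Max_in[OF FC.phi_index_eq(2)[OF x]] FC.phi_index_eq(1)[OF x] r x by simp
  then obtain b where "r = dim (range (FC.F.phc (c x) b))" by blast
  then have "r + 2 * m \<le> DIM('b) + DIM('c)" using FC.rank_bound[OF x] by simp
  moreover have "mutually_ruled (open_sub M V) g f fh (m - r)"
    unfolding mutually_ruled_def using main[OF Y0] by blast
  moreover have "int (m - r) = int n + int l - int r" using rm by simp
  ultimately show ?thesis using r main by (intro exI[of _ r] exI[of _ "m - r"]) auto
qed

text \<open>The components of \<open>W\<close> themselves have to be pieces. Disjointness makes
  every member open and closed in the union, hence, being connected, a component. Maximality gives
  density, because a nonempty open set off the closure would contain a further piece.\<close>

lemma dense_pieces:
  "\<exists>W. openin (mtop M) W \<and> mtop M closure_of W = pts M \<and> (\<forall>V\<in>connected_components_of (subtopology (mtop M) W). piece V)"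
proof -
  define \<A> where "\<A> = {\<F>. \<F> \<subseteq> Collect piece \<and> pairwise disjnt \<F>}"
  have "\<exists>\<F>\<in>\<A>. \<forall>\<G>\<in>\<A>. \<F> \<subseteq> \<G> \<longrightarrow> \<G> = \<F>"
  proof (rule subset_Zorn')
    fix \<C> assume ch: "subset.chain \<A> \<C>"
    have "pairwise disjnt (\<Union>\<C>)" unfolding pairwise_def
    proof (intro ballI impI)
      fix A B assume "A \<in> \<Union>\<C>" "B \<in> \<Union>\<C>" "A \<noteq> B"
      then obtain F G where FG: "F \<in> \<C>" "A \<in> F" "G \<in> \<C>" "B \<in> G" by blast
      then have "F \<subseteq> G \<or> G \<subseteq> F" using ch unfolding subset.chain_def by blast
      then obtain H where H: "H \<in> \<C>" "A \<in> H" "B \<in> H" using FG by blast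
      then have "H \<in> \<A>" using ch unfolding subset.chain_def by blast
      then show "disjnt A B" using H \<open>A \<noteq> B\<close> unfolding \<A>_def pairwise_def by blast
    qed
    moreover have "\<Union>\<C> \<subseteq> Collect piece" using ch unfolding subset.chain_def \<A>_def by blast
    ultimately show "\<Union>\<C> \<in> \<A>" by (simp add: \<A>_def)
  qed
  then obtain \<F> where FA: "\<F> \<in> \<A>" and mx: "\<And>\<G>. \<G> \<in> \<A> \<Longrightarrow> \<F> \<subseteq> \<G> \<Longrightarrow> \<G> = \<F>" by blast
  have Fp: "piece V" if "V \<in> \<F>" for V using FA that by (auto simp: \<A>_def)
  have Fd: "disjnt A B" if "A \<in> \<F>" "B \<in> \<F>" "A \<noteq> B" for A B using FA that by (auto simp: \<A>_def pairwise_def)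
  have Fo: "openin (mtop M) V" if "V \<in> \<F>" for V using Fp[OF that] by (simp add: piece_def)
  define W where "W = \<Union>\<F>"
  have oW: "openin (mtop M) W" unfolding W_def by (rule openin_Union) (rule Fo)
  have WM: "W \<subseteq> pts M" by (rule openin_subset[OF oW])
  have "mtop M closure_of W = pts M"
  proof (rule ccontr)
    assume ne: "mtop M closure_of W \<noteq> pts M"
    let ?G = "pts M - mtop M closure_of W"
    have "openin (mtop M) ?G" by (intro openin_diff openin_topspace closedin_closure_of)
    moreover have "?G \<noteq> {}" using ne closure_of_subset_topspace[of "mtop M" W] by blast
    ultimately obtain V where V: "V \<subseteq> ?G" "piece V" using piece_exists by blast
    have dis: "V \<inter> W = {}" using V(1) closure_of_subset[OF WM] by blast
    have Vne: "V \<noteq> {}" using V(2) by (simp add: piece_def)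
    have "insert V \<F> \<in> \<A>"
      using FA V(2) dis unfolding \<A>_def by (auto simp: W_def pairwise_insert disjnt_def)
    then have "insert V \<F> = \<F>" by (rule mx) blast
    then have "V \<subseteq> W" unfolding W_def by blast
    then show False using dis Vne by blast
  qed
  moreover have "piece K" if K: "K \<in> connected_components_of (subtopology (mtop M) W)" for K
  proof -
    let ?X = "subtopology (mtop M) W"
    have tX: "topspace ?X = W" using WM by auto
    have Kne: "K \<noteq> {}" by (rule nonempty_connected_components_of[OF K])
    have Kc: "connectedin ?X K" by (rule connectedin_connected_components_of[OF K])
    obtain x where x: "x \<in> K" using Kne by blast
    then have "x \<in> W" using connectedin_subset_topspace[OF Kc] tX by blast
    then obtain V where V: "V \<in> \<F>" "x \<in> V" by (auto simp: W_def)
    have VW: "V \<subseteq> W" using V by (auto simp: W_def)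
    have Vc: "connectedin ?X V" using Fp[OF V(1)] VW by (simp add: piece_def connectedin_subtopology)
    have "V \<subseteq> K" by (rule connected_components_of_maximal[OF K Vc]) (use x V in \<open>auto simp: disjnt_def\<close>)
    \<comment> \<open>The other members of the family have open union, which is
      \<open>W - V\<close>. So \<open>V\<close> is open and closed in \<open>W\<close>, and a
      connected set that meets it lies in it.\<close>
    moreover have "K \<subseteq> V"
    proof -
      have oV: "openin ?X V" using Fo[OF V(1)] VW by (simp add: openin_open_subtopology[OF oW])
      have "W - V = \<Union>(\<F> - {V})" using Fd[OF _ V(1)] by (auto simp: W_def disjnt_def)
      moreover have "openin (mtop M) (\<Union>(\<F> - {V}))" by (rule openin_Union) (use Fo in blast)
      moreover have "W - V \<subseteq> W" by blast
      ultimately have "openin ?X (topspace ?X - V)" unfolding tX openin_open_subtopology[OF oW] by simp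
      then have "closedin ?X V" using VW tX by (simp add: closedin_def)
      from connectedin_clopen_cases[OF Kc this oV] show ?thesis using x V by (auto simp: disjnt_def)
    qed
    ultimately show ?thesis using Fp[OF V(1)] by simp
  qed
  ultimately show ?thesis using oW by blast
qed

end

theorem corollary5:
  fixes M :: "'m mfd" and g :: "'m metric"
    and f :: "'m \<Rightarrow> 'b::euclidean_space" and fh :: "'m \<Rightarrow> 'c::euclidean_space"
    and L :: "'m \<Rightarrow> 'b set" and Lh :: "'m \<Rightarrow> 'c set" and \<tau> :: "'m \<Rightarrow> 'b \<Rightarrow> 'c"
    and n p q l :: nat
  assumes "smooth_manifold M" and "mdim M = n" and "riemannian_metric M g"
    and "DIM('b) = n + p" and "DIM('c) = n + q"
    and "strongly_genuine_deformation M g f fh"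
    and "normal_subbundle M f l L" and "normal_subbundle M fh l Lh"
    and "bundle_isometry M L Lh \<tau>"
    and "parallel_isometry M f fh L Lh \<tau>"
    and "preserves_second_fundamental_forms M f fh L Lh \<tau>"
  shows "\<exists>W. openin (mtop M) W \<and> mtop M closure_of W = pts M \<and>
    (\<forall>V\<in>connected_components_of (subtopology (mtop M) W).
      \<exists>r d. (\<forall>x\<in>V. phi_index M f fh L Lh \<tau> x = r) \<and>
        int d = int n + int l - int r \<and>
        (\<forall>Y. vector_field M V Y \<and> (\<forall>x\<in>V. Y x \<in> regular_elements M f fh L Lh \<tau> x) \<longrightarrow>
          (\<exists>D. (\<forall>x\<in>V. phi_ker M f fh L Lh \<tau> x (Y x) = D x \<times> {0}) \<and>
               mutually_bar_ruled (open_sub M V) g f fh d D)) \<and>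
        mutually_ruled (open_sub M V) g f fh d \<and>
        int d \<ge> int n - int p - int q + 3 * int l)"
proof -
  interpret deformation M g f fh L Lh \<tau> l
    by unfold_locales (use assms in \<open>simp_all add: strongly_genuine_deformation_def\<close>)
  obtain W where W: "openin (mtop M) W" "mtop M closure_of W = pts M"
    and pc: "\<forall>V\<in>connected_components_of (subtopology (mtop M) W). piece V"
    using dense_pieces by (elim exE conjE)
  show ?thesis
  proof (intro exI[of _ W] conjI W ballI)
    fix V assume "V \<in> connected_components_of (subtopology (mtop M) W)"
    then have "piece V" using pc by blast
    from piece_ruled[OF assms(6) this, unfolded assms(2)] obtain r d
      where 1: "\<forall>x\<in>V. phi_index M f fh L Lh \<tau> x = r" and 2: "int d = int n + int l - int r"
      and 3: "\<forall>Y. vector_field M V Y \<and> (\<forall>x\<in>V. Y x \<in> regular_elements M f fh L Lh \<tau> x) \<longrightarrow>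
          (\<exists>D. (\<forall>x\<in>V. phi_ker M f fh L Lh \<tau> x (Y x) = D x \<times> {0}) \<and>
               mutually_bar_ruled (open_sub M V) g f fh d D)"
      and 4: "mutually_ruled (open_sub M V) g f fh d" and 5: "r + 2 * (n + l) \<le> DIM('b) + DIM('c)"
      by (elim exE conjE)
    \<comment> \<open>In other words \<open>r\<close> is at most \<open>p + q - 2 * l\<close>;
      inserted into \<open>d = n + l - r\<close> this gives the lower bound for
      \<open>d\<close>.\<close>
    have "r + 2 * l \<le> p + q" using 5 unfolding assms(4,5) by (simp add: distrib_left)
    then have "int d \<ge> int n - int p - int q + 3 * int l" using 2 by linarith
    then show "\<exists>r d. (\<forall>x\<in>V. phi_index M f fh L Lh \<tau> x = r) \<and>
        int d = int n + int l - int r \<and>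
        (\<forall>Y. vector_field M V Y \<and> (\<forall>x\<in>V. Y x \<in> regular_elements M f fh L Lh \<tau> x) \<longrightarrow>
          (\<exists>D. (\<forall>x\<in>V. phi_ker M f fh L Lh \<tau> x (Y x) = D x \<times> {0}) \<and>
               mutually_bar_ruled (open_sub M V) g f fh d D)) \<and>
        mutually_ruled (open_sub M V) g f fh d \<and>
        int d \<ge> int n - int p - int q + 3 * int l"
      by (intro exI[of _ r] exI[of _ d] conjI) (rule 1 2 3 4, assumption?)+
  qed
qed

end
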